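(* For every knot $K$ in $S^3$, $$-\frac{1}{24}\bigl(c(K)^3-c(K)\bigr)\leq 4v_3(K)\leq \frac{1}{24}\bigl(c(K)^3-c(K)\bigr).$$
   Context: $c(K)$ denotes the (minimal) crossing number of $K$. $v_3$ is the degree three finite type invariant $$v_3(K)=-\frac{1}{144}V_K'''(1)-\frac{1}{48}V_K''(1)\in\tfrac14\mathbb{Z},$$ where $V_K(t)$ is the Jones polynomial of $K$ (with the convention that the positive (right-handed) trefoil has $V(t)=t+t^3-t^4$). *)

theory Defs
  imports "HOL-Analysis.Analysis"
begin

text \<open>
  Knots in the 3-sphere are treated combinatorially: a knot is a class of oriented knot diagrams on
  the 2-sphere modulo Reidemeister moves; by Reidemeister's theorem these are the (tame) knots up to
  isotopy. Neither the crossing number nor the Jones polynomial of a knot depends on its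
  orientation. A diagram is recorded by its signed Gauss code: walk once
  along the knot and note, at each passage through a crossing, the name of the crossing, whether
  the walk is on the over- or the under-strand, and the sign of the crossing. The list is to be
  read cyclically; the empty list is the diagram without crossings.

  Sign convention: a crossing whose over-strand has direction \<open>u\<close> and whose under-strand has
  direction \<open>v\<close> is positive iff \<open>(u, v)\<close> is a positively oriented basis of the plane
  (right-handed crossing).
\<close>

datatype level = Over | Under

type_synonym passage = "nat \<times> level \<times> int"
type_synonym gauss_code = "passage list"

definition is_gauss_code :: "gauss_code \<Rightarrow> bool" where
  "is_gauss_code D \<longleftrightarrow>
     distinct (map (\<lambda>(x, h, e). (x, h)) D) \<and>
     (\<forall>(x, h, e) \<in> set D. e \<in> {1, -1} \<and> (x, Over, e) \<in> set D \<and> (x, Under, e) \<in> set D)"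

definition labels :: "gauss_code \<Rightarrow> nat set" where
  "labels D = fst ` set D"

definition crossings :: "gauss_code \<Rightarrow> nat" where
  "crossings D = card (labels D)"

definition writhe :: "gauss_code \<Rightarrow> int" where
  "writhe D = (\<Sum>(x, h, e) \<in> {p \<in> set D. fst (snd p) = Over}. e)"

text \<open>Position of the other passage through the crossing met at position \<open>i\<close>.\<close>

definition partner :: "gauss_code \<Rightarrow> nat \<Rightarrow> nat" where
  "partner D i = (THE j. j < length D \<and> j \<noteq> i \<and> fst (D ! j) = fst (D ! i))"

text \<open>
  Edge \<open>i\<close> of the diagram runs from position \<open>i\<close> to its cyclic successor, so the passage at
  position \<open>i\<close> enters along edge \<open>inc D i\<close> and leaves along edge \<open>i\<close>. The diagram without
  crossings has a single closed edge.
\<close>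

definition edges :: "gauss_code \<Rightarrow> nat set" where
  "edges D = {..<max 1 (length D)}"

definition inc :: "gauss_code \<Rightarrow> nat \<Rightarrow> nat" where
  "inc D i = (i + length D - 1) mod length D"

text \<open>Number of classes of \<open>X\<close> under the equivalence relation generated by \<open>R \<subseteq> X \<times> X\<close>.\<close>

definition num_classes :: "'a set \<Rightarrow> ('a \<times> 'a) set \<Rightarrow> nat" where
  "num_classes X R = card (X // (R \<union> R\<inverse>)\<^sup>*)"


subsection \<open>Realizability on the sphere\<close>

text \<open>
  A dart \<open>(i, f)\<close> is edge \<open>i\<close> traversed along (\<open>f\<close>) or against (\<open>\<not> f\<close>) the orientation of the
  knot. \<open>left_turn\<close> follows a dart to the crossing at its end and turns left there; the integer \<open>s\<close>
  is 1 iff the other strand crosses from right to left as seen from the arriving dart. The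
  orbits are the boundaries of the faces of the closed oriented surface on which the code is a
  cellular diagram.
\<close>

definition left_turn :: "gauss_code \<Rightarrow> nat \<times> bool \<Rightarrow> nat \<times> bool" where
  "left_turn D d =
     (let j = (if snd d then Suc (fst d) mod length D else fst d);
          (x, h, e) = D ! j;
          s = (if snd d then 1 else -1) * (if h = Over then 1 else -1) * e
      in if s = 1 then (partner D j, True) else (inc D (partner D j), False))"

definition faces :: "gauss_code \<Rightarrow> nat" where
  "faces D = num_classes (edges D \<times> UNIV) {(d, left_turn D d) | d. fst d < length D}"

text \<open>
  With \<open>n\<close> crossings there are \<open>2n\<close> edges, so Euler characteristic 2 means \<open>n + 2\<close> faces.
  The closed edge of the empty code has two sides, so the formula also holds for \<open>n = 0\<close>.
\<close>

definition knot_diagram :: "gauss_code \<Rightarrow> bool" where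
  "knot_diagram D \<longleftrightarrow> is_gauss_code D \<and> faces D = crossings D + 2"


subsection \<open>Reidemeister moves and knots\<close>

text \<open>A crossing is given by its label and its sign.\<close>

definition over :: "nat \<times> int \<Rightarrow> passage" where
  "over c = (fst c, Over, snd c)"

definition under :: "nat \<times> int \<Rightarrow> passage" where
  "under c = (fst c, Under, snd c)"

text \<open>
  Third move: the triangle is cut out by a top, a middle and a bottom strand, and \<open>a\<close>, \<open>b\<close>, \<open>c\<close>
  are the crossings top/middle, top/bottom and middle/bottom. For three directed lines in general
  position in the plane, the order in which each of them meets the other two is the sign of the
  crossing of those other two, up to one common sign \<open>k\<close>. All eight sign patterns occur with both
  values of \<open>k\<close>, and pushing a line across the opposite crossing flips \<open>k\<close>.
\<close>

definition ordered :: "int \<Rightarrow> passage \<Rightarrow> passage \<Rightarrow> gauss_code" where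
  "ordered s p q = (if s = 1 then [p, q] else [q, p])"

definition top_side :: "int \<Rightarrow> nat \<times> int \<Rightarrow> nat \<times> int \<Rightarrow> nat \<times> int \<Rightarrow> gauss_code" where
  "top_side k a b c = ordered (k * snd c) (over a) (over b)"

definition middle_side :: "int \<Rightarrow> nat \<times> int \<Rightarrow> nat \<times> int \<Rightarrow> nat \<times> int \<Rightarrow> gauss_code" where
  "middle_side k a b c = ordered (k * snd b) (under a) (over c)"

definition bottom_side :: "int \<Rightarrow> nat \<times> int \<Rightarrow> nat \<times> int \<Rightarrow> nat \<times> int \<Rightarrow> gauss_code" where
  "bottom_side k a b c = ordered (k * snd a) (under b) (under c)"

text \<open>
  Because of \<open>rotate\<close> every move may be assumed to start at the base point. Freshness of labels and
  realizability are imposed in \<open>diagram_move\<close> by requiring both sides to be knot diagrams. In \<open>R2\<close>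
  and \<open>R3\<close> the signs and the adjacencies already force the bigon, respectively the triangle, to be
  a face.
\<close>

inductive move :: "gauss_code \<Rightarrow> gauss_code \<Rightarrow> bool" where
  relabel: "inj_on f (labels D) \<Longrightarrow> move D (map (\<lambda>(x, h, e). (f x, h, e)) D)"
| rotate: "move (xs @ ys) (ys @ xs)"
| R1_over_under: "move xs (xs @ [over a, under a])"
| R1_under_over: "move xs (xs @ [under a, over a])"
| R2_parallel: "snd b = - snd a \<Longrightarrow>
    move (xs @ ys) ([over a, over b] @ xs @ [under a, under b] @ ys)"
| R2_antiparallel: "snd b = - snd a \<Longrightarrow>
    move (xs @ ys) ([over a, over b] @ xs @ [under b, under a] @ ys)"
| R3_top_middle_bottom: "k \<in> {1, -1} \<Longrightarrow>
    move (top_side k a b c @ xs @ middle_side k a b c @ ys @ bottom_side k a b c @ zs)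
         (top_side (-k) a b c @ xs @ middle_side (-k) a b c @ ys @ bottom_side (-k) a b c @ zs)"
| R3_top_bottom_middle: "k \<in> {1, -1} \<Longrightarrow>
    move (top_side k a b c @ xs @ bottom_side k a b c @ ys @ middle_side k a b c @ zs)
         (top_side (-k) a b c @ xs @ bottom_side (-k) a b c @ ys @ middle_side (-k) a b c @ zs)"

definition diagram_move :: "gauss_code \<Rightarrow> gauss_code \<Rightarrow> bool" where
  "diagram_move D D' \<longleftrightarrow> knot_diagram D \<and> knot_diagram D' \<and> move D D'"

definition knots :: "gauss_code set set" where
  "knots = {D. knot_diagram D} // {(D, D'). equivclp diagram_move D D'}"

definition crossing_number :: "gauss_code set \<Rightarrow> nat" where
  "crossing_number K = (LEAST n. \<exists>D\<in>K. crossings D = n)"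


subsection \<open>Jones polynomial\<close>

text \<open>
  A Kauffman state is given by the set \<open>S\<close> of crossings that receive the A-smoothing. The
  A-smoothing joins the two regions swept by the over-strand when it is turned counterclockwise
  onto the under-strand; it respects the orientation iff the crossing is positive, and the
  B-smoothing respects it iff the crossing is negative.
\<close>

definition smoothing_joins :: "gauss_code \<Rightarrow> nat set \<Rightarrow> (nat \<times> nat) set" where
  "smoothing_joins D S =
     (\<Union>i\<in>{..<length D}. case D ! i of (x, h, e) \<Rightarrow>
        if (x \<in> S) = (e = 1)
        then {(inc D i, partner D i)}
        else {(inc D i, inc D (partner D i)), (i, partner D i)})"

definition circles :: "gauss_code \<Rightarrow> nat set \<Rightarrow> nat" where
  "circles D S = num_classes (edges D) (smoothing_joins D S)"

definition kauffman_bracket :: "gauss_code \<Rightarrow> real \<Rightarrow> real" where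
  "kauffman_bracket D A =
     (\<Sum>S\<in>Pow (labels D).
        A powi (int (card S) - int (card (labels D - S))) *
        (- (A powi 2) - A powi (-2)) ^ (circles D S - 1))"

text \<open>
  The Jones polynomial as a function of \<open>t > 0\<close>, by the substitution \<open>A = t\<^sup>-\<^sup>1\<^sup>/\<^sup>4\<close> in the
  normalized bracket \<open>(-A\<^sup>3)\<^sup>-\<^sup>w\<langle>D\<rangle>\<close>. This gives \<open>t + t\<^sup>3 - t\<^sup>4\<close> for the right-handed trefoil.
\<close>

definition diagram_jones :: "gauss_code \<Rightarrow> real \<Rightarrow> real" where
  "diagram_jones D t =
     (let A = t powr (-1/4) in (- (A ^ 3)) powi (- writhe D) * kauffman_bracket D A)"

text \<open>By Reidemeister invariance the choice of the diagram is immaterial.\<close>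

definition jones :: "gauss_code set \<Rightarrow> real \<Rightarrow> real" where
  "jones K = diagram_jones (SOME D. D \<in> K)"

definition v3 :: "gauss_code set \<Rightarrow> real" where
  "v3 K = - (1/144) * (deriv ^^ 3) (jones K) 1 - (1/48) * (deriv ^^ 2) (jones K) 1"

end

theory Submission
  imports Defs
begin

text \<open>
  In the variable \<open>log t\<close> the Jones polynomial of a diagram expands at \<open>0\<close> as \<open>1\<close> plus terms of order
  at least two, so \<open>4 v\<^sub>3\<close> is \<open>-1/36\<close> times the third coefficient \<open>T\<close>. From the Kauffman state sum, \<open>T\<close> is
  a cubic form in the crossing signs: a triple of distinct crossings contributes according to the
  number of interleaved pairs in it, and the rest is linear in the signs. The linear part is found
  without computing it. For signs that make the diagram descending from some base point the Jones
  polynomial is \<open>1\<close>, hence \<open>T = 0\<close>; moving the base point across a crossing flips one sign and so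
  gives the linear coefficient of this crossing in terms of the cubic part. Averaging over the two
  passages through the crossing turns \<open>T\<close> into a sum over triples of distinct crossings, in which a
  triple contributes at most a multiple of \<open>1 - q\<close>, where \<open>q\<close> is a sum of products of signed
  interlacements with a common crossing. The sum of all \<open>q\<close> is bounded below because the row sums of
  the interlacement matrix have nonnegative squares.

  That a descending diagram has Jones polynomial \<open>1\<close> is shown by removing the first loop closed by
  the walk; planarity pairs the strands inside the loop so that they come off by second moves.
\<close>

section \<open>Counting classes of generated equivalence relations\<close>

text \<open>At \<open>t = 1\<close> the loop value is \<open>-2\<close>, where the two smoothings of
  a crossing and the transparent crossing satisfy a three-term relation. It makes the state sum at
  \<open>1\<close> a signed measure of total mass 1 whose moments depend only on small chord
  subdiagrams. What it does not reach is the linear part, which involves the circle counts of all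
  states; this is the obstacle that the descending signs circumvent. These signs vary over one fixed
  shadow, so bracket and Jones polynomial are set up for words with freely chosen signs. A loop is
  removed state by state rather than by diagram moves: once every crossing off the loop is smoothed,
  the strands inside the loop are disjoint arcs, and an innermost one bounds a bigon with the loop.
  Reidemeister invariance serves to pass from the arbitrary representative in \<open>jones\<close>
  to a diagram with the least number of crossings. The constant: an ordered triple is bounded by
  \<open>2 * (1 - q)\<close>, the sum of all \<open>1 - q\<close> is at most
  \<open>n ^ 3 - n\<close>, the cubic part carries the factor \<open>3/4\<close>, and
  \<open>3/4 * 2 / 36 = 1/24\<close>.\<close>

definition conn :: "('a \<times> 'a) set \<Rightarrow> 'a \<Rightarrow> 'a \<Rightarrow> bool" where
  "conn R x y \<longleftrightarrow> (x, y) \<in> (R \<union> R\<inverse>)\<^sup>*"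

lemma conn_refl [simp]: "conn R x x"
  by (simp add: conn_def)

lemma conn_sym: "conn R x y \<Longrightarrow> conn R y x"
  unfolding conn_def by (metis Un_commute converse_Un converse_converse rtrancl_converseI)

lemma conn_commute: "conn R x y \<longleftrightarrow> conn R y x"
  using conn_sym by metis

lemma conn_trans [trans]: "conn R x y \<Longrightarrow> conn R y z \<Longrightarrow> conn R x z"
  unfolding conn_def by (rule rtrancl_trans)

lemma conn_base: "(x, y) \<in> R \<Longrightarrow> conn R x y"
  unfolding conn_def by blast

lemma conn_least:
  assumes "conn R x y" and "\<And>a b. (a, b) \<in> R \<Longrightarrow> P a b"
    and "\<And>a. P a a" and "\<And>a b. P a b \<Longrightarrow> P b a" and "\<And>a b c. P a b \<Longrightarrow> P b c \<Longrightarrow> P a c"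
  shows "P x y"
  using assms(1) unfolding conn_def
proof (induction rule: rtrancl_induct)
  case base
  show ?case by (rule assms(3))
next
  case (step y z)
  then show ?case using assms(2,4,5) by (metis Un_iff converse_iff)
qed

lemma conn_subset:
  assumes "conn R x y" and "\<And>a b. (a, b) \<in> R \<Longrightarrow> conn Q a b"
  shows "conn Q x y"
  by (rule conn_least[OF assms(1), of "conn Q"]) (auto intro: assms(2) conn_sym conn_trans)

lemma conn_mono: "conn R x y \<Longrightarrow> R \<subseteq> Q \<Longrightarrow> conn Q x y"
  by (erule conn_subset) (auto intro: conn_base)

text \<open>The device for all later separation arguments: a function constant along the generators
  that takes different values at two points proves them disconnected.\<close>

lemma conn_invariant:
  assumes "conn R x y" and "\<And>a b. (a, b) \<in> R \<Longrightarrow> h a = h b"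
  shows "h x = h y"
  by (rule conn_least[OF assms(1), of "\<lambda>a b. h a = h b"]) (auto intro: assms(2))

lemma conn_isolated:
  assumes "conn R x y" and "\<And>a b. (a, b) \<in> R \<Longrightarrow> a \<noteq> x \<and> b \<noteq> x"
  shows "y = x"
  using conn_invariant[OF assms(1), of "\<lambda>z. z = x"] assms(2) by auto

lemma conn_empty [simp]: "conn {} x y \<longleftrightarrow> x = y"
  by (auto simp: conn_def)

text \<open>A path can be shortened until it uses the new edge at most once, in one of its two
  directions. Circle counts after smoothing a crossing thereby become propositional
  computations.\<close>

lemma conn_insert:
  "conn (insert (a, b) R) x y \<longleftrightarrow>
     conn R x y \<or> conn R x a \<and> conn R b y \<or> conn R x b \<and> conn R a y"
proof
  let ?P = "\<lambda>x y. conn R x y \<or> conn R x a \<and> conn R b y \<or> conn R x b \<and> conn R a y"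
  assume "conn (insert (a, b) R) x y"
  then show "?P x y"
  proof (rule conn_least[of _ x y ?P])
    fix u v assume "(u, v) \<in> insert (a, b) R"
    then show "?P u v" by (auto intro: conn_base)
  next
    fix u v assume "?P u v"
    then show "?P v u" using conn_sym[of R] by metis
  next
    fix u v w assume "?P u v" "?P v w"
    then show "?P u w" using conn_sym[of R] conn_trans[of R] by metis
  qed simp
next
  have 1: "conn (insert (a, b) R) u v" if "conn R u v" for u v
    using that by (rule conn_mono) auto
  have 2: "conn (insert (a, b) R) a b"
    by (rule conn_base) simp
  assume "conn R x y \<or> conn R x a \<and> conn R b y \<or> conn R x b \<and> conn R a y"
  then show "conn (insert (a, b) R) x y"
    using 1 2 conn_trans conn_sym by metis
qed

text \<open>The size of an image depends only on which arguments are identified, so class counts can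
  be compared without exhibiting a bijection between classes.\<close>

lemma card_image_cong_kernel:
  assumes "\<And>x y. x \<in> A \<Longrightarrow> y \<in> A \<Longrightarrow> p x = p y \<longleftrightarrow> q x = q y"
  shows "card (p ` A) = card (q ` A)"
proof -
  let ?h = "\<lambda>c. q (SOME x. x \<in> A \<and> p x = c)"
  have "bij_betw ?h (p ` A) (q ` A)"
  proof -
    have *: "q (SOME z. z \<in> A \<and> p z = p x) = q x" if "x \<in> A" for x
    proof -
      have "(SOME z. z \<in> A \<and> p z = p x) \<in> A \<and> p (SOME z. z \<in> A \<and> p z = p x) = p x"
        by (rule someI[of _ x]) (use that in simp)
      then show ?thesis using assms that by blast
    qed
    show ?thesis
      unfolding bij_betw_def
    proof
      show "inj_on ?h (p ` A)"
        by (rule inj_onI) (use * assms in auto)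
      show "?h ` p ` A = q ` A"
        unfolding image_image using * by (rule image_cong[OF refl])
    qed
  qed
  then show ?thesis by (rule bij_betw_same_card)
qed

lemma num_classes_image: "num_classes X R = card ((\<lambda>x. {y. conn R x y}) ` X)"
proof -
  have "X // (R \<union> R\<inverse>)\<^sup>* = (\<lambda>x. {y. conn R x y}) ` X"
    unfolding quotient_def conn_def Image_def by auto
  then show ?thesis by (simp add: num_classes_def)
qed

lemma class_eq_iff: "{z. conn R x z} = {z. conn R y z} \<longleftrightarrow> conn R x y"
proof
  assume "{z. conn R x z} = {z. conn R y z}"
  then have "y \<in> {z. conn R x z}" by simp
  then show "conn R x y" by simp
next
  assume "conn R x y"
  then show "{z. conn R x z} = {z. conn R y z}"
    by (auto intro: conn_trans conn_sym)
qed

lemma num_classes_via: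
  assumes "f ` X = Y" and "\<And>x y. x \<in> X \<Longrightarrow> y \<in> X \<Longrightarrow> conn R x y \<longleftrightarrow> conn Q (f x) (f y)"
  shows "num_classes X R = num_classes Y Q"
proof -
  have "card ((\<lambda>x. {y. conn R x y}) ` X) = card ((\<lambda>x. {y. conn Q (f x) y}) ` X)"
    by (rule card_image_cong_kernel) (simp add: class_eq_iff assms(2))
  then show ?thesis
    by (simp add: num_classes_image assms(1)[symmetric] image_image)
qed

lemma num_classes_cong:
  assumes "\<And>x y. x \<in> X \<Longrightarrow> y \<in> X \<Longrightarrow> conn R x y \<longleftrightarrow> conn Q x y"
  shows "num_classes X R = num_classes X Q"
  using assms by (intro num_classes_via[of id]) auto

lemma num_classes_mutual:
  assumes "\<And>a b. (a, b) \<in> R \<Longrightarrow> conn Q a b" and "\<And>a b. (a, b) \<in> Q \<Longrightarrow> conn R a b"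
  shows "num_classes X R = num_classes X Q"
  by (rule num_classes_cong) (meson assms conn_subset)

text \<open>The two maps need to be inverse to each other only up to connection. This suits cyclic
  words, where the first and the last node are two names of one point.\<close>

lemma num_classes_transfer:
  assumes "\<And>x. x \<in> X \<Longrightarrow> f x \<in> Y" and "\<And>y. y \<in> Y \<Longrightarrow> g y \<in> X"
    and f: "\<And>a b. (a, b) \<in> R \<Longrightarrow> conn Q (f a) (f b)"
    and g: "\<And>a b. (a, b) \<in> Q \<Longrightarrow> conn R (g a) (g b)"
    and gf: "\<And>x. x \<in> X \<Longrightarrow> conn R (g (f x)) x" and fg: "\<And>y. y \<in> Y \<Longrightarrow> conn Q (f (g y)) y"
  shows "num_classes X R = num_classes Y Q"
proof -
  have F: "conn Q (f a) (f b)" if "conn R a b" for a b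
    by (rule conn_least[OF that, of "\<lambda>a b. conn Q (f a) (f b)"]) (auto intro: f conn_sym conn_trans)
  have G: "conn R (g a) (g b)" if "conn Q a b" for a b
    by (rule conn_least[OF that, of "\<lambda>a b. conn R (g a) (g b)"]) (auto intro: g conn_sym conn_trans)
  have iff: "conn R x y \<longleftrightarrow> conn Q (f x) (f y)" if "x \<in> X" "y \<in> X" for x y
  proof
    assume "conn Q (f x) (f y)"
    then have *: "conn R (g (f x)) (g (f y))" by (rule G)
    have "conn R x (g (f x))" using gf[OF that(1)] by (rule conn_sym)
    also note *
    also have "conn R (g (f y)) y" by (rule gf[OF that(2)])
    finally show "conn R x y" .
  qed (rule F)
  have "(\<lambda>y. {z. conn Q y z}) ` Y = (\<lambda>y. {z. conn Q y z}) ` f ` X"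
  proof
    show "(\<lambda>y. {z. conn Q y z}) ` Y \<subseteq> (\<lambda>y. {z. conn Q y z}) ` f ` X"
    proof clarify
      fix y assume "y \<in> Y"
      then have "{z. conn Q y z} = {z. conn Q (f (g y)) z}"
        unfolding class_eq_iff by (rule conn_sym[OF fg])
      then show "{z. conn Q y z} \<in> (\<lambda>y. {z. conn Q y z}) ` f ` X"
        using assms(2) \<open>y \<in> Y\<close> by blast
    qed
  qed (use assms(1) in blast)
  then have "num_classes Y Q = num_classes (f ` X) Q"
    by (simp add: num_classes_image)
  also have "\<dots> = num_classes X R"
    by (rule num_classes_via[symmetric, OF refl]) (use iff in blast)
  finally show ?thesis by simp
qed

text \<open>Identifying points that are already connected leaves the components alone. It serves to
  forget transparent crossings and to make the count executable.\<close>

lemma num_classes_contract: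
  assumes "\<And>x y. f x = f y \<Longrightarrow> conn R x y"
  shows "num_classes X R = num_classes (f ` X) (map_prod f f ` R)"
proof (rule num_classes_via[OF refl])
  fix x y
  show "conn R x y \<longleftrightarrow> conn (map_prod f f ` R) (f x) (f y)"
  proof
    assume "conn R x y"
    then show "conn (map_prod f f ` R) (f x) (f y)"
      by (rule conn_least[of _ _ _ "\<lambda>a b. conn (map_prod f f ` R) (f a) (f b)"])
        (force intro: conn_base, simp, erule conn_sym, erule (1) conn_trans)
  next
    have "\<forall>a b. u = f a \<longrightarrow> v = f b \<longrightarrow> conn R a b" if "conn (map_prod f f ` R) u v" for u v
      using that unfolding conn_def
    proof (induction rule: rtrancl_induct)
      case base
      then show ?case using assms by (simp add: conn_def)
    next
      case (step y z)
      from step(2) obtain c d where cd: "y = f c" "z = f d" "conn R c d"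
        using conn_base conn_sym by fastforce
      show ?case
      proof (intro allI impI)
        fix a b assume "u = f a" "z = f b"
        then have "conn R a c" "conn R d b"
          using step(3) cd assms by (auto simp: conn_def)
        then show "(a, b) \<in> (R \<union> R\<inverse>)\<^sup>*"
          using cd(3) conn_trans unfolding conn_def by metis
      qed
    qed
    then show "conn R x y" if "conn (map_prod f f ` R) (f x) (f y)"
      using that by blast
  qed
qed

lemma num_classes_insert_pair:
  "num_classes X (insert (a, b) R) =
     num_classes ((\<lambda>x. if x = b then a else x) ` X)
       (map_prod (\<lambda>x. if x = b then a else x) (\<lambda>x. if x = b then a else x) ` R)"
proof -
  let ?f = "\<lambda>x. if x = b then a else x"
  have "num_classes X (insert (a, b) R) = num_classes (?f ` X) (map_prod ?f ?f ` insert (a, b) R)"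
    by (rule num_classes_contract) (auto intro: conn_base conn_sym split: if_splits)
  also have "\<dots> = num_classes (?f ` X) (map_prod ?f ?f ` R)"
    by (rule num_classes_mutual) (auto intro: conn_base)
  finally show ?thesis .
qed

lemma num_classes_insert_conn:
  assumes "conn R a b"
  shows "num_classes X (insert (a, b) R) = num_classes X R"
  using assms by (intro num_classes_mutual) (auto intro: conn_base)

lemma num_classes_insert_not_conn:
  assumes "finite X" "a \<in> X" "b \<in> X" "\<not> conn R a b"
  shows "num_classes X R = Suc (num_classes X (insert (a, b) R))"
proof -
  let ?p = "\<lambda>x. {y. conn R x y}" and ?q = "\<lambda>x. {y. conn (insert (a, b) R) x y}"
  have ab: "?p a \<noteq> ?p b" using assms(4) unfolding class_eq_iff .
  have q1: "?q x = ?p a \<union> ?p b" if "conn R x a \<or> conn R x b" for x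
  proof -
    have "conn (insert (a, b) R) x y \<longleftrightarrow> conn R a y \<or> conn R b y" for y
    proof -
      have "conn R a y" if "conn R x a" "conn R x y"
        using that conn_sym conn_trans by metis
      moreover have "conn R b y" if "conn R x b" "conn R x y"
        using that conn_sym conn_trans by metis
      moreover have "conn R x y" if "conn R x a" "conn R a y"
        using that conn_trans by metis
      moreover have "conn R x y" if "conn R x b" "conn R b y"
        using that conn_trans by metis
      ultimately show ?thesis
        unfolding conn_insert using that by blast
    qed
    then show ?thesis by auto
  qed
  have q2: "?q x = ?p x" if "\<not> conn R x a" "\<not> conn R x b" for x
    using that by (auto simp: conn_insert)
  have 1: "?q ` X = insert (?p a \<union> ?p b) (?p ` X - {?p a, ?p b})"
  proof (intro set_eqI iffI)
    fix c assume "c \<in> ?q ` X"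
    then obtain x where x: "x \<in> X" "c = ?q x" by blast
    show "c \<in> insert (?p a \<union> ?p b) (?p ` X - {?p a, ?p b})"
    proof (cases "conn R x a \<or> conn R x b")
      case True
      then show ?thesis using q1 x by simp
    next
      case False
      then have "?p x \<noteq> ?p a" "?p x \<noteq> ?p b" unfolding class_eq_iff by auto
      then show ?thesis using q2 False x by auto
    qed
  next
    fix c assume "c \<in> insert (?p a \<union> ?p b) (?p ` X - {?p a, ?p b})"
    then consider "c = ?p a \<union> ?p b" | x where "x \<in> X" "c = ?p x" "?p x \<noteq> ?p a" "?p x \<noteq> ?p b"
      by blast
    then show "c \<in> ?q ` X"
    proof cases
      case 1
      then have "c = ?q a" using q1[of a] by simp
      then show ?thesis using assms(2) by blast
    next
      case 2
      then have "\<not> conn R x a" "\<not> conn R x b" unfolding class_eq_iff by auto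
      then have "c = ?q x" using q2 2 by simp
      then show ?thesis using 2(1) by blast
    qed
  qed
  have 2: "?p a \<union> ?p b \<notin> ?p ` X - {?p a, ?p b}"
  proof
    assume "?p a \<union> ?p b \<in> ?p ` X - {?p a, ?p b}"
    then obtain x where x: "?p a \<union> ?p b = ?p x" "?p x \<noteq> ?p a" by blast
    have "a \<in> ?p a \<union> ?p b" by simp
    then have "a \<in> ?p x" unfolding x(1) .
    then show False using x(2) unfolding class_eq_iff by simp
  qed
  have fin: "finite (?p ` X)" using assms(1) by simp
  have "{?p a, ?p b} \<subseteq> ?p ` X" using assms(2,3) by blast
  then have "card (?p ` X) = card (?p ` X - {?p a, ?p b}) + 2"
    using ab fin card_mono[OF fin, of "{?p a, ?p b}"] by (simp add: card_Diff_subset)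
  moreover have "card (?q ` X) = Suc (card (?p ` X - {?p a, ?p b}))"
    unfolding 1 using 2 fin by simp
  ultimately show ?thesis by (simp add: num_classes_image)
qed

lemma num_classes_pos: "finite X \<Longrightarrow> X \<noteq> {} \<Longrightarrow> num_classes X R > 0"
  by (simp add: num_classes_image card_gt_0_iff)

lemma num_classes_insert:
  assumes "finite X" "a \<in> X" "b \<in> X"
  shows "int (num_classes X (insert (a, b) R)) = int (num_classes X R) - (if conn R a b then 0 else 1)"
  using num_classes_insert_conn[of R a b X] num_classes_insert_not_conn[OF assms, of R] by auto

text \<open>
  Two arcs cross twice: \<open>u\<close>-\<open>l\<close>-\<open>w\<close> and \<open>o\<close>-\<open>n\<close>-\<open>o'\<close>, where \<open>l\<close>, \<open>l'\<close> and \<open>n\<close>, \<open>n'\<close>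
  are the two ends of the inner pieces.
\<close>

lemma num_classes_bigon:
  fixes X :: "'a set" and Q :: "('a \<times> 'a) set" and o1 :: 'a
  assumes fin: "finite X" and X: "{u, l, l', w, o1, n, n', o2} \<subseteq> X"
    and nn: "conn Q n n'" and ll: "conn Q l l'"
    and n: "\<And>z. z \<in> {u, w, o1, o2, l} \<Longrightarrow> \<not> conn Q n z"
    and l: "\<And>z. z \<in> {u, w, o1, o2} \<Longrightarrow> \<not> conn Q l z"
  shows "num_classes X ({(u, n), (l, o1), (l', n'), (w, o2)} \<union> Q) =
           num_classes X ({(u, o1), (l, n), (l', o2), (w, n')} \<union> Q)" (is "?bb = ?aa")
    and "num_classes X ({(u, o1), (l, n), (l', n'), (w, o2)} \<union> Q) =
           Suc (num_classes X ({(u, o1), (l, n), (l', o2), (w, n')} \<union> Q))" (is "?ab = _")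
    and "num_classes X ({(u, n), (l, o1), (l', o2), (w, n')} \<union> Q) =
           num_classes X ({(u, l), (l', w), (n, o1), (n', o2)} \<union> Q)" (is "?ba = ?t")
proof -
  \<comment> \<open>Once \<open>conn Q\<close> is expressed as equality of the labels
    \<open>k\<close>, each count below is settled by equational case distinction.\<close>
  define k where "k x = {y. conn Q x y}" for x
  have k: "conn Q x y \<longleftrightarrow> k x = k y" for x y
    unfolding k_def class_eq_iff ..
  have kk: "k n' = k n" "k l' = k l" "k u \<noteq> k n" "k w \<noteq> k n" "k o1 \<noteq> k n" "k o2 \<noteq> k n" "k l \<noteq> k n"
    "k u \<noteq> k l" "k w \<noteq> k l" "k o1 \<noteq> k l" "k o2 \<noteq> k l"
    using nn ll n[of u] n[of w] n[of o1] n[of o2] n[of l] l[of u] l[of w] l[of o1] l[of o2]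
    unfolding k by simp_all
  note s = num_classes_insert[OF fin] conn_insert k
  have "int ?bb = int ?aa"
    using X kk by (auto simp: s)
  then show "?bb = ?aa" by simp
  \<comment> \<open>Here the inner pieces \<open>l\<close>-\<open>l'\<close> and
    \<open>n\<close>-\<open>n'\<close> close up into a circle of their own; in \<open>?aa\<close>
    and \<open>?bb\<close> they are inserted into an outer arc, and in \<open>?ba\<close> each of
    them restores one of the two uncrossed arcs.\<close>
  have "int ?ab = int ?aa + 1"
    using X kk by (auto simp: s)
  then show "?ab = Suc ?aa" by simp
  have "int ?ba = int ?t"
    using X kk by (auto simp: s)
  then show "?ba = ?t" by simp
qed

section \<open>States of a double occurrence word\<close>

text \<open>
  In a word of length \<open>L\<close> the letter at position \<open>i\<close> is entered through node \<open>i\<close> and left through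
  node \<open>Suc i\<close>; the nodes \<open>0\<close> and \<open>L\<close> are joined. An erased crossing is one through which
  both strands pass straight.
\<close>

datatype smoothing = Oriented | Unoriented | Erased

fun joins :: "nat \<Rightarrow> nat \<Rightarrow> smoothing \<Rightarrow> (nat \<times> nat) set" where
  "joins p q Oriented = {(p, Suc q), (Suc p, q)}"
| "joins p q Unoriented = {(p, q), (Suc p, Suc q)}"
| "joins p q Erased = {(p, Suc p), (q, Suc q)}"

definition chords :: "nat list \<Rightarrow> (nat \<times> nat) set" where
  "chords w = {(p, q). p < length w \<and> q < length w \<and> p \<noteq> q \<and> w ! p = w ! q}"

text \<open>Only the crossings in \<open>A\<close> are resolved; the nodes at all others remain free
  ends, so that crossings can be smoothed one after another.\<close>

definition joined :: "nat set \<Rightarrow> nat list \<Rightarrow> (nat \<Rightarrow> smoothing) \<Rightarrow> (nat \<times> nat) set" where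
  "joined A w st = insert (0, length w) (\<Union>(p, q) \<in> {c \<in> chords w. w ! fst c \<in> A}. joins p q (st (w ! p)))"

definition circ :: "nat list \<Rightarrow> (nat \<Rightarrow> smoothing) \<Rightarrow> nat" where
  "circ w st = num_classes {..length w} (joined (set w) w st)"

lemma circ_pos: "circ w st > 0"
  unfolding circ_def by (rule num_classes_pos) auto

lemma joined_iff:
  "(a, b) \<in> joined A w st \<longleftrightarrow> a = 0 \<and> b = length w \<or>
     (\<exists>p q. (p, q) \<in> chords w \<and> w ! p \<in> A \<and> (a, b) \<in> joins p q (st (w ! p)))"
  by (auto simp: joined_def)

lemma joined_cong: "(\<And>x. x \<in> A \<Longrightarrow> st x = st' x) \<Longrightarrow> joined A w st = joined A w st'"
  unfolding joined_def by (intro arg_cong[of _ _ "insert _"] SUP_cong) auto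

lemma circ_cong: "(\<And>x. x \<in> set w \<Longrightarrow> st x = st' x) \<Longrightarrow> circ w st = circ w st'"
  using joined_cong[of "set w" st st' w] by (simp add: circ_def)

lemma joined_subset: "joined A w st \<subseteq> {..length w} \<times> {..length w}"
proof -
  have "joins p q s \<subseteq> {..length w} \<times> {..length w}" if "(p, q) \<in> chords w" for p q s
    using that by (cases s) (auto simp: chords_def)
  then show ?thesis by (auto simp: joined_def; blast)
qed

lemma conn_joins_swap:
  assumes "joins p q s \<subseteq> R" and "(a, b) \<in> joins q p s"
  shows "conn R a b"
  using assms by (cases s) (auto intro: conn_base conn_sym)

lemma conn_joins_map:
  assumes ab: "(a, b) \<in> joins p q s" and R: "joins p' q' s \<subseteq> R"
    and f: "conn R (f p) p'" "conn R (f q) q'" "conn R (f (Suc p)) (Suc p')" "conn R (f (Suc q)) (Suc q')"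
  shows "conn R (f a) (f b)"
proof -
  have via: "conn R (f x) (f y)" if "conn R (f x) x'" "conn R (f y) y'" "(x', y') \<in> R" for x y x' y'
    using that conn_base conn_sym conn_trans by metis
  show ?thesis
    using ab R f by (cases s) (auto intro: via)
qed

definition occurs :: "nat list \<Rightarrow> nat \<Rightarrow> nat \<Rightarrow> nat \<Rightarrow> bool" where
  "occurs w x p q \<longleftrightarrow> p < length w \<and> q < length w \<and> p \<noteq> q \<and> {i. i < length w \<and> w ! i = x} = {p, q}"

definition dow :: "nat list \<Rightarrow> bool" where
  "dow w \<longleftrightarrow> (\<forall>x \<in> set w. count_list w x = 2)"

lemma count_list_card: "count_list w x = card {i. i < length w \<and> w ! i = x}"
  by (simp add: count_list_eq_length_filter length_filter_conv_card eq_commute)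

lemma dow_occurs:
  assumes "dow w" "x \<in> set w"
  obtains p q where "occurs w x p q" "p < q"
proof -
  have "card {i. i < length w \<and> w ! i = x} = 2"
    using assms by (simp add: dow_def count_list_card)
  then obtain p q where pq: "{i. i < length w \<and> w ! i = x} = {p, q}" "p \<noteq> q"
    by (meson card_2_iff)
  then have "p < length w" "q < length w" by blast+
  with pq have "occurs w x p q" "occurs w x q p" by (auto simp: occurs_def)
  then show ?thesis using that pq(2) by (metis nat_neq_iff)
qed

lemma occurs_nth: "occurs w x p q \<Longrightarrow> w ! p = x \<and> w ! q = x"
  unfolding occurs_def by blast

lemma occurs_chords: "occurs w x p q \<Longrightarrow> (a, b) \<in> chords w \<Longrightarrow> w ! a = x \<Longrightarrow> (a, b) = (p, q) \<or> (a, b) = (q, p)"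
proof -
  assume 1: "occurs w x p q" and 2: "(a, b) \<in> chords w" "w ! a = x"
  have "a \<in> {i. i < length w \<and> w ! i = x}" "b \<in> {i. i < length w \<and> w ! i = x}" "a \<noteq> b"
    using 2 by (auto simp: chords_def)
  moreover have "{i. i < length w \<and> w ! i = x} = {p, q}" using 1 by (simp add: occurs_def)
  ultimately show ?thesis by auto
qed

lemma conn_joined_insert:
  assumes "occurs w x p q"
  shows "conn (joined (insert x A) w st) a b \<longleftrightarrow> conn (joins p q (st x) \<union> joined A w st) a b"
proof
  have pq: "(p, q) \<in> chords w" "w ! p = x"
    using assms occurs_nth[OF assms] by (auto simp: occurs_def chords_def)
  assume "conn (joined (insert x A) w st) a b"
  then show "conn (joins p q (st x) \<union> joined A w st) a b"
  proof (rule conn_subset)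
    fix c d assume "(c, d) \<in> joined (insert x A) w st"
    then consider "(c, d) \<in> joined A w st" | s t where "(s, t) \<in> chords w" "w ! s = x" "(c, d) \<in> joins s t (st x)"
      by (auto simp: joined_iff)
    then show "conn (joins p q (st x) \<union> joined A w st) c d"
    proof cases
      case 2
      then show ?thesis
        using occurs_chords[OF assms 2(1,2)] conn_joins_swap[of p q "st x" _ c d] by (auto intro: conn_base)
    qed (auto intro: conn_base)
  qed
next
  have pq: "(p, q) \<in> chords w" "w ! p = x"
    using assms occurs_nth[OF assms] by (auto simp: occurs_def chords_def)
  assume "conn (joins p q (st x) \<union> joined A w st) a b"
  then show "conn (joined (insert x A) w st) a b"
    by (rule conn_mono) (use pq in \<open>fastforce simp: joined_iff\<close>)
qed

lemma num_classes_joined_insert: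
  assumes "occurs w x p q"
  shows "num_classes X (joined (insert x A) w st) = num_classes X (joins p q (st x) \<union> joined A w st)"
  by (rule num_classes_cong) (rule conn_joined_insert[OF assms])

lemma circ_remove:
  assumes "occurs w x p q"
  shows "circ w st = num_classes {..length w} (joins p q (st x) \<union> joined (set w - {x}) w st)"
proof -
  have "x \<in> set w" using assms occurs_nth[OF assms] unfolding occurs_def by (metis nth_mem)
  then show ?thesis
    using num_classes_joined_insert[OF assms, of _ "set w - {x}"] by (simp add: circ_def insert_absorb)
qed

lemma joined_set_iff:
  "(a, b) \<in> joined (set w) w st \<longleftrightarrow> a = 0 \<and> b = length w \<or>
     (\<exists>p q. (p, q) \<in> chords w \<and> (a, b) \<in> joins p q (st (w ! p)))"
proof -
  have "w ! p \<in> set w" if "(p, q) \<in> chords w" for p q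
    using that by (auto simp: chords_def)
  then show ?thesis unfolding joined_iff by blast
qed

lemma circ_map:
  assumes "inj_on f (set w)"
  shows "circ (map f w) st = circ w (st \<circ> f)"
proof -
  have ch: "chords (map f w) = chords w"
    using assms by (auto simp: chords_def inj_on_eq_iff)
  have nth: "map f w ! p = f (w ! p)" if "(p, q) \<in> chords w" for p q
    using that by (auto simp: chords_def)
  have "(a, b) \<in> joined (set (map f w)) (map f w) st \<longleftrightarrow> (a, b) \<in> joined (set w) w (st \<circ> f)" for a b
    unfolding joined_set_iff ch using nth by (metis comp_apply length_map)
  then have "joined (set (map f w)) (map f w) st = joined (set w) w (st \<circ> f)"
    by auto
  then show ?thesis by (simp add: circ_def)
qed

lemma joins_subset_joined:
  assumes "(p, q) \<in> chords w" and "w ! p = x"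
  shows "joins p q (st x) \<subseteq> joined (set w) w st"
proof -
  have "x \<in> set w" using assms by (auto simp: chords_def)
  then show ?thesis using assms by (auto simp: joined_iff)
qed

lemma circ_rotate1: "circ (w @ [x]) st = circ (x # w) st"
proof -
  let ?L = "length w"
  let ?R = "joined (set (w @ [x])) (w @ [x]) st" and ?Q = "joined (set (x # w)) (x # w) st"
  \<comment> \<open>Moving the last letter to the front shifts every node by one; the last node
    wraps to \<open>1\<close>, the node behind \<open>x\<close>, with which the shifted node
    \<open>0\<close> coincides as well.\<close>
  let ?f = "\<lambda>i. if i \<le> ?L then Suc i else 1" and ?g = "\<lambda>i. if i = 0 then ?L else i - 1"
  have R0: "conn ?R 0 (Suc ?L)" "conn ?R (Suc ?L) 0"
    using conn_base[of 0 "Suc ?L" ?R] conn_sym by (auto simp: joined_iff)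
  have Q0: "conn ?Q 0 (Suc ?L)" "conn ?Q (Suc ?L) 0"
    using conn_base[of 0 "Suc ?L" ?Q] conn_sym by (auto simp: joined_iff)
  have chR: "(?g p, ?g q) \<in> chords (w @ [x]) \<and> (w @ [x]) ! ?g p = (x # w) ! p"
    if "(p, q) \<in> chords (x # w)" for p q
    using that by (auto simp: chords_def nth_append nth_Cons split: nat.splits if_splits)
  have chQ: "(p = ?L \<or> Suc p < Suc ?L) \<and> ((if p = ?L then 0 else Suc p), (if q = ?L then 0 else Suc q)) \<in> chords (x # w)
      \<and> (x # w) ! (if p = ?L then 0 else Suc p) = (w @ [x]) ! p"
    if "(p, q) \<in> chords (w @ [x])" for p q
    using that by (auto simp: chords_def nth_append nth_Cons split: nat.splits if_splits)
  have "num_classes {..Suc ?L} ?R = num_classes {..Suc ?L} ?Q"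
  proof (rule num_classes_transfer[where f = ?f and g = ?g])
    fix a b assume "(a, b) \<in> ?R"
    then consider "a = 0" "b = Suc ?L" | p q where "(p, q) \<in> chords (w @ [x])" "(a, b) \<in> joins p q (st ((w @ [x]) ! p))"
      by (auto simp: joined_iff)
    then show "conn ?Q (?f a) (?f b)"
    proof cases
      case 2
      let ?h = "\<lambda>p. if p = ?L then 0 else Suc p"
      have ch: "(?h p, ?h q) \<in> chords (x # w)" and eq: "(x # w) ! ?h p = (w @ [x]) ! p"
        using chQ[OF 2(1)] by auto
      have pq: "p \<le> ?L" "q \<le> ?L" using 2(1) by (auto simp: chords_def)
      have in_f: "conn ?Q (?f r) (?h r)" "?f (Suc r) = Suc (?h r)" if "r \<le> ?L" for r
        using that Q0 by auto
      show ?thesis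
        by (rule conn_joins_map[OF 2(2) joins_subset_joined[OF ch eq, of st]]) (use in_f pq Q0 in auto)
    qed (auto simp: Q0)
  next
    fix a b assume "(a, b) \<in> ?Q"
    then consider "a = 0" "b = Suc ?L" | p q where "(p, q) \<in> chords (x # w)" "(a, b) \<in> joins p q (st ((x # w) ! p))"
      by (auto simp: joined_iff)
    then show "conn ?R (?g a) (?g b)"
    proof cases
      case 2
      have ch: "(?g p, ?g q) \<in> chords (w @ [x])" and eq: "(w @ [x]) ! ?g p = (x # w) ! p"
        using chR[OF 2(1)] by auto
      have pq: "p \<le> ?L" "q \<le> ?L" using 2(1) by (auto simp: chords_def)
      have in_g: "conn ?R (?g (Suc r)) (Suc (?g r))" if "r \<le> ?L" for r
        using that R0 by auto
      show ?thesis
        by (rule conn_joins_map[OF 2(2) joins_subset_joined[OF ch eq, of st]]) (use in_g pq R0 in auto)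
    qed (auto simp: R0)
  qed (use R0 Q0 in \<open>auto simp: le_Suc_eq Suc_le_eq\<close>)
  then show ?thesis by (simp add: circ_def)
qed

lemma circ_rotate: "circ (xs @ ys) st = circ (ys @ xs) st"
proof (induction xs arbitrary: ys)
  case (Cons x xs)
  have "circ ((x # xs) @ ys) st = circ ((xs @ ys) @ [x]) st"
    using circ_rotate1[of "xs @ ys" x st] by simp
  also have "\<dots> = circ ((ys @ [x]) @ xs) st" using Cons[of "ys @ [x]"] by simp
  finally show ?case by simp
qed simp

text \<open>A state sum as nested binary expansion along a list. Crossings at the end of the list
  are summed innermost, with all other smoothings fixed in \<open>st\<close>, which is where local
  relations apply.\<close>

fun ssum :: "(nat \<Rightarrow> real) \<Rightarrow> (nat \<Rightarrow> real) \<Rightarrow> ((nat \<Rightarrow> smoothing) \<Rightarrow> real) \<Rightarrow>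
    nat list \<Rightarrow> (nat \<Rightarrow> smoothing) \<Rightarrow> real" where
  "ssum a b G [] st = G st"
| "ssum a b G (x # xs) st =
     a x * ssum a b G xs (st(x := Oriented)) + b x * ssum a b G xs (st(x := Unoriented))"

lemma ssum_append: "ssum a b G (xs @ ys) st = ssum a b (ssum a b G ys) xs st"
  by (induction xs arbitrary: st) auto

lemma ssum_move: "x \<notin> set xs \<Longrightarrow> ssum a b G (x # xs) st = ssum a b G (xs @ [x]) st"
proof (induction xs arbitrary: st)
  case (Cons y xs)
  have "ssum a b G (x # y # xs) st = ssum a b G (y # x # xs) st"
    using Cons.prems by (simp add: fun_upd_twist algebra_simps)
  also have "\<dots> = ssum a b G (y # xs @ [x]) st"
    using Cons by simp
  finally show ?case by simp
qed simp

lemma ssum_perm: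
  assumes "distinct xs" "distinct ys" "set xs = set ys"
  shows "ssum a b G xs st = ssum a b G ys st"
  using assms
proof (induction xs arbitrary: ys st)
  case (Cons x xs)
  then obtain us vs where ys: "ys = us @ x # vs"
    by (metis list.set_intros(1) split_list)
  have xs: "set xs = set (us @ vs)" "distinct (us @ vs)"
    using Cons.prems ys by auto
  have "ssum a b G ys st = ssum a b (ssum a b G vs) (us @ [x]) st"
    using ssum_append[of a b G "us @ [x]" vs] by (simp add: ys)
  also have "\<dots> = ssum a b (ssum a b G vs) (x # us) st"
    using ssum_move[of x us] Cons.prems ys by simp
  also have "\<dots> = ssum a b G (x # us @ vs) st"
    using ssum_append[of a b G "x # us" vs] by simp
  finally have 1: "ssum a b G ys st = ssum a b G (x # us @ vs) st" .
  have "ssum a b G xs st' = ssum a b G (us @ vs) st'" for st'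
    by (rule Cons.IH) (use xs Cons.prems in auto)
  then show ?case unfolding 1 by simp
qed simp

lemma ssum_cong:
  assumes "\<And>st'. (\<And>x. x \<notin> set xs \<Longrightarrow> st' x = st x) \<Longrightarrow> (\<And>x. x \<in> set xs \<Longrightarrow> st' x \<noteq> Erased) \<Longrightarrow> G st' = G' st'"
    and "\<And>x. x \<in> set xs \<Longrightarrow> a x = a' x" "\<And>x. x \<in> set xs \<Longrightarrow> b x = b' x"
  shows "ssum a b G xs st = ssum a' b' G' xs st"
  using assms
proof (induction xs arbitrary: st)
  case (Cons x xs)
  have "ssum a b G xs (st(x := s)) = ssum a' b' G' xs (st(x := s))" if "s \<noteq> Erased" for s
  proof (rule Cons.IH)
    fix st' :: "nat \<Rightarrow> smoothing"
    assume st': "\<And>y. y \<notin> set xs \<Longrightarrow> st' y = (st(x := s)) y" "\<And>y. y \<in> set xs \<Longrightarrow> st' y \<noteq> Erased"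
    show "G st' = G' st'"
    proof (rule Cons.prems(1))
      fix y assume "y \<in> set (x # xs)"
      then show "st' y \<noteq> Erased" using st' that by (cases "y \<in> set xs") auto
    qed (use st' in auto)
  qed (use Cons.prems in auto)
  then show ?case using Cons.prems by simp
qed simp

lemma ssum_cmult: "ssum a b (\<lambda>st. c * G st) xs st = c * ssum a b G xs st"
  by (induction xs arbitrary: st) (auto simp: algebra_simps)

definition state :: "nat set \<Rightarrow> nat \<Rightarrow> smoothing" where
  "state S x = (if x \<in> S then Oriented else Unoriented)"

lemma sum_Pow_insert:
  fixes f :: "'a set \<Rightarrow> 'b::comm_monoid_add"
  assumes "finite A" "x \<notin> A"
  shows "(\<Sum>S\<in>Pow (insert x A). f S) = (\<Sum>S\<in>Pow A. f (insert x S)) + (\<Sum>S\<in>Pow A. f S)"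
proof -
  have "inj_on (insert x) (Pow A)"
    using assms(2) by (auto simp: inj_on_def)
  then have "(\<Sum>S\<in>insert x ` Pow A. f S) = (\<Sum>S\<in>Pow A. f (insert x S))"
    by (simp add: sum.reindex)
  moreover have "Pow A \<inter> insert x ` Pow A = {}" using assms(2) by auto
  ultimately show ?thesis
    using assms(1) by (simp add: Pow_insert sum.union_disjoint add.commute)
qed

lemma ssum_Pow:
  assumes "distinct xs"
  shows "ssum a b G xs st = (\<Sum>S\<in>Pow (set xs). (\<Prod>x\<in>S. a x) * (\<Prod>x\<in>set xs - S. b x) *
           G (\<lambda>x. if x \<in> set xs then state S x else st x))"
  using assms
proof (induction xs arbitrary: st)
  case (Cons x xs)
  let ?T = "set xs"
  have x: "x \<notin> ?T" using Cons.prems by simp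
  have 1: "(\<lambda>y. if y \<in> ?T then state S y else (st(x := Oriented)) y) =
      (\<lambda>y. if y \<in> set (x # xs) then state (insert x S) y else st y)" for S
    using x by (auto simp: state_def)
  have 2: "(\<lambda>y. if y \<in> ?T then state S y else (st(x := Unoriented)) y) =
      (\<lambda>y. if y \<in> set (x # xs) then state S y else st y)" if "S \<subseteq> ?T" for S
    using x that by (intro ext) (auto simp: state_def)
  have p1: "(\<Prod>y\<in>insert x S. a y) = a x * (\<Prod>y\<in>S. a y)" "set (x # xs) - insert x S = ?T - S" if "S \<subseteq> ?T" for S
  proof -
    have "x \<notin> S" using x that by blast
    then show "(\<Prod>y\<in>insert x S. a y) = a x * (\<Prod>y\<in>S. a y)" using finite_subset[OF that] by simp
    show "set (x # xs) - insert x S = ?T - S" using x by auto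
  qed
  have p2: "(\<Prod>y\<in>set (x # xs) - S. b y) = b x * (\<Prod>y\<in>?T - S. b y)" if "S \<subseteq> ?T" for S
  proof -
    have "set (x # xs) - S = insert x (?T - S)" using x that by auto
    then show ?thesis using x by simp
  qed
  have xs: "distinct xs" using Cons.prems by simp
  have s1: "ssum a b G xs (st(x := Oriented)) = (\<Sum>S\<in>Pow ?T. (\<Prod>x\<in>S. a x) * (\<Prod>x\<in>?T - S. b x) *
      G (\<lambda>y. if y \<in> set (x # xs) then state (insert x S) y else st y))"
    unfolding Cons.IH[OF xs] by (intro sum.cong refl) (simp only: 1)
  have s2: "ssum a b G xs (st(x := Unoriented)) = (\<Sum>S\<in>Pow ?T. (\<Prod>x\<in>S. a x) * (\<Prod>x\<in>?T - S. b x) *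
      G (\<lambda>y. if y \<in> set (x # xs) then state S y else st y))"
    unfolding Cons.IH[OF xs] by (intro sum.cong refl) (simp only: 2 Pow_iff)
  have "ssum a b G (x # xs) st =
      (\<Sum>S\<in>Pow ?T. a x * ((\<Prod>x\<in>S. a x) * (\<Prod>x\<in>?T - S. b x) * G (\<lambda>y. if y \<in> set (x # xs) then state (insert x S) y else st y)))
    + (\<Sum>S\<in>Pow ?T. b x * ((\<Prod>x\<in>S. a x) * (\<Prod>x\<in>?T - S. b x) * G (\<lambda>y. if y \<in> set (x # xs) then state S y else st y)))"
    unfolding ssum.simps s1 s2 sum_distrib_left ..
  also have "\<dots> = (\<Sum>S\<in>Pow (insert x ?T). (\<Prod>x\<in>S. a x) * (\<Prod>x\<in>set (x # xs) - S. b x) *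
           G (\<lambda>y. if y \<in> set (x # xs) then state S y else st y))"
    unfolding sum_Pow_insert[OF finite_set x]
    by (intro arg_cong2[of _ _ _ _ "(+)"] sum.cong refl) (auto simp only: Pow_iff p1 p2 mult_ac)
  finally show ?case by simp
qed simp

text \<open>The node map \<open>f\<close> counts the kept letters before a node. Its fibres are runs
  of erased positions, which the transparent crossings connect, so contracting them does not change
  the number of circles.\<close>

lemma circ_filter:
  assumes "dow w"
  shows "circ (filter (\<lambda>x. st x \<noteq> Erased) w) st = circ w st"
proof -
  let ?P = "\<lambda>x. st x \<noteq> Erased" and ?L = "length w"
  let ?w = "filter ?P w"
  \<comment> \<open>The summand \<open>i - ?L\<close> vanishes on the nodes. It only makes
    \<open>f\<close> injective beyond them, because the contraction lemma asks for control of all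
    fibres over the naturals.\<close>
  define f where "f i = length (filter ?P (take i w)) + (i - ?L)" for i
  let ?R = "joined (set w) w st" and ?R' = "joined (set ?w) ?w st"
  have f_Suc: "f (Suc i) = (if ?P (w ! i) then Suc (f i) else f i)" if "i < ?L" for i
    using that by (simp add: f_def take_Suc_conv_app_nth)
  have f_Suc': "f (Suc i) = Suc (f i)" if "\<not> i < ?L" for i
    using that by (simp add: f_def)
  have f_mono: "f i \<le> f (Suc i)" for i
    using f_Suc[of i] f_Suc'[of i] by (cases "i < ?L") auto
  have f0: "f 0 = 0" and fL: "f ?L = length ?w"
    by (simp_all add: f_def)
  have nth: "?w ! f i = w ! i" "f i < length ?w" if "i < ?L" "?P (w ! i)" for i
  proof -
    have eq: "?w = filter ?P (take i w) @ w ! i # filter ?P (drop (Suc i) w)"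
      using that by (subst id_take_nth_drop[of i w]) auto
    have "f i = length (filter ?P (take i w))" using that by (simp add: f_def)
    then show "?w ! f i = w ! i" "f i < length ?w" by (simp_all add: eq)
  qed
  have onto: "\<exists>i < ?L. ?P (w ! i) \<and> f i = j" if "j < length ?w" for j
  proof -
    have "\<exists>i < n. ?P (w ! i) \<and> f i = j" if "j < f n" "n \<le> ?L" for n
      using that
    proof (induction n)
      case (Suc n)
      show ?case
      proof (cases "j < f n")
        case True
        then show ?thesis using Suc by (auto simp: less_Suc_eq)
      next
        case False
        then have "?P (w ! n) \<and> f n = j" using Suc.prems f_Suc[of n] by (auto split: if_splits)
        then show ?thesis by blast
      qed
    qed (simp add: f0)
    from this[of ?L] show ?thesis using that fL by simp
  qed
  have step: "(j, Suc j) \<in> ?R" if j: "j < ?L" "\<not> ?P (w ! j)" for j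
  proof -
    have "w ! j \<in> set w" using j by simp
    then obtain p q where pq: "occurs w (w ! j) p q"
      by (rule dow_occurs[OF assms])
    have "j \<in> {p, q}" using pq j unfolding occurs_def by blast
    moreover have "(p, q) \<in> chords w" "w ! p = w ! j"
      using pq occurs_nth[OF pq] by (auto simp: occurs_def chords_def)
    ultimately show ?thesis
      using j joins_subset_joined[of p q w "w ! j" st] by auto
  qed
  have fib_le: "conn ?R x (x + k)" if "f x = f (x + k)" for x k
    using that
  proof (induction k)
    case (Suc k)
    have mono: "f x \<le> f (x + k)"
      by (induction k) (use f_mono in \<open>auto intro: le_trans\<close>)
    have eq: "f (x + k) = f (Suc (x + k))" "f x = f (x + k)"
      using Suc.prems mono f_mono[of "x + k"] by auto
    then have "x + k < ?L" "\<not> ?P (w ! (x + k))"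
      using f_Suc f_Suc' by (metis n_not_Suc_n)+
    then have "conn ?R (x + k) (Suc (x + k))" using step conn_base by metis
    then show ?case using Suc.IH[OF eq(2)] conn_trans by fastforce
  qed simp
  have fib: "conn ?R x y" if "f x = f y" for x y
    using that fib_le[of x "y - x"] fib_le[of y "x - y"] conn_sym by (cases "x \<le> y") auto
  have img: "f ` {..n} = {..f n}" for n
  proof (induction n)
    case (Suc n)
    have "f (Suc n) = f n \<or> f (Suc n) = Suc (f n)"
      using f_Suc[of n] f_Suc'[of n] by (cases "n < ?L") auto
    then show ?case using Suc by (auto simp: atMost_Suc)
  qed (simp add: f0)
  have "circ w st = num_classes (f ` {..?L}) (map_prod f f ` ?R)"
    unfolding circ_def using fib by (rule num_classes_contract)
  also have "\<dots> = num_classes {..length ?w} (map_prod f f ` ?R)"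
    unfolding img fL ..
  also have "\<dots> = num_classes {..length ?w} ?R'"
  proof (rule num_classes_mutual)
    fix a b assume "(a, b) \<in> map_prod f f ` ?R"
    then obtain c d where cd: "(c, d) \<in> ?R" "a = f c" "b = f d" by auto
    then consider "c = 0" "d = ?L" | p q where "(p, q) \<in> chords w" "(c, d) \<in> joins p q (st (w ! p))"
      unfolding joined_set_iff by blast
    then show "conn ?R' a b"
    proof cases
      case 1
      have "(0, length ?w) \<in> ?R'" unfolding joined_set_iff by simp
      then show ?thesis using 1 cd f0 fL by (simp only: conn_base)
    next
      case 2
      then have pq: "p < ?L" "q < ?L" "w ! p = w ! q" "p \<noteq> q" by (auto simp: chords_def)
      show ?thesis
      proof (cases "?P (w ! p)")
        case True
        then have P: "?P (w ! p)" "?P (w ! q)" using pq by auto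
        have less: "f i < f j" if "i < j" "i < ?L" "?P (w ! i)" for i j
        proof -
          have "f (Suc i) \<le> f j" using that lift_Suc_mono_le[of f "Suc i" j] f_mono by simp
          then show ?thesis using f_Suc[of i] that by simp
        qed
        have "f p \<noteq> f q"
          using less[of p q] less[of q p] pq P by (cases "p < q") auto
        then have "(f p, f q) \<in> chords ?w" "?w ! f p = w ! p"
          using nth pq P by (auto simp: chords_def)
        from joins_subset_joined[OF this, of st]
        show ?thesis
          unfolding cd by (rule conn_joins_map[OF 2(2)]) (use f_Suc pq P in auto)
      next
        case False
        then have "f c = f d" using 2(2) f_Suc pq by auto
        then show ?thesis using cd by simp
      qed
    qed
  next
    fix a b assume "(a, b) \<in> ?R'"
    then consider "a = 0" "b = length ?w" | p q where "(p, q) \<in> chords ?w" "(a, b) \<in> joins p q (st (?w ! p))"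
      unfolding joined_set_iff by blast
    then show "conn (map_prod f f ` ?R) a b"
    proof cases
      case 1
      have "(0, ?L) \<in> ?R" by (simp add: joined_set_iff)
      then have "(f 0, f ?L) \<in> map_prod f f ` ?R" by force
      then show ?thesis using 1 f0 fL by (simp add: conn_base)
    next
      case 2
      then obtain p' q' where pq: "p' < ?L" "?P (w ! p')" "f p' = p" "q' < ?L" "?P (w ! q')" "f q' = q"
        using onto unfolding chords_def by auto metis
      then have "(p', q') \<in> chords w" "w ! p' = ?w ! p"
        using 2(1) nth by (auto simp: chords_def)
      from joins_subset_joined[OF this, of st] 2(2)
      have "(a, b) \<in> map_prod f f ` ?R"
        using pq f_Suc[of p'] f_Suc[of q'] by (cases "st (?w ! p)") (auto simp: image_iff; force)+
      then show ?thesis by (rule conn_base)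
    qed
  qed
  finally show ?thesis by (simp add: circ_def)
qed

subsection \<open>Free ends\<close>

text \<open>A partial smoothing should join the free strand ends two by two. Ends are kept apart
  from their nodes \<open>\<nu> h\<close>, because two consecutive passages share a node and yet
  have two ends there.\<close>

definition paired :: "('a \<times> 'a) set \<Rightarrow> ('h \<Rightarrow> 'a) \<Rightarrow> 'h set \<Rightarrow> bool" where
  "paired R \<nu> W \<longleftrightarrow> (\<forall>h\<in>W. \<exists>!h'. h' \<in> W \<and> h' \<noteq> h \<and> conn R (\<nu> h) (\<nu> h'))"

lemma paired_cong: "(\<And>x y. conn R x y \<longleftrightarrow> conn Q x y) \<Longrightarrow> paired R \<nu> W = paired Q \<nu> W"
  by (simp add: paired_def)

text \<open>Joining two ends makes their former mates into mates of each other, or closes a circle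
  if the two were mates; \<open>k\<close> is the resulting mate.\<close>

lemma paired_insert:
  assumes "paired R \<nu> W" "h1 \<in> W" "h2 \<in> W" "h1 \<noteq> h2"
  shows "paired (insert (\<nu> h1, \<nu> h2) R) \<nu> (W - {h1, h2})"
proof -
  define m where "m h = (THE h'. h' \<in> W \<and> h' \<noteq> h \<and> conn R (\<nu> h) (\<nu> h'))" for h
  have m: "m h \<in> W" "m h \<noteq> h" "conn R (\<nu> h) (\<nu> (m h))" if "h \<in> W" for h
    using theI'[of "\<lambda>h'. h' \<in> W \<and> h' \<noteq> h \<and> conn R (\<nu> h) (\<nu> h')"] assms(1) that
    unfolding paired_def m_def by blast+
  have iff: "conn R (\<nu> h) (\<nu> h') \<longleftrightarrow> h' = h \<or> h' = m h" if "h \<in> W" "h' \<in> W" for h h'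
    using m[OF that(1)] assms(1) that unfolding paired_def by (metis conn_refl)
  have mm: "m (m h) = h" if "h \<in> W" for h
    using iff[OF m(1)[OF that] that] m[OF that] conn_sym by metis
  show ?thesis
    unfolding paired_def
  proof
    fix h assume h: "h \<in> W - {h1, h2}"
    have c: "conn (insert (\<nu> h1, \<nu> h2) R) (\<nu> h) (\<nu> h') \<longleftrightarrow>
        h' = h \<or> h' = m h \<or> m h = h1 \<and> h' = m h2 \<or> m h = h2 \<and> h' = m h1" if "h' \<in> W - {h1, h2}" for h'
      unfolding conn_insert using h that assms(2-4) by (auto simp: iff)
    define k where "k = (if m h = h1 then m h2 else if m h = h2 then m h1 else m h)"
    have "k \<in> W - {h1, h2}" "k \<noteq> h"
      using h assms(2-4) m mm unfolding k_def by (auto split: if_splits) metis+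
    moreover have "h' = k" if "h' \<in> W - {h1, h2}" "h' \<noteq> h" "conn (insert (\<nu> h1, \<nu> h2) R) (\<nu> h) (\<nu> h')" for h'
      using c[OF that(1)] that h assms(4) unfolding k_def by auto
    moreover have "conn (insert (\<nu> h1, \<nu> h2) R) (\<nu> h) (\<nu> k)"
      using c[OF calculation(1)] unfolding k_def by auto
    ultimately show "\<exists>!h'. h' \<in> W - {h1, h2} \<and> h' \<noteq> h \<and> conn (insert (\<nu> h1, \<nu> h2) R) (\<nu> h) (\<nu> h')"
      by blast
  qed
qed

text \<open>The end \<open>(i, False)\<close> leads into position \<open>i\<close> and \<open>(i, True)\<close> out of it.\<close>

definition node :: "nat \<times> bool \<Rightarrow> nat" where
  "node h = (if snd h then Suc (fst h) else fst h)"

text \<open>Without any smoothing the ends are matched along the walk, each with the next one at the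
  same node. Every smoothing then joins the four ends of its crossing in two pairs.\<close>

lemma paired_joined:
  assumes "dow w" "finite A" "A \<subseteq> set w"
  shows "paired (joined A w st) node {h. fst h < length w \<and> w ! fst h \<notin> A}"
  using assms(2,3)
proof (induction A rule: finite_induct)
  case empty
  let ?L = "length w"
  have "joined {} w st = {(0, ?L)}" by (auto simp: joined_def)
  then have c: "conn (joined {} w st) a b \<longleftrightarrow> a = b \<or> a = 0 \<and> b = ?L \<or> a = ?L \<and> b = 0" for a b
    by (auto simp: conn_insert)
  show ?case
    unfolding paired_def
  proof
    fix h :: "nat \<times> bool" assume "h \<in> {h. fst h < ?L \<and> w ! fst h \<notin> {}}"
    then have h: "fst h < ?L" by simp
    obtain i s where hb: "h = (i, s)" by (cases h)
    define k where "k = (if s then (if Suc i = ?L then (0, False) else (Suc i, False))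
      else (if i = 0 then (?L - 1, True) else (i - 1, True)))"
    have "k \<in> {h. fst h < ?L \<and> w ! fst h \<notin> {}}" "k \<noteq> h" "conn (joined {} w st) (node h) (node k)"
      using h unfolding k_def hb c node_def by (auto split: if_splits)
    moreover have "h' = k" if "fst h' < ?L" "h' \<noteq> h" "conn (joined {} w st) (node h) (node h')" for h'
      using that h unfolding k_def hb c node_def by (cases h') (auto split: if_splits)
    ultimately show "\<exists>!h'. h' \<in> {h. fst h < ?L \<and> w ! fst h \<notin> {}} \<and> h' \<noteq> h \<and> conn (joined {} w st) (node h) (node h')"
      by blast
  qed
next
  case (insert x A)
  let ?W = "\<lambda>A. {h. fst h < length w \<and> w ! fst h \<notin> A}"
  obtain p q where pq: "occurs w x p q" using dow_occurs[OF assms(1)] insert.prems by blast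
  have nth: "w ! p = x" "w ! q = x" "p < length w" "q < length w" "p \<noteq> q"
    using pq occurs_nth[OF pq] by (auto simp: occurs_def)
  let ?H = "{(p, False), (q, False), (p, True), (q, True)}"
  have W: "?W (insert x A) = ?W A - ?H"
  proof -
    have "i = p \<or> i = q" if "i < length w" "w ! i = x" for i
      using pq that unfolding occurs_def by blast
    then show ?thesis using nth by (auto; metis (full_types))
  qed
  have mem: "?H \<subseteq> ?W A" using nth insert.hyps by auto
  have IH: "paired (joined A w st) node (?W A)" using insert by blast
  have two: "paired (insert (node h1, node h2) (insert (node h3, node h4) (joined A w st))) node (?W (insert x A))"
    if "?H = {h1, h2, h3, h4}" "distinct [h1, h2, h3, h4]" for h1 h2 h3 h4
  proof -
    have "h1 \<in> ?W A" "h2 \<in> ?W A" "h3 \<in> ?W A" "h4 \<in> ?W A" using mem that(1) by blast+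
    then have "paired (insert (node h1, node h2) (insert (node h3, node h4) (joined A w st))) node (?W A - {h3, h4} - {h1, h2})"
      using that(2) by (intro paired_insert IH) auto
    moreover have "?W A - {h3, h4} - {h1, h2} = ?W (insert x A)" unfolding W that(1) by auto
    ultimately show ?thesis by simp
  qed
  have "paired (joins p q (st x) \<union> joined A w st) node (?W (insert x A))"
  proof (cases "st x")
    case Oriented
    show ?thesis
      using two[of "(p, False)" "(q, True)" "(p, True)" "(q, False)"] nth Oriented by (auto simp: node_def insert_commute)
  next
    case Unoriented
    show ?thesis
      using two[of "(p, False)" "(q, False)" "(p, True)" "(q, True)"] nth Unoriented by (auto simp: node_def insert_commute)
  next
    case Erased
    show ?thesis
      using two[of "(p, False)" "(p, True)" "(q, False)" "(q, True)"] nth Erased by (auto simp: node_def insert_commute)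
  qed
  then show ?case
    by (subst paired_cong[OF conn_joined_insert[OF pq]])
qed

text \<open>Four points have three perfect matchings; the inequalities say that the two pairs of the
  matching are apart.\<close>

lemma four_paired:
  assumes pr: "\<And>h. h \<in> {a, b, c, d} \<Longrightarrow> \<exists>!h'. h' \<in> {a, b, c, d} \<and> h' \<noteq> h \<and> f h = f h'"
    and dist: "distinct [a, b, c, d]"
  shows "f a = f b \<and> f c = f d \<and> f a \<noteq> f c \<or> f a = f c \<and> f b = f d \<and> f a \<noteq> f b \<or>
    f a = f d \<and> f b = f c \<and> f a \<noteq> f b"
proof -
  have ex: "\<exists>h'. h' \<in> {a, b, c, d} \<and> h' \<noteq> h \<and> f h = f h'" if "h \<in> {a, b, c, d}" for h
    using pr[OF that] by (rule ex1_implies_ex)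
  have uniq: "f h \<noteq> f h1 \<or> f h \<noteq> f h2" if "{h, h1, h2} \<subseteq> {a, b, c, d}" "distinct [h, h1, h2]" for h h1 h2
  proof -
    have "\<exists>!h'. h' \<in> A \<and> h' \<noteq> h \<and> f h = f h' \<Longrightarrow> h1 \<in> A \<Longrightarrow> h2 \<in> A \<Longrightarrow> f h \<noteq> f h1 \<or> f h \<noteq> f h2" for A
      using that(2) by (metis distinct_length_2_or_more)
    from this[OF pr[of h]] show ?thesis using that(1) by simp
  qed
  have 1: "f a = f b \<or> f a = f c \<or> f a = f d"
    using ex[of a, simplified] by (elim exE conjE disjE) simp_all
  have 2: "f b = f a \<or> f b = f c \<or> f b = f d"
    using ex[of b, simplified] by (elim exE conjE disjE) simp_all
  have 3: "f c = f a \<or> f c = f b \<or> f c = f d"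
    using ex[of c, simplified] by (elim exE conjE disjE) simp_all
  have 4: "f d = f a \<or> f d = f b \<or> f d = f c"
    using ex[of d, simplified] by (elim exE conjE disjE) simp_all
  have 5: "f a \<noteq> f b \<or> f a \<noteq> f c" "f a \<noteq> f b \<or> f a \<noteq> f d" "f a \<noteq> f c \<or> f a \<noteq> f d" "f b \<noteq> f c \<or> f b \<noteq> f d"
    using uniq[of a b c] uniq[of a b d] uniq[of a c d] uniq[of b c d] dist by simp_all
  show ?thesis using 1 2 3 4 5 by argo
qed
text \<open>The remaining crossings match the four ends at \<open>x\<close> in one of three ways.
  Resolving \<open>x\<close> by this same matching closes two circles, the other two resolutions
  close one. So the counts are \<open>Suc n\<close>, \<open>n\<close>, \<open>n\<close> in some
  order, and \<open>(-2) ^ Suc n + 2 * (-2) ^ n = 0\<close>.\<close>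

lemma circ_three_terms:
  assumes "dow w" "x \<in> set w"
  shows "(-2 :: real) ^ circ w (st(x := Oriented)) + (-2) ^ circ w (st(x := Unoriented)) + (-2) ^ circ w (st(x := Erased)) = 0"
proof -
  obtain p q where pq: "occurs w x p q" using dow_occurs[OF assms] by blast
  have nth: "w ! p = x" "w ! q = x" "p < length w" "q < length w" "p \<noteq> q"
    using pq occurs_nth[OF pq] by (auto simp: occurs_def)
  let ?Q = "joined (set w - {x}) w st" and ?X = "{..length w}"
  let ?W = "{(p, False), (q, False), (p, True), (q, True)}"
  have W: "{h. fst h < length w \<and> w ! fst h \<notin> set w - {x}} = ?W"
  proof -
    have "i = p \<or> i = q" if "i < length w" "w ! i = x" for i
      using pq that unfolding occurs_def by blast
    then show ?thesis using nth by (auto; metis (full_types))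
  qed
  define k where "k z = {y. conn ?Q z y}" for z
  have k: "conn ?Q u v \<longleftrightarrow> k u = k v" for u v unfolding k_def class_eq_iff ..
  have pr: "\<forall>h\<in>?W. \<exists>!h'. h' \<in> ?W \<and> h' \<noteq> h \<and> k (node h) = k (node h')"
    using paired_joined[OF assms(1), of "set w - {x}" st] unfolding W paired_def k by simp
  note eqs = bspec[OF pr]
  have ins: "int (num_classes ?X (insert (u, v) R)) = int (num_classes ?X R) - (if conn R u v then 0 else 1)"
    if "u \<le> length w" "v \<le> length w" for u v R
    using num_classes_insert[of ?X u v R] that by auto
  have c: "circ w (st(x := s)) = num_classes ?X (joins p q s \<union> ?Q)" for s
  proof -
    have "joined (set w - {x}) w (st(x := s)) = ?Q" by (rule joined_cong) auto
    then show ?thesis using circ_remove[OF pq, of "st(x := s)"] by simp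
  qed
  have cases: "k p = k (Suc p) \<and> k q = k (Suc q) \<and> k p \<noteq> k q \<or>
      k p = k q \<and> k (Suc p) = k (Suc q) \<and> k p \<noteq> k (Suc p) \<or>
      k p = k (Suc q) \<and> k (Suc p) = k q \<and> k p \<noteq> k q"
  proof -
    have "k (node h) = k (node h') \<longleftrightarrow> (k \<circ> node) h = (k \<circ> node) h'" for h h' by simp
    then have "k (node (p, False)) = k (node (p, True)) \<and> k (node (q, False)) = k (node (q, True)) \<and> k (node (p, False)) \<noteq> k (node (q, False)) \<or>
      k (node (p, False)) = k (node (q, False)) \<and> k (node (p, True)) = k (node (q, True)) \<and> k (node (p, False)) \<noteq> k (node (p, True)) \<or>
      k (node (p, False)) = k (node (q, True)) \<and> k (node (p, True)) = k (node (q, False)) \<and> k (node (p, False)) \<noteq> k (node (p, True))"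
      using four_paired[of "(p, False)" "(p, True)" "(q, False)" "(q, True)" "k \<circ> node"] eqs nth(5)
      by (simp add: insert_commute)
    then show ?thesis unfolding node_def by auto
  qed
  have pos: "circ w (st(x := s)) > 0" for s by (rule circ_pos)
  let ?N = "int (num_classes ?X ?Q)"
  have le: "p \<le> length w" "Suc p \<le> length w" "q \<le> length w" "Suc q \<le> length w" using nth by auto
  have O: "int (circ w (st(x := Oriented))) = ?N - (if k (Suc p) = k q then 0 else 1) -
      (if k p = k (Suc q) \<or> k p = k (Suc p) \<and> k q = k (Suc q) \<or> k p = k q \<and> k (Suc p) = k (Suc q) then 0 else 1)"
    unfolding c by (simp only: joins.simps Un_insert_left Un_empty_left ins[OF le(1,4)] ins[OF le(2,3)] conn_insert k)
  have U: "int (circ w (st(x := Unoriented))) = ?N - (if k (Suc p) = k (Suc q) then 0 else 1) -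
      (if k p = k q \<or> k p = k (Suc p) \<and> k (Suc q) = k q \<or> k p = k (Suc q) \<and> k (Suc p) = k q then 0 else 1)"
    unfolding c by (simp only: joins.simps Un_insert_left Un_empty_left ins[OF le(1,3)] ins[OF le(2,4)] conn_insert k)
  have X: "int (circ w (st(x := Erased))) = ?N - (if k q = k (Suc q) then 0 else 1) -
      (if k p = k (Suc p) \<or> k p = k q \<and> k (Suc q) = k (Suc p) \<or> k p = k (Suc q) \<and> k q = k (Suc p) then 0 else 1)"
    unfolding c by (simp only: joins.simps Un_insert_left Un_empty_left ins[OF le(1,2)] ins[OF le(3,4)] conn_insert k)
  have two: "(-2 :: real) ^ Suc n + (-2) ^ n + (-2) ^ n = 0" for n by simp
  show ?thesis
  proof -
    from cases consider
      "circ w (st(x := Oriented)) = Suc (circ w (st(x := Unoriented)))" "circ w (st(x := Erased)) = circ w (st(x := Unoriented))"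
    | "circ w (st(x := Unoriented)) = Suc (circ w (st(x := Oriented)))" "circ w (st(x := Erased)) = circ w (st(x := Oriented))"
    | "circ w (st(x := Erased)) = Suc (circ w (st(x := Oriented)))" "circ w (st(x := Unoriented)) = circ w (st(x := Oriented))"
    proof (elim disjE)
      assume "k p = k (Suc p) \<and> k q = k (Suc q) \<and> k p \<noteq> k q"
      then have e: "k p = k (Suc p)" "k q = k (Suc q)" "k (Suc p) \<noteq> k (Suc q)" by metis+
      show ?thesis using O U X that(3) e(3) e(3)[symmetric] unfolding e(1,2) by simp
    next
      assume "k p = k q \<and> k (Suc p) = k (Suc q) \<and> k p \<noteq> k (Suc p)"
      then have e: "k p = k q" "k (Suc p) = k (Suc q)" "k q \<noteq> k (Suc q)" by metis+
      show ?thesis using O U X that(2) e(3) e(3)[symmetric] unfolding e(1,2) by simp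
    next
      assume "k p = k (Suc q) \<and> k (Suc p) = k q \<and> k p \<noteq> k q"
      then have e: "k p = k (Suc q)" "k (Suc p) = k q" "k (Suc q) \<noteq> k q" by metis+
      show ?thesis using O U X that(1) e(3) e(3)[symmetric] unfolding e(1,2) by simp
    qed
    then show ?thesis using two by cases simp_all
  qed
qed

section \<open>Bracket of a word and Reidemeister moves\<close>

lemma conn_representative: "\<exists>k :: 'a \<Rightarrow> 'a. \<forall>u v. conn R u v \<longleftrightarrow> k u = k v"
proof -
  define k where "k u = (SOME v. conn R u v)" for u
  have k: "conn R u (k u)" for u
    unfolding k_def by (rule someI[of _ u]) simp
  have "k u = k v" if "conn R u v" for u v
  proof -
    have "conn R u x \<longleftrightarrow> conn R v x" for x
      using that conn_trans[of R u v x] conn_trans[of R v u x] conn_sym[of R u v] by blast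
    then have "conn R u = conn R v" by blast
    then show ?thesis by (simp add: k_def)
  qed
  moreover have "conn R u v" if "k u = k v" for u v
    using k[of u] k[of v] that conn_sym conn_trans by metis
  ultimately show ?thesis by blast
qed

lemma num_classes_symmetric: "R \<union> R\<inverse> = Q \<union> Q\<inverse> \<Longrightarrow> num_classes X R = num_classes X Q"
  by (simp add: num_classes_def)

lemma conn_Un_cong:
  assumes "\<And>a b. conn R a b \<longleftrightarrow> conn Q a b"
  shows "conn (S \<union> R) x y \<longleftrightarrow> conn (S \<union> Q) x y"
proof
  assume "conn (S \<union> R) x y"
  then show "conn (S \<union> Q) x y"
  proof (rule conn_subset)
    fix a b assume "(a, b) \<in> S \<union> R"
    then show "conn (S \<union> Q) a b"
      using assms[of a b] conn_base[of a b R] conn_mono[of Q a b "S \<union> Q"] conn_base[of a b "S \<union> Q"] by auto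
  qed
next
  assume "conn (S \<union> Q) x y"
  then show "conn (S \<union> R) x y"
  proof (rule conn_subset)
    fix a b assume "(a, b) \<in> S \<union> Q"
    then show "conn (S \<union> R) a b"
      using assms[of a b] conn_base[of a b Q] conn_mono[of R a b "S \<union> R"] conn_base[of a b "S \<union> R"] by auto
  qed
qed

lemma dow_occursI:
  assumes "dow w" "p < length w" "q < length w" "p \<noteq> q" "w ! p = x" "w ! q = x"
  shows "occurs w x p q"
proof -
  have "card {i. i < length w \<and> w ! i = x} = 2"
    using assms by (auto simp: dow_def count_list_card[symmetric])
  moreover have "{p, q} \<subseteq> {i. i < length w \<and> w ! i = x}" using assms by auto
  ultimately have "{p, q} = {i. i < length w \<and> w ! i = x}"
    using assms(4) by (intro card_subset_eq) auto
  then show ?thesis using assms by (simp add: occurs_def)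
qed

lemma occurs_set: "occurs w x p q \<Longrightarrow> x \<in> set w"
  using occurs_nth[of w x p q] unfolding occurs_def by (metis nth_mem)

lemma conn_circ_remove2:
  assumes "occurs w x p q" "occurs w y p' q'" "x \<noteq> y"
  shows "conn (joined (set w) w st) a b \<longleftrightarrow>
    conn (joins p q (st x) \<union> (joins p' q' (st y) \<union> joined (set w - {x, y}) w st)) a b"
proof -
  have "set w = insert x (set w - {x})" "set w - {x} = insert y (set w - {x, y})"
    using occurs_set[OF assms(1)] occurs_set[OF assms(2)] assms(3) by auto
  then show ?thesis
    using conn_joined_insert[OF assms(1), of "set w - {x}" st]
      conn_Un_cong[OF conn_joined_insert[OF assms(2), of "set w - {x, y}" st], of "joins p q (st x)"] by metis
qed

lemma circ_remove2:
  assumes "occurs w x p q" "occurs w y p' q'" "x \<noteq> y"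
  shows "circ w (st(x := s, y := t)) =
    num_classes {..length w} (joins p q s \<union> (joins p' q' t \<union> joined (set w - {x, y}) w st))"
proof -
  have "joined (set w - {x, y}) w (st(x := s, y := t)) = joined (set w - {x, y}) w st"
    by (rule joined_cong) auto
  then show ?thesis
    unfolding circ_def using conn_circ_remove2[OF assms, of "st(x := s, y := t)"] assms(3)
    by (intro num_classes_cong) simp
qed

lemma circ_remove3:
  assumes "occurs w x p q" "occurs w y p' q'" "occurs w z p'' q''" "x \<noteq> y" "x \<noteq> z" "y \<noteq> z"
  shows "circ w (st(x := s, y := t, z := u)) =
    num_classes {..length w} (joins p q s \<union> (joins p' q' t \<union> (joins p'' q'' u \<union> joined (set w - {x, y, z}) w st)))"
proof -
  have j: "joined (set w - {x, y, z}) w (st(x := s, y := t, z := u)) = joined (set w - {x, y, z}) w st"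
    by (rule joined_cong) auto
  have eq: "set w - {x, y} = insert z (set w - {x, y, z})"
    using occurs_set[OF assms(3)] assms(5,6) by auto
  have "conn (joined (set w) w (st(x := s, y := t, z := u))) a b \<longleftrightarrow>
     conn (joins p q s \<union> (joins p' q' t \<union> (joins p'' q'' u \<union> joined (set w - {x, y, z}) w st))) a b" for a b
    using conn_circ_remove2[OF assms(1,2,4), of "st(x := s, y := t, z := u)" a b]
      conn_Un_cong[OF conn_Un_cong[OF conn_joined_insert[OF assms(3), of "set w - {x, y, z}" "st(x := s, y := t, z := u)"]],
        of "joins p q s" "joins p' q' t" a b]
    unfolding eq j using assms(4-6) by simp
  then show ?thesis
    unfolding circ_def by (intro num_classes_cong) blast
qed

text \<open>A node lies between two consecutive passages and is touched only by these. This isolates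
  the middle nodes of kinks, bigons and triangles from the rest of a state.\<close>

lemma joined_avoids:
  assumes "(a, b) \<in> joined A w st" "0 < n" "n < length w" "w ! (n - 1) \<notin> A" "w ! n \<notin> A"
  shows "a \<noteq> n \<and> b \<noteq> n"
proof -
  have ne: "p \<noteq> n \<and> Suc p \<noteq> n" if "w ! p \<in> A" for p
    using that assms by (metis diff_Suc_1)
  from assms(1) consider "a = 0" "b = length w" | p q where "(p, q) \<in> chords w" "w ! p \<in> A" "(a, b) \<in> joins p q (st (w ! p))"
    unfolding joined_iff by blast
  then show ?thesis
  proof cases
    case 2
    then have "w ! q \<in> A" by (auto simp: chords_def)
    then show ?thesis using 2 ne[of p] ne[of q] by (cases "st (w ! p)") auto
  qed (use assms in auto)
qed

text \<open>The weights \<open>a\<close> and \<open>b\<close> belong to the smoothings along and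
  against the orientation, so crossing signs enter through them alone. Taking the full number of
  circles as exponent gives \<open>d\<close> times the usual normalization.\<close>

definition bracket :: "(nat \<Rightarrow> real) \<Rightarrow> (nat \<Rightarrow> real) \<Rightarrow> real \<Rightarrow> nat list \<Rightarrow> real" where
  "bracket a b d w = ssum a b (\<lambda>st. d ^ circ w st) (remdups w) (\<lambda>_. Erased)"

lemma ssum_init:
  assumes "\<And>s s'. (\<And>x. x \<in> V \<Longrightarrow> s x = s' x) \<Longrightarrow> G s = G s'"
    and "\<And>x. x \<in> V \<Longrightarrow> x \<notin> set xs \<Longrightarrow> st x = st' x"
  shows "ssum a b G xs st = ssum a b G xs st'"
  using assms(2)
proof (induction xs arbitrary: st st')
  case Nil
  then show ?case using assms(1)[of st st'] by simp
next
  case (Cons x xs)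
  have "ssum a b G xs (st(x := s)) = ssum a b G xs (st'(x := s))" for s
    by (rule Cons.IH) (use Cons.prems in auto)
  then show ?case by simp
qed

lemma ssum_bracket:
  assumes "distinct xs" "set xs = set w"
  shows "ssum a b (\<lambda>st. d ^ circ w st) xs st = bracket a b d w"
proof -
  have "ssum a b (\<lambda>st. d ^ circ w st) xs st = ssum a b (\<lambda>st. d ^ circ w st) (remdups w) st"
    by (rule ssum_perm) (use assms in auto)
  also have "\<dots> = bracket a b d w"
    unfolding bracket_def
  proof (rule ssum_init[where V = "set w"])
    fix s s' :: "nat \<Rightarrow> smoothing" assume "\<And>x. x \<in> set w \<Longrightarrow> s x = s' x"
    then show "d ^ circ w s = d ^ circ w s'" using circ_cong[of w s s'] by simp
  qed simp
  finally show ?thesis .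
qed

lemma bracket_cong:
  "(\<And>x. x \<in> set w \<Longrightarrow> a x = a' x) \<Longrightarrow> (\<And>x. x \<in> set w \<Longrightarrow> b x = b' x) \<Longrightarrow> bracket a b d w = bracket a' b' d w"
  unfolding bracket_def by (rule ssum_cong) auto

lemma bracket_rotate: "bracket a b d (xs @ ys) = bracket a b d (ys @ xs)"
proof -
  have "bracket a b d (xs @ ys) = ssum a b (\<lambda>st. d ^ circ (ys @ xs) st) (remdups (xs @ ys)) (\<lambda>_. Erased)"
    unfolding bracket_def by (simp add: circ_rotate[of xs ys])
  also have "\<dots> = bracket a b d (ys @ xs)"
    by (rule ssum_bracket) auto
  finally show ?thesis .
qed

lemma ssum_map:
  assumes "inj_on f V" "set xs \<subseteq> V" "\<And>s s'. (\<And>x. x \<in> V \<Longrightarrow> s x = s' x) \<Longrightarrow> H s = H s'"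
  shows "ssum a b (\<lambda>st. H (st \<circ> f)) (map f xs) st = ssum (a \<circ> f) (b \<circ> f) H xs (st \<circ> f)"
  using assms(2)
proof (induction xs arbitrary: st)
  case (Cons x xs)
  have "ssum (a \<circ> f) (b \<circ> f) H xs (st(f x := s) \<circ> f) = ssum (a \<circ> f) (b \<circ> f) H xs ((st \<circ> f)(x := s))" for s
  proof (rule ssum_init[where V = V])
    fix y assume "y \<in> V"
    moreover have "x \<in> V" using Cons.prems by simp
    ultimately show "(st(f x := s) \<circ> f) y = ((st \<circ> f)(x := s)) y"
      using inj_on_eq_iff[OF assms(1)] by simp
  qed (rule assms(3))
  moreover have "ssum a b (\<lambda>st. H (st \<circ> f)) (map f xs) s = ssum (a \<circ> f) (b \<circ> f) H xs (s \<circ> f)" for s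
    by (rule Cons.IH) (use Cons.prems in simp)
  ultimately show ?case by (simp only: list.map ssum.simps comp_apply[of a f x] comp_apply[of b f x])
qed simp

lemma bracket_map:
  assumes "inj_on f (set w)"
  shows "bracket a b d (map f w) = bracket (a \<circ> f) (b \<circ> f) d w"
proof -
  have "bracket a b d (map f w) = ssum a b (\<lambda>st. d ^ circ (map f w) st) (map f (remdups w)) (\<lambda>_. Erased)"
    by (rule ssum_bracket[symmetric]) (use assms in \<open>auto simp: distinct_map\<close>)
  also have "\<dots> = ssum a b (\<lambda>st. d ^ circ w (st \<circ> f)) (map f (remdups w)) (\<lambda>_. Erased)"
    by (simp add: circ_map[OF assms])
  also have "\<dots> = ssum (a \<circ> f) (b \<circ> f) (\<lambda>st. d ^ circ w st) (remdups w) ((\<lambda>_. Erased) \<circ> f)"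
  proof (rule ssum_map[OF assms])
    fix s s' :: "nat \<Rightarrow> smoothing" assume "\<And>x. x \<in> set w \<Longrightarrow> s x = s' x"
    then show "d ^ circ w s = d ^ circ w s'" using circ_cong[of w s s'] by simp
  qed simp
  also have "\<dots> = bracket (a \<circ> f) (b \<circ> f) d w"
    by (rule ssum_bracket) auto
  finally show ?thesis .
qed

text \<open>The crossings of \<open>V\<close> can be summed innermost, so a relation valid in each
  state of the others is enough; erased letters then drop out of the word. The first two
  Reidemeister moves and the loop removal all have this form.\<close>

lemma bracket_reduce:
  assumes "dow w" "distinct V" "set V \<subseteq> set w"
    and "\<And>st. (\<And>x. x \<in> set w \<Longrightarrow> x \<notin> set V \<Longrightarrow> st x \<noteq> Erased) \<Longrightarrow>
      ssum a b (\<lambda>st. d ^ circ w st) V st = c * d ^ circ w (\<lambda>x. if x \<in> set V then Erased else st x)"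
  shows "bracket a b d w = c * bracket a b d (filter (\<lambda>x. x \<notin> set V) w)"
proof -
  let ?w = "filter (\<lambda>x. x \<notin> set V) w" and ?e = "\<lambda>_. Erased"
  have "bracket a b d w = ssum a b (\<lambda>st. d ^ circ w st) (remdups ?w @ V) ?e"
    by (rule ssum_bracket[symmetric]) (use assms(2,3) in auto)
  also have "\<dots> = ssum a b (ssum a b (\<lambda>st. d ^ circ w st) V) (remdups ?w) ?e"
    by (rule ssum_append)
  also have "\<dots> = ssum a b (\<lambda>st. c * d ^ circ ?w st) (remdups ?w) ?e"
  proof (rule ssum_cong)
    fix st :: "nat \<Rightarrow> smoothing"
    assume *: "\<And>x. x \<in> set (remdups ?w) \<Longrightarrow> st x \<noteq> Erased"
    let ?st = "\<lambda>x. if x \<in> set V then Erased else st x"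
    have "filter (\<lambda>x. ?st x \<noteq> Erased) w = ?w"
      by (rule filter_cong) (use * in auto)
    then have "circ w ?st = circ ?w ?st"
      using circ_filter[OF assms(1), of ?st] by simp
    also have "\<dots> = circ ?w st" by (rule circ_cong) auto
    finally show "ssum a b (\<lambda>st. d ^ circ w st) V st = c * d ^ circ ?w st"
      using assms(4)[of st] * by simp
  qed auto
  also have "\<dots> = c * bracket a b d ?w"
    by (simp add: ssum_cmult bracket_def)
  finally show ?thesis .
qed

text \<open>The node between the two equal letters is isolated. The oriented smoothing splits it off
  as a circle, the other one behaves like a transparent crossing.\<close>

lemma bracket_kink:
  assumes "dow (xs @ [x, x])"
  shows "bracket a b d (xs @ [x, x]) = (a x * d + b x) * bracket a b d xs"
proof -
  let ?w = "xs @ [x, x]" and ?n = "length xs"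
  have oc: "occurs ?w x ?n (Suc ?n)"
    by (rule dow_occursI[OF assms]) (auto simp: nth_append)
  have "count_list ?w x = 2" using assms by (auto simp: dow_def)
  then have x: "x \<notin> set xs" by (simp add: count_list_0_iff)
  then have fl: "filter (\<lambda>y. y \<notin> set [x]) ?w = xs" by (auto simp: filter_id_conv)
  have "bracket a b d ?w = (a x * d + b x) * bracket a b d (filter (\<lambda>y. y \<notin> set [x]) ?w)"
  proof (rule bracket_reduce[OF assms])
    fix st :: "nat \<Rightarrow> smoothing"
    let ?X = "{..length ?w}"
    define Q where "Q = joined (set ?w - {x}) ?w st"
    have c: "circ ?w (st(x := s)) = num_classes ?X (joins ?n (Suc ?n) s \<union> Q)" for s
    proof -
      have "joined (set ?w - {x}) ?w (st(x := s)) = Q" unfolding Q_def by (rule joined_cong) auto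
      then show ?thesis using circ_remove[OF oc, of "st(x := s)"] by simp
    qed
    have iso: "conn Q (Suc ?n) y \<longleftrightarrow> y = Suc ?n" for y
    proof
      assume "conn Q (Suc ?n) y"
      then show "y = Suc ?n"
      proof (rule conn_isolated)
        fix a b assume "(a, b) \<in> Q"
        from this[unfolded Q_def] show "a \<noteq> Suc ?n \<and> b \<noteq> Suc ?n"
          by (rule joined_avoids) (auto simp: nth_append)
      qed
    qed simp
    then have iso': "conn Q y (Suc ?n) \<longleftrightarrow> y = Suc ?n" for y
      using conn_commute by metis
    obtain k :: "nat \<Rightarrow> nat" where k: "\<And>u v. conn Q u v \<longleftrightarrow> k u = k v"
      using conn_representative[of Q] by blast
    have ne: "k ?n \<noteq> k (Suc ?n)" "k (Suc (Suc ?n)) \<noteq> k (Suc ?n)"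
      using iso' unfolding k by auto
    have "int (circ ?w (st(x := Oriented))) = int (circ ?w (st(x := Erased))) + 1"
      unfolding c using ne ne[symmetric] by (auto simp: num_classes_insert conn_insert k)
    moreover have "circ ?w (st(x := Unoriented)) = circ ?w (st(x := Erased))"
      unfolding c by simp
    ultimately have "circ ?w (st(x := Oriented)) = Suc (circ ?w (st(x := Erased)))"
      "circ ?w (st(x := Unoriented)) = circ ?w (st(x := Erased))" by simp_all
    moreover have "(\<lambda>y. if y \<in> set [x] then Erased else st y) = st(x := Erased)" by auto
    ultimately show "ssum a b (\<lambda>st. d ^ circ ?w st) [x] st =
        (a x * d + b x) * d ^ circ ?w (\<lambda>y. if y \<in> set [x] then Erased else st y)"
      by (simp add: algebra_simps)
  qed auto
  then show ?thesis unfolding fl .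
qed

text \<open>In the parallel bigon \<open>w\<close>, smoothing both crossings along the orientation
  gives the uncrossed strands, and smoothing both against it leaves a free circle. In the
  antiparallel bigon \<open>w'\<close> these roles are exchanged, hence the two sets of conditions
  on the weights.\<close>

lemma bracket_bigon:
  fixes xs ys :: "nat list" and x y :: nat
  defines "w \<equiv> [x, y] @ xs @ [x, y] @ ys" and "w' \<equiv> [x, y] @ xs @ [y, x] @ ys"
  assumes d: "a y * b x + b y * a x + b y * b x * d = 0 \<and> a y * a x = 1 \<and> dow w \<and> v = w \<or>
      a y * b x + b y * a x + a y * a x * d = 0 \<and> b y * b x = 1 \<and> dow w' \<and> v = w'"
    and xy: "x \<noteq> y"
  shows "bracket a b d v = bracket a b d (xs @ ys)"
proof -
  let ?n = "length xs"
  define q where "q = Suc (Suc ?n)"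
  have dow: "dow v" and vw: "v = w \<or> v = w'" using d by blast+
  have v: "v ! 0 = x" "v ! 1 = y" "{v ! q, v ! Suc q} = {x, y}" "Suc q < length v" "set v = {x, y} \<union> set xs \<union> set ys"
    using vw unfolding w_def w'_def q_def by (elim disjE; simp add: nth_append insert_commute Un_assoc; fail)+
  have "count_list v x = 2" "count_list v y = 2" using dow v(5) by (auto simp: dow_def)
  then have "x \<notin> set xs" "x \<notin> set ys" "y \<notin> set xs" "y \<notin> set ys"
    using vw xy unfolding w_def w'_def by (elim disjE; simp add: count_list_0_iff)+
  then have fl: "filter (\<lambda>z. z \<notin> set [x, y]) v = xs @ ys"
  proof -
    have "filter (\<lambda>z. z \<notin> set [x, y]) xs = xs" "filter (\<lambda>z. z \<notin> set [x, y]) ys = ys"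
      unfolding filter_id_conv using \<open>x \<notin> set xs\<close> \<open>x \<notin> set ys\<close> \<open>y \<notin> set xs\<close> \<open>y \<notin> set ys\<close> by auto
    then show ?thesis using vw unfolding w_def w'_def by auto
  qed
  have "bracket a b d v = 1 * bracket a b d (filter (\<lambda>z. z \<notin> set [x, y]) v)"
  proof (rule bracket_reduce[OF dow])
    fix st :: "nat \<Rightarrow> smoothing"
    let ?X = "{..length v}"
    define Q where "Q = joined (set v - {x, y}) v st"
    have iso: "conn Q n z \<longleftrightarrow> z = n" if "n \<in> {1, Suc q}" for n z
    proof
      assume "conn Q n z"
      then show "z = n"
      proof (rule conn_isolated)
        fix a b assume "(a, b) \<in> Q"
        from this[unfolded Q_def]
        show "a \<noteq> n \<and> b \<noteq> n"
          by (rule joined_avoids) (use that v in auto)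
      qed
    qed simp
    have X: "{0, 1, 1, 2, o1, Suc q, Suc q, o2} \<subseteq> ?X" if "{o1, o2} = {q, Suc (Suc q)}" for o1 o2
    proof -
      have "o1 \<le> Suc (Suc q) \<and> o2 \<le> Suc (Suc q)" using that by (auto simp: doubleton_eq_iff)
      moreover have "2 \<le> q" by (simp add: q_def)
      ultimately show ?thesis using v(4) by simp
    qed
    have big: "num_classes ?X ({(0, Suc q), (1, o1), (1, Suc q), (2, o2)} \<union> Q) =
           num_classes ?X ({(0, o1), (1, Suc q), (1, o2), (2, Suc q)} \<union> Q)"
      "num_classes ?X ({(0, o1), (1, Suc q), (1, Suc q), (2, o2)} \<union> Q) =
           Suc (num_classes ?X ({(0, o1), (1, Suc q), (1, o2), (2, Suc q)} \<union> Q))"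
      "num_classes ?X ({(0, Suc q), (1, o1), (1, o2), (2, Suc q)} \<union> Q) =
           num_classes ?X ({(0, 1), (1, 2), (Suc q, o1), (Suc q, o2)} \<union> Q)"
      if "{o1, o2} = {q, Suc (Suc q)}" for o1 o2
    proof -
      have "q \<ge> 2" by (simp add: q_def)
      then have o: "o1 \<noteq> Suc q" "o2 \<noteq> Suc q" "o1 \<noteq> 1" "o2 \<noteq> 1" "Suc q \<noteq> 2" "Suc q \<noteq> 1"
        using that by (auto simp: doubleton_eq_iff)
      have 1: "\<not> conn Q (Suc q) z" if "z \<in> {0, 2, o1, o2, 1}" for z
      proof -
        have "z \<noteq> Suc q" using that o by (elim insertE emptyE) auto
        then show ?thesis using iso[of "Suc q" z] by simp
      qed
      have 2: "\<not> conn Q 1 z" if "z \<in> {0, 2, o1, o2}" for z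
      proof -
        have "z \<noteq> 1" using that o by (elim insertE emptyE) auto
        then show ?thesis using iso[of 1 z] by simp
      qed
      show "num_classes ?X ({(0, Suc q), (1, o1), (1, Suc q), (2, o2)} \<union> Q) =
           num_classes ?X ({(0, o1), (1, Suc q), (1, o2), (2, Suc q)} \<union> Q)" by (rule num_classes_bigon(1)) (rule finite_atMost, rule X[OF that], rule conn_refl, rule conn_refl, erule 1, erule 2)
      show "num_classes ?X ({(0, o1), (1, Suc q), (1, Suc q), (2, o2)} \<union> Q) =
           Suc (num_classes ?X ({(0, o1), (1, Suc q), (1, o2), (2, Suc q)} \<union> Q))"
        by (rule num_classes_bigon(2)) (rule finite_atMost, rule X[OF that], rule conn_refl, rule conn_refl, erule 1, erule 2)
      show "num_classes ?X ({(0, Suc q), (1, o1), (1, o2), (2, Suc q)} \<union> Q) =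
           num_classes ?X ({(0, 1), (1, 2), (Suc q, o1), (Suc q, o2)} \<union> Q)" by (rule num_classes_bigon(3)) (rule finite_atMost, rule X[OF that], rule conn_refl, rule conn_refl, erule 1, erule 2)
    qed
    have er: "(\<lambda>z. if z \<in> set [x, y] then Erased else st z) = st(x := Erased, y := Erased)" by auto
    have "ssum a b (\<lambda>st. d ^ circ v st) [x, y] st = d ^ circ v (st(x := Erased, y := Erased))"
      using d
    proof (elim disjE conjE)
      assume h: "a y * b x + b y * a x + b y * b x * d = 0" "a y * a x = 1" "dow w" "v = w"
      have "occurs v x 0 q" "occurs v y 1 (Suc q)"
        by (rule dow_occursI[OF dow]; use v(4) h(4) in \<open>auto simp: w_def q_def nth_append\<close>)+
      note c = circ_remove2[OF this xy, of st, folded Q_def]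
      define N where "N s t = circ v (st(x := s, y := t))" for s t
      have n: "N Oriented Unoriented = num_classes ?X ({(0, Suc q), (1, q), (1, Suc q), (2, Suc (Suc q))} \<union> Q)"
        "N Unoriented Oriented = num_classes ?X ({(0, q), (1, Suc q), (1, Suc (Suc q)), (2, Suc q)} \<union> Q)"
        "N Unoriented Unoriented = num_classes ?X ({(0, q), (1, Suc q), (1, Suc q), (2, Suc (Suc q))} \<union> Q)"
        "N Oriented Oriented = num_classes ?X ({(0, Suc q), (1, q), (1, Suc (Suc q)), (2, Suc q)} \<union> Q)"
        "N Erased Erased = num_classes ?X ({(0, 1), (1, 2), (Suc q, q), (Suc q, Suc (Suc q))} \<union> Q)"
        unfolding N_def c by (rule num_classes_symmetric; auto simp: numeral_2_eq_2; fail)+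
      have "N Oriented Unoriented = N Unoriented Oriented" "N Unoriented Unoriented = Suc (N Unoriented Oriented)" "N Oriented Oriented = N Erased Erased"
        unfolding n using big[OF refl] by simp_all
      then have "ssum a b (\<lambda>st. d ^ circ v st) [x, y] st =
          (a y * b x + b y * a x + b y * b x * d) * d ^ N Unoriented Oriented + a y * a x * d ^ N Erased Erased"
        by (simp add: N_def[symmetric] algebra_simps)
      then show ?thesis using h by (simp add: N_def)
    next
      assume h: "a y * b x + b y * a x + a y * a x * d = 0" "b y * b x = 1" "dow w'" "v = w'"
      have "occurs v x 0 (Suc q)" "occurs v y 1 q"
        by (rule dow_occursI[OF dow]; use v(4) h(4) in \<open>auto simp: w'_def q_def nth_append\<close>)+
      note c = circ_remove2[OF this xy, of st, folded Q_def]
      define N where "N s t = circ v (st(x := s, y := t))" for s t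
      have n: "N Unoriented Oriented = num_classes ?X ({(0, Suc q), (1, Suc (Suc q)), (1, Suc q), (2, q)} \<union> Q)"
        "N Oriented Unoriented = num_classes ?X ({(0, Suc (Suc q)), (1, Suc q), (1, q), (2, Suc q)} \<union> Q)"
        "N Oriented Oriented = num_classes ?X ({(0, Suc (Suc q)), (1, Suc q), (1, Suc q), (2, q)} \<union> Q)"
        "N Unoriented Unoriented = num_classes ?X ({(0, Suc q), (1, Suc (Suc q)), (1, q), (2, Suc q)} \<union> Q)"
        "N Erased Erased = num_classes ?X ({(0, 1), (1, 2), (Suc q, Suc (Suc q)), (Suc q, q)} \<union> Q)"
        unfolding N_def c by (rule num_classes_symmetric; auto simp: numeral_2_eq_2; fail)+
      have "N Unoriented Oriented = N Oriented Unoriented" "N Oriented Oriented = Suc (N Oriented Unoriented)" "N Unoriented Unoriented = N Erased Erased"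
        unfolding n using big[OF insert_commute] by simp_all
      then have "ssum a b (\<lambda>st. d ^ circ v st) [x, y] st =
          (a y * b x + b y * a x + a y * a x * d) * d ^ N Oriented Unoriented + b y * b x * d ^ N Erased Erased"
        by (simp add: N_def[symmetric] algebra_simps)
      then show ?thesis using h by (simp add: N_def)
    qed
    then show "ssum a b (\<lambda>st. d ^ circ v st) [x, y] st = 1 * d ^ circ v (\<lambda>z. if z \<in> set [x, y] then Erased else st z)"
      unfolding er by simp
  qed (use v xy in auto)
  then show ?thesis unfolding fl by simp
qed

section \<open>Gauss codes\<close>

definition word :: "gauss_code \<Rightarrow> nat list" where
  "word D = map fst D"

definition crossing_sign :: "gauss_code \<Rightarrow> nat \<Rightarrow> int" where
  "crossing_sign D x = (THE e. (x, Over, e) \<in> set D)"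

lemma length_word [simp]: "length (word D) = length D"
  by (simp add: word_def)

lemma nth_word: "i < length D \<Longrightarrow> word D ! i = fst (D ! i)"
  by (simp add: word_def)

lemma set_word: "set (word D) = labels D"
  by (simp add: word_def labels_def)

lemma gauss_code_unique:
  assumes "is_gauss_code D" "(x, h, e) \<in> set D" "(x, h, e') \<in> set D"
  shows "e = e'"
proof -
  have "inj_on (\<lambda>(x, h, e). (x, h)) (set D)"
    using assms(1) by (simp add: is_gauss_code_def distinct_map)
  from inj_onD[OF this, of "(x, h, e)" "(x, h, e')"] show ?thesis
    using assms(2,3) by simp
qed

lemma gauss_code_passages:
  assumes "is_gauss_code D" "(x, h, e) \<in> set D"
  shows "(e = 1 \<or> e = -1) \<and> (x, Over, e) \<in> set D \<and> (x, Under, e) \<in> set D"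
proof -
  have "\<forall>p \<in> set D. case p of (x, h, e) \<Rightarrow> e \<in> {1, -1} \<and> (x, Over, e) \<in> set D \<and> (x, Under, e) \<in> set D"
    using assms(1) unfolding is_gauss_code_def by (rule conjunct2)
  from bspec[OF this assms(2)] show ?thesis by simp
qed

lemma crossing_sign_eq:
  assumes "is_gauss_code D" "(x, h, e) \<in> set D"
  shows "crossing_sign D x = e"
proof -
  have mem: "(x, Over, e) \<in> set D" using gauss_code_passages[OF assms] by blast
  show ?thesis
    unfolding crossing_sign_def
    by (rule the_equality[where P = "\<lambda>e. (x, Over, e) \<in> set D", OF mem]) (rule gauss_code_unique[OF assms(1) _ mem])
qed

lemma crossing_sign_cases:
  assumes "is_gauss_code D" "x \<in> labels D"
  shows "crossing_sign D x = 1 \<or> crossing_sign D x = -1"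
proof -
  from assms(2) obtain h e where "(x, h, e) \<in> set D" unfolding labels_def by force
  then show ?thesis
    using crossing_sign_eq[OF assms(1)] gauss_code_passages[OF assms(1)] by metis
qed

lemma nth_gauss_code:
  assumes "is_gauss_code D" "i < length D"
  obtains h where "D ! i = (word D ! i, h, crossing_sign D (word D ! i))"
proof -
  obtain x h e where xhe: "D ! i = (x, h, e)" by (cases "D ! i")
  then have "(x, h, e) \<in> set D" using assms(2) nth_mem by metis
  from crossing_sign_eq[OF assms(1) this] xhe show ?thesis
    using that[of h] nth_word[OF assms(2)] by simp
qed

lemma dow_word:
  assumes "is_gauss_code D"
  shows "dow (word D)"
  unfolding dow_def
proof
  fix x assume "x \<in> set (word D)"
  then obtain h e where xhe: "(x, h, e) \<in> set D" unfolding word_def by force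
  have "count_list (word D) x = length (filter (\<lambda>p. fst p = x) D)"
    by (simp add: word_def count_list_eq_length_filter filter_map comp_def eq_commute)
  also have "\<dots> = card (set (filter (\<lambda>p. fst p = x) D))"
    using assms by (intro distinct_card[symmetric]) (auto simp: is_gauss_code_def distinct_map)
  also have "set (filter (\<lambda>p. fst p = x) D) = {(x, Over, e), (x, Under, e)}"
  proof -
    have "(x, Over, e) \<in> set D" "(x, Under, e) \<in> set D"
      using gauss_code_passages[OF assms xhe] by blast+
    moreover have "p \<in> {(x, Over, e), (x, Under, e)}" if p: "p \<in> set D" "fst p = x" for p
    proof -
      obtain h' e' where p': "p = (x, h', e')" using p(2) by (cases p) auto
      then have "e' = e" using crossing_sign_eq[OF assms] p(1) xhe by metis
      then show ?thesis using p' by (cases h') auto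
    qed
    ultimately show ?thesis by auto
  qed
  finally show "count_list (word D) x = 2" by simp
qed

lemma partner_eq:
  assumes "is_gauss_code D" "(i, j) \<in> chords (word D)"
  shows "partner D i = j"
proof -
  have ij: "i < length D" "j < length D" "i \<noteq> j" "word D ! i = word D ! j"
    using assms(2) by (auto simp: chords_def)
  have oc: "occurs (word D) (word D ! i) i j"
    by (rule dow_occursI[OF dow_word[OF assms(1)]]) (use ij in auto)
  show ?thesis
    unfolding partner_def
  proof (rule the_equality)
    show "j < length D \<and> j \<noteq> i \<and> fst (D ! j) = fst (D ! i)"
      using ij nth_word[of _ D] by auto
  next
    fix k assume k: "k < length D \<and> k \<noteq> i \<and> fst (D ! k) = fst (D ! i)"
    then have "(i, k) \<in> chords (word D)" using ij nth_word[of _ D] by (auto simp: chords_def)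
    from occurs_chords[OF oc this] show "k = j" using k by auto
  qed
qed

lemma chords_partner:
  assumes "is_gauss_code D" "i < length D"
  shows "(i, partner D i) \<in> chords (word D)"
proof -
  have "word D ! i \<in> set (word D)" using assms(2) by simp
  then obtain p q where pq: "occurs (word D) (word D ! i) p q" "p < q"
    using dow_occurs[OF dow_word[OF assms(1)]] by blast
  then have "i \<in> {p, q}" using assms(2) unfolding occurs_def by auto
  moreover have "p < length (word D) \<and> q < length (word D) \<and> p \<noteq> q"
    using pq(1) unfolding occurs_def by simp
  then have "(p, q) \<in> chords (word D)" "(q, p) \<in> chords (word D)"
    using occurs_nth[OF pq(1)] by (simp_all add: chords_def)
  ultimately have "\<exists>j. (i, j) \<in> chords (word D)" by blast
  then show ?thesis using partner_eq[OF assms(1)] by blast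
qed

text \<open>
  The bracket of a Gauss code is a sum over the sets of A-smoothed crossings, that of a word a sum
  over the sets of crossings smoothed along the orientation.
\<close>

definition oriented_set :: "gauss_code \<Rightarrow> nat set \<Rightarrow> nat set" where
  "oriented_set D S = {x \<in> labels D. (x \<in> S) = (crossing_sign D x = 1)}"

text \<open>Edge \<open>e\<close> of the diagram is node \<open>Suc e\<close> of the word. Only the
  edge through the base point is cut into two nodes, \<open>0\<close> and \<open>length D\<close>,
  which \<open>joined\<close> connects again.\<close>

lemma circles_eq_circ:
  assumes "is_gauss_code D"
  shows "circles D S = circ (word D) (state (oriented_set D S))"
proof (cases "D = []")
  case True
  have "joined {} [] st = {(0, 0)}" for st by (auto simp: joined_def chords_def)
  moreover have "num_classes {0::nat} {(0, 0)} = num_classes {0::nat} {}"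
    using num_classes_insert_conn[of "{}" 0 0 "{0}"] by simp
  ultimately show ?thesis
    unfolding True by (simp add: circles_def circ_def word_def edges_def smoothing_joins_def lessThan_Suc)
next
  case False
  let ?L = "length D" and ?w = "word D"
  let ?st = "state (oriented_set D S)"
  have L: "?L > 0" using False by simp
  let ?Q = "smoothing_joins D S" and ?R = "joined (set ?w) ?w ?st"
  define f where "f i = (i + ?L - 1) mod ?L" for i
  have f0: "f 0 = ?L - 1" and fSuc: "f (Suc i) = i" if "i < ?L" for i
    using L that by (auto simp: f_def)
  have finc: "f i = inc D i" for i by (simp add: f_def inc_def)
  have f0: "f 0 = ?L - 1" using L by (simp add: f_def)
  have Q: "(a, b) \<in> ?Q \<longleftrightarrow> (\<exists>i j. (i, j) \<in> chords ?w \<and>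
      (if ?st (?w ! i) = Oriented then (a, b) = (f i, j) else (a, b) \<in> {(f i, f j), (i, j)}))" for a b
  proof -
    have st: "(case D ! i of (x, h, e) \<Rightarrow> if (x \<in> S) = (e = 1) then {(inc D i, partner D i)}
        else {(inc D i, inc D (partner D i)), (i, partner D i)}) =
      (if ?st (?w ! i) = Oriented then {(f i, partner D i)} else {(f i, f (partner D i)), (i, partner D i)})"
      if i: "i < ?L" for i
    proof -
      obtain h where h: "D ! i = (?w ! i, h, crossing_sign D (?w ! i))" using nth_gauss_code[OF assms i] .
      have "?w ! i \<in> labels D" using i set_word[of D] nth_mem[of i ?w] by simp
      then show ?thesis unfolding h by (auto simp: state_def oriented_set_def finc)
    qed
    have "(a, b) \<in> ?Q \<longleftrightarrow> (\<exists>i < ?L. (a, b) \<in> (if ?st (?w ! i) = Oriented then {(f i, partner D i)}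
        else {(f i, f (partner D i)), (i, partner D i)}))"
      unfolding smoothing_joins_def using st by auto
    also have "\<dots> \<longleftrightarrow> (\<exists>i j. (i, j) \<in> chords ?w \<and>
      (if ?st (?w ! i) = Oriented then (a, b) = (f i, j) else (a, b) \<in> {(f i, f j), (i, j)}))"
    proof
      assume "\<exists>i < ?L. (a, b) \<in> (if ?st (?w ! i) = Oriented then {(f i, partner D i)}
        else {(f i, f (partner D i)), (i, partner D i)})"
      then obtain i where "i < ?L" "(a, b) \<in> (if ?st (?w ! i) = Oriented then {(f i, partner D i)}
        else {(f i, f (partner D i)), (i, partner D i)})" by blast
      then show "\<exists>i j. (i, j) \<in> chords ?w \<and>
          (if ?st (?w ! i) = Oriented then (a, b) = (f i, j) else (a, b) \<in> {(f i, f j), (i, j)})"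
        using chords_partner[OF assms, of i] by (intro exI[of _ i] exI[of _ "partner D i"]) (auto split: if_splits)
    next
      assume "\<exists>i j. (i, j) \<in> chords ?w \<and>
          (if ?st (?w ! i) = Oriented then (a, b) = (f i, j) else (a, b) \<in> {(f i, f j), (i, j)})"
      then obtain i j where ij: "(i, j) \<in> chords ?w"
          "if ?st (?w ! i) = Oriented then (a, b) = (f i, j) else (a, b) \<in> {(f i, f j), (i, j)}" by blast
      then show "\<exists>i < ?L. (a, b) \<in> (if ?st (?w ! i) = Oriented then {(f i, partner D i)}
        else {(f i, f (partner D i)), (i, partner D i)})"
        using partner_eq[OF assms ij(1)] by (intro exI[of _ i]) (auto simp: chords_def split: if_splits)
    qed
    finally show ?thesis .
  qed
  have st: "?st x = Oriented \<or> ?st x = Unoriented" for x by (auto simp: state_def)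
  have base: "(0, ?L) \<in> ?R" unfolding joined_set_iff by simp
  have "num_classes {..?L} ?R = num_classes {..<?L} ?Q"
  proof (rule num_classes_transfer[where f = f and g = Suc])
    fix a b assume "(a, b) \<in> ?R"
    then consider "a = 0" "b = ?L" | p q where "(p, q) \<in> chords ?w" "(a, b) \<in> joins p q (?st (?w ! p))"
      unfolding joined_set_iff by auto
    then show "conn ?Q (f a) (f b)"
    proof cases
      case 1
      then show ?thesis using f0 fSuc[of "?L - 1"] L by simp
    next
      case 2
      have sw: "(q, p) \<in> chords ?w" "?w ! q = ?w ! p" and pq: "p < ?L" "q < ?L"
        using 2(1) by (auto simp: chords_def)
      show ?thesis
      proof (cases "?st (?w ! p) = Oriented")
        case True
        have "(f p, q) \<in> ?Q"
          unfolding Q using 2(1) True by (intro exI[of _ p] exI[of _ q]) simp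
        moreover have "(f q, p) \<in> ?Q"
          unfolding Q using sw True by (intro exI[of _ q] exI[of _ p]) simp
        ultimately show ?thesis
          using 2(2) True fSuc pq conn_base[of "f p" q ?Q] conn_sym[OF conn_base[of "f q" p ?Q]] by auto
      next
        case False
        have "(f p, f q) \<in> ?Q" "(p, q) \<in> ?Q"
          unfolding Q by (rule exI[of _ p], rule exI[of _ q], use 2(1) False in simp)+
        then show ?thesis
          using 2(2) False st[of "?w ! p"] fSuc pq conn_base[of "f p" "f q" ?Q] conn_base[of p q ?Q] by auto
      qed
    qed
  next
    have g: "conn ?R (Suc (f i)) i" if "i \<le> ?L" for i
    proof (cases i)
      case 0
      then show ?thesis using f0 L conn_sym[OF conn_base[OF base]] by simp
    next
      case (Suc j)
      then show ?thesis using fSuc that by simp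
    qed
    then show "conn ?R (Suc (f i)) i" if "i \<in> {..?L}" for i using that by simp
    fix a b assume "(a, b) \<in> ?Q"
    then obtain i j where ij: "(i, j) \<in> chords ?w"
        "if ?st (?w ! i) = Oriented then (a, b) = (f i, j) else (a, b) \<in> {(f i, f j), (i, j)}"
      unfolding Q by blast
    have lt: "i < ?L" "j < ?L" using ij by (auto simp: chords_def)
    have R: "joins i j (?st (?w ! i)) \<subseteq> ?R" by (rule joins_subset_joined[OF ij(1) refl])
    show "conn ?R (Suc a) (Suc b)"
    proof (cases "?st (?w ! i) = Oriented")
      case True
      then have "(i, Suc j) \<in> ?R" "a = f i" "b = j" using R ij(2) by auto
      then show ?thesis using conn_trans[OF g[of i] conn_base] lt by simp
    next
      case False
      then have "(i, j) \<in> ?R" "(Suc i, Suc j) \<in> ?R" using R st[of "?w ! i"] by auto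
      moreover have "conn ?R (Suc (f i)) (Suc (f j))"
        using conn_trans[OF conn_trans[OF g[of i] conn_base[OF calculation(1)]] conn_sym[OF g[of j]]] lt by simp
      ultimately show ?thesis using ij(2) False conn_base[of "Suc i" "Suc j" ?R] by auto
    qed
  next
    fix e assume "e \<in> {..<?L}"
    then show "conn ?Q (f (Suc e)) e" using fSuc by simp
  qed (use L in \<open>auto simp: f_def\<close>)
  moreover have "edges D = {..<?L}" using L by (simp add: edges_def max_def Suc_le_eq)
  ultimately show ?thesis by (simp add: circles_def circ_def)
qed

text \<open>The signs \<open>s\<close> are an argument of their own, since later the signs vary over
  a fixed word. The division by \<open>d\<close> corrects the exponent of the loop value in
  \<open>bracket\<close>.\<close>

definition jones_word :: "nat list \<Rightarrow> (nat \<Rightarrow> int) \<Rightarrow> real \<Rightarrow> real" where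
  "jones_word w s t = (let A = t powr (-1/4); d = - (A powi 2) - A powi (-2) in
     (\<Prod>x\<in>set w. (- (A ^ 3)) powi (- s x)) * bracket (\<lambda>x. A powi s x) (\<lambda>x. A powi (- s x)) d w / d)"

lemma loop_value_neg: "A > 0 \<Longrightarrow> - (A powi 2) - A powi (-2) < (0 :: real)"
proof -
  assume "A > 0"
  then have "A powi 2 > 0" "A powi (-2) > 0" by (rule zero_less_power_int)+
  then show ?thesis by linarith
qed

lemma power_int_sum:
  assumes "(x :: 'a :: field) \<noteq> 0" "finite S"
  shows "x powi (\<Sum>i\<in>S. f i) = (\<Prod>i\<in>S. x powi f i)"
  using assms(2) by (induction S rule: finite_induct) (auto simp: power_int_add assms(1))

lemma writhe_sum:
  assumes "is_gauss_code D"
  shows "writhe D = (\<Sum>x\<in>labels D. crossing_sign D x)"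
proof -
  have "writhe D = (\<Sum>p \<in> {p \<in> set D. fst (snd p) = Over}. crossing_sign D (fst p))"
    unfolding writhe_def by (rule sum.cong) (auto simp: crossing_sign_eq[OF assms])
  also have "\<dots> = (\<Sum>x \<in> fst ` {p \<in> set D. fst (snd p) = Over}. crossing_sign D x)"
  proof (rule sum.reindex[symmetric, unfolded comp_def])
    show "inj_on fst {p \<in> set D. fst (snd p) = Over}"
      by (rule inj_onI) (auto dest: gauss_code_unique[OF assms])
  qed
  also have "fst ` {p \<in> set D. fst (snd p) = Over} = labels D"
  proof
    show "labels D \<subseteq> fst ` {p \<in> set D. fst (snd p) = Over}"
    proof
      fix x assume "x \<in> labels D"
      then obtain h e where "(x, h, e) \<in> set D" unfolding labels_def by force
      then have "(x, Over, e) \<in> set D" using gauss_code_passages[OF assms] by blast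
      then show "x \<in> fst ` {p \<in> set D. fst (snd p) = Over}" by force
    qed
  qed (auto simp: labels_def)
  finally show ?thesis .
qed

lemma kauffman_bracket_eq:
  assumes "is_gauss_code D" "A > 0"
  defines "d \<equiv> - (A powi 2) - A powi (-2)"
  shows "kauffman_bracket D A =
    bracket (\<lambda>x. A powi crossing_sign D x) (\<lambda>x. A powi (- crossing_sign D x)) d (word D) / d"
proof -
  let ?N = "labels D" and ?s = "crossing_sign D" and ?o = "oriented_set D"
  have fin: "finite ?N" by (simp add: labels_def)
  have d: "d \<noteq> 0" unfolding d_def using loop_value_neg[OF assms(2)] by simp
  have "bracket (\<lambda>x. A powi ?s x) (\<lambda>x. A powi (- ?s x)) d (word D) =
      (\<Sum>T\<in>Pow ?N. (\<Prod>x\<in>T. A powi ?s x) * (\<Prod>x\<in>?N - T. A powi (- ?s x)) * d ^ circ (word D) (state T))"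
    unfolding bracket_def ssum_Pow[OF distinct_remdups] set_remdups set_word
    by (intro sum.cong refl arg_cong2[of _ _ _ _ "(*)"] arg_cong2[of _ _ _ _ "(^)"] circ_cong) (simp add: set_word)
  also have "\<dots> = (\<Sum>S\<in>Pow ?N. (\<Prod>x\<in>?o S. A powi ?s x) * (\<Prod>x\<in>?N - ?o S. A powi (- ?s x)) * d ^ circ (word D) (state (?o S)))"
  proof -
    \<comment> \<open>Exchanging A-smoothed crossings with crossings smoothed along the orientation
      is an involution on sets of crossings, so it reindexes the state sum.\<close>
    have oo: "?o (?o S) = S" if "S \<subseteq> ?N" for S
      using that by (auto simp: oriented_set_def)
    have o: "?o S \<subseteq> ?N" for S
      by (auto simp: oriented_set_def)
    show ?thesis
      by (rule sum.reindex_bij_witness[of _ ?o ?o]) (simp_all only: Pow_iff oo o)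
  qed
  also have "\<dots> = (\<Sum>S\<in>Pow ?N. A powi (int (card S) - int (card (?N - S))) * d ^ circles D S)"
  proof (rule sum.cong[OF refl])
    fix S assume "S \<in> Pow ?N"
    then have S: "S \<subseteq> ?N" by simp
    have o: "?o S \<subseteq> ?N" by (auto simp: oriented_set_def)
    have split: "(\<Prod>x\<in>T. g x) * (\<Prod>x\<in>?N - T. h x) = (\<Prod>x\<in>?N. if x \<in> T then g x else h x)"
      if "T \<subseteq> ?N" for T and g h :: "nat \<Rightarrow> real"
    proof -
      have "{x \<in> ?N. x \<in> T} = T" "{x \<in> ?N. x \<notin> T} = ?N - T" using that by auto
      then show ?thesis using prod.If_cases[OF fin, of "\<lambda>x. x \<in> T" g h] by (simp add: Int_def Compl_eq)
    qed
    have "(\<Prod>x\<in>?o S. A powi ?s x) * (\<Prod>x\<in>?N - ?o S. A powi (- ?s x)) =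
        (\<Prod>x\<in>?N. if x \<in> ?o S then A powi ?s x else A powi (- ?s x))"
      by (rule split[OF o])
    also have "\<dots> = (\<Prod>x\<in>?N. if x \<in> S then A else inverse A)"
    proof (intro prod.cong refl)
      fix x assume x: "x \<in> ?N"
      show "(if x \<in> ?o S then A powi ?s x else A powi (- ?s x)) = (if x \<in> S then A else inverse A)"
        using crossing_sign_cases[OF assms(1) x] x
        by (elim disjE) (simp_all add: oriented_set_def power_int_minus)
    qed
    also have "\<dots> = (\<Prod>x\<in>S. A) * (\<Prod>x\<in>?N - S. inverse A)"
      by (rule split[OF S(1), symmetric])
    also have "\<dots> = A powi (int (card S) - int (card (?N - S)))"
      using assms(2) by (simp add: power_int_diff field_simps)
    finally show "(\<Prod>x\<in>?o S. A powi ?s x) * (\<Prod>x\<in>?N - ?o S. A powi (- ?s x)) * d ^ circ (word D) (state (?o S)) =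
        A powi (int (card S) - int (card (?N - S))) * d ^ circles D S"
      by (simp add: circles_eq_circ[OF assms(1)])
  qed
  also have "\<dots> = d * kauffman_bracket D A"
  proof -
    have "d ^ circles D S = d * d ^ (circles D S - 1)" for S
      using circ_pos[of "word D" "state (?o S)"] unfolding circles_eq_circ[OF assms(1)]
      by (metis Suc_pred' power_Suc)
    then show ?thesis
      unfolding kauffman_bracket_def d_def[symmetric] sum_distrib_left by (intro sum.cong refl) simp
  qed
  finally show ?thesis using d by simp
qed

lemma diagram_jones_eq:
  assumes "is_gauss_code D" "t > 0"
  shows "diagram_jones D t = jones_word (word D) (crossing_sign D) t"
proof -
  let ?A = "t powr (-1/4)"
  have A: "?A > 0" using assms(2) by simp
  have fin: "finite (labels D)" by (simp add: labels_def)
  have "(- (?A ^ 3)) powi (- writhe D) = (\<Prod>x\<in>labels D. (- (?A ^ 3)) powi (- crossing_sign D x))"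
    unfolding writhe_sum[OF assms(1)] sum_negf[symmetric]
    by (rule power_int_sum[OF _ fin]) (use A in auto)
  then show ?thesis
    unfolding diagram_jones_def jones_word_def Let_def kauffman_bracket_eq[OF assms(1) A] set_word by simp
qed

section \<open>The third Reidemeister move\<close>

lemma num_classes_attach:
  assumes "finite X" "m \<in> X" "x \<in> X" "y \<in> X" "m \<noteq> x" "m \<noteq> y"
    and "\<And>a b. (a, b) \<in> R \<Longrightarrow> a \<noteq> m \<and> b \<noteq> m"
  shows "num_classes X (insert (m, x) R) = num_classes X (insert (m, y) R)"
proof -
  have "\<not> conn R m x" "\<not> conn R m y"
    using conn_isolated[of R m x] conn_isolated[of R m y] assms(5-7) by auto
  then show ?thesis
    using num_classes_insert_not_conn[of X m x R] num_classes_insert_not_conn[of X m y R] assms(1-4) by simp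
qed

lemma num_classes_slide:
  assumes "conn R b c"
  shows "num_classes X (insert (a, b) R) = num_classes X (insert (a, c) R)"
proof (rule num_classes_mutual)
  show "conn (insert (a, c) R) u v" if "(u, v) \<in> insert (a, b) R" for u v
    using that assms conn_sym[OF assms] by (auto simp: conn_insert intro: conn_base)
  show "conn (insert (a, b) R) u v" if "(u, v) \<in> insert (a, c) R" for u v
    using that assms conn_sym[OF assms] by (auto simp: conn_insert intro: conn_base)
qed

text \<open>The pairs joined when two strand pieces \<open>p0\<close>-\<open>p1\<close> and \<open>r0\<close>-\<open>r1\<close> meet.\<close>

definition meet :: "bool \<Rightarrow> 'a \<Rightarrow> 'a \<Rightarrow> 'a \<Rightarrow> 'a \<Rightarrow> ('a \<times> 'a) set" where
  "meet k p0 p1 r0 r1 = (if k then {(p0, r1), (p1, r0)} else {(p0, r0), (p1, r1)})"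

text \<open>
  Smoothing the crossing of the middle and the bottom strand leaves either a bigon with the top
  strand, on either side, or two arcs that the top strand meets in the same way on either side.
\<close>

lemma triangle_sum:
  fixes X :: "'a set" and t0 t1 t2 m0 m1 m2 b0 b1 b2 :: 'a and c p d :: real
  assumes fin: "finite X" and X: "{t0, t1, t2, m0, m1, m2, b0, b1, b2} \<subseteq> X"
    and Q: "\<And>a b. (a, b) \<in> Q \<Longrightarrow> {a, b} \<inter> {t1, m1, b1} = {}"
    and dist: "t1 \<noteq> m1" "t1 \<noteq> b1" "m1 \<noteq> b1" "{t0, t2, m0, m2, b0, b2} \<inter> {t1, m1, b1} = {}"
    and cp: "c * p = 1" and d: "d = - c\<^sup>2 - p\<^sup>2"
  defines "N \<equiv> \<lambda>k1 k2 k3. num_classes X (meet k1 t0 t1 m0 m1 \<union> (meet k2 t1 t2 b0 b1 \<union> (meet k3 m1 m2 b1 b2 \<union> Q)))"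
    and "N' \<equiv> \<lambda>k1 k2 k3. num_classes X (meet k1 t1 t2 m1 m2 \<union> (meet k2 t0 t1 b1 b2 \<union> (meet k3 m0 m1 b0 b1 \<union> Q)))"
    and "v \<equiv> \<lambda>k. if k then c else p"
  shows "(\<Sum>k1\<in>UNIV. \<Sum>k2\<in>UNIV. \<Sum>k3\<in>UNIV. v k1 * v k2 * v k3 * d ^ N k1 k2 k3) =
         (\<Sum>k1\<in>UNIV. \<Sum>k2\<in>UNIV. \<Sum>k3\<in>UNIV. v k1 * v k2 * v k3 * d ^ N' k1 k2 k3)"
proof -
  have Q': "a \<noteq> t1 \<and> a \<noteq> m1 \<and> a \<noteq> b1 \<and> b \<noteq> t1 \<and> b \<noteq> m1 \<and> b \<noteq> b1" if "(a, b) \<in> Q" for a b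
    using Q[OF that] by auto
  have ne: "t0 \<noteq> t1" "t0 \<noteq> m1" "t0 \<noteq> b1" "t2 \<noteq> t1" "t2 \<noteq> m1" "t2 \<noteq> b1" "m0 \<noteq> t1" "m0 \<noteq> m1" "m0 \<noteq> b1"
    "m2 \<noteq> t1" "m2 \<noteq> m1" "m2 \<noteq> b1" "b0 \<noteq> t1" "b0 \<noteq> m1" "b0 \<noteq> b1" "b2 \<noteq> t1" "b2 \<noteq> m1" "b2 \<noteq> b1"
    using dist(4) by auto
  have inX: "t0 \<in> X" "t1 \<in> X" "t2 \<in> X" "m0 \<in> X" "m1 \<in> X" "m2 \<in> X" "b0 \<in> X" "b1 \<in> X" "b2 \<in> X"
    using X by auto
  have bigon: "num_classes X ({(t0, n), (t1, o1), (t1, n'), (t2, o2)} \<union> S) =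
           num_classes X ({(t0, o1), (t1, n), (t1, o2), (t2, n')} \<union> S)"
      "num_classes X ({(t0, o1), (t1, n), (t1, n'), (t2, o2)} \<union> S) =
           Suc (num_classes X ({(t0, o1), (t1, n), (t1, o2), (t2, n')} \<union> S))"
      "num_classes X ({(t0, n), (t1, o1), (t1, o2), (t2, n')} \<union> S) =
           num_classes X ({(t0, t1), (t1, t2), (n, o1), (n', o2)} \<union> S)"
    if "S = {(m1, b1), (e, f)} \<union> Q" "{n, n'} = {m1, b1}" "{e, f, o1, o2} \<subseteq> {m0, m2, b0, b2}" for S n n' o1 o2 e f
  proof -
    have ef: "e \<notin> {t1, m1, b1}" "f \<notin> {t1, m1, b1}" using that(3) ne by auto
    note S_eq = that(1)
    have S: "(a \<noteq> t1 \<and> b \<noteq> t1) \<and> ((a \<in> {m1, b1}) = (b \<in> {m1, b1}))" if "(a, b) \<in> S" for a b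
    proof -
      from that consider "a = m1" "b = b1" | "a = e" "b = f" | "(a, b) \<in> Q" unfolding S_eq by blast
      then show ?thesis using ef Q'[of a b] dist(1,2) by cases auto
    qed
    have n: "n \<in> {m1, b1}" "n' \<in> {m1, b1}" using that(2) by auto
    have "conn S m1 b1" using that(1) by (auto intro: conn_base)
    then have nn: "conn S n n'" using n conn_sym by auto
    have o: "o1 \<in> {m0, m2, b0, b2}" "o2 \<in> {m0, m2, b0, b2}" using that(3) by auto
    have 1: "\<not> conn S n z" if "z \<in> {t0, t2, o1, o2, t1}" for z
    proof
      assume "conn S n z"
      then have "(n \<in> {m1, b1}) = (z \<in> {m1, b1})" by (rule conn_invariant) (use S in blast)
      then show False using n that o ne dist by auto
    qed
    have 2: "\<not> conn S t1 z" if "z \<in> {t0, t2, o1, o2}" for z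
    proof
      assume "conn S t1 z"
      then have "z = t1" by (rule conn_isolated) (use S in blast)
      then show False using that o ne by auto
    qed
    have Xs: "{t0, t1, t1, t2, o1, n, n', o2} \<subseteq> X" using inX n o by auto
    show "num_classes X ({(t0, n), (t1, o1), (t1, n'), (t2, o2)} \<union> S) =
           num_classes X ({(t0, o1), (t1, n), (t1, o2), (t2, n')} \<union> S)"
      by (rule num_classes_bigon(1)) (rule fin, rule Xs, rule nn, rule conn_refl, erule 1, erule 2)
    show "num_classes X ({(t0, o1), (t1, n), (t1, n'), (t2, o2)} \<union> S) =
           Suc (num_classes X ({(t0, o1), (t1, n), (t1, o2), (t2, n')} \<union> S))"
      by (rule num_classes_bigon(2)) (rule fin, rule Xs, rule nn, rule conn_refl, erule 1, erule 2)
    show "num_classes X ({(t0, n), (t1, o1), (t1, o2), (t2, n')} \<union> S) =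
           num_classes X ({(t0, t1), (t1, t2), (n, o1), (n', o2)} \<union> S)"
      by (rule num_classes_bigon(3)) (rule fin, rule Xs, rule nn, rule conn_refl, erule 1, erule 2)
  qed
  \<comment> \<open>The value \<open>False\<close> of the third flag joins \<open>m1\<close> to
    \<open>b1\<close>: the top strand forms a bigon with the arc from \<open>m0\<close> to
    \<open>b0\<close>, and the three relations of a bigon apply.\<close>
  have F: "N True True False = N False False False" "N False True False = Suc (N False False False)"
    "N True False False = num_classes X ({(t0, t1), (t1, t2), (m1, m0), (b1, b0)} \<union> ({(m1, b1), (m2, b2)} \<union> Q))"
  proof -
    let ?S = "{(m1, b1), (m2, b2)} \<union> Q"
    have "N True True False = num_classes X ({(t0, m1), (t1, m0), (t1, b1), (t2, b0)} \<union> ?S)"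
      "N False False False = num_classes X ({(t0, m0), (t1, m1), (t1, b0), (t2, b1)} \<union> ?S)"
      "N False True False = num_classes X ({(t0, m0), (t1, m1), (t1, b1), (t2, b0)} \<union> ?S)"
      "N True False False = num_classes X ({(t0, m1), (t1, m0), (t1, b0), (t2, b1)} \<union> ?S)"
      unfolding N_def meet_def by (rule num_classes_symmetric; auto; fail)+
    then show "N True True False = N False False False" "N False True False = Suc (N False False False)"
      "N True False False = num_classes X ({(t0, t1), (t1, t2), (m1, m0), (b1, b0)} \<union> ({(m1, b1), (m2, b2)} \<union> Q))"
      using bigon[of ?S m2 b2 m1 b1 m0 b0] by simp_all
  qed
  have F': "N' True True False = N' False False False" "N' True False False = num_classes X ({(t0, t1), (t1, t2), (b1, b2), (m1, m2)} \<union> ({(m1, b1), (m0, b0)} \<union> Q))"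
    "N' False True False = Suc (N' False False False)"
  proof -
    let ?S = "{(m1, b1), (m0, b0)} \<union> Q"
    have "N' False False False = num_classes X ({(t0, b1), (t1, b2), (t1, m1), (t2, m2)} \<union> ?S)"
      "N' True True False = num_classes X ({(t0, b2), (t1, b1), (t1, m2), (t2, m1)} \<union> ?S)"
      "N' False True False = num_classes X ({(t0, b2), (t1, b1), (t1, m1), (t2, m2)} \<union> ?S)"
      "N' True False False = num_classes X ({(t0, b1), (t1, b2), (t1, m2), (t2, m1)} \<union> ?S)"
      unfolding N'_def meet_def by (rule num_classes_symmetric; auto; fail)+
    then show "N' True True False = N' False False False" "N' True False False = num_classes X ({(t0, t1), (t1, t2), (b1, b2), (m1, m2)} \<union> ({(m1, b1), (m0, b0)} \<union> Q))"
      "N' False True False = Suc (N' False False False)"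
      using bigon[of ?S m0 b0 b1 m1 b2 m2] by (simp_all add: insert_commute)
  qed
  \<comment> \<open>With the top strand pulled off the bigon, the two sides differ only in where the
    nodes \<open>m1\<close> and \<open>b1\<close> hang, and a pendant node lowers the count by one
    wherever it is attached.\<close>
  have FF: "N True False False = N' True False False"
  proof -
    let ?S = "{(t0, t1), (t1, t2), (m0, b0), (m2, b2)} \<union> Q"
    have S: "a \<noteq> m1 \<and> b \<noteq> m1 \<and> a \<noteq> b1 \<and> b \<noteq> b1" if "(a, b) \<in> ?S" for a b
      using that Q'[of a b] dist ne by auto
    have "N True False False = num_classes X (insert (b1, b0) (insert (m1, m0) ?S))"
      unfolding F
    proof (rule num_classes_mutual)
      let ?R = "insert (b1, b0) (insert (m1, m0) ?S)"
      have 1: "conn ?R m1 m0" "conn ?R m0 b0" "conn ?R b1 b0" by (rule conn_base, simp)+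
      have "conn ?R m1 b1" using conn_trans[OF conn_trans[OF 1(1,2)] conn_sym[OF 1(3)]] .
      then show "conn ?R u v" if "(u, v) \<in> {(t0, t1), (t1, t2), (m1, m0), (b1, b0)} \<union> ({(m1, b1), (m2, b2)} \<union> Q)" for u v
        using that by (auto intro: conn_base)
      let ?R = "{(t0, t1), (t1, t2), (m1, m0), (b1, b0)} \<union> ({(m1, b1), (m2, b2)} \<union> Q)"
      have 1: "conn ?R m1 m0" "conn ?R m1 b1" "conn ?R b1 b0" by (rule conn_base, simp)+
      have "conn ?R m0 b0" using conn_trans[OF conn_trans[OF conn_sym[OF 1(1)] 1(2)] 1(3)] .
      then show "conn ?R u v" if "(u, v) \<in> insert (b1, b0) (insert (m1, m0) ?S)" for u v
        using that by (auto intro: conn_base)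
    qed
    also have "\<dots> = num_classes X (insert (b1, b2) (insert (m1, m0) ?S))"
      by (rule num_classes_attach) (use fin inX ne dist S in auto)
    also have "\<dots> = num_classes X (insert (m1, m0) (insert (b1, b2) ?S))"
      by (simp add: insert_commute)
    also have "\<dots> = num_classes X (insert (m1, m2) (insert (b1, b2) ?S))"
      by (rule num_classes_attach) (use fin inX ne dist S in auto)
    also have "\<dots> = N' True False False"
      unfolding F'
    proof (rule num_classes_mutual)
      let ?R = "{(t0, t1), (t1, t2), (b1, b2), (m1, m2)} \<union> ({(m1, b1), (m0, b0)} \<union> Q)"
      have 1: "conn ?R m1 m2" "conn ?R m1 b1" "conn ?R b1 b2" by (rule conn_base, simp)+
      have "conn ?R m2 b2" using conn_trans[OF conn_trans[OF conn_sym[OF 1(1)] 1(2)] 1(3)] .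
      then show "conn ?R u v" if "(u, v) \<in> insert (m1, m2) (insert (b1, b2) ?S)" for u v
        using that by (auto intro: conn_base)
      let ?R = "insert (m1, m2) (insert (b1, b2) ?S)"
      have 1: "conn ?R m1 m2" "conn ?R m2 b2" "conn ?R b1 b2" by (rule conn_base, simp)+
      have "conn ?R m1 b1" using conn_trans[OF conn_trans[OF 1(1,2)] conn_sym[OF 1(3)]] .
      then show "conn ?R u v" if "(u, v) \<in> {(t0, t1), (t1, t2), (b1, b2), (m1, m2)} \<union> ({(m1, b1), (m0, b0)} \<union> Q)" for u v
        using that by (auto intro: conn_base)
    qed
    finally show ?thesis .
  qed
  have slide: "num_classes X ({(x, m1), (y, b1)} \<union> ({(m1, e), (b1, f)} \<union> S)) =
      num_classes X ({(x, e), (y, f)} \<union> ({(m1, g), (b1, h)} \<union> S))"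
    if S: "\<And>a b. (a, b) \<in> S \<Longrightarrow> a \<noteq> m1 \<and> b \<noteq> m1 \<and> a \<noteq> b1 \<and> b \<noteq> b1"
      and "{x, y, e, f, g, h} \<subseteq> {t0, t1, t2, m0, m2, b0, b2}" for x y e f g h S
  proof -
    have xs: "x \<noteq> m1" "x \<noteq> b1" "y \<noteq> m1" "y \<noteq> b1" "e \<noteq> m1" "e \<noteq> b1" "f \<noteq> m1" "f \<noteq> b1" "g \<noteq> m1" "g \<noteq> b1" "h \<noteq> m1" "h \<noteq> b1"
      "e \<in> X" "f \<in> X" "g \<in> X" "h \<in> X"
    proof -
      define Y where "Y = {t0, t1, t2, m0, m2, b0, b2}"
      have Y: "z \<noteq> m1 \<and> z \<noteq> b1 \<and> z \<in> X" if "z \<in> Y" for z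
        using that ne dist(1-3) inX unfolding Y_def by (elim insertE emptyE) simp_all
      have "x \<in> Y" "y \<in> Y" "e \<in> Y" "f \<in> Y" "g \<in> Y" "h \<in> Y"
        using that(2) unfolding Y_def[symmetric] by simp_all
      then show "x \<noteq> m1" "x \<noteq> b1" "y \<noteq> m1" "y \<noteq> b1" "e \<noteq> m1" "e \<noteq> b1" "f \<noteq> m1" "f \<noteq> b1" "g \<noteq> m1" "g \<noteq> b1" "h \<noteq> m1" "h \<noteq> b1"
        "e \<in> X" "f \<in> X" "g \<in> X" "h \<in> X"
        using Y by auto
    qed
    have "num_classes X ({(x, m1), (y, b1)} \<union> ({(m1, e), (b1, f)} \<union> S)) =
        num_classes X (insert (x, m1) (insert (y, b1) ({(m1, e), (b1, f)} \<union> S)))"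
      by (rule arg_cong[of _ _ "num_classes X"]) auto
    also have "\<dots> = num_classes X (insert (x, e) (insert (y, b1) ({(m1, e), (b1, f)} \<union> S)))"
      by (rule num_classes_slide, rule conn_base) simp
    also have "\<dots> = num_classes X (insert (y, b1) (insert (x, e) ({(m1, e), (b1, f)} \<union> S)))"
      by (rule arg_cong[of _ _ "num_classes X"]) auto
    also have "\<dots> = num_classes X (insert (y, f) (insert (x, e) ({(m1, e), (b1, f)} \<union> S)))"
      by (rule num_classes_slide, rule conn_base) simp
    also have "\<dots> = num_classes X (insert (m1, e) (insert (b1, f) ({(x, e), (y, f)} \<union> S)))"
      by (rule arg_cong[of _ _ "num_classes X"]) auto
    also have "\<dots> = num_classes X (insert (m1, g) (insert (b1, f) ({(x, e), (y, f)} \<union> S)))"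
      by (rule num_classes_attach) (use fin inX xs dist(3) S in auto)
    also have "\<dots> = num_classes X (insert (b1, f) (insert (m1, g) ({(x, e), (y, f)} \<union> S)))"
      by (rule arg_cong[of _ _ "num_classes X"]) auto
    also have "\<dots> = num_classes X (insert (b1, h) (insert (m1, g) ({(x, e), (y, f)} \<union> S)))"
      by (rule num_classes_attach) (use fin inX xs dist(3) S in auto)
    also have "\<dots> = num_classes X ({(x, e), (y, f)} \<union> ({(m1, g), (b1, h)} \<union> S))"
      by (rule arg_cong[of _ _ "num_classes X"]) auto
    finally show ?thesis .
  qed
  \<comment> \<open>Now the middle and bottom strands are rejoined to two arcs,
    \<open>m0\<close>-\<open>b2\<close> and \<open>b0\<close>-\<open>m2\<close>. The top strand
    meets the first of them on the middle strand in \<open>N\<close> and on the bottom strand in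
    \<open>N'\<close>, and conversely for the second, so \<open>s\<close> and \<open>r\<close> trade
    places.\<close>
  have T: "N s r True = N' r s True" for s r
  proof -
    define S where "S = {(if s then t1 else t0, m0), (if r then t2 else t1, b0)} \<union> Q"
    define S' where "S' = {(if r then t1 else t2, m2), (if s then t0 else t1, b2)} \<union> Q"
    have S: "a \<noteq> m1 \<and> b \<noteq> m1 \<and> a \<noteq> b1 \<and> b \<noteq> b1" if "(a, b) \<in> S" for a b
      using that Q'[of a b] dist ne unfolding S_def by (auto split: if_splits)
    have S': "a \<noteq> m1 \<and> b \<noteq> m1 \<and> a \<noteq> b1 \<and> b \<noteq> b1" if "(a, b) \<in> S'" for a b
      using that Q'[of a b] dist ne unfolding S'_def by (auto split: if_splits)
    let ?x = "if s then t0 else t1" and ?y = "if r then t1 else t2"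
    let ?x' = "if r then t2 else t1" and ?y' = "if s then t1 else t0"
    have "N s r True = num_classes X ({(?x, m1), (?y, b1)} \<union> ({(m1, b2), (b1, m2)} \<union> S))"
      unfolding N_def meet_def S_def by (rule num_classes_symmetric) (cases s; cases r; auto)
    also have "\<dots> = num_classes X ({(?x, b2), (?y, m2)} \<union> ({(m1, b2), (b1, m2)} \<union> S))"
      by (rule slide[OF S]) auto
    also have "\<dots> = num_classes X ({(?x', b0), (?y', m0)} \<union> ({(m1, b2), (b1, m2)} \<union> S'))"
      unfolding S_def S'_def by (rule arg_cong[of _ _ "num_classes X"]) (cases s; cases r; auto)
    also have "\<dots> = num_classes X ({(?x', m1), (?y', b1)} \<union> ({(m1, b0), (b1, m0)} \<union> S'))"
      by (rule slide[OF S', symmetric]) auto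
    also have "\<dots> = N' r s True"
      unfolding N'_def meet_def S'_def by (rule num_classes_symmetric) (cases s; cases r; auto)
    finally show ?thesis .
  qed
  \<comment> \<open>Of the four states with a bigon, the three that do not pull the strands apart
    cancel, as in the second move.\<close>
  have 0: "p * p * p * d ^ n + c * c * p * d ^ n + p * c * p * d ^ Suc n = 0" for n
  proof -
    have "p * p * p * d ^ n + c * c * p * d ^ n + p * c * p * d ^ Suc n = p * d ^ n * (p\<^sup>2 + c\<^sup>2 + (c * p) * d)"
      by (simp add: algebra_simps power2_eq_square)
    then show ?thesis by (simp add: cp d)
  qed
  show ?thesis
    using 0[of "N False False False"] 0[of "N' False False False"]
    by (simp add: UNIV_bool v_def F(1,2) F'(1,3) FF T algebra_simps)
qed

text \<open>The move exchanges the two letters on each side of the triangle and keeps the nodes. For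
  a pair of strands, the flag \<open>(ta < tb) = (ma < mc)\<close> and its analogues tell whether
  both run in the same sense from the outer nodes numbered 0 to those numbered 2; this decides which
  smoothing is \<open>meet True\<close> and must carry the weight \<open>c\<close>.\<close>

lemma bracket_triangle:
  fixes w w' :: "nat list" and ta tb ma mc bb bc x y z :: nat and a b :: "nat \<Rightarrow> real"
  assumes dow: "dow w" "dow w'" and len: "length w' = length w" and set: "set w' = set w"
    and xyz: "x \<noteq> y" "x \<noteq> z" "y \<noteq> z"
    and adj: "tb = Suc ta \<or> ta = Suc tb" "mc = Suc ma \<or> ma = Suc mc" "bc = Suc bb \<or> bb = Suc bc"
    and pos: "distinct [ta, tb, ma, mc, bb, bc]"
      "ta < length w" "tb < length w" "ma < length w" "mc < length w" "bb < length w" "bc < length w"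
    and w: "w ! ta = x" "w ! tb = y" "w ! ma = x" "w ! mc = z" "w ! bb = y" "w ! bc = z"
    and w': "w' ! ta = y" "w' ! tb = x" "w' ! ma = z" "w' ! mc = x" "w' ! bb = z" "w' ! bc = y"
    and other: "\<And>i. i < length w \<Longrightarrow> i \<notin> {ta, tb, ma, mc, bb, bc} \<Longrightarrow> w' ! i = w ! i"
    and x: "(if (ta < tb) = (ma < mc) then a x else b x) = c" "(if (ta < tb) = (ma < mc) then b x else a x) = p"
    and y: "(if (ta < tb) = (bb < bc) then a y else b y) = c" "(if (ta < tb) = (bb < bc) then b y else a y) = p"
    and z: "(if (ma < mc) = (bb < bc) then a z else b z) = c" "(if (ma < mc) = (bb < bc) then b z else a z) = p"
    and cp: "c * p = 1" and d: "d = - c\<^sup>2 - p\<^sup>2"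
  shows "bracket a b d w = bracket a b d w'"
proof -
  let ?V = "[x, y, z]" and ?us = "remdups (filter (\<lambda>u. u \<notin> {x, y, z}) w)"
  let ?L = "length w"
  have xyzw: "{x, y, z} \<subseteq> set w" using w pos nth_mem by auto
  have oc: "occurs w x ta ma" "occurs w y tb bb" "occurs w z mc bc"
    by (rule dow_occursI[OF dow(1)]; use pos w in simp)+
  have oc': "occurs w' x tb mc" "occurs w' y ta bc" "occurs w' z ma bb"
    by (rule dow_occursI[OF dow(2)]; use pos w' len in simp)+
  define t0 where "t0 = (if ta < tb then ta else Suc ta)"
  define t1 where "t1 = max ta tb"
  define t2 where "t2 = (if ta < tb then Suc tb else tb)"
  define m0 where "m0 = (if ma < mc then ma else Suc ma)"
  define m1 where "m1 = max ma mc"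
  define m2 where "m2 = (if ma < mc then Suc mc else mc)"
  define b0 where "b0 = (if bb < bc then bb else Suc bb)"
  define b1 where "b1 = max bb bc"
  define b2 where "b2 = (if bb < bc then Suc bc else bc)"
  note node_defs = t0_def t1_def t2_def m0_def m1_def m2_def b0_def b1_def b2_def
  define sm where "sm k f = (if k = f then Oriented else Unoriented)" for k f :: bool
  let ?fx = "(ta < tb) = (ma < mc)" and ?fy = "(ta < tb) = (bb < bc)" and ?fz = "(ma < mc) = (bb < bc)"
  have tcase: "ta < tb \<and> t0 = ta \<and> t1 = Suc ta \<and> t1 = tb \<and> t2 = Suc tb \<or> \<not> ta < tb \<and> t0 = Suc ta \<and> t1 = ta \<and> t1 = Suc tb \<and> t2 = tb"
    using adj(1) unfolding node_defs by auto
  have mcase: "ma < mc \<and> m0 = ma \<and> m1 = Suc ma \<and> m1 = mc \<and> m2 = Suc mc \<or> \<not> ma < mc \<and> m0 = Suc ma \<and> m1 = ma \<and> m1 = Suc mc \<and> m2 = mc"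
    using adj(2) unfolding node_defs by auto
  have bcase: "bb < bc \<and> b0 = bb \<and> b1 = Suc bb \<and> b1 = bc \<and> b2 = Suc bc \<or> \<not> bb < bc \<and> b0 = Suc bb \<and> b1 = bb \<and> b1 = Suc bc \<and> b2 = bc"
    using adj(3) unfolding node_defs by auto
  have meet_gen: "joins i j (sm k (f = g)) = meet k p0 p1 r0 r1"
    if "if f then p0 = i \<and> p1 = Suc i else p0 = Suc i \<and> p1 = i" "if g then r0 = j \<and> r1 = Suc j else r0 = Suc j \<and> r1 = j"
    for i j p0 p1 r0 r1 :: nat and f g k
    using that unfolding sm_def meet_def by (cases f; cases g; cases k) auto
  have piece: "if ta < tb then t0 = ta \<and> t1 = Suc ta else t0 = Suc ta \<and> t1 = ta"
    "if ta < tb then t1 = tb \<and> t2 = Suc tb else t1 = Suc tb \<and> t2 = tb"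
    "if ma < mc then m0 = ma \<and> m1 = Suc ma else m0 = Suc ma \<and> m1 = ma"
    "if ma < mc then m1 = mc \<and> m2 = Suc mc else m1 = Suc mc \<and> m2 = mc"
    "if bb < bc then b0 = bb \<and> b1 = Suc bb else b0 = Suc bb \<and> b1 = bb"
    "if bb < bc then b1 = bc \<and> b2 = Suc bc else b1 = Suc bc \<and> b2 = bc"
    using tcase mcase bcase by auto
  note J = meet_gen[OF piece(1,3)] meet_gen[OF piece(2,5)] meet_gen[OF piece(4,6)]
    meet_gen[OF piece(2,4)] meet_gen[OF piece(1,6)] meet_gen[OF piece(3,5)]
  have chords_eq: "{e \<in> chords w'. w' ! fst e \<in> set w - {x, y, z}} = {e \<in> chords w. w ! fst e \<in> set w - {x, y, z}}"
  proof -
    have 1: "i \<notin> {ta, tb, ma, mc, bb, bc}" if "w ! i \<in> set w - {x, y, z} \<or> w' ! i \<in> set w - {x, y, z}" for i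
      using that w w' by auto
    have 2: "w' ! i = w ! i" if "i < ?L" "w ! i \<in> set w - {x, y, z} \<or> w' ! i \<in> set w - {x, y, z}" for i
      using other[OF that(1) 1[OF that(2)]] .
    have "(i, j) \<in> chords w' \<and> w' ! i \<in> set w - {x, y, z} \<longleftrightarrow> (i, j) \<in> chords w \<and> w ! i \<in> set w - {x, y, z}" for i j
      unfolding chords_def len using 2[of i] 2[of j] by auto
    note iff = this
    show ?thesis
    proof (rule set_eqI)
      fix e
      show "e \<in> {e \<in> chords w'. w' ! fst e \<in> set w - {x, y, z}} \<longleftrightarrow> e \<in> {e \<in> chords w. w ! fst e \<in> set w - {x, y, z}}"
        using iff[of "fst e" "snd e"] by simp
    qed
  qed
  have joined_eq: "joined (set w - {x, y, z}) w' st = joined (set w - {x, y, z}) w st" for st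
  proof -
    have eq: "w' ! fst e = w ! fst e" if "e \<in> {e \<in> chords w. w ! fst e \<in> set w - {x, y, z}}" for e
    proof -
      have "fst e < ?L" "fst e \<notin> {ta, tb, ma, mc, bb, bc}"
        using that w by (auto simp: chords_def)
      then show ?thesis by (rule other)
    qed
    show ?thesis
      unfolding joined_def chords_eq len
      by (intro arg_cong[of _ _ "insert _"] SUP_cong refl) (use eq in \<open>auto split: prod.splits\<close>)
  qed
  have local: "ssum a b (\<lambda>st. d ^ circ w st) ?V st = ssum a b (\<lambda>st. d ^ circ w' st) ?V st" for st
  proof -
    let ?X = "{..?L}"
    define Q where "Q = joined (set w - {x, y, z}) w st"
    have c: "circ w (st(x := s, y := t, z := u)) = num_classes ?X (joins ta ma s \<union> (joins tb bb t \<union> (joins mc bc u \<union> Q)))" for s t u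
      using circ_remove3[OF oc xyz, of st s t u] unfolding Q_def .
    have c': "circ w' (st(x := s, y := t, z := u)) = num_classes ?X (joins tb mc s \<union> (joins ta bc t \<union> (joins ma bb u \<union> Q)))" for s t u
      using circ_remove3[OF oc' xyz, of st s t u] unfolding Q_def set joined_eq len .
    define v where "v k = (if k then c else p)" for k
    have sum2: "(\<Sum>k\<in>UNIV. v k * F (sm k f)) = (if f then c else p) * F Oriented + (if f then p else c) * F Unoriented"
      for F :: "smoothing \<Rightarrow> real" and f
      by (simp add: UNIV_bool v_def sm_def)
    have xs: "a x * F Oriented + b x * F Unoriented = (\<Sum>k\<in>UNIV. v k * F (sm k ?fx))"
      "a y * F Oriented + b y * F Unoriented = (\<Sum>k\<in>UNIV. v k * F (sm k ?fy))"
      "a z * F Oriented + b z * F Unoriented = (\<Sum>k\<in>UNIV. v k * F (sm k ?fz))" for F :: "smoothing \<Rightarrow> real"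
      unfolding sum2 x[symmetric] by (simp, unfold x y[symmetric], simp, unfold y z[symmetric], simp)
    have ex: "ssum a b G ?V st = (\<Sum>k1\<in>UNIV. \<Sum>k2\<in>UNIV. \<Sum>k3\<in>UNIV. v k1 * v k2 * v k3 *
        G (st(x := sm k1 ?fx, y := sm k2 ?fy, z := sm k3 ?fz)))" for G
      unfolding ssum.simps xs(1)[of "\<lambda>s. a y * (a z * G (st(x := s, y := Oriented, z := Oriented)) + b z * G (st(x := s, y := Oriented, z := Unoriented))) +
            b y * (a z * G (st(x := s, y := Unoriented, z := Oriented)) + b z * G (st(x := s, y := Unoriented, z := Unoriented)))"]
      unfolding xs(2)[of "\<lambda>t. a z * G (st(x := _, y := t, z := Oriented)) + b z * G (st(x := _, y := t, z := Unoriented))"]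
      unfolding xs(3)[of "\<lambda>u. G (st(x := _, y := _, z := u))"]
      by (simp add: sum_distrib_left mult.assoc)
    have t1: "0 < t1" "t1 < ?L" "w ! (t1 - 1) \<in> {x, y}" "w ! t1 \<in> {x, y}"
      using tcase w pos by auto
    have m1: "0 < m1" "m1 < ?L" "w ! (m1 - 1) \<in> {x, z}" "w ! m1 \<in> {x, z}"
      using mcase w pos by auto
    have b1: "0 < b1" "b1 < ?L" "w ! (b1 - 1) \<in> {y, z}" "w ! b1 \<in> {y, z}"
      using bcase w pos by auto
    have Q: "{e, f} \<inter> {t1, m1, b1} = {}" if "(e, f) \<in> Q" for e f
      using joined_avoids[OF that[unfolded Q_def] t1(1,2)] joined_avoids[OF that[unfolded Q_def] m1(1,2)]
        joined_avoids[OF that[unfolded Q_def] b1(1,2)] t1(3,4) m1(3,4) b1(3,4) by auto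
    have X: "{t0, t1, t2, m0, m1, m2, b0, b1, b2} \<subseteq> ?X"
    proof -
      have "t0 \<le> ?L \<and> t1 \<le> ?L \<and> t2 \<le> ?L" using tcase pos(2,3) by (elim disjE) simp_all
      moreover have "m0 \<le> ?L \<and> m1 \<le> ?L \<and> m2 \<le> ?L" using mcase pos(4,5) by (elim disjE) simp_all
      moreover have "b0 \<le> ?L \<and> b1 \<le> ?L \<and> b2 \<le> ?L" using bcase pos(6,7) by (elim disjE) simp_all
      ultimately show ?thesis by simp
    qed
    have dist: "t1 \<noteq> m1" "t1 \<noteq> b1" "m1 \<noteq> b1" "{t0, t2, m0, m2, b0, b2} \<inter> {t1, m1, b1} = {}"
    proof -
      obtain t where t: "t1 = Suc t" "t0 = t \<or> t0 = Suc (Suc t)" "t2 = t \<or> t2 = Suc (Suc t)" "{ta, tb} = {t, Suc t}"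
        using tcase by (elim disjE) (auto simp: insert_commute)
      obtain m where m: "m1 = Suc m" "m0 = m \<or> m0 = Suc (Suc m)" "m2 = m \<or> m2 = Suc (Suc m)" "{ma, mc} = {m, Suc m}"
        using mcase by (elim disjE) (auto simp: insert_commute)
      obtain b where b: "b1 = Suc b" "b0 = b \<or> b0 = Suc (Suc b)" "b2 = b \<or> b2 = Suc (Suc b)" "{bb, bc} = {b, Suc b}"
        using bcase by (elim disjE) (auto simp: insert_commute)
      have disj: "{ta, tb} \<inter> {ma, mc} = {}" "{ta, tb} \<inter> {bb, bc} = {}" "{ma, mc} \<inter> {bb, bc} = {}"
        using pos(1) by auto
      have ne: "t \<noteq> m" "t \<noteq> Suc m" "m \<noteq> Suc t" "t \<noteq> b" "t \<noteq> Suc b" "b \<noteq> Suc t" "m \<noteq> b" "m \<noteq> Suc b" "b \<noteq> Suc m"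
        using disj unfolding t(4) m(4) b(4) by auto
      show "t1 \<noteq> m1" "t1 \<noteq> b1" "m1 \<noteq> b1" using ne t(1) m(1) b(1) by simp_all
      have "x \<notin> {t1, m1, b1}" if "x \<in> {t, Suc (Suc t), m, Suc (Suc m), b, Suc (Suc b)}" for x
        using that ne ne[symmetric] unfolding t(1) m(1) b(1) by (elim insertE emptyE) simp_all
      moreover have "{t0, t2} \<subseteq> {t, Suc (Suc t)}" "{m0, m2} \<subseteq> {m, Suc (Suc m)}" "{b0, b2} \<subseteq> {b, Suc (Suc b)}"
        using t(2,3) m(2,3) b(2,3) by auto
      ultimately show "{t0, t2, m0, m2, b0, b2} \<inter> {t1, m1, b1} = {}" by blast
    qed
    show ?thesis
      unfolding ex c c' J v_def
      by (rule triangle_sum[OF _ X Q dist cp d]) simp_all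
  qed
  have "bracket a b d w = ssum a b (\<lambda>st. d ^ circ w st) (?us @ ?V) (\<lambda>_. Erased)"
    by (rule ssum_bracket[symmetric]) (use xyz xyzw in auto)
  also have "\<dots> = ssum a b (\<lambda>st. d ^ circ w' st) (?us @ ?V) (\<lambda>_. Erased)"
    unfolding ssum_append by (rule ssum_cong) (simp_all only: local)
  also have "\<dots> = bracket a b d w'"
    by (rule ssum_bracket) (use xyz xyzw set in auto)
  finally show ?thesis .
qed

definition pair_list :: "bool \<Rightarrow> nat \<Rightarrow> nat \<Rightarrow> nat list" where
  "pair_list s x y = (if s then [x, y] else [y, x])"

lemma length_pair_list [simp]: "length (pair_list s x y) = 2"
  by (simp add: pair_list_def)

lemma set_pair_list [simp]: "set (pair_list s x y) = {x, y}"
  by (auto simp: pair_list_def)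

lemma nth_pair_list:
  "pair_list s x y ! 0 = (if s then x else y)" "pair_list s x y ! Suc 0 = (if s then y else x)"
  by (simp_all add: pair_list_def)

lemma bracket_triangle_lists:
  fixes n1 n2 n3 :: nat
  assumes dow: "dow w" "dow w'" and len: "length w' = length w" and set: "set w' = set w"
    and xyz: "x \<noteq> y" "x \<noteq> z" "y \<noteq> z"
    and pos: "Suc n1 < length w" "Suc n2 < length w" "Suc n3 < length w"
      "{n1, Suc n1} \<inter> {n2, Suc n2} = {}" "{n1, Suc n1} \<inter> {n3, Suc n3} = {}" "{n2, Suc n2} \<inter> {n3, Suc n3} = {}"
    and w: "w ! n1 = pair_list s1 x y ! 0" "w ! Suc n1 = pair_list s1 x y ! 1"
      "w ! n2 = pair_list s2 x z ! 0" "w ! Suc n2 = pair_list s2 x z ! 1"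
      "w ! n3 = pair_list s3 y z ! 0" "w ! Suc n3 = pair_list s3 y z ! 1"
    and w': "w' ! n1 = pair_list (\<not> s1) x y ! 0" "w' ! Suc n1 = pair_list (\<not> s1) x y ! 1"
      "w' ! n2 = pair_list (\<not> s2) x z ! 0" "w' ! Suc n2 = pair_list (\<not> s2) x z ! 1"
      "w' ! n3 = pair_list (\<not> s3) y z ! 0" "w' ! Suc n3 = pair_list (\<not> s3) y z ! 1"
    and other: "\<And>i. i < length w \<Longrightarrow> i \<notin> {n1, Suc n1, n2, Suc n2, n3, Suc n3} \<Longrightarrow> w' ! i = w ! i"
    and x: "(if s1 = s2 then a x else b x) = c" "(if s1 = s2 then b x else a x) = p"
    and y: "(if s1 = s3 then a y else b y) = c" "(if s1 = s3 then b y else a y) = p"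
    and z: "(if s2 = s3 then a z else b z) = c" "(if s2 = s3 then b z else a z) = p"
    and cp: "c * p = 1" and d: "d = - c\<^sup>2 - p\<^sup>2"
  shows "bracket a b d w = bracket a b d w'"
proof -
  define ta where "ta = (if s1 then n1 else Suc n1)"
  define tb where "tb = (if s1 then Suc n1 else n1)"
  define ma where "ma = (if s2 then n2 else Suc n2)"
  define mc where "mc = (if s2 then Suc n2 else n2)"
  define bb where "bb = (if s3 then n3 else Suc n3)"
  define bc where "bc = (if s3 then Suc n3 else n3)"
  note defs = ta_def tb_def ma_def mc_def bb_def bc_def
  have lt: "(ta < tb) = s1" "(ma < mc) = s2" "(bb < bc) = s3" unfolding defs by simp_all
  have sets: "{ta, tb} = {n1, Suc n1}" "{ma, mc} = {n2, Suc n2}" "{bb, bc} = {n3, Suc n3}"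
    unfolding defs by auto
  have all: "{ta, tb, ma, mc, bb, bc} = {n1, Suc n1, n2, Suc n2, n3, Suc n3}"
    using sets by (metis Un_insert_left sup_bot_left)
  note nths = nth_pair_list
  show ?thesis
  proof (rule bracket_triangle[where ta = ta and tb = tb and ma = ma and mc = mc and bb = bb and bc = bc])
    show "distinct [ta, tb, ma, mc, bb, bc]"
    proof -
      have "ta \<noteq> tb" "ma \<noteq> mc" "bb \<noteq> bc" unfolding defs by simp_all
      moreover have "{ta, tb} \<inter> {ma, mc} = {}" "{ta, tb} \<inter> {bb, bc} = {}" "{ma, mc} \<inter> {bb, bc} = {}"
        unfolding sets using pos(4-6) .
      ultimately show ?thesis by auto
    qed
    show "w' ! i = w ! i" if "i < length w" "i \<notin> {ta, tb, ma, mc, bb, bc}" for i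
      using other that unfolding all by blast
    show "(if (ta < tb) = (ma < mc) then a x else b x) = c" "(if (ta < tb) = (ma < mc) then b x else a x) = p"
      "(if (ta < tb) = (bb < bc) then a y else b y) = c" "(if (ta < tb) = (bb < bc) then b y else a y) = p"
      "(if (ma < mc) = (bb < bc) then a z else b z) = c" "(if (ma < mc) = (bb < bc) then b z else a z) = p"
      unfolding lt by (fact x y z)+
    show "w ! ta = x" "w ! tb = y" "w' ! ta = y" "w' ! tb = x"
      using w(1,2) w'(1,2) by (cases s1; simp add: defs nths)+
    show "w ! ma = x" "w ! mc = z" "w' ! ma = z" "w' ! mc = x"
      using w(3,4) w'(3,4) by (cases s2; simp add: defs nths)+
    show "w ! bb = y" "w ! bc = z" "w' ! bb = z" "w' ! bc = y"
      using w(5,6) w'(5,6) by (cases s3; simp add: defs nths)+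
    show "tb = Suc ta \<or> ta = Suc tb" "mc = Suc ma \<or> ma = Suc mc" "bc = Suc bb \<or> bb = Suc bc"
      unfolding defs by auto
    show "ta < length w" "tb < length w" "ma < length w" "mc < length w" "bb < length w" "bc < length w"
      using pos(1-3) unfolding defs by auto
  qed (fact dow len set xyz cp d)+
qed

lemma crossing_sign_cong: "set D = set D' \<Longrightarrow> crossing_sign D = crossing_sign D'"
  by (simp add: crossing_sign_def fun_eq_iff)

lemma jones_word_cong:
  assumes "set w = set w'" "\<And>A. A > 0 \<Longrightarrow> bracket (\<lambda>x. A powi s x) (\<lambda>x. A powi (- s x)) (- (A powi 2) - A powi (-2)) w =
    bracket (\<lambda>x. A powi s x) (\<lambda>x. A powi (- s x)) (- (A powi 2) - A powi (-2)) w'" "t > 0"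
  shows "jones_word w s t = jones_word w' s t"
  using assms(2)[of "t powr (-1/4)"] assms(1,3) unfolding jones_word_def Let_def by simp

lemma word_append [simp]: "word (xs @ ys) = word xs @ word ys"
  by (simp add: word_def)

lemma word_ordered: "word (ordered s p q) = pair_list (s = 1) (fst p) (fst q)"
  by (simp add: word_def ordered_def pair_list_def)

lemma set_ordered: "set (ordered s p q) = {p, q}"
  by (auto simp: ordered_def)

lemma word_sides:
  "word (top_side k a b c) = pair_list (k * snd c = 1) (fst a) (fst b)"
  "word (middle_side k a b c) = pair_list (k * snd b = 1) (fst a) (fst c)"
  "word (bottom_side k a b c) = pair_list (k * snd a = 1) (fst b) (fst c)"
  by (simp_all add: top_side_def middle_side_def bottom_side_def word_ordered over_def under_def)

lemma set_sides:
  "set (top_side k a b c) = {over a, over b}" "set (middle_side k a b c) = {under a, over c}"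
  "set (bottom_side k a b c) = {under b, under c}"
  by (simp_all add: top_side_def middle_side_def bottom_side_def set_ordered)

lemma distinct_side_labels:
  assumes gc: "is_gauss_code D" and sub: "over p \<in> set D" "over q \<in> set D" "p \<noteq> q"
  shows "fst p \<noteq> fst q"
proof
  assume eq: "fst p = fst q"
  then have "snd p = snd q"
    using gauss_code_unique[OF gc, of "fst p" Over "snd p" "snd q"] sub(1,2) by (simp add: over_def)
  then show False using eq sub(3) by (simp add: prod_eq_iff)
qed

lemma jones_word_R3:
  assumes gc: "is_gauss_code D" "is_gauss_code D'" and sets: "set D' = set D"
    and k: "k = 1 \<or> k = (-1 :: int)" and t: "t > 0"
    and D: "D = top_side k a b c @ xs @ middle_side k a b c @ ys @ bottom_side k a b c @ zs \<and>
         D' = top_side (-k) a b c @ xs @ middle_side (-k) a b c @ ys @ bottom_side (-k) a b c @ zs \<or>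
       D = top_side k a b c @ xs @ bottom_side k a b c @ ys @ middle_side k a b c @ zs \<and>
         D' = top_side (-k) a b c @ xs @ bottom_side (-k) a b c @ ys @ middle_side (-k) a b c @ zs"
  shows "jones_word (word D) (crossing_sign D) t = jones_word (word D') (crossing_sign D') t"
proof -
  let ?s = "crossing_sign D" and ?w = "word D" and ?w' = "word D'"
  have mem: "over a \<in> set D" "over b \<in> set D" "over c \<in> set D"
    using D by (auto simp: set_sides)
  have sign: "?s (fst p) = snd p" "snd p = 1 \<or> snd p = -1" if "over p \<in> set D" for p
    using crossing_sign_eq[OF gc(1), of "fst p" Over "snd p"] gauss_code_passages[OF gc(1), of "fst p" Over "snd p"] that
    by (simp_all add: over_def)
  have dist: "distinct D" using gc(1) unfolding is_gauss_code_def by (simp add: distinct_map)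
  have abc: "a \<noteq> b" "a \<noteq> c" "b \<noteq> c"
    using D dist by (auto simp: set_sides top_side_def middle_side_def bottom_side_def ordered_def split: if_splits)
  let ?x = "fst a" and ?y = "fst b" and ?z = "fst c"
  have xyz: "?x \<noteq> ?y" "?x \<noteq> ?z" "?y \<noteq> ?z"
    using distinct_side_labels[OF gc(1)] mem abc by blast+
  define s1 where "s1 = (k * snd c = 1)"
  define s2 where "s2 = (k * snd b = 1)"
  define s3 where "s3 = (k * snd a = 1)"
  have neg: "(- k * snd c = 1) = (\<not> s1)" "(- k * snd b = 1) = (\<not> s2)" "(- k * snd a = 1) = (\<not> s3)"
    using k sign(2)[OF mem(1)] sign(2)[OF mem(2)] sign(2)[OF mem(3)] unfolding s1_def s2_def s3_def by auto
  note ws = word_sides[of k a b c, folded s1_def s2_def s3_def] word_sides[of "- k" a b c, unfolded neg]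
  show ?thesis
    unfolding crossing_sign_cong[OF sets]
  proof (rule jones_word_cong[OF _ _ t])
    show "set ?w = set ?w'" using sets by (simp add: word_def)
    fix A :: real assume A: "A > 0"
    \<comment> \<open>If the two sides at a crossing run in the same sense, the signs of the other
      two crossings agree, and otherwise they are opposite. Hence the smoothing selected by the
      directions has the weight \<open>A powi e\<close> at all three crossings.\<close>
    define e where "e = snd a * snd b * snd c"
    let ?a = "\<lambda>x. A powi ?s x" and ?b = "\<lambda>x. A powi (- ?s x)"
    have sg: "?s ?x = snd a" "?s ?y = snd b" "?s ?z = snd c" using sign(1) mem by blast+
    have x: "(if s1 = s2 then ?a ?x else ?b ?x) = A powi e" "(if s1 = s2 then ?b ?x else ?a ?x) = A powi (- e)"
      and y: "(if s1 = s3 then ?a ?y else ?b ?y) = A powi e" "(if s1 = s3 then ?b ?y else ?a ?y) = A powi (- e)"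
      and z: "(if s2 = s3 then ?a ?z else ?b ?z) = A powi e" "(if s2 = s3 then ?b ?z else ?a ?z) = A powi (- e)"
      using k sign(2)[OF mem(1)] sign(2)[OF mem(2)] sign(2)[OF mem(3)]
      unfolding sg s1_def s2_def s3_def e_def by (elim disjE; simp)+
    have e: "e = 1 \<or> e = -1"
      using sign(2)[OF mem(1)] sign(2)[OF mem(2)] sign(2)[OF mem(3)] unfolding e_def by auto
    have cp: "A powi e * A powi (- e) = 1" using A by (simp add: power_int_minus)
    have d: "- (A powi 2) - A powi (-2) = - (A powi e)\<^sup>2 - (A powi (- e))\<^sup>2"
      using e A by (auto simp: power_int_minus power_inverse)
    have lens: "length ?w' = length ?w" using D by (auto simp: top_side_def middle_side_def bottom_side_def ordered_def)
    note tri = bracket_triangle_lists[OF dow_word[OF gc(1)] dow_word[OF gc(2)] lens _ xyz]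
    from D show "bracket ?a ?b (- (A powi 2) - A powi (-2)) ?w = bracket ?a ?b (- (A powi 2) - A powi (-2)) ?w'"
    proof (elim disjE conjE)
      assume D1: "D = top_side k a b c @ xs @ middle_side k a b c @ ys @ bottom_side k a b c @ zs"
        and D2: "D' = top_side (-k) a b c @ xs @ middle_side (-k) a b c @ ys @ bottom_side (-k) a b c @ zs"
      let ?n2 = "2 + length xs" and ?n3 = "4 + length xs + length ys"
      have w: "?w = pair_list s1 ?x ?y @ word xs @ pair_list s2 ?x ?z @ word ys @ pair_list s3 ?y ?z @ word zs"
        and w': "?w' = pair_list (\<not> s1) ?x ?y @ word xs @ pair_list (\<not> s2) ?x ?z @ word ys @ pair_list (\<not> s3) ?y ?z @ word zs"
        unfolding D1 D2 by (simp_all add: ws)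
      have L: "length D = 6 + length xs + length ys + length zs"
        using arg_cong[OF w, of length] by (simp add: word_def)
      show ?thesis
      proof (rule tri[where ?n1.0 = 0 and ?n2.0 = ?n2 and ?n3.0 = ?n3 and ?s1.0 = s1 and ?s2.0 = s2 and ?s3.0 = s3, OF _ _ _ _ _ _ _ _ _ _ _ _ _ _ _ _ _ _ _ _ x y z cp d])
        show "?w' ! i = ?w ! i" if "i < length ?w" "i \<notin> {0, Suc 0, ?n2, Suc ?n2, ?n3, Suc ?n3}" for i
          using that unfolding w w' by (auto simp: nth_append less_2_cases_iff; presburger)
      qed (simp_all add: sets set_word labels_def L, simp_all add: w w' nth_append numeral_2_eq_2)
    next
      assume D1: "D = top_side k a b c @ xs @ bottom_side k a b c @ ys @ middle_side k a b c @ zs"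
        and D2: "D' = top_side (-k) a b c @ xs @ bottom_side (-k) a b c @ ys @ middle_side (-k) a b c @ zs"
      let ?n3 = "2 + length xs" and ?n2 = "4 + length xs + length ys"
      have w: "?w = pair_list s1 ?x ?y @ word xs @ pair_list s3 ?y ?z @ word ys @ pair_list s2 ?x ?z @ word zs"
        and w': "?w' = pair_list (\<not> s1) ?x ?y @ word xs @ pair_list (\<not> s3) ?y ?z @ word ys @ pair_list (\<not> s2) ?x ?z @ word zs"
        unfolding D1 D2 by (simp_all add: ws)
      have L: "length D = 6 + length xs + length ys + length zs"
        using arg_cong[OF w, of length] by (simp add: word_def)
      show ?thesis
      proof (rule tri[where ?n1.0 = 0 and ?n2.0 = ?n2 and ?n3.0 = ?n3 and ?s1.0 = s1 and ?s2.0 = s2 and ?s3.0 = s3, OF _ _ _ _ _ _ _ _ _ _ _ _ _ _ _ _ _ _ _ _ x y z cp d])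
        show "?w' ! i = ?w ! i" if "i < length ?w" "i \<notin> {0, Suc 0, ?n2, Suc ?n2, ?n3, Suc ?n3}" for i
          using that unfolding w w' by (auto simp: nth_append less_2_cases_iff; presburger)
      qed (simp_all add: sets set_word labels_def L, simp_all add: w w' nth_append numeral_2_eq_2)
    qed
  qed
qed

section \<open>Invariance of the Jones polynomial under the moves\<close>

lemma crossing_sign_extend:
  assumes "is_gauss_code D" "is_gauss_code D'" "set D \<subseteq> set D'" "x \<in> labels D"
  shows "crossing_sign D' x = crossing_sign D x"
proof -
  from assms(4) obtain h e where "(x, h, e) \<in> set D" unfolding labels_def by force
  then show ?thesis
    using crossing_sign_eq[OF assms(1)] crossing_sign_eq[OF assms(2)] assms(3) by (metis subsetD)
qed

lemma jones_word_sign_cong: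
  "(\<And>x. x \<in> set w \<Longrightarrow> s x = s' x) \<Longrightarrow> jones_word w s t = jones_word w s' t"
proof -
  assume *: "\<And>x. x \<in> set w \<Longrightarrow> s x = s' x"
  have "bracket (\<lambda>x. A powi s x) (\<lambda>x. A powi (- s x)) d w = bracket (\<lambda>x. A powi s' x) (\<lambda>x. A powi (- s' x)) d w" for A d
    by (rule bracket_cong) (simp_all add: *)
  moreover have "(\<Prod>x\<in>set w. (- (A ^ 3)) powi (- s x)) = (\<Prod>x\<in>set w. (- (A ^ 3)) powi (- s' x))" for A :: real
    by (rule prod.cong) (simp_all add: *)
  ultimately show ?thesis by (simp add: jones_word_def)
qed

text \<open>A kink multiplies the bracket by \<open>- (A ^ 3)\<close> raised to the power of its
  sign, and the framing factor of the crossing is the inverse of this.\<close>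

lemma jones_word_kink:
  assumes "dow (w @ [x, x])" "s x = 1 \<or> s x = -1" "t > 0"
  shows "jones_word (w @ [x, x]) s t = jones_word w s t"
proof -
  define A where "A = t powr (-1/4)"
  have A: "A > 0" using assms(3) by (simp add: A_def)
  have "count_list (w @ [x, x]) x = 2" using assms(1) by (auto simp: dow_def)
  then have x: "x \<notin> set w" by (simp add: count_list_0_iff)
  let ?d = "- (A powi 2) - A powi (-2)"
  have "(- (A ^ 3)) powi (- s x) * (A powi s x * ?d + A powi (- s x)) = 1"
    using assms(2)
  proof
    assume "s x = 1"
    then show ?thesis using A by (simp add: power_int_minus field_simps power2_eq_square power3_eq_cube)
  next
    assume "s x = -1"
    then show ?thesis using A by (simp add: power_int_minus field_simps power2_eq_square power3_eq_cube)
  qed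
  then show ?thesis
    unfolding jones_word_def Let_def A_def[symmetric] bracket_kink[OF assms(1)] using x
    by (simp add: mult_ac)
qed

text \<open>With opposite signs the framing factors cancel, and both sets of weight conditions of
  \<open>bracket_bigon\<close> hold, so one argument covers the parallel and the antiparallel
  move.\<close>

lemma jones_word_bigon:
  assumes v: "v = [x, y] @ xs @ [x, y] @ ys \<or> v = [x, y] @ xs @ [y, x] @ ys"
    and dow: "dow v" and s: "s x = 1 \<or> s x = -1" "s y = - s x" and xy: "x \<noteq> y" and t: "t > 0"
  shows "jones_word v s t = jones_word (xs @ ys) s t"
proof -
  define A where "A = t powr (-1/4)"
  have A: "A > 0" using t by (simp add: A_def)
  let ?d = "- (A powi 2) - A powi (-2)"
  have "count_list v x = 2" "count_list v y = 2" using dow v by (auto simp: dow_def)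
  then have nx: "x \<notin> set (xs @ ys)" "y \<notin> set (xs @ ys)" "set v = insert x (insert y (set (xs @ ys)))"
    using v xy by (auto simp: count_list_0_iff)
  have e: "A powi s y * A powi (- s x) + A powi (- s y) * A powi s x + 1 * ?d = 0"
    "A powi s y * A powi s x = 1" "A powi (- s y) * A powi (- s x) = 1"
    using s A by (auto simp: power_int_minus power_inverse power2_eq_square)
  have "bracket (\<lambda>x. A powi s x) (\<lambda>x. A powi (- s x)) ?d v = bracket (\<lambda>x. A powi s x) (\<lambda>x. A powi (- s x)) ?d (xs @ ys)"
    by (rule bracket_bigon[OF _ xy]) (use v dow e in auto)
  moreover have "(- (A ^ 3)) powi (- s x) * (- (A ^ 3)) powi (- s y) = 1"
    using s A by (auto simp: power_int_minus)
  ultimately show ?thesis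
    unfolding jones_word_def Let_def A_def[symmetric] nx(3) using nx(1,2) xy
    by (simp add: mult.assoc[symmetric])
qed

lemma jones_word_rotate: "jones_word (xs @ ys) s t = jones_word (ys @ xs) s t"
proof -
  have "set (xs @ ys) = set (ys @ xs)" by auto
  then show ?thesis
    unfolding jones_word_def Let_def bracket_rotate[of _ _ _ xs ys] by simp
qed

lemma jones_word_relabel:
  assumes "inj_on f (set w)"
  shows "jones_word (map f w) s t = jones_word w (s \<circ> f) t"
  unfolding jones_word_def Let_def bracket_map[OF assms] using assms
  by (simp add: prod.reindex comp_def)

lemma jones_word_move:
  assumes gc: "is_gauss_code D" "is_gauss_code D'" and mv: "move D D'" and t: "t > 0"
  shows "jones_word (word D) (crossing_sign D) t = jones_word (word D') (crossing_sign D') t"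
proof -
  have sg: "crossing_sign D (fst p) = snd p" "snd p = 1 \<or> snd p = -1" if "over p \<in> set D" "is_gauss_code D" for p D
    using crossing_sign_eq[OF that(2), of "fst p" Over "snd p"] gauss_code_passages[OF that(2), of "fst p" Over "snd p"] that(1)
    by (simp_all add: over_def)
  have ext: "jones_word (word D) (crossing_sign D) t = jones_word (word D) (crossing_sign D') t" if "set D \<subseteq> set D'"
    by (rule jones_word_sign_cong) (use crossing_sign_extend[OF gc that] set_word in simp)
  from mv show ?thesis
  proof cases
    case (relabel f)
    have w: "word D' = map f (word D)" unfolding relabel(1) by (auto simp: word_def)
    have inj: "inj_on f (set (word D))" using relabel(2) by (simp add: set_word)
    have "(crossing_sign D' \<circ> f) x = crossing_sign D x" if "x \<in> set (word D)" for x
    proof -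
      from that obtain h e where xhe: "(x, h, e) \<in> set D" unfolding word_def by force
      then have "(f x, h, e) \<in> set D'" unfolding relabel(1) by force
      then show ?thesis using crossing_sign_eq[OF gc(2)] crossing_sign_eq[OF gc(1) xhe] by simp
    qed
    then show ?thesis
      unfolding w jones_word_relabel[OF inj] by (intro jones_word_sign_cong) simp
  next
    case (rotate xs ys)
    have "crossing_sign (xs @ ys) = crossing_sign (ys @ xs)" by (rule crossing_sign_cong) auto
    then show ?thesis
      using jones_word_rotate[of "word xs" "word ys"] unfolding rotate by simp
  next
    case (R1_over_under a)
    have "over a \<in> set D'" unfolding R1_over_under by simp
    from sg[OF this gc(2)] have "crossing_sign D' (fst a) = 1 \<or> crossing_sign D' (fst a) = -1" by simp
    moreover have w: "word D' = word D @ [fst a, fst a]"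
      unfolding R1_over_under by (simp add: word_def over_def under_def)
    ultimately have "jones_word (word D') (crossing_sign D') t = jones_word (word D) (crossing_sign D') t"
      using jones_word_kink[of "word D" "fst a"] dow_word[OF gc(2)] t by simp
    moreover have "set D \<subseteq> set D'" unfolding R1_over_under by auto
    ultimately show ?thesis using ext by simp
  next
    case (R1_under_over a)
    have "over a \<in> set D'" unfolding R1_under_over by simp
    from sg[OF this gc(2)] have "crossing_sign D' (fst a) = 1 \<or> crossing_sign D' (fst a) = -1" by simp
    moreover have w: "word D' = word D @ [fst a, fst a]"
      unfolding R1_under_over by (simp add: word_def over_def under_def)
    ultimately have "jones_word (word D') (crossing_sign D') t = jones_word (word D) (crossing_sign D') t"
      using jones_word_kink[of "word D" "fst a"] dow_word[OF gc(2)] t by simp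
    moreover have "set D \<subseteq> set D'" unfolding R1_under_over by auto
    ultimately show ?thesis using ext by simp
  next
    case (R2_parallel b a xs ys)
    have m: "over a \<in> set D'" "over b \<in> set D'" unfolding R2_parallel by simp_all
    have "a \<noteq> b" using gc(2) unfolding R2_parallel is_gauss_code_def by auto
    then have ab: "fst a \<noteq> fst b" using distinct_side_labels[OF gc(2) m] by simp
    have "jones_word (word D') (crossing_sign D') t = jones_word (word xs @ word ys) (crossing_sign D') t"
    proof (rule jones_word_bigon[OF _ dow_word[OF gc(2)] _ _ ab t])
      show "word D' = [fst a, fst b] @ word xs @ [fst a, fst b] @ word ys \<or> word D' = [fst a, fst b] @ word xs @ [fst b, fst a] @ word ys"
        unfolding R2_parallel by (simp add: word_def over_def under_def)
    qed (use sg[OF m(1) gc(2)] sg[OF m(2) gc(2)] R2_parallel in simp_all)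
    moreover have "set D \<subseteq> set D'" unfolding R2_parallel by auto
    ultimately show ?thesis using ext R2_parallel by simp
  next
    case (R2_antiparallel b a xs ys)
    have m: "over a \<in> set D'" "over b \<in> set D'" unfolding R2_antiparallel by simp_all
    have "a \<noteq> b" using gc(2) unfolding R2_antiparallel is_gauss_code_def by auto
    then have ab: "fst a \<noteq> fst b" using distinct_side_labels[OF gc(2) m] by simp
    have "jones_word (word D') (crossing_sign D') t = jones_word (word xs @ word ys) (crossing_sign D') t"
    proof (rule jones_word_bigon[OF _ dow_word[OF gc(2)] _ _ ab t])
      show "word D' = [fst a, fst b] @ word xs @ [fst a, fst b] @ word ys \<or> word D' = [fst a, fst b] @ word xs @ [fst b, fst a] @ word ys"
        unfolding R2_antiparallel by (simp add: word_def over_def under_def)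
    qed (use sg[OF m(1) gc(2)] sg[OF m(2) gc(2)] R2_antiparallel in simp_all)
    moreover have "set D \<subseteq> set D'" unfolding R2_antiparallel by auto
    ultimately show ?thesis using ext R2_antiparallel by simp
  next
    case (R3_top_middle_bottom k a b c xs ys zs)
    have "set D' = set D" unfolding R3_top_middle_bottom by (auto simp: set_sides)
    then show ?thesis using jones_word_R3[OF gc _ _ t, of k a b c xs ys zs] R3_top_middle_bottom by blast
  next
    case (R3_top_bottom_middle k a b c xs ys zs)
    have "set D' = set D" unfolding R3_top_bottom_middle by (auto simp: set_sides)
    then show ?thesis using jones_word_R3[OF gc _ _ t, of k a b c xs ys zs] R3_top_bottom_middle by blast
  qed
qed

section \<open>Planarity as two-colourability\<close>

text \<open>
  A shadow records at each position the label and whether the other strand crosses from right to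
  left. On the sphere every mod-2 cycle is the boundary of a set of faces; \<open>lam\<close> and \<open>rho\<close>
  tell whether the faces to the left and to the right of a node belong to this set.
\<close>

type_synonym shadow = "(nat \<times> bool) list"

text \<open>Mod-2 cycles of the 4-valent graph: an even number of marked edge ends at a crossing
  means that both strands change their value there or neither does.\<close>

definition cycle :: "nat list \<Rightarrow> (nat \<Rightarrow> bool) \<Rightarrow> bool" where
  "cycle w z \<longleftrightarrow> z 0 = z (length w) \<and>
     (\<forall>(i, j) \<in> chords w. (z i \<noteq> z (Suc i)) = (z j \<noteq> z (Suc j)))"

text \<open>The four equations identify the sides that meet in the four corners of a crossing. Of
  its two passages one has a true flag in the shadows considered, so each crossing is listed
  once.\<close>

definition colouring :: "shadow \<Rightarrow> (nat \<Rightarrow> bool) \<Rightarrow> (nat \<Rightarrow> bool) \<Rightarrow> (nat \<Rightarrow> bool) \<Rightarrow> bool" where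
  "colouring E z lam rho \<longleftrightarrow> lam 0 = lam (length E) \<and> rho 0 = rho (length E) \<and>
     (\<forall>i \<le> length E. z i = (lam i \<noteq> rho i)) \<and>
     (\<forall>(i, j) \<in> chords (map fst E). snd (E ! i) \<longrightarrow>
        lam i = lam (Suc j) \<and> lam (Suc i) = rho (Suc j) \<and> rho i = lam j \<and> rho (Suc i) = rho j)"

text \<open>Every mod-2 cycle bounds. In contrast to the face count, this form of planarity passes
  easily to a diagram with crossings removed.\<close>

definition planar :: "shadow \<Rightarrow> bool" where
  "planar E \<longleftrightarrow> (\<forall>z. cycle (map fst E) z \<longrightarrow> (\<exists>lam rho. colouring E z lam rho))"

definition shadow :: "gauss_code \<Rightarrow> shadow" where
  "shadow D = map (\<lambda>(x, h, e). (x, (h = Over) = (e = 1))) D"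

lemma map_fst_shadow [simp]: "map fst (shadow D) = word D"
  by (auto simp: shadow_def word_def)

lemma length_shadow [simp]: "length (shadow D) = length D"
  by (simp add: shadow_def)

lemma shadow_chord:
  assumes "is_gauss_code D" "(i, j) \<in> chords (word D)"
  shows "snd (shadow D ! j) = (\<not> snd (shadow D ! i))"
proof -
  have ij: "i < length D" "j < length D" "i \<noteq> j" "word D ! i = word D ! j"
    using assms(2) by (auto simp: chords_def)
  obtain h where h: "D ! i = (word D ! i, h, crossing_sign D (word D ! i))"
    by (rule nth_gauss_code[OF assms(1) ij(1)])
  obtain h' where h': "D ! j = (word D ! j, h', crossing_sign D (word D ! j))"
    by (rule nth_gauss_code[OF assms(1) ij(2)])
  have "distinct (map (\<lambda>(x, h, e). (x, h)) D)" using assms(1) unfolding is_gauss_code_def by (rule conjunct1)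
  then have "map (\<lambda>(x, h, e). (x, h)) D ! i \<noteq> map (\<lambda>(x, h, e). (x, h)) D ! j"
    using ij by (simp only: nth_eq_iff_index_eq length_map simp_thms)
  then have "h \<noteq> h'" using ij h h' by auto
  then have "(h' = Over) = (h \<noteq> Over)" by (cases h; cases h') auto
  then show ?thesis using h h' ij by (auto simp: shadow_def)
qed

lemma left_turn_shadow:
  assumes "is_gauss_code D" "j < length D"
    and "j = (if snd dart then Suc (fst dart) mod length D else fst dart)"
  shows "left_turn D dart = (if snd dart = snd (shadow D ! j) then (partner D j, True) else (inc D (partner D j), False))"
proof -
  obtain h where h: "D ! j = (word D ! j, h, crossing_sign D (word D ! j))"
    by (rule nth_gauss_code[OF assms(1,2)])
  have "word D ! j \<in> labels D" using assms(2) set_word[of D] nth_mem[of j "word D"] by simp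
  from crossing_sign_cases[OF assms(1) this] show ?thesis
    using h assms(2) unfolding left_turn_def assms(3)[symmetric] Let_def
    by (auto simp: shadow_def)
qed

lemma planar_Nil: "planar []"
  unfolding planar_def
proof (intro allI impI)
  fix z :: "nat \<Rightarrow> bool"
  show "\<exists>lam rho. colouring [] z lam rho"
    by (rule exI[of _ z], rule exI[of _ "\<lambda>_. False"]) (simp add: colouring_def chords_def)
qed

lemma card_pairing_half:
  assumes "finite A" and "\<And>x y. x \<in> A \<Longrightarrow> y \<in> A \<Longrightarrow> f x = f y \<Longrightarrow> y = x \<or> y = h x"
  shows "card A \<le> 2 * card (f ` A)"
proof -
  have "card A = (\<Sum>c\<in>f ` A. card {x \<in> A. f x = c})"
    using assms(1) sum.image_gen[OF assms(1), of "\<lambda>_. 1 :: nat" f] by simp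
  also have "\<dots> \<le> (\<Sum>c\<in>f ` A. 2)"
  proof (rule sum_mono)
    fix c assume "c \<in> f ` A"
    then obtain x where x: "x \<in> A" "c = f x" by blast
    have "{x \<in> A. f x = c} \<subseteq> {x, h x}"
    proof
      fix y assume "y \<in> {x \<in> A. f x = c}"
      then show "y \<in> {x, h x}" using assms(2)[OF x(1), of y] x(2) by simp
    qed
    then have "card {x \<in> A. f x = c} \<le> card {x, h x}" by (intro card_mono) auto
    also have "\<dots> \<le> 2" by (simp add: card_insert_if)
    finally show "card {x \<in> A. f x = c} \<le> 2" .
  qed
  finally show ?thesis by simp
qed

text \<open>A count of dimensions mod 2. Connectedness of the diagram makes a set of faces unique up
  to complement once its boundary is given, so \<open>n + 2\<close> faces yield at least
  \<open>2 ^ (n + 1)\<close> boundaries. A cycle is determined by its value on one edge and by the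
  crossings where it toggles, so there are at most \<open>2 ^ (n + 1)\<close> cycles. Hence every
  cycle is a boundary.\<close>

lemma knot_diagram_planar:
  assumes "knot_diagram D"
  shows "planar (shadow D)"
proof (cases "D = []")
  case True
  then show ?thesis using planar_Nil by (simp add: shadow_def)
next
  case False
  have gc: "is_gauss_code D" and faces: "faces D = crossings D + 2"
    using assms unfolding knot_diagram_def by auto
  let ?L = "length D" and ?w = "word D" and ?r = "\<lambda>i. snd (shadow D ! i)"
  have L: "?L > 0" using False by simp
  define X where "X = {..<?L} \<times> (UNIV :: bool set)"
  define R where "R = {(d, left_turn D d) | d. fst d < ?L}"
  define cl where "cl d = {d'. conn R d d'}" for d
  define C where "C = cl ` X"
  have finX: "finite X" unfolding X_def by simp
  have finC: "finite C" unfolding C_def using finX by simp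
  have cardC: "card C = crossings D + 2"
  proof -
    have "edges D = {..<?L}" using L by (simp add: edges_def max_def Suc_le_eq)
    then have "faces D = num_classes X R" by (simp add: faces_def X_def R_def)
    then show ?thesis using faces by (simp add: num_classes_image C_def cl_def)
  qed
  have clX: "cl (e, s) \<in> C" if "e < ?L" for e s
    using that unfolding C_def X_def by auto
  have inc: "inc D i < ?L" "Suc (inc D i) mod ?L = i" if "i < ?L" for i
  proof -
    show "inc D i < ?L" using L by (simp add: inc_def)
    show "Suc (inc D i) mod ?L = i"
    proof (cases i)
      case 0
      then show ?thesis using L by (simp add: inc_def)
    next
      case (Suc k)
      then have "inc D i = k" using that by (simp add: inc_def)
      then show ?thesis using Suc that by simp
    qed
  qed
  have cl_turn: "cl d = cl (left_turn D d)" if "fst d < ?L" for d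
  proof -
    have "conn R d (left_turn D d)" by (rule conn_base) (use that in \<open>unfold R_def, blast\<close>)
    then show ?thesis unfolding cl_def class_eq_iff .
  qed
  have corners: "cl (inc D i, True) = cl (j, True)" "cl (i, True) = cl (j, False)"
    "cl (inc D i, False) = cl (inc D j, True)" "cl (i, False) = cl (inc D j, False)"
    if "(i, j) \<in> chords ?w" "?r i" for i j
  proof -
    have ij: "i < ?L" "j < ?L" using that(1) by (auto simp: chords_def)
    have ji: "(j, i) \<in> chords ?w" using that(1) by (auto simp: chords_def)
    have rj: "\<not> ?r j" using shadow_chord[OF gc that(1)] that(2) by simp
    note p = partner_eq[OF gc that(1)] partner_eq[OF gc ji]
    have "left_turn D (inc D i, True) = (j, True)"
      using left_turn_shadow[OF gc ij(1), of "(inc D i, True)"] inc[OF ij(1)] that(2) p by simp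
    then show "cl (inc D i, True) = cl (j, True)" using cl_turn[of "(inc D i, True)"] inc[OF ij(1)] by simp
    have "left_turn D (j, False) = (i, True)"
      using left_turn_shadow[OF gc ij(2), of "(j, False)"] rj p by simp
    then show "cl (i, True) = cl (j, False)" using cl_turn[of "(j, False)"] ij by simp
    have "left_turn D (inc D j, True) = (inc D i, False)"
      using left_turn_shadow[OF gc ij(2), of "(inc D j, True)"] inc[OF ij(2)] rj p by simp
    then show "cl (inc D i, False) = cl (inc D j, True)" using cl_turn[of "(inc D j, True)"] inc[OF ij(2)] by simp
    have "left_turn D (i, False) = (inc D j, False)"
      using left_turn_shadow[OF gc ij(1), of "(i, False)"] that(2) p by simp
    then show "cl (i, False) = cl (inc D j, False)" using cl_turn[of "(i, False)"] ij by simp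
  qed
  define Z where "Z P = {e. e < ?L \<and> (cl (e, True) \<in> P) \<noteq> (cl (e, False) \<in> P)}" for P
  have Z_eq: "Q = P \<or> Q = C - P" if PQ: "P \<subseteq> C" "Q \<subseteq> C" "Z P = Z Q" for P Q
  proof -
    \<comment> \<open>Where \<open>P\<close> and \<open>Q\<close> disagree. Equal boundaries make
      this the same on both sides of an edge, and the corners carry it from edge to edge along the
      walk, so it is constant.\<close>
    define \<psi> where "\<psi> e s = ((cl (e, s) \<in> P) \<noteq> (cl (e, s) \<in> Q))" for e s
    have side: "\<psi> e True = \<psi> e False" if "e < ?L" for e
      using PQ(3) that unfolding Z_def \<psi>_def set_eq_iff by auto
    have step: "\<psi> (inc D i) True = \<psi> i True" if i: "i < ?L" for i
    proof -
      define j where "j = partner D i"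
      have ch: "(i, j) \<in> chords ?w" "(j, i) \<in> chords ?w"
        using chords_partner[OF gc i] unfolding j_def chords_def by auto
      have j: "j < ?L" using ch(1) by (auto simp: chords_def)
      show ?thesis
      proof (cases "?r i")
        case True
        note c = corners[OF ch(1) True]
        have "\<psi> (inc D i) True = \<psi> j True" unfolding \<psi>_def c(1) ..
        also have "\<dots> = \<psi> j False" by (rule side[OF j])
        also have "\<dots> = \<psi> i True" unfolding \<psi>_def c(2) ..
        finally show ?thesis .
      next
        case False
        then have "?r j" using shadow_chord[OF gc ch(1)] by simp
        note c = corners[OF ch(2) this]
        have "\<psi> (inc D i) True = \<psi> (inc D j) False" unfolding \<psi>_def c(3) ..
        also have "\<dots> = \<psi> (inc D j) True" using side[OF inc(1)[OF j]] by simp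
        also have "\<dots> = \<psi> i True" unfolding \<psi>_def c(1) ..
        finally show ?thesis .
      qed
    qed
    have "\<psi> e True = \<psi> 0 True" if "e < ?L" for e
      using that
    proof (induction e)
      case (Suc e)
      have "inc D (Suc e) = e" using Suc.prems by (simp add: inc_def)
      then show ?case using step[OF Suc.prems] Suc by simp
    qed simp
    then have const: "\<psi> e s = \<psi> 0 True" if "e < ?L" for e s
      using side[OF that] that by (cases s) auto
    have mem: "c \<in> P \<longleftrightarrow> (c \<in> Q) = (\<not> \<psi> 0 True)" if "c \<in> C" for c
    proof -
      obtain e s where "c = cl (e, s)" "e < ?L" using \<open>c \<in> C\<close> unfolding C_def X_def by auto
      then show ?thesis using const[of e s] unfolding \<psi>_def by auto
    qed
    show ?thesis
    proof (cases "\<psi> 0 True")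
      case True
      have "Q = C - P" using mem True PQ(1,2) by blast
      then show ?thesis ..
    next
      case False
      have "Q = P" using mem False PQ(1,2) by blast
      then show ?thesis ..
    qed
  qed
  define Cyc where "Cyc = {S. S \<subseteq> {..<?L} \<and> (\<forall>(i, j) \<in> chords ?w.
      ((inc D i \<in> S) \<noteq> (i \<in> S)) = ((inc D j \<in> S) \<noteq> (j \<in> S)))}"
  have ZCyc: "Z P \<in> Cyc" for P
  proof -
    have ev: "((inc D i \<in> Z P) \<noteq> (i \<in> Z P)) = ((inc D j \<in> Z P) \<noteq> (j \<in> Z P))"
      if "(i, j) \<in> chords ?w" "?r i" for i j
    proof -
      have ij: "i < ?L" "j < ?L" using that(1) by (auto simp: chords_def)
      show ?thesis
        using corners[OF that] ij inc unfolding Z_def by auto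
    qed
    have "((inc D i \<in> Z P) \<noteq> (i \<in> Z P)) = ((inc D j \<in> Z P) \<noteq> (j \<in> Z P))"
      if "(i, j) \<in> chords ?w" for i j
    proof (cases "?r i")
      case False
      then have "?r j" "(j, i) \<in> chords ?w" using shadow_chord[OF gc that] that by (auto simp: chords_def)
      from ev[OF this(2,1)] show ?thesis by simp
    qed (rule ev[OF that])
    then show ?thesis unfolding Cyc_def Z_def by auto
  qed
  have finCyc: "finite Cyc"
    by (rule finite_subset[of _ "Pow {..<?L}"]) (auto simp: Cyc_def)
  have "card Cyc \<le> 2 ^ (crossings D + 1)"
  proof -
    define code where "code S = (inc D 0 \<in> S, {x \<in> labels D. \<exists>i < ?L. ?w ! i = x \<and> (inc D i \<in> S) \<noteq> (i \<in> S)})" for S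
    have "inj_on code Cyc"
    proof (rule inj_onI)
      fix S T assume ST: "S \<in> Cyc" "T \<in> Cyc" "code S = code T"
      have toggle: "(?w ! i \<in> snd (code U)) = ((inc D i \<in> U) \<noteq> (i \<in> U))" if U: "U \<in> Cyc" and i: "i < ?L" for U i
      proof
        assume "?w ! i \<in> snd (code U)"
        then obtain k where k: "k < ?L" "?w ! k = ?w ! i" "(inc D k \<in> U) \<noteq> (k \<in> U)"
          unfolding code_def by auto
        show "(inc D i \<in> U) \<noteq> (i \<in> U)"
        proof (cases "k = i")
          case False
          then have "(k, i) \<in> chords ?w" using k i by (auto simp: chords_def)
          then have "((inc D k \<in> U) \<noteq> (k \<in> U)) = ((inc D i \<in> U) \<noteq> (i \<in> U))"
            using U unfolding Cyc_def by blast
          then show ?thesis using k(3) by simp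
        qed (use k in simp)
      next
        assume "(inc D i \<in> U) \<noteq> (i \<in> U)"
        moreover have "?w ! i \<in> labels D" using i set_word[of D] nth_mem[of i ?w] by simp
        ultimately show "?w ! i \<in> snd (code U)" unfolding code_def using i by auto
      qed
      have same: "(i \<in> S) = (i \<in> T)" if "i < ?L" for i
        using that
      proof (induction i)
        case 0
        have "(inc D 0 \<in> S) = (inc D 0 \<in> T)" using ST(3) by (simp add: code_def)
        then show ?case using toggle[OF ST(1), of 0] toggle[OF ST(2), of 0] ST(3) L by auto
      next
        case (Suc i)
        have "inc D (Suc i) = i" using Suc.prems by (simp add: inc_def)
        then show ?case
          using Suc toggle[OF ST(1), of "Suc i"] toggle[OF ST(2), of "Suc i"] ST(3) by auto
      qed
      then show "S = T" using ST(1,2) unfolding Cyc_def by blast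
    qed
    moreover have "code ` Cyc \<subseteq> UNIV \<times> Pow (labels D)" unfolding code_def by auto
    moreover have "finite (labels D)" by (simp add: labels_def)
    ultimately have "card Cyc \<le> card ((UNIV :: bool set) \<times> Pow (labels D))"
      by (intro card_inj_on_le[of code]) auto
    then show ?thesis
      using \<open>finite (labels D)\<close> by (simp add: card_cartesian_product card_Pow crossings_def)
  qed
  moreover have "2 ^ (crossings D + 2) \<le> 2 * card (Z ` Pow C)"
  proof -
    have "card (Pow C) \<le> 2 * card (Z ` Pow C)"
      by (rule card_pairing_half[of _ _ "\<lambda>P. C - P"]) (use finC Z_eq in auto)
    then show ?thesis using finC cardC by (simp add: card_Pow)
  qed
  ultimately have "card Cyc \<le> card (Z ` Pow C)" by simp
  moreover have "Z ` Pow C \<subseteq> Cyc" using ZCyc by blast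
  ultimately have surj: "Z ` Pow C = Cyc"
    using finCyc by (intro card_seteq) auto
  show ?thesis
    unfolding planar_def map_fst_shadow
  proof (intro allI impI)
    fix z assume z: "cycle ?w z"
    define f where "f i = (i + ?L - 1) mod ?L" for i
    have f_lt: "f i < ?L" for i using L by (simp add: f_def)
    have f_Suc: "f (Suc i) = i" "f i = inc D i" if "i < ?L" for i using that by (simp_all add: f_def inc_def)
    have f_ends: "f 0 = ?L - 1" "f ?L = ?L - 1" using L f_Suc[of "?L - 1"] by (auto simp: f_def)
    have Sf: "z (Suc (f i)) = z i" if "i \<le> ?L" for i
    proof (cases i)
      case 0
      then show ?thesis using f_ends L z by (simp add: cycle_def)
    next
      case (Suc k)
      then show ?thesis using f_Suc that by simp
    qed
    define S where "S = {e. e < ?L \<and> z (Suc e)}"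
    have inS: "f i \<in> S \<longleftrightarrow> z i" if "i \<le> ?L" for i
      using Sf[OF that] f_lt unfolding S_def by simp
    have "S \<in> Cyc"
    proof -
      have "((inc D i \<in> S) \<noteq> (i \<in> S)) = ((inc D j \<in> S) \<noteq> (j \<in> S))" if ch: "(i, j) \<in> chords ?w" for i j
      proof -
        have ij: "i < ?L" "j < ?L" using ch by (auto simp: chords_def)
        have e: "(inc D k \<in> S) = z k" "(k \<in> S) = z (Suc k)" if "k < ?L" for k
          using inS[of k] inS[of "Suc k"] f_Suc that by auto
        have "(z i \<noteq> z (Suc i)) = (z j \<noteq> z (Suc j))" using z ch unfolding cycle_def by blast
        then show ?thesis using e ij by simp
      qed
      then show ?thesis unfolding Cyc_def S_def by auto
    qed
    then obtain P where P: "S = Z P" using surj by blast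
    define lam where "lam i = (cl (f i, True) \<in> P)" for i
    define rho where "rho i = (cl (f i, False) \<in> P)" for i
    have "colouring (shadow D) z lam rho"
      unfolding colouring_def length_shadow map_fst_shadow
    proof (intro conjI)
      show "lam 0 = lam ?L" "rho 0 = rho ?L" using f_ends by (simp_all add: lam_def rho_def)
      show "\<forall>i\<le>?L. z i = (lam i \<noteq> rho i)"
        using inS f_lt unfolding P Z_def lam_def rho_def by auto
      show "\<forall>(i, j)\<in>chords ?w. ?r i \<longrightarrow> lam i = lam (Suc j) \<and> lam (Suc i) = rho (Suc j) \<and> rho i = lam j \<and> rho (Suc i) = rho j"
      proof clarify
        fix i j assume ch: "(i, j) \<in> chords ?w" "?r i"
        have ij: "i < ?L" "j < ?L" using ch by (auto simp: chords_def)
        show "lam i = lam (Suc j) \<and> lam (Suc i) = rho (Suc j) \<and> rho i = lam j \<and> rho (Suc i) = rho j"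
          using corners[OF ch] f_Suc[OF ij(1)] f_Suc[OF ij(2)] by (simp add: lam_def rho_def)
      qed
    qed
    then show "\<exists>lam rho. colouring (shadow D) z lam rho" by blast
  qed
qed

section \<open>Planarity does not depend on the base point\<close>

lemma chords_rotate1:
  assumes "(i, j) \<in> chords (w @ [x])"
  defines "h \<equiv> \<lambda>i. if i = length w then 0 else Suc i"
  shows "(h i, h j) \<in> chords (x # w) \<and> h i \<le> length w \<and> h j \<le> length w"
  using assms(1) unfolding h_def
  by (auto simp: chords_def nth_append nth_Cons split: nat.splits if_splits)

lemma planar_rotate1:
  assumes "planar (p # E)"
  shows "planar (E @ [p])"
  unfolding planar_def
proof (intro allI impI)
  let ?L = "length E"
  fix z assume z: "cycle (map fst (E @ [p])) z"
  define z' where "z' i = (if i = 0 then z ?L else z (i - 1))" for i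
  have z0: "z 0 = z (Suc ?L)" using z by (simp add: cycle_def)
  have ch: "(if i = 0 then ?L else i - 1, if j = 0 then ?L else j - 1) \<in> chords (map fst (E @ [p]))"
    if "(i, j) \<in> chords (map fst (p # E))" for i j
    using that by (auto simp: chords_def nth_append nth_Cons split: nat.splits if_splits)
  have "cycle (map fst (p # E)) z'"
    unfolding cycle_def
  proof (intro conjI ballI, goal_cases)
    case 1
    show ?case by (simp add: z'_def)
  next
    case (2 c)
    obtain i j where c: "c = (i, j)" by (cases c)
    let ?g = "\<lambda>i. if i = 0 then ?L else i - 1"
    have k: "z' i = z (?g i)" "z' (Suc i) = z (Suc (?g i))" for i
      using z0 by (auto simp: z'_def)
    have "(?g i, ?g j) \<in> chords (map fst (E @ [p]))"
      using ch 2 c by simp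
    then have "(z (?g i) \<noteq> z (Suc (?g i))) = (z (?g j) \<noteq> z (Suc (?g j)))"
      using z unfolding cycle_def by blast
    then show ?case
      unfolding c prod.case k(1)[of i] k(1)[of j] k(2)[of i] k(2)[of j] .
  qed
  then obtain lam rho where col: "colouring (p # E) z' lam rho" using assms unfolding planar_def by blast
  let ?sh = "\<lambda>f i. if i \<le> ?L then f (Suc i) else (f 1 :: bool)"
  have ends: "lam 0 = lam (Suc ?L)" "rho 0 = rho (Suc ?L)" using col by (simp_all add: colouring_def)
  have "colouring (E @ [p]) z (?sh lam) (?sh rho)"
    unfolding colouring_def
  proof (intro conjI ballI, goal_cases)
    case 1
    show ?case by simp
  next
    case 2
    show ?case by simp
  next
    case 3
    show ?case
    proof (intro allI impI)
      fix i assume i: "i \<le> length (E @ [p])"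
      have zz: "z' (Suc k) = (lam (Suc k) \<noteq> rho (Suc k))" if "k \<le> ?L" for k
        using col that by (simp add: colouring_def)
      show "z i = (?sh lam i \<noteq> ?sh rho i)"
      proof (cases "i \<le> ?L")
        case True
        then show ?thesis using zz[OF True] by (simp add: z'_def)
      next
        case False
        then have "i = Suc ?L" using i by simp
        then show ?thesis using zz[of 0] z0 by (simp add: z'_def)
      qed
    qed
  next
    case (4 c)
    obtain i j where c: "c = (i, j)" by (cases c)
    let ?h = "\<lambda>i. if i = ?L then 0 else Suc i"
    have ij: "(?h i, ?h j) \<in> chords (map fst (p # E))" "i \<le> ?L" "j \<le> ?L"
      using chords_rotate1[of i j "map fst E" "fst p"] 4 c by (auto simp: chords_def)
    have sn: "snd ((E @ [p]) ! i) = snd ((p # E) ! ?h i)"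
      using ij(2) by (auto simp: nth_append)
    have k: "?sh f i = f (?h i)" "?sh f (Suc i) = f (Suc (?h i))" if "i \<le> ?L" "f 0 = f (Suc ?L)" for i and f :: "nat \<Rightarrow> bool"
      using that by auto
    have "snd ((p # E) ! ?h i) \<longrightarrow> lam (?h i) = lam (Suc (?h j)) \<and> lam (Suc (?h i)) = rho (Suc (?h j)) \<and>
        rho (?h i) = lam (?h j) \<and> rho (Suc (?h i)) = rho (?h j)"
      using col ij(1) unfolding colouring_def by fast
    then show ?case
      unfolding c prod.case sn k[where f = lam, OF ij(2) ends(1)] k[where f = rho, OF ij(2) ends(2)]
        k[where f = lam, OF ij(3) ends(1)] k[where f = rho, OF ij(3) ends(2)] .
  qed
  then show "\<exists>lam rho. colouring (E @ [p]) z lam rho" by blast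
qed

lemma planar_rotate: "planar (xs @ ys) \<Longrightarrow> planar (ys @ xs)"
proof (induction xs arbitrary: ys)
  case (Cons x xs)
  then have "planar (xs @ (ys @ [x]))" using planar_rotate1[of x "xs @ ys"] by simp
  from Cons.IH[OF this] show ?case by simp
qed simp

section \<open>Third order expansion at \<open>t = 1\<close>\<close>

text \<open>\<open>a0\<close>, ..., \<open>a3\<close> are the values at \<open>1\<close> of \<open>f\<close> and its iterates under \<open>t d/dt\<close>.\<close>

definition jet :: "(real \<Rightarrow> real) \<Rightarrow> real \<Rightarrow> real \<Rightarrow> real \<Rightarrow> real \<Rightarrow> bool" where
  "jet f a0 a1 a2 a3 \<longleftrightarrow> (\<exists>f1 f2 f3. (\<forall>t>0. (f has_real_derivative f1 t / t) (at t) \<and>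
     (f1 has_real_derivative f2 t / t) (at t) \<and> (f2 has_real_derivative f3 t / t) (at t)) \<and>
     f 1 = a0 \<and> f1 1 = a1 \<and> f2 1 = a2 \<and> f3 1 = a3)"

lemma jet_powr: "jet (\<lambda>t. t powr r) 1 r (r\<^sup>2) (r ^ 3)"
proof -
  have "((\<lambda>t. c * t powr r) has_real_derivative (r * c * t powr r) / t) (at t)" if "t > 0" for t c
    using that by (auto intro!: derivative_eq_intros simp: powr_diff)
  note 1 = this
  show ?thesis
    unfolding jet_def
    by (rule exI[of _ "\<lambda>t. r * t powr r"], rule exI[of _ "\<lambda>t. r * r * t powr r"], rule exI[of _ "\<lambda>t. r * (r * r) * t powr r"])
      (use 1[of _ 1] 1[of _ r] 1[of _ "r * r"] in \<open>simp add: power2_eq_square power3_eq_cube\<close>)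
qed

lemma jet_const: "jet (\<lambda>t. c) c 0 0 0"
  unfolding jet_def by (rule exI[of _ "\<lambda>t. 0"])+ auto

lemma jet_add:
  assumes "jet f a0 a1 a2 a3" "jet g b0 b1 b2 b3"
  shows "jet (\<lambda>t. f t + g t) (a0 + b0) (a1 + b1) (a2 + b2) (a3 + b3)"
proof -
  obtain f1 f2 f3 where f: "\<And>t. t > 0 \<Longrightarrow> (f has_real_derivative f1 t / t) (at t)"
    "\<And>t. t > 0 \<Longrightarrow> (f1 has_real_derivative f2 t / t) (at t)" "\<And>t. t > 0 \<Longrightarrow> (f2 has_real_derivative f3 t / t) (at t)"
    "f 1 = a0" "f1 1 = a1" "f2 1 = a2" "f3 1 = a3"
    using assms(1) unfolding jet_def by blast
  obtain g1 g2 g3 where g: "\<And>t. t > 0 \<Longrightarrow> (g has_real_derivative g1 t / t) (at t)"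
    "\<And>t. t > 0 \<Longrightarrow> (g1 has_real_derivative g2 t / t) (at t)" "\<And>t. t > 0 \<Longrightarrow> (g2 has_real_derivative g3 t / t) (at t)"
    "g 1 = b0" "g1 1 = b1" "g2 1 = b2" "g3 1 = b3"
    using assms(2) unfolding jet_def by blast
  show ?thesis
    unfolding jet_def
    by (rule exI[of _ "\<lambda>t. f1 t + g1 t"], rule exI[of _ "\<lambda>t. f2 t + g2 t"], rule exI[of _ "\<lambda>t. f3 t + g3 t"])
      (auto simp: f(4-7) g(4-7) add_divide_distrib intro!: DERIV_add f(1-3) g(1-3))
qed

lemma jet_mult:
  assumes "jet f a0 a1 a2 a3" "jet g b0 b1 b2 b3"
  shows "jet (\<lambda>t. f t * g t) (a0 * b0) (a0 * b1 + a1 * b0) (a0 * b2 + 2 * a1 * b1 + a2 * b0)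
    (a0 * b3 + 3 * a1 * b2 + 3 * a2 * b1 + a3 * b0)"
proof -
  obtain f1 f2 f3 where f: "\<And>t. t > 0 \<Longrightarrow> (f has_real_derivative f1 t / t) (at t)"
    "\<And>t. t > 0 \<Longrightarrow> (f1 has_real_derivative f2 t / t) (at t)" "\<And>t. t > 0 \<Longrightarrow> (f2 has_real_derivative f3 t / t) (at t)"
    "f 1 = a0" "f1 1 = a1" "f2 1 = a2" "f3 1 = a3"
    using assms(1) unfolding jet_def by blast
  obtain g1 g2 g3 where g: "\<And>t. t > 0 \<Longrightarrow> (g has_real_derivative g1 t / t) (at t)"
    "\<And>t. t > 0 \<Longrightarrow> (g1 has_real_derivative g2 t / t) (at t)" "\<And>t. t > 0 \<Longrightarrow> (g2 has_real_derivative g3 t / t) (at t)"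
    "g 1 = b0" "g1 1 = b1" "g2 1 = b2" "g3 1 = b3"
    using assms(2) unfolding jet_def by blast
  have m: "((\<lambda>t. p t * q t) has_real_derivative (p t * q' t + p' t * q t) / t) (at t)"
    if "(p has_real_derivative p' t / t) (at t)" "(q has_real_derivative q' t / t) (at t)" for p q p' q' :: "real \<Rightarrow> real" and t
    using DERIV_mult[OF that] by (rule DERIV_cong) (simp add: field_simps add_divide_distrib)
  show ?thesis
    unfolding jet_def
  proof (rule exI[of _ "\<lambda>t. f t * g1 t + f1 t * g t"], rule exI[of _ "\<lambda>t. (f t * g2 t + f1 t * g1 t) + (f1 t * g1 t + f2 t * g t)"],
      rule exI[of _ "\<lambda>t. ((f t * g3 t + f1 t * g2 t) + (f1 t * g2 t + f2 t * g1 t)) + ((f1 t * g2 t + f2 t * g1 t) + (f2 t * g1 t + f3 t * g t))"], intro conjI allI impI)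
    fix t :: real assume t: "t > 0"
    show "((\<lambda>t. f t * g t) has_real_derivative (f t * g1 t + f1 t * g t) / t) (at t)"
      by (intro m f g t)
    show "((\<lambda>t. f t * g1 t + f1 t * g t) has_real_derivative ((f t * g2 t + f1 t * g1 t) + (f1 t * g1 t + f2 t * g t)) / t) (at t)"
      unfolding add_divide_distrib[of "f t * g2 t + f1 t * g1 t"]
      by (intro DERIV_add m f g t)
    show "((\<lambda>t. (f t * g2 t + f1 t * g1 t) + (f1 t * g1 t + f2 t * g t)) has_real_derivative
      (((f t * g3 t + f1 t * g2 t) + (f1 t * g2 t + f2 t * g1 t)) + ((f1 t * g2 t + f2 t * g1 t) + (f2 t * g1 t + f3 t * g t))) / t) (at t)"
      unfolding add_divide_distrib[of "(f t * g3 t + f1 t * g2 t) + (f1 t * g2 t + f2 t * g1 t)"]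
        add_divide_distrib[of "f t * g3 t + f1 t * g2 t"] add_divide_distrib[of "f1 t * g2 t + f2 t * g1 t"]
      by (intro DERIV_add m f g t)
  qed (simp_all add: f(4-7) g(4-7) algebra_simps)
qed

lemma jet_cong_values: "jet f a0 a1 a2 a3 \<Longrightarrow> a0 = b0 \<Longrightarrow> a1 = b1 \<Longrightarrow> a2 = b2 \<Longrightarrow> a3 = b3 \<Longrightarrow> jet f b0 b1 b2 b3"
  by simp

lemma jet_cmult: "jet f a0 a1 a2 a3 \<Longrightarrow> jet (\<lambda>t. c * f t) (c * a0) (c * a1) (c * a2) (c * a3)"
  by (rule jet_cong_values[OF jet_mult[OF jet_const]]) auto

lemma jet_sum:
  assumes "finite I" "\<And>i. i \<in> I \<Longrightarrow> jet (f i) (a0 i) (a1 i) (a2 i) (a3 i)"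
  shows "jet (\<lambda>t. \<Sum>i\<in>I. f i t) (\<Sum>i\<in>I. a0 i) (\<Sum>i\<in>I. a1 i) (\<Sum>i\<in>I. a2 i) (\<Sum>i\<in>I. a3 i)"
  using assms
proof (induction I rule: finite_induct)
  case empty
  show ?case using jet_const[of 0] by simp
next
  case (insert i I)
  have "jet (\<lambda>t. f i t + (\<Sum>i\<in>I. f i t)) (a0 i + (\<Sum>i\<in>I. a0 i)) (a1 i + (\<Sum>i\<in>I. a1 i)) (a2 i + (\<Sum>i\<in>I. a2 i)) (a3 i + (\<Sum>i\<in>I. a3 i))"
    by (rule jet_add) (use insert in auto)
  then show ?case using insert.hyps by simp
qed

text \<open>With \<open>D\<close> for \<open>d/dt\<close> and \<open>E\<close> for
  \<open>t d/dt\<close> one has \<open>t^2 D^2 = E (E - 1)\<close> and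
  \<open>t^3 D^3 = E (E - 1) (E - 2)\<close>. Agreement of \<open>F\<close> and \<open>f\<close> for
  positive arguments is what the state sum provides, and it suffices near \<open>1\<close>.\<close>

lemma jet_derivs:
  assumes "jet f a0 a1 a2 a3" "\<And>t. t > 0 \<Longrightarrow> F t = f t"
  shows "deriv F 1 = a1" "(deriv ^^ 2) F 1 = a2 - a1" "(deriv ^^ 3) F 1 = a3 - 3 * a2 + 2 * a1"
proof -
  obtain f1 f2 f3 where f: "\<And>t. t > 0 \<Longrightarrow> (f has_real_derivative f1 t / t) (at t)"
    "\<And>t. t > 0 \<Longrightarrow> (f1 has_real_derivative f2 t / t) (at t)" "\<And>t. t > 0 \<Longrightarrow> (f2 has_real_derivative f3 t / t) (at t)"
    "f 1 = a0" "f1 1 = a1" "f2 1 = a2" "f3 1 = a3"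
    using assms(1) unfolding jet_def by blast
  have near: "\<forall>\<^sub>F s in nhds t. s > 0" if "t > 0" for t :: real
    using that by (rule order_tendstoD(1)[OF filterlim_ident])
  have step: "deriv G t = d" if G: "\<And>s. s > 0 \<Longrightarrow> G s = g s" "t > 0" "(g has_real_derivative d) (at t)" for G g :: "real \<Rightarrow> real" and t d
  proof -
    have "\<forall>\<^sub>F s in nhds t. G s = g s" using near[OF G(2)] by (rule eventually_mono) (rule G(1))
    then have "deriv G t = deriv g t" by (rule deriv_cong_ev) simp
    then show ?thesis using DERIV_imp_deriv[OF G(3)] by simp
  qed
  have d1: "deriv F t = f1 t / t" if "t > 0" for t
    by (rule step[OF assms(2) that f(1)[OF that]])
  have d2: "deriv (deriv F) t = f2 t / t ^ 2 - f1 t / t ^ 2" if "t > 0" for t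
    by (rule step[OF d1 that]) (use that f(2)[OF that] in \<open>auto intro!: derivative_eq_intros simp: field_simps power2_eq_square\<close>)
  have d3: "deriv (deriv (deriv F)) t = f3 t / t ^ 3 - 3 * f2 t / t ^ 3 + 2 * f1 t / t ^ 3" if "t > 0" for t
    by (rule step[OF d2 that]) (use that f(2,3)[OF that] in \<open>auto intro!: derivative_eq_intros simp: field_simps eval_nat_numeral\<close>)
  show "deriv F 1 = a1" "(deriv ^^ 2) F 1 = a2 - a1" "(deriv ^^ 3) F 1 = a3 - 3 * a2 + 2 * a1"
    using d1[of 1] d2[of 1] d3[of 1] f(5-7) by (simp_all add: eval_nat_numeral)
qed

text \<open>The coefficient of a state at \<open>t = 1\<close>: a factor \<open>-1\<close> per
  crossing from the framing, and the loop value \<open>-2\<close> per circle beyond the first. The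
  masses have both signs and total 1.\<close>

definition mass :: "nat list \<Rightarrow> nat set \<Rightarrow> real" where
  "mass w S = (-1) ^ card (set w) * (-2) ^ (circ w (state S) - 1)"

definition mean :: "nat list \<Rightarrow> (nat set \<Rightarrow> real) \<Rightarrow> real" where
  "mean w h = (\<Sum>S\<in>Pow (set w). mass w S * h S)"

text \<open>Framing factor and smoothing weight combine to \<open>A^(-2s) = t^(s/2)\<close> for the
  oriented smoothing and to \<open>A^(-4s) = t^s\<close> for the other one, up to sign.\<close>

definition exponent :: "nat set \<Rightarrow> nat \<Rightarrow> real" where
  "exponent S x = (if x \<in> S then 1/2 else 1)"

lemma mean_add: "mean w (\<lambda>S. g S + h S) = mean w g + mean w h"
  by (simp add: mean_def sum.distrib distrib_left)

lemma mean_cmult: "mean w (\<lambda>S. c * h S) = c * mean w h"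
  by (simp add: mean_def sum_distrib_left mult_ac)

lemma mean_sum: "mean w (\<lambda>S. \<Sum>i\<in>I. h i S) = (\<Sum>i\<in>I. mean w (h i))"
  unfolding mean_def sum_distrib_left by (rule sum.swap)

lemma jones_word_sum:
  assumes s: "\<And>x. x \<in> set w \<Longrightarrow> s x = 1 \<or> s x = -1" and t: "t > 0"
  shows "jones_word w s t = (\<Sum>S\<in>Pow (set w). (-1) ^ card (set w) *
    (t powr (\<Sum>x\<in>set w. real_of_int (s x) * exponent S x) * (- (t powr (1/2) + t powr (-1/2))) ^ (circ w (state S) - 1)))"
proof -
  let ?N = "set w"
  define A where "A = t powr (-1/4)"
  have A: "A > 0" using t by (simp add: A_def)
  have powi: "A powi k = t powr (- real_of_int k / 4)" for k
    using powr_real_of_int'[of A k] A by (simp add: A_def powr_powr)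
  let ?d = "- (A powi 2) - A powi (-2)"
  have d: "?d = - (t powr (1/2) + t powr (-1/2))" unfolding powi by simp
  have d0: "?d \<noteq> 0" using loop_value_neg[OF A] by simp
  have c: "(- (A ^ 3)) powi (- s x) * (if x \<in> S then A powi s x else A powi (- s x)) = - (t powr (real_of_int (s x) * exponent S x))"
    if "x \<in> ?N" for x S
  proof -
    have e: "(- (A ^ 3)) powi (- s x) = - (A powi (-3 * s x))"
      using s[OF that] A by (auto simp: power_int_minus)
    have "A powi (-3 * s x) * A powi k = A powi (-3 * s x + k)" for k
      by (rule power_int_add[symmetric]) (use A in simp)
    then have "A powi (-3 * s x) * (if x \<in> S then A powi s x else A powi (- s x)) = A powi (if x \<in> S then -2 * s x else -4 * s x)"
      by simp
    also have "\<dots> = t powr (real_of_int (s x) * exponent S x)" unfolding powi by (simp add: exponent_def)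
    finally show ?thesis unfolding e by simp
  qed
  have split: "(\<Prod>x\<in>S. g x) * (\<Prod>x\<in>?N - S. h x) = (\<Prod>x\<in>?N. if x \<in> S then g x else h x)"
    if "S \<subseteq> ?N" for S and g h :: "nat \<Rightarrow> real"
  proof -
    have "{x \<in> ?N. x \<in> S} = S" "{x \<in> ?N. x \<notin> S} = ?N - S" using that by auto
    then show ?thesis using prod.If_cases[OF finite_set, of "\<lambda>x. x \<in> S" g h w] by (simp add: Int_def Compl_eq)
  qed
  have br: "bracket (\<lambda>x. A powi s x) (\<lambda>x. A powi (- s x)) ?d w =
      (\<Sum>S\<in>Pow ?N. (\<Prod>x\<in>S. A powi s x) * (\<Prod>x\<in>?N - S. A powi (- s x)) * ?d ^ circ w (state S))"
    unfolding bracket_def ssum_Pow[OF distinct_remdups] set_remdups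
    by (intro sum.cong refl arg_cong2[of _ _ _ _ "(*)"] arg_cong2[of _ _ _ _ "(^)"] circ_cong) simp
  have "jones_word w s t = (\<Sum>S\<in>Pow ?N. (\<Prod>x\<in>?N. (- (A ^ 3)) powi (- s x)) *
      ((\<Prod>x\<in>S. A powi s x) * (\<Prod>x\<in>?N - S. A powi (- s x)) * ?d ^ circ w (state S)) / ?d)"
    unfolding jones_word_def Let_def A_def[symmetric] br by (simp add: sum_distrib_left sum_divide_distrib)
  also have "\<dots> = (\<Sum>S\<in>Pow ?N. (-1) ^ card ?N * (t powr (\<Sum>x\<in>?N. real_of_int (s x) * exponent S x) *
      (- (t powr (1/2) + t powr (-1/2))) ^ (circ w (state S) - 1)))"
  proof (rule sum.cong[OF refl])
    fix S assume "S \<in> Pow ?N"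
    then have S: "S \<subseteq> ?N" by simp
    have "(\<Prod>x\<in>?N. (- (A ^ 3)) powi (- s x)) * ((\<Prod>x\<in>S. A powi s x) * (\<Prod>x\<in>?N - S. A powi (- s x))) =
        (\<Prod>x\<in>?N. - (t powr (real_of_int (s x) * exponent S x)))"
      unfolding split[OF S] prod.distrib[symmetric] by (rule prod.cong[OF refl]) (rule c)
    also have "\<dots> = (\<Prod>x\<in>?N. (-1) * t powr (real_of_int (s x) * exponent S x))" by simp
    also have "\<dots> = (-1) ^ card ?N * t powr (\<Sum>x\<in>?N. real_of_int (s x) * exponent S x)"
      unfolding prod.distrib using t by (subst powr_sum) auto
    finally have 1: "(\<Prod>x\<in>?N. (- (A ^ 3)) powi (- s x)) * ((\<Prod>x\<in>S. A powi s x) * (\<Prod>x\<in>?N - S. A powi (- s x))) =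
      (-1) ^ card ?N * t powr (\<Sum>x\<in>?N. real_of_int (s x) * exponent S x)" .
    have "?d ^ circ w (state S) = ?d * ?d ^ (circ w (state S) - 1)"
      using circ_pos[of w "state S"] by (metis Suc_pred' power_Suc)
    then show "(\<Prod>x\<in>?N. (- (A ^ 3)) powi (- s x)) * ((\<Prod>x\<in>S. A powi s x) * (\<Prod>x\<in>?N - S. A powi (- s x)) * ?d ^ circ w (state S)) / ?d =
      (-1) ^ card ?N * (t powr (\<Sum>x\<in>?N. real_of_int (s x) * exponent S x) * (- (t powr (1/2) + t powr (-1/2))) ^ (circ w (state S) - 1))"
      using 1 d0 unfolding d[symmetric] by (simp add: mult.assoc[symmetric])
  qed
  finally show ?thesis .
qed

text \<open>In \<open>u = log t\<close> the loop value is \<open>-2 * cosh (u/2)\<close>. It is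
  even, and its second derivative at \<open>0\<close> is a quarter of its value there.\<close>

lemma jet_loop_power:
  "jet (\<lambda>t. (- (t powr (1/2) + t powr (-1/2))) ^ m) ((-2) ^ m) 0 ((-2) ^ m * (real m / 4)) 0"
proof (induction m)
  case 0
  show ?case using jet_const[of 1] by simp
next
  case (Suc m)
  have 1: "jet (\<lambda>t. - (t powr (1/2) + t powr (-1/2))) (-2) 0 (-1/2) 0"
  proof -
    have eq: "(\<lambda>t :: real. - (t powr (1/2) + t powr (-1/2))) = (\<lambda>t. -1 * (t powr (1/2) + t powr (-1/2)))"
      by (intro ext) simp
    show ?thesis
      unfolding eq by (rule jet_cong_values[OF jet_cmult[OF jet_add[OF jet_powr jet_powr]]])
        (simp_all add: power2_eq_square power3_eq_cube)
  qed
  show ?case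
    unfolding power_Suc by (rule jet_cong_values[OF jet_mult[OF 1 Suc]]) (simp_all add: field_simps)
qed

text \<open>The second coefficient is left existential, because it cancels in \<open>v3\<close>. The
  factor \<open>3/4\<close> is the binomial coefficient 3 times the quarter in the loop
  factor.\<close>

lemma jet_jones_word:
  assumes s: "\<And>x. x \<in> set w \<Longrightarrow> s x = 1 \<or> s x = -1"
  defines "W \<equiv> \<lambda>S. \<Sum>x\<in>set w. real_of_int (s x) * exponent S x" and "m \<equiv> \<lambda>S. real (circ w (state S) - 1)"
  shows "\<exists>f a2. (\<forall>t>0. jones_word w s t = f t) \<and>
    jet f (mean w (\<lambda>_. 1)) (mean w W) a2 (mean w (\<lambda>S. W S ^ 3 + 3 / 4 * (W S * m S)))"
proof -
  let ?f = "\<lambda>S t. (-1) ^ card (set w) * (t powr W S * (- (t powr (1/2) + t powr (-1/2))) ^ (circ w (state S) - 1))"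
  have "jet (?f S) (mass w S * 1) (mass w S * W S) (mass w S * (W S ^ 2 + m S / 4)) (mass w S * (W S ^ 3 + 3 / 4 * (W S * m S)))" for S
    by (rule jet_cong_values[OF jet_cmult[OF jet_mult[OF jet_powr jet_loop_power]]])
      (simp_all add: mass_def m_def algebra_simps)
  then have 1: "jet (\<lambda>t. \<Sum>S\<in>Pow (set w). ?f S t) (mean w (\<lambda>_. 1)) (mean w W) (mean w (\<lambda>S. W S ^ 2 + m S / 4)) (mean w (\<lambda>S. W S ^ 3 + 3 / 4 * (W S * m S)))"
    unfolding mean_def by (intro jet_sum) auto
  have 2: "\<forall>t>0. jones_word w s t = (\<Sum>S\<in>Pow (set w). ?f S t)"
    unfolding W_def by (intro allI impI jones_word_sum s)
  show ?thesis
    by (rule exI[of _ "\<lambda>t. \<Sum>S\<in>Pow (set w). ?f S t"], rule exI[of _ "mean w (\<lambda>S. W S ^ 2 + m S / 4)"], rule conjI[OF 2 1])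
qed

subsection \<open>Means over all states\<close>

text \<open>By the three-term relation, summing over both smoothings of a crossing erases it and
  changes the sign; this is iterated over the list.\<close>

lemma ssum_minus_two:
  assumes "dow w" "distinct xs" "set xs \<subseteq> set w"
  shows "ssum (\<lambda>_. 1) (\<lambda>_. 1) (\<lambda>st. (-2) ^ circ w st) xs st = (-1) ^ length xs * (-2) ^ circ w (\<lambda>x. if x \<in> set xs then Erased else st x)"
  using assms(2,3)
proof (induction xs arbitrary: st)
  case (Cons x xs)
  define st' where "st' = (\<lambda>y. if y \<in> set xs then Erased else st y)"
  have upd: "(\<lambda>y. if y \<in> set xs then Erased else (st(x := v)) y) = st'(x := v)" for v
    using Cons.prems by (auto simp: st'_def)
  have e: "(\<lambda>y. if y \<in> set (x # xs) then Erased else st y) = st'(x := Erased)"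
    by (auto simp: st'_def)
  have "ssum (\<lambda>_. 1) (\<lambda>_. 1) (\<lambda>st. (-2) ^ circ w st) (x # xs) st =
      (-1) ^ length xs * ((-2) ^ circ w (st'(x := Oriented)) + (-2) ^ circ w (st'(x := Unoriented)))"
    using Cons by (simp only: ssum.simps upd[symmetric]) (simp add: algebra_simps)
  also have "(-2) ^ circ w (st'(x := Oriented)) + (-2) ^ circ w (st'(x := Unoriented)) = - ((-2 :: real) ^ circ w (st'(x := Erased)))"
    using circ_three_terms[OF assms(1), of x st'] Cons.prems by simp
  finally show ?case unfolding e by simp
qed simp

definition oriented_circles :: "nat list \<Rightarrow> nat set \<Rightarrow> nat" where
  "oriented_circles w T = circ (filter (\<lambda>x. x \<in> T) w) (\<lambda>_. Oriented)"

text \<open>The crossings outside \<open>T\<close> are summed freely and therefore erased. So the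
  joint moments of the events \<open>x \<in> S\<close> depend only on the chord subdiagram in
  question.\<close>

lemma mean_subset:
  assumes "dow w" "T \<subseteq> set w"
  shows "mean w (\<lambda>S. if T \<subseteq> S then 1 else 0) = (-1) ^ card T * (-2) ^ (oriented_circles w T - 1)"
proof -
  let ?N = "set w"
  have fin: "finite T" using assms(2) finite_subset by blast
  obtain xs where xs: "distinct xs" "set xs = ?N - T" using finite_distinct_list[of "?N - T"] by auto
  have m: "mass w S = (-1) ^ card ?N * ((-2) ^ circ w (state S) / (-2))" for S
    using circ_pos[of w "state S"] unfolding mass_def by (cases "circ w (state S)") auto
  have "mean w (\<lambda>S. if T \<subseteq> S then 1 else 0) = (\<Sum>S\<in>{S \<in> Pow ?N. T \<subseteq> S}. mass w S)"
    unfolding mean_def by (rule sum.mono_neutral_cong_right) auto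
  also have "\<dots> = (\<Sum>S\<in>Pow (?N - T). mass w (S \<union> T))"
    by (rule sum.reindex_bij_witness[of _ "\<lambda>S. S \<union> T" "\<lambda>S. S - T"]) (use assms(2) in \<open>auto simp: Un_absorb2\<close>)
  also have "\<dots> = (-1) ^ card ?N / (-2) * (\<Sum>S\<in>Pow (?N - T). (-2) ^ circ w (state (S \<union> T)))"
    unfolding m by (simp add: sum_distrib_left)
  also have "(\<Sum>S\<in>Pow (?N - T). (-2 :: real) ^ circ w (state (S \<union> T))) = ssum (\<lambda>_. 1) (\<lambda>_. 1) (\<lambda>st. (-2) ^ circ w st) xs (\<lambda>_. Oriented)"
    unfolding ssum_Pow[OF xs(1)] xs(2)
    by (intro sum.cong refl) (simp, intro arg_cong2[of _ _ _ _ "(^)"] refl circ_cong, auto simp: state_def)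
  also have "\<dots> = (-1) ^ card (?N - T) * (-2) ^ circ w (\<lambda>x. if x \<in> ?N - T then Erased else Oriented)"
    using ssum_minus_two[OF assms(1) xs(1), of "\<lambda>_. Oriented"] xs by (simp add: distinct_card[symmetric])
  also have "circ w (\<lambda>x. if x \<in> ?N - T then Erased else Oriented) = oriented_circles w T"
  proof -
    let ?st = "\<lambda>x. if x \<in> ?N - T then Erased else Oriented"
    have "filter (\<lambda>x. ?st x \<noteq> Erased) w = filter (\<lambda>x. x \<in> T) w"
      by (rule filter_cong) auto
    then have "circ w ?st = circ (filter (\<lambda>x. x \<in> T) w) ?st"
      using circ_filter[OF assms(1), of ?st] by simp
    also have "\<dots> = oriented_circles w T" unfolding oriented_circles_def by (rule circ_cong) auto
    finally show ?thesis .
  qed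
  finally have 1: "mean w (\<lambda>S. if T \<subseteq> S then 1 else 0) =
      (-1) ^ card ?N / (-2) * ((-1) ^ card (?N - T) * (-2) ^ oriented_circles w T)" .
  have "card ?N = card T + card (?N - T)"
    using card_Diff_subset[OF fin assms(2)] card_mono[OF finite_set assms(2)] by simp
  then have 2: "(-1 :: real) ^ card ?N * (-1) ^ card (?N - T) = (-1) ^ card T"
    by (simp add: power_add mult.assoc flip: power_mult_distrib)
  have 3: "(-2 :: real) ^ oriented_circles w T = (-2) * (-2) ^ (oriented_circles w T - 1)"
    unfolding oriented_circles_def using circ_pos by (metis Suc_pred' power_Suc)
  show ?thesis unfolding 1 3 2[symmetric] by simp
qed

section \<open>Circle counts of small chord diagrams\<close>

fun count_classes :: "nat list \<Rightarrow> (nat \<times> nat) list \<Rightarrow> nat" where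
  "count_classes xs [] = length (remdups xs)"
| "count_classes xs ((a, b) # ps) = count_classes (map (\<lambda>x. if x = b then a else x) xs)
     (map (\<lambda>(x, y). (if x = b then a else x, if y = b then a else y)) ps)"

text \<open>Each generating pair is contracted by substituting one point for the other, which lets
  concrete counts be evaluated.\<close>

lemma num_classes_code: "num_classes (set xs) (set ps) = count_classes xs ps"
proof (induction xs ps rule: count_classes.induct)
  case (1 xs)
  have "num_classes (set xs) {} = card ((\<lambda>x. {x}) ` set xs)" by (simp add: num_classes_image)
  also have "\<dots> = card (set xs)" by (rule card_image) auto
  finally show ?case by (simp add: length_remdups_card_conv)
next
  case (2 xs a b ps)
  have "map_prod (\<lambda>x. if x = b then a else x) (\<lambda>x. if x = b then a else x) ` set ps =
      set (map (\<lambda>(x, y). (if x = b then a else x, if y = b then a else y)) ps)"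
    by (auto simp: map_prod_def)
  then show ?case using 2 num_classes_insert_pair[of "set xs" a b "set ps"] by simp
qed

lemma circ_oriented_code:
  "circ w (\<lambda>_. Oriented) = count_classes [0..<Suc (length w)]
     ((0, length w) # [(p, Suc q). p \<leftarrow> [0..<length w], q \<leftarrow> [0..<length w], p \<noteq> q \<and> w ! p = w ! q])"
proof -
  let ?ps = "(0, length w) # [(p, Suc q). p \<leftarrow> [0..<length w], q \<leftarrow> [0..<length w], p \<noteq> q \<and> w ! p = w ! q]"
  have ps: "(a, b) \<in> set ?ps \<longleftrightarrow> a = 0 \<and> b = length w \<or> (\<exists>p q. (p, q) \<in> chords w \<and> a = p \<and> b = Suc q)" for a b
    by (auto simp: chords_def)
  have "num_classes X (joined (set w) w (\<lambda>_. Oriented)) = num_classes X (set ?ps)" for X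
  proof (rule num_classes_mutual)
    fix a b assume "(a, b) \<in> joined (set w) w (\<lambda>_. Oriented)"
    then consider "(a, b) \<in> set ?ps" | p q where "(p, q) \<in> chords w" "a = Suc p" "b = q"
      unfolding joined_set_iff ps by auto
    then show "conn (set ?ps) a b"
    proof cases
      case 2
      then have "(q, p) \<in> chords w" by (auto simp: chords_def)
      then have "(b, a) \<in> set ?ps" unfolding ps using 2 by blast
      then show ?thesis by (rule conn_sym[OF conn_base])
    qed (rule conn_base)
  next
    fix a b assume "(a, b) \<in> set ?ps"
    then have "(a, b) \<in> joined (set w) w (\<lambda>_. Oriented)"
      unfolding joined_set_iff ps by auto
    then show "conn (joined (set w) w (\<lambda>_. Oriented)) a b" by (rule conn_base)
  qed
  moreover have "{..length w} = set [0..<Suc (length w)]" by auto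
  ultimately show ?thesis unfolding circ_def num_classes_code[symmetric] by simp
qed

text \<open>All 1, 3 and 15 words with one, two and three crossings, numbered in the order of first
  occurrence. The three-chord words have 4 circles if no two chords interleave and 2
  otherwise.\<close>

lemma circ_oriented_small:
  "circ [0, 0] (\<lambda>_. Oriented) = 2"
  "circ [0, 0, 1, 1] (\<lambda>_. Oriented) = 3" "circ [0, 1, 0, 1] (\<lambda>_. Oriented) = 1" "circ [0, 1, 1, 0] (\<lambda>_. Oriented) = 3"
    "circ [0, 0, 1, 1, 2, 2] (\<lambda>_. Oriented) = 4"
    "circ [0, 0, 1, 2, 1, 2] (\<lambda>_. Oriented) = 2"
    "circ [0, 0, 1, 2, 2, 1] (\<lambda>_. Oriented) = 4"
    "circ [0, 1, 0, 1, 2, 2] (\<lambda>_. Oriented) = 2"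
    "circ [0, 1, 0, 2, 1, 2] (\<lambda>_. Oriented) = 2"
    "circ [0, 1, 0, 2, 2, 1] (\<lambda>_. Oriented) = 2"
    "circ [0, 1, 1, 0, 2, 2] (\<lambda>_. Oriented) = 4"
    "circ [0, 1, 1, 2, 0, 2] (\<lambda>_. Oriented) = 2"
    "circ [0, 1, 1, 2, 2, 0] (\<lambda>_. Oriented) = 4"
    "circ [0, 1, 2, 0, 1, 2] (\<lambda>_. Oriented) = 2"
    "circ [0, 1, 2, 0, 2, 1] (\<lambda>_. Oriented) = 2"
    "circ [0, 1, 2, 1, 0, 2] (\<lambda>_. Oriented) = 2"
    "circ [0, 1, 2, 1, 2, 0] (\<lambda>_. Oriented) = 2"
    "circ [0, 1, 2, 2, 0, 1] (\<lambda>_. Oriented) = 2"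
    "circ [0, 1, 2, 2, 1, 0] (\<lambda>_. Oriented) = 4"
  unfolding circ_oriented_code by code_simp+

lemma filter_positions:
  assumes "sorted_wrt (<) ps" "set ps = {i. i < length w \<and> w ! i \<in> T}"
  shows "filter (\<lambda>x. x \<in> T) w = map ((!) w) ps"
proof -
  have "filter (\<lambda>x. x \<in> T) w = filter (\<lambda>x. x \<in> T) (map ((!) w) [0..<length w])"
    by (simp add: map_nth)
  also have "\<dots> = map ((!) w) (filter (\<lambda>i. w ! i \<in> T) [0..<length w])"
    by (simp add: filter_map comp_def)
  also have "filter (\<lambda>i. w ! i \<in> T) [0..<length w] = ps"
    by (rule strict_sorted_equal) (use assms in \<open>auto simp: sorted_wrt_filter\<close>)
  finally show ?thesis .
qed

definition first_pos :: "nat list \<Rightarrow> nat \<Rightarrow> nat" where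
  "first_pos w x = Min {i. i < length w \<and> w ! i = x}"

definition second_pos :: "nat list \<Rightarrow> nat \<Rightarrow> nat" where
  "second_pos w x = Max {i. i < length w \<and> w ! i = x}"

lemma occurs_positions:
  assumes "dow w" "x \<in> set w"
  shows "occurs w x (first_pos w x) (second_pos w x)" "first_pos w x < second_pos w x"
proof -
  obtain p q where pq: "occurs w x p q" "p < q" using dow_occurs[OF assms] by blast
  then have "{i. i < length w \<and> w ! i = x} = {p, q}" by (simp add: occurs_def)
  then have "first_pos w x = p" "second_pos w x = q" using pq(2) by (simp_all add: first_pos_def second_pos_def)
  then show "occurs w x (first_pos w x) (second_pos w x)" "first_pos w x < second_pos w x" using pq by simp_all
qed

text \<open>The relation records which of the two crossings is met first. The undirected version
  governs circle counts, the direction supplies the sign in \<open>lk\<close>.\<close>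

definition interleaved :: "nat list \<Rightarrow> nat \<Rightarrow> nat \<Rightarrow> bool" where
  "interleaved w x y \<longleftrightarrow> first_pos w x < first_pos w y \<and> first_pos w y < second_pos w x \<and> second_pos w x < second_pos w y"

definition crossing :: "nat list \<Rightarrow> nat \<Rightarrow> nat \<Rightarrow> bool" where
  "crossing w x y \<longleftrightarrow> interleaved w x y \<or> interleaved w y x"

lemma positions_facts:
  assumes "dow w" "x \<in> set w"
  shows "w ! first_pos w x = x" "w ! second_pos w x = x" "first_pos w x < length w" "second_pos w x < length w"
    "{i. i < length w \<and> w ! i = x} = {first_pos w x, second_pos w x}"
  using occurs_positions(1)[OF assms] occurs_nth[OF occurs_positions(1)[OF assms]] unfolding occurs_def by blast+

lemma oriented_circles_code:
  assumes "dow w" "T \<subseteq> set w" "sorted_wrt (<) ps" "set ps = (\<Union>x\<in>T. {first_pos w x, second_pos w x})"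
    and "map ((!) w) ps = map f u" "inj_on f (set u)"
  shows "oriented_circles w T = circ u (\<lambda>_. Oriented)"
proof -
  have "set ps = {i. i < length w \<and> w ! i \<in> T}"
  proof -
    have "{i. i < length w \<and> w ! i \<in> T} = (\<Union>x\<in>T. {i. i < length w \<and> w ! i = x})" by auto
    also have "\<dots> = (\<Union>x\<in>T. {first_pos w x, second_pos w x})"
      by (rule SUP_cong[OF refl]) (use positions_facts(5)[OF assms(1)] assms(2) in blast)
    finally show ?thesis using assms(4) by simp
  qed
  from filter_positions[OF assms(3) this] show ?thesis
    unfolding oriented_circles_def assms(5) by (simp add: circ_map[OF assms(6)] comp_def)
qed

lemma oriented_circles_1:
  assumes "dow w" "x \<in> set w"
  shows "oriented_circles w {x} = 2"
  using oriented_circles_code[OF assms(1), of "{x}" "[first_pos w x, second_pos w x]" "\<lambda>_. x" "[0, 0]"]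
    positions_facts[OF assms] occurs_positions(2)[OF assms] assms(2) circ_oriented_small(1) by simp

lemma positions_distinct:
  assumes "dow w" "x \<in> set w" "y \<in> set w" "x \<noteq> y"
  shows "first_pos w x \<noteq> first_pos w y" "first_pos w x \<noteq> second_pos w y" "second_pos w x \<noteq> second_pos w y"
  using positions_facts(1,2)[OF assms(1,2)] positions_facts(1,2)[OF assms(1,3)] assms(4) by metis+

lemma oriented_circles_2:
  assumes "dow w" "x \<in> set w" "y \<in> set w" "x \<noteq> y"
  shows "oriented_circles w {x, y} = (if crossing w x y then 1 else 3)"
proof -
  have *: "oriented_circles w {x, y} = (if crossing w x y then 1 else 3)"
    if xy: "x \<in> set w" "y \<in> set w" "x \<noteq> y" and lt: "first_pos w x < first_pos w y" for x y
  proof -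
    let ?f = "\<lambda>n. [x, y] ! n"
    note px = positions_facts[OF assms(1) xy(1)] and py = positions_facts[OF assms(1) xy(2)]
    note ox = occurs_positions(2)[OF assms(1) xy(1)] and oy = occurs_positions(2)[OF assms(1) xy(2)]
    note code = oriented_circles_code[OF assms(1), of "{x, y}" _ ?f]
    have cr: "crossing w x y \<longleftrightarrow> first_pos w y < second_pos w x \<and> second_pos w x < second_pos w y"
      using lt ox oy unfolding crossing_def interleaved_def by auto
    consider "second_pos w x < first_pos w y" | "first_pos w y < second_pos w x" "second_pos w x < second_pos w y"
      | "second_pos w y < second_pos w x"
      using positions_distinct[OF assms(1) xy] positions_distinct(2)[OF assms(1) xy(2,1)] xy(3) by fastforce
    then show ?thesis
    proof cases
      case 1
      then show ?thesis
        using code[of "[first_pos w x, second_pos w x, first_pos w y, second_pos w y]" "[0, 0, 1, 1]"]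
          px py ox oy lt xy circ_oriented_small(2) cr by (auto simp: insert_commute)
    next
      case 2
      then show ?thesis
        using code[of "[first_pos w x, first_pos w y, second_pos w x, second_pos w y]" "[0, 1, 0, 1]"]
          px py ox oy lt xy circ_oriented_small(3) cr by (auto simp: insert_commute)
    next
      case 3
      then show ?thesis
        using code[of "[first_pos w x, first_pos w y, second_pos w y, second_pos w x]" "[0, 1, 1, 0]"]
          px py ox oy lt xy circ_oriented_small(4) cr by (auto simp: insert_commute)
    qed
  qed
  show ?thesis
  proof (cases "first_pos w x < first_pos w y")
    case True
    then show ?thesis using *[OF assms(2-4)] by simp
  next
    case False
    then have "first_pos w y < first_pos w x" using positions_distinct(1)[OF assms] by simp
    then show ?thesis using *[OF assms(3,2) assms(4)[symmetric]] by (simp add: insert_commute crossing_def disj_commute)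
  qed
qed

text \<open>The 15 perfect matchings of six points on a line, with the pairs named by the order of
  their left ends.\<close>

lemma three_pairs_order:
  fixes fx sx fy sy fz sz :: nat
  assumes "fx < sx" "fy < sy" "fz < sz" "fx < fy" "fy < fz"
    and "sx \<noteq> fy" "sx \<noteq> fz" "sx \<noteq> sy" "sx \<noteq> sz" "sy \<noteq> fz" "sy \<noteq> sz"
  shows "fx < sx \<and> sx < fy \<and> fy < sy \<and> sy < fz \<and> fz < sz \<or>
    fx < sx \<and> sx < fy \<and> fy < fz \<and> fz < sy \<and> sy < sz \<or>
    fx < sx \<and> sx < fy \<and> fy < fz \<and> fz < sz \<and> sz < sy \<or>
    fx < fy \<and> fy < sx \<and> sx < sy \<and> sy < fz \<and> fz < sz \<or>
    fx < fy \<and> fy < sx \<and> sx < fz \<and> fz < sy \<and> sy < sz \<or>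
    fx < fy \<and> fy < sx \<and> sx < fz \<and> fz < sz \<and> sz < sy \<or>
    fx < fy \<and> fy < sy \<and> sy < sx \<and> sx < fz \<and> fz < sz \<or>
    fx < fy \<and> fy < sy \<and> sy < fz \<and> fz < sx \<and> sx < sz \<or>
    fx < fy \<and> fy < sy \<and> sy < fz \<and> fz < sz \<and> sz < sx \<or>
    fx < fy \<and> fy < fz \<and> fz < sx \<and> sx < sy \<and> sy < sz \<or>
    fx < fy \<and> fy < fz \<and> fz < sx \<and> sx < sz \<and> sz < sy \<or>
    fx < fy \<and> fy < fz \<and> fz < sy \<and> sy < sx \<and> sx < sz \<or>
    fx < fy \<and> fy < fz \<and> fz < sy \<and> sy < sz \<and> sz < sx \<or>
    fx < fy \<and> fy < fz \<and> fz < sz \<and> sz < sx \<and> sx < sy \<or>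
    fx < fy \<and> fy < fz \<and> fz < sz \<and> sz < sy \<and> sy < sx"
proof -
  have "sx < fy \<or> fy < sx" "sx < fz \<or> fz < sx" "sx < sy \<or> sy < sx" "sx < sz \<or> sz < sx" "sy < fz \<or> fz < sy" "sy < sz \<or> sz < sy"
    using assms by auto
  then show ?thesis
    using assms(1-5) by (elim disjE) simp_all
qed

lemma oriented_circles_3_sorted:
  assumes "dow w" "x \<in> set w" "y \<in> set w" "z \<in> set w"
    and lt: "first_pos w x < first_pos w y" "first_pos w y < first_pos w z"
  shows "oriented_circles w {x, y, z} = (if crossing w x y \<or> crossing w y z \<or> crossing w x z then 2 else 4)"
proof -
  have ne: "x \<noteq> y" "y \<noteq> z" "x \<noteq> z" using lt by auto
  let ?f = "\<lambda>n. [x, y, z] ! n"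
  define fx where "fx = first_pos w x"
  define sx where "sx = second_pos w x"
  define fy where "fy = first_pos w y"
  define sy where "sy = second_pos w y"
  define fz where "fz = first_pos w z"
  define sz where "sz = second_pos w z"
  note defs = fx_def[symmetric] sx_def[symmetric] fy_def[symmetric] sy_def[symmetric] fz_def[symmetric] sz_def[symmetric]
  note o = occurs_positions(2)[OF assms(1,2)] occurs_positions(2)[OF assms(1,3)] occurs_positions(2)[OF assms(1,4)]
  note d = positions_distinct[OF assms(1,2,3) ne(1)] positions_distinct[OF assms(1,3,4) ne(2)] positions_distinct[OF assms(1,2,4) ne(3)]
    positions_distinct(2)[OF assms(1,3,2) ne(1)[symmetric]] positions_distinct(2)[OF assms(1,4,3) ne(2)[symmetric]]
    positions_distinct(2)[OF assms(1,4,2) ne(3)[symmetric]]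
  note n = positions_facts(1,2)[OF assms(1,2)] positions_facts(1,2)[OF assms(1,3)] positions_facts(1,2)[OF assms(1,4)]
  have cr: "crossing w x y \<longleftrightarrow> fy < sx \<and> sx < sy" "crossing w y z \<longleftrightarrow> fz < sy \<and> sy < sz" "crossing w x z \<longleftrightarrow> fz < sx \<and> sx < sz"
    using lt o unfolding crossing_def interleaved_def defs by auto
  have code: "oriented_circles w {x, y, z} = circ u (\<lambda>_. Oriented)"
    if "sorted_wrt (<) ps" "set ps = {fx, sx, fy, sy, fz, sz}" "map ((!) w) ps = map ?f u" "set u = {0, 1, 2}" for ps u
    by (rule oriented_circles_code[OF assms(1) _ that(1) _ that(3)])
      (use assms(2-4) that(2,4) ne in \<open>auto simp: defs inj_on_def\<close>)
  note lt' = lt[unfolded defs] o[unfolded defs] and n' = n[unfolded defs]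
  have "fx < sx \<and> sx < fy \<and> fy < sy \<and> sy < fz \<and> fz < sz \<or>
    fx < sx \<and> sx < fy \<and> fy < fz \<and> fz < sy \<and> sy < sz \<or>
    fx < sx \<and> sx < fy \<and> fy < fz \<and> fz < sz \<and> sz < sy \<or>
    fx < fy \<and> fy < sx \<and> sx < sy \<and> sy < fz \<and> fz < sz \<or>
    fx < fy \<and> fy < sx \<and> sx < fz \<and> fz < sy \<and> sy < sz \<or>
    fx < fy \<and> fy < sx \<and> sx < fz \<and> fz < sz \<and> sz < sy \<or>
    fx < fy \<and> fy < sy \<and> sy < sx \<and> sx < fz \<and> fz < sz \<or>
    fx < fy \<and> fy < sy \<and> sy < fz \<and> fz < sx \<and> sx < sz \<or>
    fx < fy \<and> fy < sy \<and> sy < fz \<and> fz < sz \<and> sz < sx \<or>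
    fx < fy \<and> fy < fz \<and> fz < sx \<and> sx < sy \<and> sy < sz \<or>
    fx < fy \<and> fy < fz \<and> fz < sx \<and> sx < sz \<and> sz < sy \<or>
    fx < fy \<and> fy < fz \<and> fz < sy \<and> sy < sx \<and> sx < sz \<or>
    fx < fy \<and> fy < fz \<and> fz < sy \<and> sy < sz \<and> sz < sx \<or>
    fx < fy \<and> fy < fz \<and> fz < sz \<and> sz < sx \<and> sx < sy \<or>
    fx < fy \<and> fy < fz \<and> fz < sz \<and> sz < sy \<and> sy < sx"
    by (rule three_pairs_order) (use lt o d in \<open>simp_all add: defs eq_commute\<close>)
  then show ?thesis
  proof (elim disjE conjE)
    assume h: "fx < sx" "sx < fy" "fy < sy" "sy < fz" "fz < sz"
    have "oriented_circles w {x, y, z} = circ [0, 0, 1, 1, 2, 2] (\<lambda>_. Oriented)"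
      by (rule code[of "[fx, sx, fy, sy, fz, sz]"]) (use h n' in auto)
    then show ?thesis using h cr unfolding circ_oriented_small by simp
  next
    assume h: "fx < sx" "sx < fy" "fy < fz" "fz < sy" "sy < sz"
    have "oriented_circles w {x, y, z} = circ [0, 0, 1, 2, 1, 2] (\<lambda>_. Oriented)"
      by (rule code[of "[fx, sx, fy, fz, sy, sz]"]) (use h n' in auto)
    then show ?thesis using h cr unfolding circ_oriented_small by simp
  next
    assume h: "fx < sx" "sx < fy" "fy < fz" "fz < sz" "sz < sy"
    have "oriented_circles w {x, y, z} = circ [0, 0, 1, 2, 2, 1] (\<lambda>_. Oriented)"
      by (rule code[of "[fx, sx, fy, fz, sz, sy]"]) (use h n' in auto)
    then show ?thesis using h cr unfolding circ_oriented_small by simp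
  next
    assume h: "fx < fy" "fy < sx" "sx < sy" "sy < fz" "fz < sz"
    have "oriented_circles w {x, y, z} = circ [0, 1, 0, 1, 2, 2] (\<lambda>_. Oriented)"
      by (rule code[of "[fx, fy, sx, sy, fz, sz]"]) (use h n' in auto)
    then show ?thesis using h cr unfolding circ_oriented_small by simp
  next
    assume h: "fx < fy" "fy < sx" "sx < fz" "fz < sy" "sy < sz"
    have "oriented_circles w {x, y, z} = circ [0, 1, 0, 2, 1, 2] (\<lambda>_. Oriented)"
      by (rule code[of "[fx, fy, sx, fz, sy, sz]"]) (use h n' in auto)
    then show ?thesis using h cr unfolding circ_oriented_small by simp
  next
    assume h: "fx < fy" "fy < sx" "sx < fz" "fz < sz" "sz < sy"
    have "oriented_circles w {x, y, z} = circ [0, 1, 0, 2, 2, 1] (\<lambda>_. Oriented)"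
      by (rule code[of "[fx, fy, sx, fz, sz, sy]"]) (use h n' in auto)
    then show ?thesis using h cr unfolding circ_oriented_small by simp
  next
    assume h: "fx < fy" "fy < sy" "sy < sx" "sx < fz" "fz < sz"
    have "oriented_circles w {x, y, z} = circ [0, 1, 1, 0, 2, 2] (\<lambda>_. Oriented)"
      by (rule code[of "[fx, fy, sy, sx, fz, sz]"]) (use h n' in auto)
    then show ?thesis using h cr unfolding circ_oriented_small by simp
  next
    assume h: "fx < fy" "fy < sy" "sy < fz" "fz < sx" "sx < sz"
    have "oriented_circles w {x, y, z} = circ [0, 1, 1, 2, 0, 2] (\<lambda>_. Oriented)"
      by (rule code[of "[fx, fy, sy, fz, sx, sz]"]) (use h n' in auto)
    then show ?thesis using h cr unfolding circ_oriented_small by simp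
  next
    assume h: "fx < fy" "fy < sy" "sy < fz" "fz < sz" "sz < sx"
    have "oriented_circles w {x, y, z} = circ [0, 1, 1, 2, 2, 0] (\<lambda>_. Oriented)"
      by (rule code[of "[fx, fy, sy, fz, sz, sx]"]) (use h n' in auto)
    then show ?thesis using h cr unfolding circ_oriented_small by simp
  next
    assume h: "fx < fy" "fy < fz" "fz < sx" "sx < sy" "sy < sz"
    have "oriented_circles w {x, y, z} = circ [0, 1, 2, 0, 1, 2] (\<lambda>_. Oriented)"
      by (rule code[of "[fx, fy, fz, sx, sy, sz]"]) (use h n' in auto)
    then show ?thesis using h cr unfolding circ_oriented_small by simp
  next
    assume h: "fx < fy" "fy < fz" "fz < sx" "sx < sz" "sz < sy"
    have "oriented_circles w {x, y, z} = circ [0, 1, 2, 0, 2, 1] (\<lambda>_. Oriented)"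
      by (rule code[of "[fx, fy, fz, sx, sz, sy]"]) (use h n' in auto)
    then show ?thesis using h cr unfolding circ_oriented_small by simp
  next
    assume h: "fx < fy" "fy < fz" "fz < sy" "sy < sx" "sx < sz"
    have "oriented_circles w {x, y, z} = circ [0, 1, 2, 1, 0, 2] (\<lambda>_. Oriented)"
      by (rule code[of "[fx, fy, fz, sy, sx, sz]"]) (use h n' in auto)
    then show ?thesis using h cr unfolding circ_oriented_small by simp
  next
    assume h: "fx < fy" "fy < fz" "fz < sy" "sy < sz" "sz < sx"
    have "oriented_circles w {x, y, z} = circ [0, 1, 2, 1, 2, 0] (\<lambda>_. Oriented)"
      by (rule code[of "[fx, fy, fz, sy, sz, sx]"]) (use h n' in auto)
    then show ?thesis using h cr unfolding circ_oriented_small by simp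
  next
    assume h: "fx < fy" "fy < fz" "fz < sz" "sz < sx" "sx < sy"
    have "oriented_circles w {x, y, z} = circ [0, 1, 2, 2, 0, 1] (\<lambda>_. Oriented)"
      by (rule code[of "[fx, fy, fz, sz, sx, sy]"]) (use h n' in auto)
    then show ?thesis using h cr unfolding circ_oriented_small by simp
  next
    assume h: "fx < fy" "fy < fz" "fz < sz" "sz < sy" "sy < sx"
    have "oriented_circles w {x, y, z} = circ [0, 1, 2, 2, 1, 0] (\<lambda>_. Oriented)"
      by (rule code[of "[fx, fy, fz, sz, sy, sx]"]) (use h n' in auto)
    then show ?thesis using h cr unfolding circ_oriented_small by simp
  qed
qed

lemma oriented_circles_3:
  assumes "dow w" "x \<in> set w" "y \<in> set w" "z \<in> set w" "x \<noteq> y" "y \<noteq> z" "x \<noteq> z"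
  shows "oriented_circles w {x, y, z} = (if crossing w x y \<or> crossing w y z \<or> crossing w x z then 2 else 4)"
proof -
  let ?P = "\<lambda>x y z. oriented_circles w {x, y, z} = (if crossing w x y \<or> crossing w y z \<or> crossing w x z then 2 else 4)"
  let ?f = "first_pos w"
  have sym: "crossing w a b = crossing w b a" for a b unfolding crossing_def by auto
  have perm: "?P a b c \<Longrightarrow> ?P b a c" "?P a b c \<Longrightarrow> ?P a c b" for a b c
    using sym[of a b] sym[of a c] sym[of b c] by (simp_all add: insert_commute disj_commute disj_left_commute)
  note sorted = oriented_circles_3_sorted[OF assms(1)]
  have "?f x \<noteq> ?f y" "?f y \<noteq> ?f z" "?f x \<noteq> ?f z"
    using positions_distinct(1)[OF assms(1)] assms(2-7) by blast+
  then consider "?f x < ?f y" "?f y < ?f z" | "?f x < ?f z" "?f z < ?f y" | "?f y < ?f x" "?f x < ?f z"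
    | "?f y < ?f z" "?f z < ?f x" | "?f z < ?f x" "?f x < ?f y" | "?f z < ?f y" "?f y < ?f x"
    by linarith
  then show ?thesis
  proof cases
    case 1
    then show ?thesis by (intro sorted assms)
  next
    case 2
    then have "?P x z y" by (intro sorted assms)
    then show ?thesis by (rule perm(2))
  next
    case 3
    then have "?P y x z" by (intro sorted assms)
    then show ?thesis by (rule perm(1))
  next
    case 4
    then have "?P y z x" by (intro sorted assms)
    then have "?P y x z" by (rule perm(2))
    then show ?thesis by (rule perm(1))
  next
    case 5
    then have "?P z x y" by (intro sorted assms)
    then have "?P x z y" by (rule perm(1))
    then show ?thesis by (rule perm(2))
  next
    case 6
    then have "?P z y x" by (intro sorted assms)
    then have "?P y z x" by (rule perm(1))
    then have "?P y x z" by (rule perm(2))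
    then show ?thesis by (rule perm(1))
  qed
qed

section \<open>First and third moments of the exponents\<close>

lemma mean_one:
  assumes "dow w"
  shows "mean w (\<lambda>_. 1) = 1"
proof -
  have "oriented_circles w {} = 1"
    unfolding oriented_circles_def circ_oriented_code by simp
  then show ?thesis using mean_subset[OF assms, of "{}"] by simp
qed

lemma exponent_eq: "exponent S x = 1 - (if {x} \<subseteq> S then 1 else 0) / 2"
  by (simp add: exponent_def)

text \<open>The event \<open>x \<in> S\<close> has mean 2, as a signed measure allows, and
  \<open>1 - 2/2 = 0\<close>. This is why the first derivative of the Jones polynomial vanishes at
  1.\<close>

lemma mean_exponent:
  assumes "dow w" "x \<in> set w"
  shows "mean w (\<lambda>S. exponent S x) = 0"
proof -
  have "mean w (\<lambda>S. exponent S x) = mean w (\<lambda>S. 1 + (-1/2) * (if {x} \<subseteq> S then 1 else 0))"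
    unfolding exponent_eq by (intro arg_cong[of _ _ "mean w"] ext) simp
  also have "\<dots> = 1 + (-1/2) * ((-1) ^ card {x} * (-2) ^ (oriented_circles w {x} - 1))"
    unfolding mean_add mean_cmult mean_one[OF assms(1)] using mean_subset[OF assms(1), of "{x}"] assms(2) by simp
  finally show ?thesis using oriented_circles_1[OF assms] by simp
qed

definition crossings_among :: "nat list \<Rightarrow> nat \<Rightarrow> nat \<Rightarrow> nat \<Rightarrow> real" where
  "crossings_among w x y z = of_bool (crossing w x y) + of_bool (crossing w y z) + of_bool (crossing w x z)"

text \<open>Expand in indicators. Single events have mean 2, pairs 4 or 1, the triple 8 or 2, the
  smaller values under interleaving. With 0, 1, 2, 3 interleaved pairs the total is
  \<open>0\<close>, \<open>0\<close>, \<open>-3/4\<close>, \<open>-3/2\<close>.\<close>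

lemma mean_exponent3:
  assumes "dow w" "x \<in> set w" "y \<in> set w" "z \<in> set w" "x \<noteq> y" "y \<noteq> z" "x \<noteq> z"
  shows "mean w (\<lambda>S. exponent S x * exponent S y * exponent S z) = - (3/4) * max 0 (crossings_among w x y z - 1)"
proof -
  define i where "i T S = (if T \<subseteq> S then 1 else 0 :: real)" for T S :: "nat set"
  have e: "exponent S x * exponent S y * exponent S z =
      1 + (-1/2) * i {x} S + ((-1/2) * i {y} S + ((-1/2) * i {z} S + ((1/4) * i {x, y} S + ((1/4) * i {y, z} S +
      ((1/4) * i {x, z} S + (-1/8) * i {x, y, z} S)))))" for S
    unfolding exponent_def i_def by auto
  have m: "mean w (i T) = (-1) ^ card T * (-2) ^ (oriented_circles w T - 1)" if "T \<subseteq> set w" for T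
    unfolding i_def by (rule mean_subset[OF assms(1) that])
  have "mean w (i {x}) = 2" "mean w (i {y}) = 2" "mean w (i {z}) = 2"
    using m[of "{x}"] m[of "{y}"] m[of "{z}"] oriented_circles_1[OF assms(1)] assms(2-4) by simp_all
  moreover have "mean w (i {x, y}) = (if crossing w x y then 1 else 4)" "mean w (i {y, z}) = (if crossing w y z then 1 else 4)"
    "mean w (i {x, z}) = (if crossing w x z then 1 else 4)"
    using m[of "{x, y}"] m[of "{y, z}"] m[of "{x, z}"] oriented_circles_2[OF assms(1)] assms(2-7) by simp_all
  moreover have "mean w (i {x, y, z}) = (if crossing w x y \<or> crossing w y z \<or> crossing w x z then 2 else 8)"
    using m[of "{x, y, z}"] oriented_circles_3[OF assms] assms(2-7) by simp
  ultimately show ?thesis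
    unfolding e mean_add mean_cmult mean_one[OF assms(1)] crossings_among_def by auto
qed

text \<open>The third derivative in \<open>log t\<close> at \<open>t = 1\<close>. The second sum
  comes from the circle counts; it is linear in the signs and is never evaluated.\<close>

definition third_order :: "nat list \<Rightarrow> (nat \<Rightarrow> real) \<Rightarrow> real" where
  "third_order w s =
     (\<Sum>x\<in>set w. \<Sum>y\<in>set w. \<Sum>z\<in>set w. s x * s y * s z * mean w (\<lambda>S. exponent S x * exponent S y * exponent S z)) +
     (\<Sum>x\<in>set w. s x * mean w (\<lambda>S. 3/4 * (exponent S x * real (circ w (state S) - 1))))"

lemma jet_jones_third_order:
  assumes "dow w" "\<And>x. x \<in> set w \<Longrightarrow> s x = 1 \<or> s x = -1"
  shows "\<exists>f a2. (\<forall>t>0. jones_word w s t = f t) \<and> jet f 1 0 a2 (third_order w (\<lambda>x. real_of_int (s x)))"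
proof -
  let ?s = "\<lambda>x. real_of_int (s x)" and ?N = "set w"
  let ?W = "\<lambda>S. \<Sum>x\<in>?N. ?s x * exponent S x" and ?m = "\<lambda>S. real (circ w (state S) - 1)"
  obtain f a2 where f: "\<forall>t>0. jones_word w s t = f t"
    "jet f (mean w (\<lambda>_. 1)) (mean w ?W) a2 (mean w (\<lambda>S. ?W S ^ 3 + 3 / 4 * (?W S * ?m S)))"
    using jet_jones_word[of w s, OF assms(2)] by auto
  have 1: "mean w ?W = 0"
    unfolding mean_sum mean_cmult using mean_exponent[OF assms(1)] by simp
  have "?W S ^ 3 + 3 / 4 * (?W S * ?m S) = (\<Sum>x\<in>?N. \<Sum>y\<in>?N. \<Sum>z\<in>?N. ?s x * ?s y * ?s z * (exponent S x * exponent S y * exponent S z)) +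
      (\<Sum>x\<in>?N. ?s x * (3/4 * (exponent S x * ?m S)))" for S
  proof -
    have "?W S ^ 3 = ?W S * (?W S * ?W S)" by (simp add: power3_eq_cube)
    also have "\<dots> = (\<Sum>x\<in>?N. \<Sum>y\<in>?N. \<Sum>z\<in>?N. ?s x * exponent S x * (?s y * exponent S y * (?s z * exponent S z)))"
      unfolding sum_product by (simp add: sum_distrib_left)
    also have "\<dots> = (\<Sum>x\<in>?N. \<Sum>y\<in>?N. \<Sum>z\<in>?N. ?s x * ?s y * ?s z * (exponent S x * exponent S y * exponent S z))"
      by (simp add: mult_ac)
    finally show ?thesis by (simp add: sum_distrib_left sum_distrib_right mult_ac)
  qed
  then have "mean w (\<lambda>S. ?W S ^ 3 + 3 / 4 * (?W S * ?m S)) = third_order w ?s"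
    unfolding third_order_def by (simp only: mean_add mean_sum mean_cmult)
  then show ?thesis using f 1 mean_one[OF assms(1)] by auto
qed

section \<open>Descending diagrams\<close>

text \<open>The flags at the two passages are opposite: if one strand sees the other come from the
  right, then the other sees the first come from the left.\<close>

definition good_shadow :: "shadow \<Rightarrow> bool" where
  "good_shadow E \<longleftrightarrow> dow (map fst E) \<and> (\<forall>(i, j) \<in> chords (map fst E). snd (E ! j) = (\<not> snd (E ! i)))"

text \<open>
  The walk closes a loop for the first time between the positions \<open>a\<close> and \<open>b\<close>. The other passages
  \<open>other k\<close> through the crossings of the loop have an end \<open>inner k\<close> on the side of the loop that
  does not contain the rest of the diagram at the crossing \<open>a\<close>, and an end \<open>outer k\<close> on the other side.
\<close>

locale first_loop =
  fixes E :: shadow and a b :: nat and w :: "nat list"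
  defines "w \<equiv> map fst E"
  assumes good: "good_shadow E" and ab: "a < b" "b < length E" and same: "w ! a = w ! b"
    and dist: "distinct (take b w)"
begin

definition other :: "nat \<Rightarrow> nat" where
  "other k = (THE q. (k, q) \<in> chords w)"

definition inner :: "nat \<Rightarrow> nat" where
  "inner k = (if snd (E ! k) = snd (E ! a) then other k else Suc (other k))"

definition outer :: "nat \<Rightarrow> nat" where
  "outer k = (if snd (E ! k) = snd (E ! a) then Suc (other k) else other k)"

definition V :: "nat set" where
  "V = (!) w ` {a..<b}"

lemma length_w [simp]: "length w = length E"
  by (simp add: w_def)

lemma dow_w: "dow w"
  using good by (simp add: good_shadow_def w_def)

lemma chord_sides: "(i, j) \<in> chords w \<Longrightarrow> snd (E ! j) = (\<not> snd (E ! i))"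
  using good unfolding good_shadow_def w_def by blast

lemma chords_unique:
  assumes "(i, j) \<in> chords w" "(i, k) \<in> chords w"
  shows "j = k"
proof -
  have ij: "i < length w" "j < length w" "i \<noteq> j" "w ! i = w ! j" using assms(1) by (auto simp: chords_def)
  have "occurs w (w ! i) i j" by (rule dow_occursI[OF dow_w]) (use ij in auto)
  from occurs_chords[OF this assms(2) refl] show ?thesis using ij by auto
qed

lemma chords_sym: "(i, j) \<in> chords w \<Longrightarrow> (j, i) \<in> chords w"
  by (auto simp: chords_def)

lemma chord_ex:
  assumes "i < length E"
  shows "\<exists>j. (i, j) \<in> chords w"
proof -
  have "w ! i \<in> set w" using assms by simp
  then obtain p q where pq: "occurs w (w ! i) p q" "p < q" by (rule dow_occurs[OF dow_w])
  have "{i'. i' < length w \<and> w ! i' = w ! i} = {p, q}" using pq(1) unfolding occurs_def by (elim conjE)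
  moreover have "i \<in> {i'. i' < length w \<and> w ! i' = w ! i}" using assms by simp
  ultimately have i: "i = p \<or> i = q" by simp
  have "p < length w \<and> q < length w \<and> p \<noteq> q" using pq(1) unfolding occurs_def by simp
  then have "(p, q) \<in> chords w" using occurs_nth[OF pq(1)] by (simp add: chords_def)
  then show ?thesis using i chords_sym by blast
qed

lemma chord_ab: "(a, b) \<in> chords w"
  using ab same by (simp add: chords_def)

lemma inj_loop: "i < b \<Longrightarrow> j < b \<Longrightarrow> w ! i = w ! j \<Longrightarrow> i = j"
  using dist ab(2) nth_eq_iff_index_eq[of "take b w" i j] by simp

lemma other_chord:
  assumes "k < length E"
  shows "(k, other k) \<in> chords w"
proof -
  obtain j where j: "(k, j) \<in> chords w" using chord_ex[OF assms] by blast
  show ?thesis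
    unfolding other_def by (rule theI[of "\<lambda>q. (k, q) \<in> chords w", OF j]) (rule chords_unique[OF _ j])
qed

text \<open>The labels before \<open>b\<close> are distinct, so a crossing in the interior of the
  loop is revisited only after the loop has closed.\<close>

lemma other_gt:
  assumes "k \<in> {a<..<b}"
  shows "b < other k" "other k < length E" "w ! other k = w ! k"
proof -
  have k: "k < length E" using assms ab by simp
  have ch: "other k < length E" "other k \<noteq> k" "w ! other k = w ! k"
    using other_chord[OF k] by (auto simp: chords_def)
  have "\<not> other k < b" using inj_loop[of "other k" k] ch assms by auto
  moreover have "other k \<noteq> b"
  proof
    assume "other k = b"
    then have "(b, k) \<in> chords w" using chords_sym[OF other_chord[OF k]] by simp
    then have "k = a" using chords_unique chords_sym[OF chord_ab] by blast
    then show False using assms by simp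
  qed
  ultimately show "b < other k" by simp
  show "other k < length E" "w ! other k = w ! k" by (fact ch)+
qed

lemma in_V:
  assumes "i < length E"
  shows "w ! i \<in> V \<longleftrightarrow> i \<in> {a..b} \<or> (\<exists>k\<in>{a<..<b}. i = other k)"
proof
  assume "w ! i \<in> V"
  then obtain k where k: "a \<le> k" "k < b" "w ! i = w ! k" unfolding V_def by auto
  show "i \<in> {a..b} \<or> (\<exists>k\<in>{a<..<b}. i = other k)"
  proof (cases "i = k")
    case False
    then have ch: "(k, i) \<in> chords w" using k assms ab by (simp add: chords_def)
    show ?thesis
    proof (cases "k = a")
      case True
      then have "i = b" using chords_unique chord_ab ch by blast
      then show ?thesis using ab by simp
    next
      case False
      then have "i = other k" using chords_unique[OF ch other_chord] k ab by simp
      then show ?thesis using False k by auto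
    qed
  qed (use k in simp)
next
  assume "i \<in> {a..b} \<or> (\<exists>k\<in>{a<..<b}. i = other k)"
  then show "w ! i \<in> V"
  proof
    assume "i \<in> {a..b}"
    then have "w ! i = w ! (if i = b then a else i)" "(if i = b then a else i) \<in> {a..<b}"
      using same ab by auto
    then show ?thesis unfolding V_def by blast
  next
    assume "\<exists>k\<in>{a<..<b}. i = other k"
    then show ?thesis using other_gt(3) unfolding V_def by fastforce
  qed
qed

lemma V_subset: "V \<subseteq> set w"
  using ab unfolding V_def by auto

lemma inner_outer: "{inner k, outer k} = {other k, Suc (other k)}"
  by (auto simp: inner_def outer_def)

lemma ends_gt:
  assumes "k \<in> {a<..<b}"
  shows "b < inner k" "b < outer k" "inner k \<le> length E" "outer k \<le> length E" "inner k \<noteq> outer k"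
  using other_gt[OF assms] by (auto simp: inner_def outer_def)

lemma not_V_nodes:
  assumes "i < length E" "w ! i \<notin> V"
  shows "\<not> (a < i \<and> i \<le> b)" "\<not> (a < Suc i \<and> Suc i \<le> b)"
  using assms in_V[OF assms(1)] by auto

subsection \<open>Colourings near the loop\<close>

text \<open>The sides of the strand that face the inside and the outside of the loop.\<close>

definition inside :: "(nat \<Rightarrow> bool) \<Rightarrow> (nat \<Rightarrow> bool) \<Rightarrow> nat \<Rightarrow> bool" where
  "inside lam rho = (if snd (E ! a) then rho else lam)"

definition outside :: "(nat \<Rightarrow> bool) \<Rightarrow> (nat \<Rightarrow> bool) \<Rightarrow> nat \<Rightarrow> bool" where
  "outside lam rho = (if snd (E ! a) then lam else rho)"

context
  fixes z lam rho
  assumes col: "colouring E z lam rho"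
begin

lemma col_z: "i \<le> length E \<Longrightarrow> z i = (lam i \<noteq> rho i)"
  using col by (simp add: colouring_def)

lemma col_corner:
  assumes "(i, j) \<in> chords w" "snd (E ! i)"
  shows "lam i = lam (Suc j)" "lam (Suc i) = rho (Suc j)" "rho i = lam j" "rho (Suc i) = rho j"
  using col assms unfolding colouring_def w_def by blast+

text \<open>The inner end at \<open>k\<close> separates the two corners inside the loop, one before
  and one after \<open>k\<close>. Which of them lies on its left depends on the direction of the
  strand, hence the disjunctions.\<close>

lemma inner_sides:
  assumes "k \<in> {a<..<b}"
  shows "lam (inner k) = inside lam rho k \<and> rho (inner k) = inside lam rho (Suc k) \<or>
    rho (inner k) = inside lam rho k \<and> lam (inner k) = inside lam rho (Suc k)"
    and "lam (outer k) = outside lam rho k \<and> rho (outer k) = outside lam rho (Suc k) \<or>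
    rho (outer k) = outside lam rho k \<and> lam (outer k) = outside lam rho (Suc k)"
proof -
  have ch: "(k, other k) \<in> chords w" using other_chord assms ab by simp
  note ch' = chords_sym[OF ch]
  have or: "snd (E ! other k) = (\<not> snd (E ! k))" by (rule chord_sides[OF ch])
  have 1: "snd (E ! k) \<Longrightarrow> lam k = lam (Suc (other k)) \<and> lam (Suc k) = rho (Suc (other k)) \<and> rho k = lam (other k) \<and> rho (Suc k) = rho (other k)"
    using col_corner[OF ch] by blast
  have 2: "\<not> snd (E ! k) \<Longrightarrow> lam (other k) = lam (Suc k) \<and> lam (Suc (other k)) = rho (Suc k) \<and> rho (other k) = lam k \<and> rho (Suc (other k)) = rho k"
    using col_corner[OF ch'] or by blast
  have "(lam (inner k) = inside lam rho k \<and> rho (inner k) = inside lam rho (Suc k) \<or>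
    rho (inner k) = inside lam rho k \<and> lam (inner k) = inside lam rho (Suc k)) \<and>
    (lam (outer k) = outside lam rho k \<and> rho (outer k) = outside lam rho (Suc k) \<or>
    rho (outer k) = outside lam rho k \<and> lam (outer k) = outside lam rho (Suc k))"
  proof (cases "snd (E ! k)")
    case True
    show ?thesis
      unfolding inner_def outer_def inside_def outside_def using True 1[OF True] by presburger
  next
    case False
    show ?thesis
      unfolding inner_def outer_def inside_def outside_def using False 2[OF False] by presburger
  qed
  then show "lam (inner k) = inside lam rho k \<and> rho (inner k) = inside lam rho (Suc k) \<or>
    rho (inner k) = inside lam rho k \<and> lam (inner k) = inside lam rho (Suc k)"
    "lam (outer k) = outside lam rho k \<and> rho (outer k) = outside lam rho (Suc k) \<or>
    rho (outer k) = outside lam rho k \<and> lam (outer k) = outside lam rho (Suc k)"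
    by blast+
qed

text \<open>Just one of the four corners at the closing crossing is inside the loop, and it touches
  both ends of the loop. The strands arriving at \<open>a\<close> and leaving from \<open>b\<close>
  border the outer corners.\<close>

lemma loop_sides:
  "inside lam rho (Suc a) = inside lam rho b"
  "lam a = outside lam rho b \<or> rho a = outside lam rho b"
  "lam (Suc b) = outside lam rho (Suc a) \<or> rho (Suc b) = outside lam rho (Suc a)"
proof -
  have br: "snd (E ! b) = (\<not> snd (E ! a))" by (rule chord_sides[OF chord_ab])
  have 1: "snd (E ! a) \<Longrightarrow> lam a = lam (Suc b) \<and> lam (Suc a) = rho (Suc b) \<and> rho a = lam b \<and> rho (Suc a) = rho b"
    using col_corner[OF chord_ab] by blast
  have 2: "\<not> snd (E ! a) \<Longrightarrow> lam b = lam (Suc a) \<and> lam (Suc b) = rho (Suc a) \<and> rho b = lam a \<and> rho (Suc b) = rho a"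
    using col_corner[OF chords_sym[OF chord_ab]] br by blast
  show "inside lam rho (Suc a) = inside lam rho b"
    "lam a = outside lam rho b \<or> rho a = outside lam rho b"
    "lam (Suc b) = outside lam rho (Suc a) \<or> rho (Suc b) = outside lam rho (Suc a)"
    unfolding inside_def outside_def using 1 2 by presburger+
qed

lemma inside_outside: "i \<le> length E \<Longrightarrow> z i = (inside lam rho i \<noteq> outside lam rho i)"
  using col_z[of i] by (auto simp: inside_def outside_def)

text \<open>A smoothing joins strands that share a corner. Off the cycle a strand has the same
  colour on both sides, so the colour passes on across the join; a transparent crossing gives no
  such corner.\<close>

lemma joined_side:
  assumes "(u, v) \<in> joined A w st" "\<And>y. y \<in> A \<Longrightarrow> st y \<noteq> Erased" "\<not> z u" "\<not> z v"
  shows "lam u = lam v"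
proof -
  have le: "u \<le> length E" "v \<le> length E" using assms(1) joined_subset[of A w st] by auto
  have eq: "lam u = rho u" "lam v = rho v" using col_z[OF le(1)] col_z[OF le(2)] assms(3,4) by auto
  from assms(1) consider "u = 0" "v = length E" | p q where "(p, q) \<in> chords w" "w ! p \<in> A" "(u, v) \<in> joins p q (st (w ! p))"
    unfolding joined_iff length_w by blast
  then show ?thesis
  proof cases
    case 1
    then show ?thesis using col by (simp add: colouring_def)
  next
    case 2
    have qp: "(q, p) \<in> chords w" by (rule chords_sym[OF 2(1)])
    have r: "snd (E ! q) = (\<not> snd (E ! p))" by (rule chord_sides[OF 2(1)])
    have c1: "snd (E ! p) \<Longrightarrow> lam p = lam (Suc q) \<and> lam (Suc p) = rho (Suc q) \<and> rho p = lam q \<and> rho (Suc p) = rho q"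
      using col_corner[OF 2(1)] by blast
    have c2: "\<not> snd (E ! p) \<Longrightarrow> lam q = lam (Suc p) \<and> lam (Suc q) = rho (Suc p) \<and> rho q = lam p \<and> rho (Suc q) = rho p"
      using col_corner[OF qp] r by blast
    show ?thesis
    proof (cases "st (w ! p)")
      case Oriented
      then have "u = p \<and> v = Suc q \<or> u = Suc p \<and> v = q" using 2(3) by simp
      then show ?thesis using c1 c2 eq by (cases "snd (E ! p)") auto
    next
      case Unoriented
      then have "u = p \<and> v = q \<or> u = Suc p \<and> v = Suc q" using 2(3) by simp
      then show ?thesis using c1 c2 eq by (cases "snd (E ! p)") auto
    next
      case Erased
      then show ?thesis using assms(2) 2(2) by blast
    qed
  qed
qed

end

subsection \<open>Inner ends are matched without crossings\<close>

context
  fixes st :: "nat \<Rightarrow> smoothing"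
  assumes pl: "planar E" and st: "\<forall>y\<in>set w - V. st y \<noteq> Erased"
begin

text \<open>The arcs that remain when all crossings off the loop are smoothed by \<open>st\<close>
  and those on the loop are left open.\<close>

definition R :: "(nat \<times> nat) set" where
  "R = joined (set w - V) w st"

lemma R_avoids:
  assumes "(u, v) \<in> R"
  shows "\<not> (a < u \<and> u \<le> b)" "\<not> (a < v \<and> v \<le> b)"
proof -
  have *: "u \<noteq> n \<and> v \<noteq> n" if n: "a < n" "n \<le> b" for n
  proof (rule joined_avoids[OF assms[unfolded R_def]])
    show "0 < n" "n < length w" using n ab by auto
    show "w ! (n - 1) \<notin> set w - V" using in_V[of "n - 1"] n ab by auto
    show "w ! n \<notin> set w - V" using in_V[of n] n ab by auto
  qed
  show "\<not> (a < u \<and> u \<le> b)" "\<not> (a < v \<and> v \<le> b)" using * by blast+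
qed

lemma R_isolated:
  assumes "conn R n v" "a < n" "n \<le> b"
  shows "v = n"
  using assms(1) by (rule conn_isolated) (use R_avoids assms(2,3) in blast)

lemma loop_cycle: "cycle w (\<lambda>v. a < v \<and> v \<le> b)"
  unfolding cycle_def
proof (intro conjI ballI, goal_cases)
  case 1
  show ?case using ab by simp
next
  case (2 c)
  obtain i j where c: "c = (i, j)" by (cases c)
  have *: "((a < i \<and> i \<le> b) \<noteq> (a < Suc i \<and> Suc i \<le> b)) = (i = a \<or> i = b)" for i
    using ab by auto
  have "(i = a \<or> i = b) = (j = a \<or> j = b)"
    using 2 c chords_unique chord_ab chords_sym by blast
  then show ?case unfolding c prod.case * .
qed

text \<open>A Jordan curve argument with the loop itself as cycle. The arcs of \<open>R\<close>
  avoid the loop, so its colour is constant along them; inner ends carry the inside colour, while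
  \<open>a\<close>, \<open>Suc b\<close> and the outer ends carry the other one.\<close>

lemma inner_separated:
  assumes k: "k \<in> {a<..<b}"
  shows "\<not> conn R (inner k) a" "\<not> conn R (inner k) (Suc b)" "\<And>j. j \<in> {a<..<b} \<Longrightarrow> \<not> conn R (inner k) (outer j)"
    "\<And>n. a < n \<Longrightarrow> n \<le> b \<Longrightarrow> \<not> conn R (inner k) n"
proof -
  let ?z = "\<lambda>v. a < v \<and> v \<le> b"
  obtain lam rho where col: "colouring E ?z lam rho"
    using pl loop_cycle unfolding planar_def w_def by blast
  let ?i = "inside lam rho" and ?o = "outside lam rho"
  have side: "lam u = lam v" if "conn R u v" for u v
  proof (rule conn_invariant[OF that])
    fix u v assume uv: "(u, v) \<in> R"
    show "lam u = lam v"
      by (rule joined_side[OF col uv[unfolded R_def]]) (use st R_avoids[OF uv] in auto)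
  qed
  have zz: "(lam v = rho v) = (\<not> (a < v \<and> v \<le> b))" if "v \<le> length E" for v
    using col_z[OF col that] by auto
  have const: "?i (Suc m) = ?i m" "lam (inner m) = ?i m" "rho (inner m) = ?i m" if m: "m \<in> {a<..<b}" for m
    using inner_sides(1)[OF col m] zz[of "inner m"] ends_gt[OF m] by auto
  have ic: "?i (Suc a + n) = ?i (Suc a)" if "Suc a + n \<le> b" for n
    using that
  proof (induction n)
    case (Suc n)
    then have "Suc a + n \<in> {a<..<b}" by auto
    then show ?case using const(1)[of "Suc a + n"] Suc by simp
  qed simp
  have i: "?i v = ?i (Suc a)" if "a < v" "v \<le> b" for v
    using ic[of "v - Suc a"] that by simp
  have o: "?o v = (\<not> ?i (Suc a))" if "a < v" "v \<le> b" for v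
    using inside_outside[OF col, of v] i[OF that] that ab by auto
  have lk: "lam (inner k) = ?i (Suc a)" using const(2)[OF k] i[of k] k by simp
  have "lam a = (\<not> ?i (Suc a))"
    using loop_sides(2)[OF col] o[of b] ab zz[of a] by auto
  then show "\<not> conn R (inner k) a" using side lk by metis
  have "lam (Suc b) = (\<not> ?i (Suc a))"
    using loop_sides(3)[OF col] o[of "Suc a"] ab zz[of "Suc b"] by auto
  then show "\<not> conn R (inner k) (Suc b)" using side lk by metis
  show "\<not> conn R (inner k) (outer j)" if j: "j \<in> {a<..<b}" for j
  proof -
    have "lam (outer j) = (\<not> ?i (Suc a))"
      using inner_sides(2)[OF col j] o[of j] o[of "Suc j"] j by auto
    then show ?thesis using side lk by metis
  qed
  show "\<not> conn R (inner k) n" if n: "a < n" "n \<le> b" for n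
  proof
    assume "conn R (inner k) n"
    then have "inner k = n" using R_isolated[OF conn_sym n] by blast
    then show False using ends_gt(1)[OF k] n by simp
  qed
qed

text \<open>The free ends of \<open>R\<close> are exactly those at crossings of the loop, and they
  are paired. By the separation just shown, the mate of an inner end can only be an inner
  end.\<close>

lemma mate_unique:
  assumes k: "k \<in> {a<..<b}"
  shows "\<exists>!k'. k' \<in> {a<..<b} \<and> k' \<noteq> k \<and> conn R (inner k) (inner k')"
proof -
  let ?W = "{h. fst h < length w \<and> w ! fst h \<notin> set w - V}"
  define hin where "hin k = (other k, snd (E ! k) \<noteq> snd (E ! a))" for k
  define hout where "hout k = (other k, snd (E ! k) = snd (E ! a))" for k
  have node: "node (hin k) = inner k" "node (hout k) = outer k" for k
    by (simp_all add: node_def hin_def hout_def inner_def outer_def)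
  have inW: "hin k \<in> ?W" if "k \<in> {a<..<b}" for k
    using other_gt[OF that] in_V[of "other k"] that unfolding hin_def by auto
  have inj: "j = k" if "hin j = hin k" "j \<in> {a<..<b}" "k \<in> {a<..<b}" for j k
  proof -
    have "w ! j = w ! k" using that other_gt(3) unfolding hin_def by (metis prod.inject)
    then show ?thesis using inj_loop[of j k] that by simp
  qed
  have pr: "paired R node ?W"
    unfolding R_def by (rule paired_joined[OF dow_w]) auto
  have ex1: "\<exists>!h'. h' \<in> ?W \<and> h' \<noteq> hin k \<and> conn R (node (hin k)) (node h')"
    using pr inW[OF k] unfolding paired_def by blast
  have isin: "\<exists>k'\<in>{a<..<b}. h' = hin k'" if h': "h' \<in> ?W" "conn R (inner k) (node h')" for h'
  proof -
    obtain i s where hs: "h' = (i, s)" by (cases h')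
    have i: "i < length E" "w ! i \<in> V" using h'(1) hs nth_mem[of i w] by auto
    have "\<not> i \<in> {a..b}"
    proof
      assume "i \<in> {a..b}"
      then have "node h' = a \<or> node h' = Suc b \<or> a < node h' \<and> node h' \<le> b"
        unfolding hs node_def by auto
      then show False using h'(2) inner_separated[OF k] by auto
    qed
    then obtain k' where k': "k' \<in> {a<..<b}" "i = other k'" using in_V[OF i(1)] i(2) by auto
    have "h' \<noteq> hout k'" using inner_separated(3)[OF k k'(1)] h'(2) node(2)[of k'] by auto
    then have "h' = hin k'" unfolding hs hin_def hout_def k'(2) by auto
    then show ?thesis using k'(1) by blast
  qed
  from ex1 obtain h' where h': "h' \<in> ?W" "h' \<noteq> hin k" "conn R (inner k) (node h')" unfolding node by blast
  then obtain k' where k': "k' \<in> {a<..<b}" "h' = hin k'" using isin by blast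
  show ?thesis
  proof (rule ex1I[of _ k'])
    show "k' \<in> {a<..<b} \<and> k' \<noteq> k \<and> conn R (inner k) (inner k')"
      using k' h' node(1) by auto
  next
    fix j assume j: "j \<in> {a<..<b} \<and> j \<noteq> k \<and> conn R (inner k) (inner j)"
    then have "hin j \<in> ?W \<and> hin j \<noteq> hin k \<and> conn R (node (hin k)) (node (hin j))"
      using inW[of j] inj[of j k] k unfolding node by blast
    moreover have "h' \<in> ?W \<and> h' \<noteq> hin k \<and> conn R (node (hin k)) (node h')"
      using h' unfolding node by blast
    ultimately have "hin j = h'" using ex1 by blast
    then show "j = k'" using inj[of j k'] j k' by simp
  qed
qed

text \<open>The arc between the inner ends at \<open>k\<close> and \<open>k'\<close>, closed up
  along the loop from \<open>k\<close> to \<open>k'\<close>, is a cycle \<open>z\<close> and hence a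
  boundary. A different arc inside the loop does not meet this curve, so both of its ends lie on the
  same side.\<close>

lemma mates_nested:
  assumes k: "k \<in> {a<..<b}" "k' \<in> {a<..<b}" "k < k'" "conn R (inner k) (inner k')"
    and r: "r \<in> {a<..<b}" "r' \<in> {a<..<b}" "r \<noteq> k" "r \<noteq> k'" "r \<noteq> r'" "conn R (inner r) (inner r')"
  shows "(k < r \<and> r < k') = (k < r' \<and> r' < k')"
proof -
  define C where "C v = conn R (inner k) v" for v
  define z where "z v = (C v \<or> k < v \<and> v \<le> k')" for v
  have kk: "a < k" "k' < b" using k by auto
  have Cv: "C u = C v" if "(u, v) \<in> R" for u v
    using conn_base[OF that] conn_sym conn_trans unfolding C_def by metis
  have Cin: "C (inner m) = (m = k \<or> m = k')" if "m \<in> {a<..<b}" for m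
    using mate_unique[OF k(1)] k that unfolding C_def by (metis conn_refl less_irrefl)
  have Cout: "\<not> C (outer m)" if "m \<in> {a<..<b}" for m
    using inner_separated(3)[OF k(1) that] unfolding C_def .
  have Ca: "\<not> C a" "\<not> C (Suc b)" "\<And>n. a < n \<Longrightarrow> n \<le> b \<Longrightarrow> \<not> C n"
    using inner_separated[OF k(1)] unfolding C_def by blast+
  have cyc: "cycle w z"
    unfolding cycle_def
  proof (intro conjI ballI, goal_cases)
    case 1
    have "(0, length w) \<in> R" unfolding R_def joined_iff by simp
    then show ?case using Cv k ab unfolding z_def by auto
  next
    case (2 c)
    obtain i j where c: "c = (i, j)" by (cases c)
    have ch: "(i, j) \<in> chords w" using 2 c by simp
    have ij: "i < length E" "j < length E" "w ! i = w ! j" using ch by (auto simp: chords_def)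
    have loop: "(z m \<noteq> z (Suc m)) = (z (other m) \<noteq> z (Suc (other m)))" if m: "m \<in> {a<..<b}" for m
    proof -
      have zm: "z m = (k < m \<and> m \<le> k')" "z (Suc m) = (k \<le> m \<and> m < k')"
        using Ca(3)[of m] Ca(3)[of "Suc m"] m unfolding z_def by auto
      then have l: "(z m \<noteq> z (Suc m)) = (m = k \<or> m = k')" using k(3) by auto
      have zi: "z (inner m) = C (inner m)" "z (outer m) = C (outer m)"
        using ends_gt[OF m] kk unfolding z_def by auto
      have "(z (inner m) \<noteq> z (outer m)) = (m = k \<or> m = k')" unfolding zi using Cin[OF m] Cout[OF m] by simp
      moreover have "(z (other m) \<noteq> z (Suc (other m))) = (z (inner m) \<noteq> z (outer m))"
        by (auto simp: inner_def outer_def)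
      ultimately show ?thesis using l by simp
    qed
    have flat: "\<not> z a" "\<not> z (Suc a)" "\<not> z b" "\<not> z (Suc b)"
      using Ca k ab unfolding z_def by auto
    have "(z i \<noteq> z (Suc i)) = (z j \<noteq> z (Suc j))"
    proof (cases "w ! i \<in> V")
      case False
      then have jV: "w ! j \<notin> V" using ij by simp
      have "\<not> (k < n \<and> n \<le> k')" if "n \<in> {i, Suc i, j, Suc j}" for n
        using that not_V_nodes[OF ij(1) False] not_V_nodes[OF ij(2) jV] kk by auto
      then have zC: "z n = C n" if "n \<in> {i, Suc i, j, Suc j}" for n
        using that unfolding z_def by blast
      have iA: "w ! i \<in> set w - V" using False ij(1) by simp
      have sub: "joins i j (st (w ! i)) \<subseteq> R"
      proof
        fix e assume "e \<in> joins i j (st (w ! i))"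
        then show "e \<in> R" unfolding R_def using joined_iff[of "fst e" "snd e"] ch iA by auto
      qed
      show ?thesis
      proof (cases "st (w ! i)")
        case Oriented
        then have "C i = C (Suc j)" "C (Suc i) = C j" using Cv sub by auto
        then show ?thesis using zC by auto
      next
        case Unoriented
        then have "C i = C j" "C (Suc i) = C (Suc j)" using Cv sub by auto
        then show ?thesis using zC by auto
      next
        case Erased
        then show ?thesis using st iA by blast
      qed
    next
      case True
      from in_V[OF ij(1)] True consider "i = a" | "i = b" | "i \<in> {a<..<b}" | m where "m \<in> {a<..<b}" "i = other m"
        by fastforce
      then show ?thesis
      proof cases
        case 1
        then have "j = b" using chords_unique ch chord_ab by blast
        then show ?thesis using 1 flat by simp
      next
        case 2
        then have "j = a" using chords_unique[OF ch] chords_sym[OF chord_ab] by blast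
        then show ?thesis using 2 flat by simp
      next
        case 3
        then have "j = other i" using chords_unique[OF ch other_chord[OF ij(1)]] by simp
        then show ?thesis using loop[OF 3] by simp
      next
        case 4
        then have "m < length E" using ab by simp
        then have "(i, m) \<in> chords w" using chords_sym[OF other_chord] 4(2) by simp
        then have "j = m" using chords_unique[OF ch] by simp
        then show ?thesis using loop[OF 4(1)] 4(2) by simp
      qed
    qed
    then show ?case unfolding c prod.case .
  qed
  obtain lam rho where col: "colouring E z lam rho"
    using pl cyc unfolding planar_def w_def by blast
  let ?i = "inside lam rho"
  have step: "(?i (Suc m) = ?i m) = (m \<noteq> k \<and> m \<noteq> k')" "m \<noteq> k \<and> m \<noteq> k' \<Longrightarrow> lam (inner m) = ?i m"
    if m: "m \<in> {a<..<b}" for m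
  proof -
    have "z (inner m) = (m = k \<or> m = k')" using Cin[OF m] ends_gt(1)[OF m] kk unfolding z_def by auto
    then have "(lam (inner m) = rho (inner m)) = (m \<noteq> k \<and> m \<noteq> k')"
      using col_z[OF col ends_gt(3)[OF m]] by auto
    then show "(?i (Suc m) = ?i m) = (m \<noteq> k \<and> m \<noteq> k')" "m \<noteq> k \<and> m \<noteq> k' \<Longrightarrow> lam (inner m) = ?i m"
      using inner_sides(1)[OF col m] by auto
  qed
  have ic: "?i (Suc a + n) = (?i (Suc a) \<noteq> (k < Suc a + n \<and> Suc a + n \<le> k'))" if "Suc a + n \<le> b" for n
    using that
  proof (induction n)
    case 0
    then show ?case using k by auto
  next
    case (Suc n)
    then have m: "Suc a + n \<in> {a<..<b}" by auto
    show ?case using step(1)[OF m] Suc k(3) by auto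
  qed
  have i: "?i v = (?i (Suc a) \<noteq> (k < v \<and> v \<le> k'))" if "a < v" "v \<le> b" for v
    using ic[of "v - Suc a"] that by simp
  have nC: "\<not> C (inner r)" using Cin[OF r(1)] r by simp
  \<comment> \<open>On the arc itself, where \<open>C\<close> holds, \<open>z\<close> is true and
    the colour need not be constant. The invariant therefore masks the colour there and records
    \<open>C\<close> separately.\<close>
  have "(C (inner r), \<not> C (inner r) \<and> lam (inner r)) = (C (inner r'), \<not> C (inner r') \<and> lam (inner r'))"
  proof (rule conn_invariant[OF r(6), of "\<lambda>v. (C v, \<not> C v \<and> lam v)"])
    fix u v assume uv: "(u, v) \<in> R"
    show "(C u, \<not> C u \<and> lam u) = (C v, \<not> C v \<and> lam v)"
    proof (cases "C u")
      case False
      then have "\<not> z u" "\<not> z v" using Cv[OF uv] R_avoids[OF uv] kk unfolding z_def by auto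
      then have "lam u = lam v"
        using joined_side[OF col uv[unfolded R_def]] st by blast
      then show ?thesis using Cv[OF uv] by simp
    qed (use Cv[OF uv] in simp)
  qed
  then have eq: "lam (inner r) = lam (inner r')" "\<not> C (inner r')" using nC by auto
  then have r'k: "r' \<noteq> k" "r' \<noteq> k'" using Cin[OF r(2)] by auto
  have "?i r = ?i r'" using eq(1) step(2)[OF r(1)] step(2)[OF r(2)] r r'k by simp
  then have "(k < r \<and> r \<le> k') = (k < r' \<and> r' \<le> k')" using i[of r] i[of r'] r by auto
  then show ?thesis using r(3,4) r'k by auto
qed

end

end

section \<open>Removing the first loop\<close>

definition erase :: "nat set \<Rightarrow> (nat \<Rightarrow> smoothing) \<Rightarrow> nat \<Rightarrow> smoothing" where
  "erase S st x = (if x \<in> S then Erased else st x)"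

lemma erase_erase: "erase S (erase T st) = erase (S \<union> T) st"
  by (auto simp: erase_def)

lemma ssum_erase:
  assumes "set xs \<inter> S = {}"
  shows "ssum a b (\<lambda>st. G (erase S st)) xs st = ssum a b G xs (erase S st)"
  using assms
proof (induction xs arbitrary: st)
  case (Cons x xs)
  have "erase S (st(x := s)) = (erase S st)(x := s)" for s
    using Cons.prems by (auto simp: erase_def)
  then show ?case using Cons by simp
qed simp

context first_loop
begin

lemma occurs_loop:
  assumes "k \<in> {a<..<b}"
  shows "occurs w (w ! k) k (other k)"
  by (rule dow_occursI[OF dow_w]) (use other_gt[OF assms] assms ab in auto)

text \<open>The second move inside a fixed state: when everything between \<open>k\<close> and
  \<open>k'\<close> is erased, the loop piece from \<open>k\<close> to \<open>k'\<close> and the arc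
  joining the two inner ends bound a bigon. The weight \<open>c\<close> belongs to the smoothing
  that joins the arriving loop strand to the outer end.\<close>

lemma pair_removal:
  fixes st st' :: "nat \<Rightarrow> smoothing" and wO wU :: "nat \<Rightarrow> real" and c p d :: real
  assumes pl: "planar E" and st: "\<forall>y\<in>set w - V. st y \<noteq> Erased"
    and agree: "\<And>y. y \<in> set w \<Longrightarrow> y \<notin> V \<Longrightarrow> st' y = st y"
    and k: "k \<in> {a<..<b}" "k' \<in> {a<..<b}" "k < k'" "conn (R st) (inner k) (inner k')"
    and between: "\<And>j. k < j \<Longrightarrow> j < k' \<Longrightarrow> st' (w ! j) = Erased"
    and wt: "\<And>k. k \<in> {a<..<b} \<Longrightarrow> (if snd (E ! k) = snd (E ! a) then wO (w ! k) else wU (w ! k)) = c"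
      "\<And>k. k \<in> {a<..<b} \<Longrightarrow> (if snd (E ! k) = snd (E ! a) then wU (w ! k) else wO (w ! k)) = p"
    and cp: "c * p = 1" and d: "d = - c\<^sup>2 - p\<^sup>2"
  shows "ssum wO wU (\<lambda>st. d ^ circ w st) [w ! k, w ! k'] st' = d ^ circ w (erase {w ! k, w ! k'} st')"
proof -
  let ?y = "w ! k" and ?y' = "w ! k'" and ?X = "{..length w}"
  note R_eq = R_def[where st = st, OF pl st]
  have kb: "a < k" "k < b" "a < k'" "k' < b" using k by auto
  have ne: "?y \<noteq> ?y'" using inj_loop[of k k'] k by auto
  define Q where "Q = joined (set w - {?y, ?y'}) w st'"
  define C where "C v = conn (R st) (inner k) v" for v
  have Cv: "C u = C v" if "(u, v) \<in> R st" for u v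
    using conn_base[OF that] conn_sym conn_trans unfolding C_def by metis
  have Cin: "C (inner m) = (m = k \<or> m = k')" if "m \<in> {a<..<b}" for m
    using mate_unique[where st = st, OF pl st k(1)] k that unfolding C_def by (metis conn_refl less_irrefl)
  note sep = inner_separated[where st = st, OF pl st k(1), folded C_def]
  have V_nodes: "\<not> C i \<and> \<not> C (Suc i)" if i: "i < length E" "w ! i \<in> V" "w ! i \<noteq> ?y" "w ! i \<noteq> ?y'" for i
  proof -
    from in_V[OF i(1)] i(2) consider "i \<in> {a..b}" | m where "m \<in> {a<..<b}" "i = other m" by auto
    then show ?thesis
    proof cases
      case 1
      have "i = a \<or> a < i" "i = b \<or> Suc i \<le> b" using 1 by auto
      then show ?thesis using sep(1,2,4) 1 by auto
    next
      case 2
      then have "w ! i = w ! m" using other_gt(3) by simp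
      then have "m \<noteq> k" "m \<noteq> k'" using i by auto
      then have "\<not> C (inner m)" "\<not> C (outer m)" using Cin[OF 2(1)] sep(3)[OF 2(1)] by auto
      then show ?thesis using inner_outer[of m] 2(2) by (metis insertI1 insert_iff singletonD)
    qed
  qed
  have Q_cases: "(u, v) \<in> R st \<or> (\<exists>i j. (i, j) \<in> chords w \<and> w ! i \<in> V \<and> w ! i \<noteq> ?y \<and> w ! i \<noteq> ?y' \<and> (u, v) \<in> joins i j (st' (w ! i)))"
    if "(u, v) \<in> Q" for u v
  proof -
    from that consider "u = 0" "v = length w" | i j where "(i, j) \<in> chords w" "w ! i \<in> set w - {?y, ?y'}" "(u, v) \<in> joins i j (st' (w ! i))"
      unfolding Q_def joined_iff by blast
    then show ?thesis
    proof cases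
      case 1
      have "(0, length w) \<in> R st" unfolding R_eq joined_iff by blast
      then show ?thesis using 1 by simp
    next
      case 2
      show ?thesis
      proof (cases "w ! i \<in> V")
        case False
        then have "(u, v) \<in> R st" using 2 agree[of "w ! i"] unfolding R_eq joined_iff by auto
        then show ?thesis ..
      qed (use 2 in blast)
    qed
  qed
  have CQ: "C u = C v" if "(u, v) \<in> Q" for u v
    using Q_cases[OF that]
  proof (elim disjE exE conjE)
    fix i j assume h: "(i, j) \<in> chords w" "w ! i \<in> V" "w ! i \<noteq> ?y" "w ! i \<noteq> ?y'" "(u, v) \<in> joins i j (st' (w ! i))"
    have ij: "i < length E" "j < length E" "w ! j = w ! i" using h(1) by (auto simp: chords_def)
    have "\<not> C i \<and> \<not> C (Suc i) \<and> \<not> C j \<and> \<not> C (Suc j)"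
      using V_nodes[OF ij(1) h(2-4)] V_nodes[OF ij(2)] h(2-4) ij(3) by simp
    then show "C u = C v" using h(5) by (cases "st' (w ! i)") auto
  qed (rule Cv)
  \<comment> \<open>\<open>B\<close> marks the loop piece of the bigon as \<open>C\<close> marks its
    arc. Both are invariant under the remaining joins \<open>Q\<close>, so each separates its piece
    from everything else.\<close>
  define B where "B v = (k < v \<and> v \<le> k')" for v
  have B_pos: "if k < i \<and> i < k' then st' (w ! i) = Erased \<and> B i \<and> B (Suc i) else \<not> B i \<and> \<not> B (Suc i)"
    if i: "i < length E" "w ! i \<in> V" "w ! i \<noteq> ?y" "w ! i \<noteq> ?y'" for i
  proof -
    have "i \<noteq> k" "i \<noteq> k'" using i by auto
    then show ?thesis using between[of i] k(3) unfolding B_def by auto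
  qed
  have BQ: "B u = B v" if "(u, v) \<in> Q" for u v
    using Q_cases[OF that]
  proof (elim disjE exE conjE)
    assume "(u, v) \<in> R st"
    from R_avoids[where st = st, OF pl st this] show "B u = B v" using kb unfolding B_def by auto
  next
    fix i j assume h: "(i, j) \<in> chords w" "w ! i \<in> V" "w ! i \<noteq> ?y" "w ! i \<noteq> ?y'" "(u, v) \<in> joins i j (st' (w ! i))"
    have ij: "i < length E" "j < length E" "w ! j = w ! i" using h(1) by (auto simp: chords_def)
    note bi = B_pos[OF ij(1) h(2-4)] and bj = B_pos[OF ij(2), unfolded ij(3), OF h(2-4)]
    show "B u = B v"
    proof (cases "st' (w ! i)")
      case Erased
      then show ?thesis using h(5) bi bj by (auto split: if_splits)
    next
      case Oriented
      then have "\<not> B i" "\<not> B (Suc i)" "\<not> B j" "\<not> B (Suc j)" using bi bj by (simp_all split: if_splits)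
      then show ?thesis using h(5) Oriented by auto
    next
      case Unoriented
      then have "\<not> B i" "\<not> B (Suc i)" "\<not> B j" "\<not> B (Suc j)" using bi bj by (simp_all split: if_splits)
      then show ?thesis using h(5) Unoriented by auto
    qed
  qed
  have RQ: "R st \<subseteq> Q"
  proof clarify
    fix u v assume "(u, v) \<in> R st"
    then consider "u = 0" "v = length w" | i j where "(i, j) \<in> chords w" "w ! i \<in> set w - V" "(u, v) \<in> joins i j (st (w ! i))"
      unfolding R_eq joined_iff by blast
    then show "(u, v) \<in> Q"
    proof cases
      case 1
      then show ?thesis unfolding Q_def joined_iff by simp
    next
      case 2
      have "?y \<in> V" "?y' \<in> V" using kb unfolding V_def by auto
      then have "w ! i \<in> set w - {?y, ?y'}" "st' (w ! i) = st (w ! i)" using 2(2) agree by auto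
      then show ?thesis using 2 unfolding Q_def joined_iff by (intro disjI2 exI[of _ i] exI[of _ j]) simp
    qed
  qed
  have nn: "conn Q (inner k) (inner k')" using k(4) RQ by (rule conn_mono)
  have chain: "conn Q (Suc k) (Suc k + n)" if "Suc k + n \<le> k'" for n
    using that
  proof (induction n)
    case (Suc n)
    let ?j = "Suc k + n"
    have j: "k < ?j" "?j < k'" "?j < length E" "?j < b" using Suc.prems kb ab by auto
    have "w ! ?j \<noteq> ?y" "w ! ?j \<noteq> ?y'" using inj_loop[of ?j k] inj_loop[of ?j k'] j kb by auto
    then have "w ! ?j \<in> set w - {?y, ?y'}" using j by simp
    moreover have "(?j, Suc ?j) \<in> joins ?j (other ?j) (st' (w ! ?j))" using between[OF j(1,2)] by simp
    ultimately have "(?j, Suc ?j) \<in> Q" unfolding Q_def joined_iff using other_chord[OF j(3)] by blast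
    then have "conn Q ?j (Suc ?j)" by (rule conn_base)
    then show ?case using conn_trans[OF Suc.IH] Suc.prems by simp
  qed simp
  have ll: "conn Q (Suc k) k'" using chain[of "k' - Suc k"] k(3) by simp
  have C_sep: "\<not> conn Q (inner k) z" if "\<not> C z" for z
    using conn_invariant[of Q "inner k" z C, OF _ CQ] that by (auto simp: C_def)
  have B_sep: "\<not> conn Q (Suc k) z" if "\<not> B z" for z
    using conn_invariant[of Q "Suc k" z B, OF _ BQ] that k(3) by (auto simp: B_def)
  have n: "\<not> conn Q (inner k) z" if "z \<in> {k, Suc k', outer k, outer k', Suc k}" for z
    by (rule C_sep) (use that sep(3)[OF k(1)] sep(3)[OF k(2)] sep(4)[of k] sep(4)[of "Suc k'"] sep(4)[of "Suc k"] kb in auto)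
  have l: "\<not> conn Q (Suc k) z" if "z \<in> {k, Suc k', outer k, outer k'}" for z
    by (rule B_sep) (use that ends_gt(2)[OF k(1)] ends_gt(2)[OF k(2)] kb in \<open>auto simp: B_def\<close>)
  have X: "{k, Suc k, k', Suc k', outer k, inner k, inner k', outer k'} \<subseteq> ?X"
    using ends_gt[OF k(1)] ends_gt[OF k(2)] kb ab by simp
  note big = num_classes_bigon[of ?X k "Suc k" k' "Suc k'" "outer k" "inner k" "inner k'" "outer k'" Q, OF finite_atMost X nn ll]
  define N where "N s t = circ w (st'(?y := s, ?y' := t))" for s t
  have N: "N s t = num_classes ?X (joins k (other k) s \<union> (joins k' (other k') t \<union> Q))" for s t
    unfolding N_def Q_def by (rule circ_remove2[OF occurs_loop[OF k(1)] occurs_loop[OF k(2)] ne])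
  define al where "al k = (if snd (E ! k) = snd (E ! a) then Oriented else Unoriented)" for k
  define be where "be k = (if snd (E ! k) = snd (E ! a) then Unoriented else Oriented)" for k
  have ja: "joins k (other k) (al k) = {(k, outer k), (Suc k, inner k)}" "joins k (other k) (be k) = {(k, inner k), (Suc k, outer k)}" for k
    by (auto simp: al_def be_def inner_def outer_def)
  have "N (be k) (be k') = num_classes ?X ({(k, inner k), (Suc k, outer k), (k', inner k'), (Suc k', outer k')} \<union> Q)"
    "N (al k) (al k') = num_classes ?X ({(k, outer k), (Suc k, inner k), (k', outer k'), (Suc k', inner k')} \<union> Q)"
    "N (al k) (be k') = num_classes ?X ({(k, outer k), (Suc k, inner k), (k', inner k'), (Suc k', outer k')} \<union> Q)"
    "N (be k) (al k') = num_classes ?X ({(k, inner k), (Suc k, outer k), (k', outer k'), (Suc k', inner k')} \<union> Q)"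
    unfolding N ja by (simp_all add: insert_commute)
  moreover have "N Erased Erased = num_classes ?X ({(k, Suc k), (k', Suc k'), (inner k, outer k), (inner k', outer k')} \<union> Q)"
    unfolding N by (rule num_classes_symmetric) (auto simp: inner_def outer_def)
  ultimately have Ns: "N (be k) (be k') = N (al k) (al k')" "N (al k) (be k') = Suc (N (al k) (al k'))" "N (be k) (al k') = N Erased Erased"
    using big(1)[OF n l] big(2)[OF n l] big(3)[OF n l] by simp_all
  have sum: "wO (w ! k) * F Oriented + wU (w ! k) * F Unoriented = c * F (al k) + p * F (be k)" if "k \<in> {a<..<b}" for F :: "smoothing \<Rightarrow> real" and k
    using wt(1)[OF that] wt(2)[OF that] unfolding al_def be_def by (auto split: if_splits)
  have "ssum wO wU (\<lambda>st. d ^ circ w st) [?y, ?y'] st' =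
      wO ?y * (wO ?y' * d ^ N Oriented Oriented + wU ?y' * d ^ N Oriented Unoriented) +
      wU ?y * (wO ?y' * d ^ N Unoriented Oriented + wU ?y' * d ^ N Unoriented Unoriented)"
    by (simp add: N_def)
  also have "\<dots> = c * (c * d ^ N (al k) (al k') + p * d ^ N (al k) (be k')) + p * (c * d ^ N (be k) (al k') + p * d ^ N (be k) (be k'))"
    using sum[OF k(1), of "\<lambda>s. wO ?y' * d ^ N s Oriented + wU ?y' * d ^ N s Unoriented"]
      sum[OF k(2), of "\<lambda>t. d ^ N (al k) t"] sum[OF k(2), of "\<lambda>t. d ^ N (be k) t"] by simp
  also have "\<dots> = (c\<^sup>2 + p\<^sup>2 + (c * p) * d) * d ^ N (al k) (al k') + (c * p) * d ^ N Erased Erased"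
    unfolding Ns by (simp add: algebra_simps power2_eq_square)
  also have "\<dots> = d ^ N Erased Erased" unfolding cp d by simp
  also have "N Erased Erased = circ w (erase {?y, ?y'} st')"
    unfolding N_def by (rule circ_cong) (auto simp: erase_def)
  finally show ?thesis .
qed

text \<open>Induction on intervals closed under mates. The mate \<open>k\<close> of the leftmost
  crossing \<open>i\<close> cuts the interval into the part between \<open>i\<close> and
  \<open>k\<close> and the part behind \<open>k\<close>, and nestedness makes both closed
  again.\<close>

lemma interval_removal:
  fixes st st' :: "nat \<Rightarrow> smoothing" and wO wU :: "nat \<Rightarrow> real" and c p d :: real
  assumes pl: "planar E" and st: "\<forall>y\<in>set w - V. st y \<noteq> Erased"
    and wt: "\<And>k. k \<in> {a<..<b} \<Longrightarrow> (if snd (E ! k) = snd (E ! a) then wO (w ! k) else wU (w ! k)) = c"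
      "\<And>k. k \<in> {a<..<b} \<Longrightarrow> (if snd (E ! k) = snd (E ! a) then wU (w ! k) else wO (w ! k)) = p"
    and cp: "c * p = 1" and d: "d = - c\<^sup>2 - p\<^sup>2"
    and "a < i" "i \<le> j" "j \<le> b"
    and "\<And>r r'. i \<le> r \<Longrightarrow> r < j \<Longrightarrow> r' \<in> {a<..<b} \<Longrightarrow> r' \<noteq> r \<Longrightarrow> conn (R st) (inner r) (inner r') \<Longrightarrow> i \<le> r' \<and> r' < j"
    and "\<And>y. y \<in> set w \<Longrightarrow> y \<notin> V \<Longrightarrow> st' y = st y"
  shows "ssum wO wU (\<lambda>st. d ^ circ w st) (map ((!) w) [i..<j]) st' = d ^ circ w (erase ((!) w ` {i..<j}) st')"
  using assms(7-11)
proof (induction "j - i" arbitrary: i j st' rule: less_induct)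
  case less
  let ?G = "\<lambda>st. d ^ circ w st"
  show ?case
  proof (cases "i = j")
    case True
    then have "erase ((!) w ` {i..<j}) st' = st'" by (auto simp: erase_def)
    then show ?thesis using True by simp
  next
    case False
    then have ij: "i < j" "i \<in> {a<..<b}" using less.prems by auto
    obtain k where k: "k \<in> {a<..<b}" "k \<noteq> i" "conn (R st) (inner i) (inner k)"
      using mate_unique[where st = st, OF pl st ij(2)] by blast
    have ik: "i < k" "k < j" using less.prems(4)[of i k] k ij by auto
    have mate_i: "r' = k" if "r' \<in> {a<..<b}" "r' \<noteq> i" "conn (R st) (inner i) (inner r')" for r'
      using mate_unique[where st = st, OF pl st ij(2)] k that by blast
    have mate_k: "r' = i" if "r' \<in> {a<..<b}" "r' \<noteq> k" "conn (R st) (inner k) (inner r')" for r'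
      using mate_unique[where st = st, OF pl st k(1)] k(2) conn_sym[OF k(3)] ij(2) that by blast
    have sub: "(i < r \<and> r < k) = (i < r' \<and> r' < k)" "r' \<noteq> i" "r' \<noteq> k"
      if "r \<in> {a<..<b}" "r \<noteq> i" "r \<noteq> k" "r' \<in> {a<..<b}" "r' \<noteq> r" "conn (R st) (inner r) (inner r')" for r r'
    proof -
      show "(i < r \<and> r < k) = (i < r' \<and> r' < k)"
        by (rule mates_nested[where st = st, OF pl st ij(2) k(1) ik(1) k(3) that(1,4,2,3)]) (use that in auto)
      show "r' \<noteq> i"
      proof
        assume "r' = i"
        then have "conn (R st) (inner i) (inner r)" using conn_sym[OF that(6)] by simp
        then show False using mate_i[OF that(1,2)] that(3) by simp
      qed
      show "r' \<noteq> k"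
      proof
        assume "r' = k"
        then have "conn (R st) (inner k) (inner r)" using conn_sym[OF that(6)] by simp
        then show False using mate_k[OF that(1,3)] that(2) by simp
      qed
    qed
    have IH1: "ssum wO wU ?G (map ((!) w) [Suc i..<k]) s = ?G (erase ((!) w ` {Suc i..<k}) s)"
      if "\<And>y. y \<in> set w \<Longrightarrow> y \<notin> V \<Longrightarrow> s y = st y" for s
    proof (rule less.hyps)
      show "k - Suc i < j - i" using ik by simp
      show "a < Suc i" "Suc i \<le> k" "k \<le> b" using less.prems ik by auto
      fix r r' assume r: "Suc i \<le> r" "r < k" "r' \<in> {a<..<b}" "r' \<noteq> r" "conn (R st) (inner r) (inner r')"
      then have "r \<in> {a<..<b}" using less.prems ik by auto
      from sub(1)[OF this _ _ r(3-5)] r(1,2) show "Suc i \<le> r' \<and> r' < k" by auto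
    qed (rule that)
    have IH2: "ssum wO wU ?G (map ((!) w) [Suc k..<j]) s = ?G (erase ((!) w ` {Suc k..<j}) s)"
      if "\<And>y. y \<in> set w \<Longrightarrow> y \<notin> V \<Longrightarrow> s y = st y" for s
    proof (rule less.hyps)
      show "j - Suc k < j - i" using ik by simp
      show "a < Suc k" "Suc k \<le> j" "j \<le> b" using less.prems ik by auto
      fix r r' assume r: "Suc k \<le> r" "r < j" "r' \<in> {a<..<b}" "r' \<noteq> r" "conn (R st) (inner r) (inner r')"
      have rK: "r \<in> {a<..<b}" using r less.prems ik by auto
      have "i \<le> r' \<and> r' < j" using less.prems(4)[of r r'] r ik by auto
      moreover have "\<not> (i < r' \<and> r' < k)" "r' \<noteq> i" "r' \<noteq> k" using sub[OF rK _ _ r(3-5)] r(1) ik by auto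
      ultimately show "Suc k \<le> r' \<and> r' < j" by auto
    qed (rule that)
    have inj: "inj_on ((!) w) {i..<j}"
      by (rule inj_onI) (use inj_loop less.prems in auto)
    let ?I1 = "(!) w ` {Suc i..<k}" and ?I2 = "(!) w ` {Suc k..<j}" and ?P = "{w ! i, w ! k}"
    have range: "{i..<j} = {Suc i..<k} \<union> ({i, k} \<union> {Suc k..<j})" using ik by auto
    have subV: "(!) w ` {i..<j} \<subseteq> V" using less.prems unfolding V_def by auto
    \<comment> \<open>In this order the crossings between \<open>i\<close> and \<open>k\<close> are
      innermost, so they are already erased when the pair \<open>i\<close>, \<open>k\<close> is
      treated.\<close>
    have "ssum wO wU ?G (map ((!) w) [i..<j]) st' = ssum wO wU ?G (map ((!) w) [Suc k..<j] @ ([w ! i, w ! k] @ map ((!) w) [Suc i..<k])) st'"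
    proof (rule ssum_perm)
      show "distinct (map ((!) w) [i..<j])" using inj by (simp add: distinct_map)
      have "distinct (map ((!) w) ([Suc k..<j] @ [i, k] @ [Suc i..<k]))"
        unfolding distinct_map by (intro conjI inj_on_subset[OF inj]) (use ik in auto)
      then show "distinct (map ((!) w) [Suc k..<j] @ ([w ! i, w ! k] @ map ((!) w) [Suc i..<k]))" by simp
      show "set (map ((!) w) [i..<j]) = set (map ((!) w) [Suc k..<j] @ ([w ! i, w ! k] @ map ((!) w) [Suc i..<k]))"
        using range by auto
    qed
    also have "\<dots> = ssum wO wU (\<lambda>s. ssum wO wU ?G ([w ! i, w ! k] @ map ((!) w) [Suc i..<k]) s) (map ((!) w) [Suc k..<j]) st'"
      unfolding ssum_append ..
    also have "\<dots> = ssum wO wU (\<lambda>s. ?G (erase (?I1 \<union> ?P) s)) (map ((!) w) [Suc k..<j]) st'"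
    proof (rule ssum_cong)
      fix s assume s: "\<And>x. x \<notin> set (map ((!) w) [Suc k..<j]) \<Longrightarrow> s x = st' x"
      have s': "s y = st y" if "y \<in> set w" "y \<notin> V" for y
      proof -
        have "y \<notin> set (map ((!) w) [Suc k..<j])" using that(2) subV range by auto
        then show ?thesis using s less.prems(5)[OF that] by simp
      qed
      have "ssum wO wU ?G ([w ! i, w ! k] @ map ((!) w) [Suc i..<k]) s = ssum wO wU (\<lambda>s. ?G (erase ?I1 s)) [w ! i, w ! k] s"
        unfolding ssum_append
      proof (rule ssum_cong)
        fix s'' assume s'': "\<And>x. x \<notin> set [w ! i, w ! k] \<Longrightarrow> s'' x = s x"
        show "ssum wO wU ?G (map ((!) w) [Suc i..<k]) s'' = ?G (erase ?I1 s'')"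
        proof (rule IH1)
          fix y assume y: "y \<in> set w" "y \<notin> V"
          then have "y \<notin> set [w ! i, w ! k]" using subV range by auto
          then show "s'' y = st y" using s'' s'[OF y] by simp
        qed
      qed auto
      also have "\<dots> = ssum wO wU ?G [w ! i, w ! k] (erase ?I1 s)"
      proof (rule ssum_erase)
        have "w ! i \<notin> ?I1" "w ! k \<notin> ?I1" using inj_onD[OF inj] ik by fastforce+
        then show "set [w ! i, w ! k] \<inter> ?I1 = {}" by simp
      qed
      also have "\<dots> = ?G (erase {w ! i, w ! k} (erase ?I1 s))"
      proof (rule pair_removal[where st = st, OF pl st _ ij(2) k(1) ik(1) k(3) _ wt cp d])
        fix y assume y: "y \<in> set w" "y \<notin> V"
        then have "y \<notin> ?I1" using subV range by auto
        then show "erase ?I1 s y = st y" using s'[OF y] by (simp add: erase_def)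
      next
        fix m assume "i < m" "m < k"
        then show "erase ?I1 s (w ! m) = Erased" by (auto simp: erase_def)
      qed
      finally show "ssum wO wU ?G ([w ! i, w ! k] @ map ((!) w) [Suc i..<k]) s = ?G (erase (?I1 \<union> ?P) s)"
        by (simp add: erase_erase Un_commute)
    qed auto
    also have "\<dots> = ssum wO wU ?G (map ((!) w) [Suc k..<j]) (erase (?I1 \<union> ?P) st')"
    proof (rule ssum_erase)
      have "{Suc k..<j} \<inter> ({Suc i..<k} \<union> {i, k}) = {}" using ik by auto
      then have "(!) w ` {Suc k..<j} \<inter> (!) w ` ({Suc i..<k} \<union> {i, k}) = {}"
        using inj_on_image_Int[OF inj, of "{Suc k..<j}" "{Suc i..<k} \<union> {i, k}"] ik by auto
      then show "set (map ((!) w) [Suc k..<j]) \<inter> (?I1 \<union> ?P) = {}" by (simp add: image_Un)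
    qed
    also have "\<dots> = ?G (erase ?I2 (erase (?I1 \<union> ?P) st'))"
    proof (rule IH2)
      fix y assume y: "y \<in> set w" "y \<notin> V"
      then have "y \<notin> ?I1 \<union> ?P" using subV range by auto
      then show "erase (?I1 \<union> ?P) st' y = st y" using less.prems(5)[OF y] by (simp add: erase_def)
    qed
    also have "erase ?I2 (erase (?I1 \<union> ?P) st') = erase ((!) w ` {i..<j}) st'"
      unfolding erase_erase range by (simp add: image_Un Un_ac)
    finally show ?thesis .
  qed
qed

text \<open>The sign hypothesis says that the loop runs over every strand it meets. Once the
  interior crossings are erased, the loop is a kink at \<open>a\<close>, with the factor
  \<open>c * d + p\<close>.\<close>

lemma loop_removal:
  fixes s :: "nat \<Rightarrow> int" and A :: real
  assumes pl: "planar E" and A: "A > 0"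
    and s: "\<And>k. k \<in> {a..<b} \<Longrightarrow> s (w ! k) = (if snd (E ! k) then 1 else -1)"
  defines "d \<equiv> - (A powi 2) - A powi (-2)"
  shows "bracket (\<lambda>x. A powi s x) (\<lambda>x. A powi (- s x)) d w =
    - (A powi (3 * s (w ! a))) * bracket (\<lambda>x. A powi s x) (\<lambda>x. A powi (- s x)) d (filter (\<lambda>x. x \<notin> V) w)"
proof -
  let ?wO = "\<lambda>x. A powi s x" and ?wU = "\<lambda>x. A powi (- s x)" and ?x = "w ! a"
  let ?L = "map ((!) w) [Suc a..<b]"
  define c where "c = A powi s ?x"
  define p where "p = A powi (- s ?x)"
  have sa: "s ?x = (if snd (E ! a) then 1 else -1)" using s[of a] ab by simp
  have cp: "c * p = 1" unfolding c_def p_def using A by (simp add: power_int_minus)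
  have d: "d = - c\<^sup>2 - p\<^sup>2"
    unfolding d_def c_def p_def sa using A by (simp add: power_int_minus power_inverse)
  have wt: "(if snd (E ! k) = snd (E ! a) then ?wO (w ! k) else ?wU (w ! k)) = c"
    "(if snd (E ! k) = snd (E ! a) then ?wU (w ! k) else ?wO (w ! k)) = p" if "k \<in> {a<..<b}" for k
    using s[of k] that unfolding c_def p_def sa by auto
  have set_V: "set (?x # ?L) = V"
  proof -
    have "{a..<b} = insert a {Suc a..<b}" using ab by auto
    then show ?thesis unfolding V_def by simp
  qed
  have inj: "inj_on ((!) w) {a..<b}" by (rule inj_onI) (use inj_loop in auto)
  have dV: "distinct (?x # ?L)"
  proof -
    have "distinct (map ((!) w) (a # [Suc a..<b]))"
      unfolding distinct_map by (intro conjI inj_on_subset[OF inj]) (use ab in auto)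
    then show ?thesis by simp
  qed
  have kink: "c * d + p = - (A powi (3 * s ?x))"
    unfolding c_def p_def d_def sa using A by (auto simp: power_int_minus field_simps power2_eq_square power3_eq_cube)
  have "bracket ?wO ?wU d w = (c * d + p) * bracket ?wO ?wU d (filter (\<lambda>x. x \<notin> set (?x # ?L)) w)"
  proof (rule bracket_reduce[OF dow_w dV])
    show "set (?x # ?L) \<subseteq> set w" unfolding set_V by (rule V_subset)
    fix st :: "nat \<Rightarrow> smoothing"
    assume st0: "\<And>y. y \<in> set w \<Longrightarrow> y \<notin> set (?x # ?L) \<Longrightarrow> st y \<noteq> Erased"
    have st: "\<forall>y\<in>set w - V. st y \<noteq> Erased" using st0 set_V by auto
    let ?K = "(!) w ` {Suc a..<b}"
    have xK: "?x \<notin> ?K" using inj_onD[OF inj, of a] ab by fastforce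
    have xV: "?x \<in> V" using ab unfolding V_def by auto
    have inner_sum: "ssum ?wO ?wU (\<lambda>st. d ^ circ w st) ?L st' = d ^ circ w (erase ?K st')"
      if "\<And>y. y \<in> set w \<Longrightarrow> y \<notin> V \<Longrightarrow> st' y = st y" for st'
      by (rule interval_removal[where st = st, OF pl st wt cp d]) (use ab that in auto)
    define st1 where "st1 = erase ?K st"
    define Q where "Q = joined (set w - {?x}) w st1"
    have oc: "occurs w ?x a b" by (rule dow_occursI[OF dow_w]) (use ab same in auto)
    have N: "circ w (st1(?x := t)) = num_classes {..length w} (joins a b t \<union> Q)" for t
    proof -
      have "joined (set w - {?x}) w (st1(?x := t)) = Q" unfolding Q_def by (rule joined_cong) auto
      then show ?thesis using circ_remove[OF oc, of "st1(?x := t)"] by simp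
    qed
    define B where "B v = (a < v \<and> v \<le> b)" for v
    have pos: "if a < i \<and> i < b then st1 (w ! i) = Erased \<and> B i \<and> B (Suc i) else \<not> B i \<and> \<not> B (Suc i)"
      if i: "i < length E" "w ! i \<noteq> ?x" for i
    proof -
      have "i \<noteq> a" "i \<noteq> b" using i same by auto
      moreover have "st1 (w ! i) = Erased" if "a < i" "i < b" using that by (auto simp: st1_def erase_def)
      ultimately show ?thesis unfolding B_def by auto
    qed
    have BQ: "B u = B v" if "(u, v) \<in> Q" for u v
    proof -
      from that consider "u = 0" "v = length w" | i j where "(i, j) \<in> chords w" "w ! i \<in> set w - {?x}" "(u, v) \<in> joins i j (st1 (w ! i))"
        unfolding Q_def joined_iff by blast
      then show ?thesis
      proof cases
        case 1
        then show ?thesis using ab by (simp add: B_def)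
      next
        case 2
        have ij: "i < length E" "j < length E" "w ! j = w ! i" using 2(1) by (auto simp: chords_def)
        note bi = pos[OF ij(1)] and bj = pos[OF ij(2)]
        show ?thesis
        proof (cases "st1 (w ! i)")
          case Erased
          then show ?thesis using 2 bi bj ij(3) by (auto split: if_splits)
        next
          case Oriented
          then have "\<not> B i" "\<not> B (Suc i)" "\<not> B j" "\<not> B (Suc j)" using bi bj ij(3) 2(2) by (simp_all split: if_splits)
          then show ?thesis using 2(3) Oriented by auto
        next
          case Unoriented
          then have "\<not> B i" "\<not> B (Suc i)" "\<not> B j" "\<not> B (Suc j)" using bi bj ij(3) 2(2) by (simp_all split: if_splits)
          then show ?thesis using 2(3) Unoriented by auto
        qed
      qed
    qed
    have chain: "conn Q (Suc a) (Suc a + n)" if "Suc a + n \<le> b" for n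
      using that
    proof (induction n)
      case (Suc n)
      let ?j = "Suc a + n"
      have j: "a < ?j" "?j < b" "?j < length E" using Suc.prems ab by auto
      have "w ! ?j \<noteq> ?x" using inj_loop[of ?j a] j by auto
      moreover have "(?j, Suc ?j) \<in> joins ?j (other ?j) (st1 (w ! ?j))" using j by (auto simp: st1_def erase_def)
      ultimately have "(?j, Suc ?j) \<in> Q" unfolding Q_def joined_iff using other_chord[OF j(3)] j(3)
        by (intro disjI2 exI[of _ ?j] exI[of _ "other ?j"]) simp
      then have "conn Q ?j (Suc ?j)" by (rule conn_base)
      then show ?case using conn_trans[OF Suc.IH] Suc.prems by simp
    qed simp
    have ll: "conn Q (Suc a) b" using chain[of "b - Suc a"] ab by simp
    have sep: "\<not> conn Q b z" if "\<not> B z" for z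
      using conn_invariant[of Q b z B, OF _ BQ] that ab by (auto simp: B_def)
    obtain k :: "nat \<Rightarrow> nat" where k: "\<And>u v. conn Q u v \<longleftrightarrow> k u = k v"
      using conn_representative[of Q] by blast
    have kk: "k (Suc a) = k b" "k b \<noteq> k a" "k b \<noteq> k (Suc b)"
      using ll sep[of a] sep[of "Suc b"] unfolding k by (auto simp: B_def)
    have ins: "int (num_classes {..length w} (insert (u, v) Z)) = int (num_classes {..length w} Z) - (if conn Z u v then 0 else 1)"
      if "u \<le> length w" "v \<le> length w" for u v Z
      using num_classes_insert[of "{..length w}" u v Z] that by auto
    have le: "a \<le> length w" "Suc a \<le> length w" "b \<le> length w" "Suc b \<le> length w" using ab by auto
    have "int (circ w (st1(?x := Oriented))) = int (circ w (st1(?x := Erased))) + 1"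
      "int (circ w (st1(?x := Unoriented))) = int (circ w (st1(?x := Erased)))"
      unfolding N joins.simps Un_insert_left Un_empty_left ins[OF le(1,4)] ins[OF le(2,3)] ins[OF le(1,2)] ins[OF le(3,4)] ins[OF le(1,3)] ins[OF le(2,4)] conn_insert k
      using kk by (auto split: if_splits)
    then have n: "circ w (st1(?x := Oriented)) = Suc (circ w (st1(?x := Erased)))"
      "circ w (st1(?x := Unoriented)) = circ w (st1(?x := Erased))" by linarith+
    have upd: "erase ?K (st(?x := t)) = st1(?x := t)" for t
      using xK by (auto simp: st1_def erase_def)
    have fin: "(\<lambda>y. if y \<in> set (?x # ?L) then Erased else st y) = st1(?x := Erased)"
      by (auto simp: st1_def erase_def)
    have "ssum ?wO ?wU (\<lambda>st. d ^ circ w st) (?x # ?L) st =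
        c * d ^ circ w (st1(?x := Oriented)) + p * d ^ circ w (st1(?x := Unoriented))"
    proof -
      have ag: "(st(?x := t)) y = st y" if "y \<in> set w" "y \<notin> V" for t y using that xV by auto
      have "ssum ?wO ?wU (\<lambda>st. d ^ circ w st) ?L (st(?x := t)) = d ^ circ w (st1(?x := t))" for t
        using inner_sum[of "st(?x := t)", OF ag] unfolding upd .
      then show ?thesis by (simp add: c_def p_def)
    qed
    then show "ssum ?wO ?wU (\<lambda>st. d ^ circ w st) (?x # ?L) st =
        (c * d + p) * d ^ circ w (\<lambda>y. if y \<in> set (?x # ?L) then Erased else st y)"
      unfolding fin n by (simp add: algebra_simps)
  qed
  then show ?thesis unfolding kink set_V by simp
qed

end

section \<open>The diagram without the crossings of the loop\<close>

lemma filter_index: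
  fixes P :: "'a \<Rightarrow> bool" and xs :: "'a list"
  defines "f \<equiv> \<lambda>i. length (filter P (take i xs))"
  shows "i < length xs \<Longrightarrow> f (Suc i) = (if P (xs ! i) then Suc (f i) else f i)"
    and "i < length xs \<Longrightarrow> P (xs ! i) \<Longrightarrow> filter P xs ! f i = xs ! i \<and> f i < length (filter P xs)"
    and "j < length (filter P xs) \<Longrightarrow> \<exists>i < length xs. P (xs ! i) \<and> f i = j"
    and "i \<le> j \<Longrightarrow> f i \<le> f j"
    and "i < j \<Longrightarrow> i < length xs \<Longrightarrow> P (xs ! i) \<Longrightarrow> f i < f j"
proof -
  show f_Suc: "f (Suc i) = (if P (xs ! i) then Suc (f i) else f i)" if "i < length xs" for i
    using that by (simp add: f_def take_Suc_conv_app_nth)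
  show "filter P xs ! f i = xs ! i \<and> f i < length (filter P xs)" if "i < length xs" "P (xs ! i)" for i
  proof -
    have eq: "filter P xs = filter P (take i xs) @ xs ! i # filter P (drop (Suc i) xs)"
      using that by (subst id_take_nth_drop[of i xs]) auto
    show ?thesis by (simp add: eq f_def)
  qed
  have onto: "\<exists>i < n. P (xs ! i) \<and> f i = j" if "j < f n" "n \<le> length xs" for n
    using that
  proof (induction n)
    case 0
    then show ?case by (simp add: f_def)
  next
    case (Suc n)
    show ?case
    proof (cases "j < f n")
      case True
      then show ?thesis using Suc by (auto simp: less_Suc_eq)
    next
      case False
      then have "P (xs ! n) \<and> f n = j" using Suc.prems f_Suc[of n] by (auto split: if_splits)
      then show ?thesis by blast
    qed
  qed
  show "\<exists>i < length xs. P (xs ! i) \<and> f i = j" if "j < length (filter P xs)"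
    using onto[of "length xs"] that by (simp add: f_def)
  have step: "f i \<le> f (Suc i)" for i
    using f_Suc[of i] by (cases "i < length xs") (simp_all add: f_def)
  show mono: "f i \<le> f j" if "i \<le> j" for i j
    using step that by (rule lift_Suc_mono_le)
  show "f i < f j" if "i < j" "i < length xs" "P (xs ! i)" for i j
    using mono[of "Suc i" j] f_Suc[of i] that by simp
qed

lemma dow_filter: "dow w \<Longrightarrow> dow (filter P w)"
  unfolding dow_def count_list_eq_length_filter
proof
  fix x assume w: "\<forall>x\<in>set w. length (filter ((=) x) w) = 2" and x: "x \<in> set (filter P w)"
  then have "filter ((=) x) (filter P w) = filter ((=) x) w"
    unfolding filter_filter by (intro filter_cong) auto
  then show "length (filter ((=) x) (filter P w)) = 2" using w x by simp
qed

text \<open>The sign that turns the first passage into an overpass: in \<open>shadow\<close>, an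
  overpass has a true flag iff its crossing is positive.\<close>

definition desc_sign :: "shadow \<Rightarrow> nat \<Rightarrow> int" where
  "desc_sign E x = (if snd (E ! first_pos (map fst E) x) then 1 else -1)"

context first_loop
begin

definition rest :: shadow where
  "rest = filter (\<lambda>p. fst p \<notin> V) E"

definition idx :: "nat \<Rightarrow> nat" where
  "idx i = length (filter (\<lambda>p. fst p \<notin> V) (take i E))"

lemma nth_w: "i < length E \<Longrightarrow> fst (E ! i) = w ! i"
  by (simp add: w_def)

lemma idx_Suc: "i < length E \<Longrightarrow> idx (Suc i) = (if w ! i \<in> V then idx i else Suc (idx i))"
  using filter_index(1)[of i E "\<lambda>p. fst p \<notin> V"] nth_w unfolding idx_def by simp

lemma idx_0 [simp]: "idx 0 = 0"
  by (simp add: idx_def)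

lemma idx_length: "idx (length E) = length rest"
  by (simp add: idx_def rest_def)

lemma rest_nth: "i < length E \<Longrightarrow> w ! i \<notin> V \<Longrightarrow> rest ! idx i = E ! i \<and> idx i < length rest"
  using filter_index(2)[of i E "\<lambda>p. fst p \<notin> V"] nth_w unfolding idx_def rest_def by simp

lemma idx_onto:
  assumes "j < length rest"
  obtains i where "i < length E" "w ! i \<notin> V" "idx i = j"
  using filter_index(3)[of j "\<lambda>p. fst p \<notin> V" E] nth_w assms unfolding idx_def rest_def by auto

lemma idx_mono: "i \<le> j \<Longrightarrow> idx i \<le> idx j"
  unfolding idx_def by (rule filter_index(4))

lemma idx_less: "i < j \<Longrightarrow> i < length E \<Longrightarrow> w ! i \<notin> V \<Longrightarrow> idx i < idx j"
  using filter_index(5)[of i j E "\<lambda>p. fst p \<notin> V"] nth_w unfolding idx_def by simp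

lemma idx_fibre:
  assumes h: "\<And>i. i < length E \<Longrightarrow> w ! i \<in> V \<Longrightarrow> h (Suc i) = h i"
    and "i \<le> length E" "j \<le> length E" "idx i = idx j"
  shows "h i = h j"
proof -
  have le: "h i = h (i + n)" if "idx i = idx (i + n)" "i + n \<le> length E" for i n
    using that
  proof (induction n)
    case (Suc n)
    have "idx i \<le> idx (i + n)" "idx (i + n) \<le> idx (i + Suc n)" by (rule idx_mono; simp)+
    then have eq: "idx i = idx (i + n)" "idx (Suc (i + n)) = idx (i + n)" using Suc.prems(1) by simp_all
    have "w ! (i + n) \<in> V" using idx_Suc[of "i + n"] eq(2) Suc.prems(2) by (auto split: if_splits)
    then have "h (Suc (i + n)) = h (i + n)" using h Suc.prems(2) by simp
    then show ?case using Suc.IH[OF eq(1)] Suc.prems(2) by simp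
  qed simp
  show ?thesis
  proof (cases "i \<le> j")
    case True
    then have "i + (j - i) = j" by simp
    from le[of i "j - i", unfolded this] show ?thesis using assms(3,4) by blast
  next
    case False
    then have "j + (i - j) = i" by simp
    from le[of j "i - j", unfolded this] show ?thesis using assms(2) assms(4)[symmetric] by metis
  qed
qed

lemma map_fst_rest: "map fst rest = filter (\<lambda>x. x \<notin> V) w"
  unfolding rest_def w_def by (simp add: filter_map comp_def)

lemma idx_chord:
  assumes "(i, j) \<in> chords w" "w ! i \<notin> V"
  shows "(idx i, idx j) \<in> chords (map fst rest)"
proof -
  have ij: "i < length E" "j < length E" "i \<noteq> j" "w ! i = w ! j" using assms(1) by (auto simp: chords_def)
  have "w ! j \<notin> V" using ij assms(2) by simp
  note r = rest_nth[OF ij(1) assms(2)] rest_nth[OF ij(2) this]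
  have "idx i \<noteq> idx j"
    using idx_less[of i j] idx_less[of j i] ij assms(2) \<open>w ! j \<notin> V\<close> by (cases "i < j") auto
  then show ?thesis using r ij nth_w by (simp add: chords_def)
qed

lemma chord_rest:
  assumes "(i, j) \<in> chords (map fst rest)"
  obtains p q where "(p, q) \<in> chords w" "w ! p \<notin> V" "w ! q \<notin> V" "idx p = i" "idx q = j" "p < length E" "q < length E"
proof -
  have ij: "i < length rest" "j < length rest" "i \<noteq> j" "fst (rest ! i) = fst (rest ! j)"
    using assms by (auto simp: chords_def)
  obtain p where p: "p < length E" "w ! p \<notin> V" "idx p = i" by (rule idx_onto[OF ij(1)])
  obtain q where q: "q < length E" "w ! q \<notin> V" "idx q = j" by (rule idx_onto[OF ij(2)])
  have "w ! p = w ! q" using ij(4) rest_nth[OF p(1,2)] rest_nth[OF q(1,2)] p q nth_w by simp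
  then have "(p, q) \<in> chords w" using p q ij(3) by (auto simp: chords_def)
  then show ?thesis using that p q by blast
qed

lemma good_rest: "good_shadow rest"
  unfolding good_shadow_def
proof (intro conjI ballI)
  show "dow (map fst rest)" unfolding map_fst_rest by (rule dow_filter[OF dow_w])
  fix c assume c: "c \<in> chords (map fst rest)"
  obtain i j where ij: "c = (i, j)" by (cases c)
  obtain p q where pq: "(p, q) \<in> chords w" "w ! p \<notin> V" "w ! q \<notin> V" "idx p = i" "idx q = j" "p < length E" "q < length E"
    by (rule chord_rest[OF c[unfolded ij]])
  show "case c of (i, j) \<Rightarrow> snd (rest ! j) = (\<not> snd (rest ! i))"
    using chord_sides[OF pq(1)] rest_nth[OF pq(6,2)] rest_nth[OF pq(7,3)] pq(4,5) unfolding ij by simp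
qed

text \<open>
  The loop is not part of the lifted cycle, so a colouring does not change across the loop; hence it
  descends to the diagram without the crossings of the loop.
\<close>

lemma colouring_flat:
  assumes col: "colouring E z lam rho" and flat: "\<And>v. a < v \<Longrightarrow> v \<le> b \<Longrightarrow> \<not> z v"
    and i: "i < length E" "w ! i \<in> V"
  defines "h \<equiv> \<lambda>f v. if a < v \<and> v \<le> b then f a else f v"
  shows "h lam (Suc i) = h lam i" "h rho (Suc i) = h rho i"
proof -
  have zz: "lam v = rho v" if "a < v" "v \<le> b" for v
    using col_z[OF col, of v] flat[OF that] that ab by simp
  have br: "snd (E ! b) = (\<not> snd (E ! a))" by (rule chord_sides[OF chord_ab])
  have c1: "snd (E ! a) \<Longrightarrow> lam a = lam (Suc b) \<and> lam (Suc a) = rho (Suc b) \<and> rho a = lam b \<and> rho (Suc a) = rho b"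
    using col_corner[OF col chord_ab] by blast
  have c2: "\<not> snd (E ! a) \<Longrightarrow> lam b = lam (Suc a) \<and> lam (Suc b) = rho (Suc a) \<and> rho b = lam a \<and> rho (Suc b) = rho a"
    using col_corner[OF col chords_sym[OF chord_ab]] br by blast
  have zab: "lam (Suc a) = rho (Suc a)" "lam b = rho b" using zz[of "Suc a"] zz[of b] ab by simp_all
  have end_ab: "lam (Suc b) = lam a \<and> rho (Suc b) = rho a"
    using c1 c2 zab by (cases "snd (E ! a)") metis+
  have mid: "lam (Suc (other k)) = lam (other k) \<and> rho (Suc (other k)) = rho (other k)" if k: "k \<in> {a<..<b}" for k
  proof -
    have ch: "(k, other k) \<in> chords w" using other_chord k ab by simp
    note ch' = chords_sym[OF ch]
    have or: "snd (E ! other k) = (\<not> snd (E ! k))" by (rule chord_sides[OF ch])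
    have 1: "snd (E ! k) \<Longrightarrow> lam k = lam (Suc (other k)) \<and> lam (Suc k) = rho (Suc (other k)) \<and> rho k = lam (other k) \<and> rho (Suc k) = rho (other k)"
      using col_corner[OF col ch] by blast
    have 2: "\<not> snd (E ! k) \<Longrightarrow> lam (other k) = lam (Suc k) \<and> lam (Suc (other k)) = rho (Suc k) \<and> rho (other k) = lam k \<and> rho (Suc (other k)) = rho k"
      using col_corner[OF col ch'] or by blast
    have "lam k = rho k" "lam (Suc k) = rho (Suc k)" using zz[of k] zz[of "Suc k"] k by simp_all
    then show ?thesis using 1 2 by (cases "snd (E ! k)") metis+
  qed
  have "h lam (Suc i) = h lam i \<and> h rho (Suc i) = h rho i"
  proof (cases "i \<in> {a..b}")
    case True
    then show ?thesis using end_ab ab unfolding h_def by (cases "i = b") auto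
  next
    case False
    then obtain k where k: "k \<in> {a<..<b}" "i = other k" using in_V[OF i(1)] i(2) by auto
    then show ?thesis using mid[OF k(1)] other_gt(1)[OF k(1)] unfolding h_def by simp
  qed
  then show "h lam (Suc i) = h lam i" "h rho (Suc i) = h rho i" by blast+
qed

lemma planar_rest:
  assumes "planar E"
  shows "planar rest"
  unfolding planar_def
proof (intro allI impI)
  fix z' assume z': "cycle (map fst rest) z'"
  \<comment> \<open>The lift leaves out the loop. Nodes \<open>a\<close> and \<open>Suc b\<close>
    both lie over \<open>idx a\<close>, so the lift toggles at \<open>a\<close> iff it toggles at
    \<open>b\<close>, as a cycle must.\<close>
  define z where "z v = (if a < v \<and> v \<le> b then False else z' (idx v))" for v
  have idx_ab: "idx (Suc a + n) = idx a" if "a + n \<le> b" for n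
    using that
  proof (induction n)
    case 0
    then show ?case using idx_Suc[of a] in_V[of a] ab by simp
  next
    case (Suc n)
    then show ?case using idx_Suc[of "Suc (a + n)"] in_V[of "Suc (a + n)"] ab by simp
  qed
  have idx_b: "idx (Suc b) = idx a" using idx_ab[of "b - a"] ab by simp
  have zV: "(z i \<noteq> z (Suc i)) = ((i = a \<or> i = b) \<and> z' (idx a))" if i: "i < length E" "w ! i \<in> V" for i
  proof (cases "i \<in> {a..b}")
    case True
    then show ?thesis using idx_b ab unfolding z_def by (cases "i = b") auto
  next
    case False
    then obtain k where k: "k \<in> {a<..<b}" "i = other k" using in_V[OF i(1)] i(2) by auto
    then have "z i = z (Suc i)" using idx_Suc[OF i(1)] i(2) other_gt(1)[OF k(1)] unfolding z_def by simp
    then show ?thesis using False ab by auto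
  qed
  have zN: "z i = z' (idx i)" "z (Suc i) = z' (Suc (idx i))" if i: "i < length E" "w ! i \<notin> V" for i
    using not_V_nodes[OF i] idx_Suc[OF i(1)] i(2) unfolding z_def by auto
  have "cycle w z"
    unfolding cycle_def
  proof (intro conjI ballI, goal_cases)
    case 1
    have "z' 0 = z' (length rest)" using z' by (simp add: cycle_def)
    then show ?case using idx_length ab by (simp add: z_def)
  next
    case (2 c)
    obtain i j where c: "c = (i, j)" by (cases c)
    have ch: "(i, j) \<in> chords w" using 2 c by simp
    have ij: "i < length E" "j < length E" "w ! i = w ! j" using ch by (auto simp: chords_def)
    have "(z i \<noteq> z (Suc i)) = (z j \<noteq> z (Suc j))"
    proof (cases "w ! i \<in> V")
      case True
      then have jV: "w ! j \<in> V" using ij by simp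
      have "(i = a \<or> i = b) = (j = a \<or> j = b)"
        using ch chords_unique chord_ab chords_sym by blast
      then show ?thesis using zV[OF ij(1) True] zV[OF ij(2) jV] by blast
    next
      case False
      then have jV: "w ! j \<notin> V" using ij by simp
      have "(z' (idx i) \<noteq> z' (Suc (idx i))) = (z' (idx j) \<noteq> z' (Suc (idx j)))"
        using z' idx_chord[OF ch False] unfolding cycle_def by blast
      then show ?thesis unfolding zN[OF ij(1) False] zN[OF ij(2) jV] .
    qed
    then show ?case unfolding c prod.case .
  qed
  then obtain lam rho where col: "colouring E z lam rho"
    using assms unfolding planar_def w_def by blast
  define h where "h f v = (if a < v \<and> v \<le> b then f a else f v :: bool)" for f v
  \<comment> \<open>Any node over \<open>j\<close> may be chosen: by \<open>colouring_flat\<close>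
    the values of \<open>h\<close> agree on all nodes between two kept letters.\<close>
  define g where "g f j = h f (SOME v. v \<le> length E \<and> idx v = j)" for f j
  have flat: "\<not> z v" if "a < v" "v \<le> b" for v using that by (simp add: z_def)
  have hs: "h lam (Suc i) = h lam i \<and> h rho (Suc i) = h rho i" if i: "i < length E" "w ! i \<in> V" for i
    by (intro conjI colouring_flat[OF col _ i, folded h_def] flat)
  have g: "g lam (idx v) = h lam v" "g rho (idx v) = h rho v" if v: "v \<le> length E" for v
  proof -
    have sm: "(SOME u. u \<le> length E \<and> idx u = idx v) \<le> length E \<and> idx (SOME u. u \<le> length E \<and> idx u = idx v) = idx v"
      by (rule someI[of "\<lambda>u. u \<le> length E \<and> idx u = idx v" v]) (use v in simp)
    show "g lam (idx v) = h lam v"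
      unfolding g_def by (rule idx_fibre[where h = "h lam"]) (use hs sm v in auto)
    show "g rho (idx v) = h rho v"
      unfolding g_def by (rule idx_fibre[where h = "h rho"]) (use hs sm v in auto)
  qed
  have gN: "g lam (idx i) = lam i" "g rho (idx i) = rho i" "g lam (Suc (idx i)) = lam (Suc i)" "g rho (Suc (idx i)) = rho (Suc i)"
    if i: "i < length E" "w ! i \<notin> V" for i
    using g[of i] g[of "Suc i"] not_V_nodes[OF i] idx_Suc[OF i(1)] i unfolding h_def by auto
  have ends: "lam 0 = lam (length E)" "rho 0 = rho (length E)" using col by (simp_all add: colouring_def)
  have gE: "g lam 0 = lam 0" "g rho 0 = rho 0" "g lam (length rest) = lam (length E)" "g rho (length rest) = rho (length E)"
    using g[of 0] g[of "length E"] idx_length ab unfolding h_def by simp_all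
  have "colouring rest z' (g lam) (g rho)"
    unfolding colouring_def
  proof (intro conjI ballI allI impI, goal_cases)
    case 1
    show ?case using gE ends by simp
  next
    case 2
    show ?case using gE ends by simp
  next
    case (3 j)
    show ?case
    proof (cases "j < length rest")
      case True
      obtain i where i: "i < length E" "w ! i \<notin> V" "idx i = j" by (rule idx_onto[OF True])
      then show ?thesis using gN[OF i(1,2)] zN[OF i(1,2)] col_z[OF col, of i] by simp
    next
      case False
      then have j: "j = length rest" using 3 by simp
      have "z (length E) = z' (length rest)" using idx_length ab by (simp add: z_def)
      then show ?thesis using gE j col_z[OF col, of "length E"] by simp
    qed
  next
    case (4 c)
    obtain i j where c: "c = (i, j)" by (cases c)
    obtain p q where pq: "(p, q) \<in> chords w" "w ! p \<notin> V" "w ! q \<notin> V" "idx p = i" "idx q = j" "p < length E" "q < length E"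
      by (rule chord_rest[OF 4[unfolded c]])
    have sn: "snd (rest ! i) = snd (E ! p)" using rest_nth[OF pq(6,2)] pq(4) by simp
    show ?case
      unfolding c prod.case sn
      using gN[OF pq(6,2)] gN[OF pq(7,3)] pq(4,5) col_corner[OF col pq(1)] by auto
  qed
  then show "\<exists>lam rho. colouring rest z' lam rho" by blast
qed

lemma desc_sign_loop:
  assumes "k \<in> {a..<b}"
  shows "desc_sign E (w ! k) = (if snd (E ! k) then 1 else -1)"
proof -
  have x: "w ! k \<in> set w" using assms ab by simp
  have "first_pos w (w ! k) \<le> k"
    unfolding first_pos_def by (rule Min_le) (use assms ab in auto)
  then have "first_pos w (w ! k) = k"
    using inj_loop[of "first_pos w (w ! k)" k] positions_facts(1)[OF dow_w x] assms by simp
  then show ?thesis by (simp add: desc_sign_def w_def[symmetric])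
qed

lemma desc_sign_rest:
  assumes "x \<in> set w" "x \<notin> V"
  shows "desc_sign rest x = desc_sign E x"
proof -
  define f where "f = first_pos w x"
  have f: "w ! f = x" "f < length E" using positions_facts(1,3)[OF dow_w assms(1)] unfolding f_def by simp_all
  have r: "rest ! idx f = E ! f" "idx f < length rest" using rest_nth[of f] f assms(2) by simp_all
  have "first_pos (map fst rest) x = idx f"
    unfolding first_pos_def
  proof (rule Min_eqI)
    show "idx f \<in> {i. i < length (map fst rest) \<and> map fst rest ! i = x}"
      using r f nth_w[OF f(2)] by simp
    fix j assume j: "j \<in> {i. i < length (map fst rest) \<and> map fst rest ! i = x}"
    then have jl: "j < length rest" by simp
    obtain i where i: "i < length E" "w ! i \<notin> V" "idx i = j" by (rule idx_onto[OF jl])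
    then have "w ! i = x" using j jl rest_nth[OF i(1,2)] nth_w[OF i(1)] by simp
    then have "f \<le> i" unfolding f_def first_pos_def by (intro Min_le) (use i in auto)
    then show "idx f \<le> j" using idx_mono i(3) by blast
  qed simp
  then show ?thesis using r unfolding desc_sign_def f_def w_def by simp
qed

lemma length_rest: "length rest < length E"
proof -
  have "E ! a \<in> set E" "\<not> fst (E ! a) \<notin> V" using ab in_V[of a] nth_w[of a] by auto
  then show ?thesis unfolding rest_def by (rule length_filter_less)
qed

end

text \<open>The framing factor of the crossing where the loop closes cancels the factor of the kink
  that the loop becomes.\<close>

lemma powi_descent:
  fixes t :: real
  assumes "t > 0" "e = 1 \<or> e = -1"
  shows "(- ((t powr (-1/4)) ^ 3)) powi (- e) * - ((t powr (-1/4)) powi (3 * e)) = 1"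
proof -
  define B where "B = (t powr (-1/4)) ^ 3"
  have B: "B > 0" unfolding B_def using assms by simp
  have "(t powr (-1/4)) powi (3 * e) = B powi e"
    unfolding B_def using assms(2) by (auto simp: power_int_minus)
  then show ?thesis unfolding B_def[symmetric] using B assms(2) by (auto simp: power_int_minus)
qed

lemma first_loop_exists:
  assumes "good_shadow E" "E \<noteq> []"
  obtains a b where "first_loop E a b"
proof -
  let ?w = "map fst E"
  have dow: "dow ?w" using assms(1) by (simp add: good_shadow_def)
  define Q where "Q b \<longleftrightarrow> b < length ?w \<and> (\<exists>a<b. ?w ! a = ?w ! b)" for b
  have "?w ! 0 \<in> set ?w" using assms(2) by simp
  then obtain p q where pq: "occurs ?w (?w ! 0) p q" "p < q" by (rule dow_occurs[OF dow])
  have "q < length ?w" using pq by (simp add: occurs_def)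
  moreover have "?w ! p = ?w ! q" using occurs_nth[OF pq(1)] by simp
  ultimately have "Q q" unfolding Q_def using pq(2) by blast
  define b where "b = (LEAST b. Q b)"
  have Qb: "Q b" unfolding b_def using \<open>Q q\<close> by (rule LeastI)
  have least: "\<not> Q b'" if "b' < b" for b' using that not_less_Least unfolding b_def by blast
  obtain a where a: "a < b" "?w ! a = ?w ! b" "b < length ?w" using Qb unfolding Q_def by blast
  have ne: "?w ! i \<noteq> ?w ! j" if "i < j" "j < b" for i j
    using least[OF that(2)] that a(3) unfolding Q_def by auto
  have "distinct (take b ?w)"
    unfolding distinct_conv_nth
  proof (intro allI impI)
    fix i j assume ij: "i < length (take b ?w)" "j < length (take b ?w)" "i \<noteq> j"
    then show "take b ?w ! i \<noteq> take b ?w ! j"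
      using ne[of i j] ne[of j i] a(3) by (cases "i < j") auto
  qed
  then have "first_loop E a b" by (unfold_locales) (use assms(1) a in auto)
  then show ?thesis by (rule that)
qed

text \<open>
  The first loop comes off at the cost of a unit \<open>\<plusminus>t\<^sup>r\<close>. Since every Jones polynomial has value 1 and
  derivative 0 at 1, this unit is trivial.
\<close>

lemma jones_word_descending:
  assumes "good_shadow E" "planar E" "t > 0"
  shows "jones_word (map fst E) (desc_sign E) t = 1"
  using assms
proof (induction "length E" arbitrary: E t rule: less_induct)
  case less
  show ?case
  proof (cases "E = []")
    case True
    define d where "d = - ((t powr (-1/4)) powi 2) - (t powr (-1/4)) powi (-2)"
    have "d < 0" unfolding d_def using less.prems(3) by (intro loop_value_neg) simp
    moreover have "circ [] (\<lambda>_. Erased) = 1"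
      unfolding circ_def joined_def chords_def by (simp add: num_classes_def quotient_def)
    ultimately show ?thesis
      unfolding jones_word_def bracket_def Let_def d_def[symmetric] by (simp add: True)
  next
    case False
    obtain a b where "first_loop E a b" by (rule first_loop_exists[OF less.prems(1) False])
    then interpret first_loop E a b "map fst E" .
    let ?w = "map fst E" and ?s = "desc_sign E"
    have sV: "?s x = 1 \<or> ?s x = -1" for x by (simp add: desc_sign_def)
    define c where "c u = (\<Prod>x\<in>V. (- ((u powr (-1/4)) ^ 3)) powi (- ?s x)) * - ((u powr (-1/4)) powi (3 * ?s (?w ! a)))" for u :: real
    have red: "jones_word ?w ?s u = c u" if u: "u > 0" for u
    proof -
      define A where "A = u powr (-1/4)"
      have A: "A > 0" unfolding A_def using u by simp
      define d where "d = - (A powi 2) - A powi (-2)"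
      have split: "(\<Prod>x\<in>set ?w. (- (A ^ 3)) powi (- ?s x)) =
          (\<Prod>x\<in>V. (- (A ^ 3)) powi (- ?s x)) * (\<Prod>x\<in>set (map fst rest). (- (A ^ 3)) powi (- ?s x))"
      proof -
        have "set ?w = V \<union> set (map fst rest)" "V \<inter> set (map fst rest) = {}"
          using V_subset unfolding map_fst_rest by auto
        moreover have "finite V" using V_subset by (rule finite_subset) simp
        ultimately show ?thesis by (simp add: prod.union_disjoint)
      qed
      have IH: "jones_word (map fst rest) (desc_sign rest) u = 1"
        by (rule less.hyps[OF length_rest good_rest planar_rest[OF less.prems(2)] u])
      have ds: "desc_sign rest x = ?s x" if "x \<in> set (map fst rest)" for x
        by (rule desc_sign_rest) (use that in \<open>auto simp: map_fst_rest\<close>)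
      have "jones_word (map fst rest) ?s u = jones_word (map fst rest) (desc_sign rest) u"
        by (rule jones_word_sign_cong) (use ds in simp)
      then have one: "jones_word (map fst rest) ?s u = 1" using IH by simp
      have br: "bracket (\<lambda>x. A powi ?s x) (\<lambda>x. A powi (- ?s x)) d ?w =
          - (A powi (3 * ?s (?w ! a))) * bracket (\<lambda>x. A powi ?s x) (\<lambda>x. A powi (- ?s x)) d (map fst rest)"
        unfolding map_fst_rest d_def by (rule loop_removal[OF less.prems(2) A]) (rule desc_sign_loop)
      have "jones_word ?w ?s u = c u * jones_word (map fst rest) ?s u"
        unfolding jones_word_def Let_def A_def[symmetric] d_def[symmetric] split br c_def by simp
      then show ?thesis using one by simp
    qed
    \<comment> \<open>What is left are the framing factors of the other crossings on the loop. That
      they cancel is not shown by counting signs: the value at \<open>1\<close> forces the sign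
      \<open>(-1) ^ m\<close> to be positive and the derivative at \<open>1\<close> forces
      \<open>r = 0\<close>.\<close>
    define m where "m = card (V - {?w ! a})"
    define r where "r = (3/4) * (\<Sum>x\<in>V - {?w ! a}. real_of_int (?s x))"
    have cu: "c u = (-1) ^ m * u powr r" if u: "u > 0" for u
    proof -
      have aV: "?w ! a \<in> V" using ab unfolding V_def by simp
      have fV: "finite V" using V_subset by (rule finite_subset) simp
      have unit: "(- ((u powr (-1/4)) ^ 3)) powi (- ?s x) = - (u powr ((3/4) * real_of_int (?s x)))" for x
      proof -
        have p: "(u powr (-1/4)) ^ 3 = u powr (-3/4)" using u by (simp add: powr_power)
        show ?thesis unfolding p using sV[of x] by (auto simp: power_int_minus powr_minus)
      qed
      have cancel: "x * y * z = y" if "x * z = 1" for x y z :: real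
      proof -
        have "x * y * z = x * z * y" by simp
        then show ?thesis using that by simp
      qed
      have "c u = (\<Prod>x\<in>V - {?w ! a}. (- ((u powr (-1/4)) ^ 3)) powi (- ?s x))"
        unfolding c_def prod.remove[OF fV aV] by (rule cancel[OF powi_descent[OF u sV]])
      also have "\<dots> = (\<Prod>x\<in>V - {?w ! a}. (-1) * u powr ((3/4) * real_of_int (?s x)))"
        unfolding unit by simp
      also have "\<dots> = (-1) ^ m * u powr r"
        unfolding prod.distrib m_def r_def sum_distrib_left using u by (simp add: powr_sum)
      finally show ?thesis .
    qed
    obtain f a2 where f: "\<forall>t>0. jones_word ?w ?s t = f t"
      "jet f 1 0 a2 (third_order ?w (\<lambda>x. real_of_int (?s x)))"
      using jet_jones_third_order[of ?w ?s, OF dow_w sV] by blast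
    have f1: "f 1 = 1" using f(2) unfolding jet_def by blast
    then have m1: "(-1 :: real) ^ m = 1" using f(1) red[of 1] cu[of 1] by simp
    have g: "jet (\<lambda>t. t powr r) 1 r (r\<^sup>2) (r ^ 3)" by (rule jet_powr)
    have "deriv (\<lambda>t. t powr r) 1 = 0"
      by (rule jet_derivs(1)[OF f(2)]) (use f(1) red cu m1 in auto)
    moreover have "deriv (\<lambda>t. t powr r) 1 = r" by (rule jet_derivs(1)[OF g refl])
    ultimately show ?thesis using red[OF less.prems(3)] cu[OF less.prems(3)] m1 less.prems(3) by simp
  qed
qed

section \<open>The bound\<close>

lemma third_order_trivial:
  assumes "dow w" "\<And>x. x \<in> set w \<Longrightarrow> s x = 1 \<or> s x = -1" "\<And>t. t > 0 \<Longrightarrow> jones_word w s t = 1"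
  shows "third_order w (\<lambda>x. real_of_int (s x)) = 0"
proof -
  obtain f a2 where f: "\<forall>t>0. jones_word w s t = f t" "jet f 1 0 a2 (third_order w (\<lambda>x. real_of_int (s x)))"
    using jet_jones_third_order[of w s, OF assms(1,2)] by blast
  have F: "(1 :: real) = f t" if "t > 0" for t using f(1) assms(3)[OF that] that by simp
  have 0: "deriv (\<lambda>_ :: real. 1 :: real) = (\<lambda>_. 0)" by (rule ext) simp
  have "(deriv ^^ 2) (\<lambda>_. 1) (1 :: real) = (0 :: real)" "(deriv ^^ 3) (\<lambda>_. 1) (1 :: real) = (0 :: real)"
    by (simp_all add: numeral_2_eq_2 numeral_3_eq_3 0)
  then show ?thesis using jet_derivs(2,3)[OF f(2), of "\<lambda>_. 1", OF F] by simp
qed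

definition rotated :: "nat \<Rightarrow> 'a list \<Rightarrow> 'a list" where
  "rotated c xs = drop c xs @ take c xs"

lemma rotated_nth:
  assumes "c \<le> length xs" "i < length xs"
  shows "rotated c xs ! i = xs ! (if i < length xs - c then c + i else i - (length xs - c))"
  using assms by (simp add: rotated_def nth_append)

lemma length_rotated [simp]: "length (rotated c xs) = length xs"
  by (simp add: rotated_def)

lemma map_rotated: "map f (rotated c xs) = rotated c (map f xs)"
  by (simp add: rotated_def drop_map take_map)

lemma set_rotated [simp]: "set (rotated c xs) = set xs"
  unfolding rotated_def set_append by (metis append_take_drop_id set_append Un_commute)

lemma dow_rotated: "dow w \<Longrightarrow> dow (rotated c w)"
proof -
  have "count_list (rotated c w) x = count_list w x" for x
    unfolding rotated_def by (metis append_take_drop_id count_list_append add.commute)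
  then show "dow w \<Longrightarrow> dow (rotated c w)" by (simp add: dow_def)
qed

lemma good_rotated:
  assumes "good_shadow E" "c \<le> length E"
  shows "good_shadow (rotated c E)"
  unfolding good_shadow_def map_rotated
proof (intro conjI ballI)
  show "dow (rotated c (map fst E))" using assms(1) unfolding good_shadow_def by (intro dow_rotated) blast
  fix e assume e: "e \<in> chords (rotated c (map fst E))"
  obtain i j where ij: "e = (i, j)" by (cases e)
  let ?g = "\<lambda>i. if i < length E - c then c + i else i - (length E - c)"
  have l: "i < length E" "j < length E" "i \<noteq> j" "rotated c (map fst E) ! i = rotated c (map fst E) ! j"
    using e ij by (auto simp: chords_def)
  have "?g i < length E" "?g j < length E" "?g i \<noteq> ?g j" using l assms(2) by auto
  moreover have "map fst E ! ?g i = map fst E ! ?g j"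
    using l(4) unfolding rotated_nth[of c "map fst E", unfolded length_map, OF assms(2) l(1)]
      rotated_nth[of c "map fst E", unfolded length_map, OF assms(2) l(2)] .
  ultimately have "(?g i, ?g j) \<in> chords (map fst E)" by (simp add: chords_def)
  then have "snd (E ! ?g j) = (\<not> snd (E ! ?g i))" using assms(1) unfolding good_shadow_def by blast
  then show "case e of (i, j) \<Rightarrow> snd (rotated c E ! j) = (\<not> snd (rotated c E ! i))"
    unfolding ij prod.case rotated_nth[OF assms(2) l(1)] rotated_nth[OF assms(2) l(2)] .
qed

text \<open>The value \<open>-1\<close> marks the crossings whose later passage is met first by a
  walk starting at position \<open>c\<close>; their descending sign is reversed.\<close>

definition passed :: "nat list \<Rightarrow> nat \<Rightarrow> nat \<Rightarrow> int" where
  "passed w x c = (if first_pos w x < c \<and> c \<le> second_pos w x then -1 else 1)"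

text \<open>A rotation can change which passage comes first, and the two passages through a crossing
  have opposite flags.\<close>

lemma desc_sign_rotated:
  assumes "good_shadow E" "c \<le> length E" "x \<in> fst ` set E"
  shows "desc_sign (rotated c E) x = desc_sign E x * passed (map fst E) x c"
proof -
  let ?w = "map fst E" and ?L = "length E"
  have dow: "dow ?w" using assms(1) by (simp add: good_shadow_def)
  have x: "x \<in> set ?w" using assms(3) by simp
  define f where "f = first_pos ?w x"
  define s where "s = second_pos ?w x"
  have fs: "f < s" "s < ?L" unfolding f_def s_def using occurs_positions(2)[OF dow x] positions_facts(4)[OF dow x] by simp_all
  have pos: "?w ! i = x \<longleftrightarrow> i = f \<or> i = s" if "i < ?L" for i
  proof -
    have S: "{i. i < length ?w \<and> ?w ! i = x} = {f, s}"
      using positions_facts(5)[OF dow x] unfolding f_def s_def .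
    have "i \<in> {i. i < length ?w \<and> ?w ! i = x} \<longleftrightarrow> i \<in> {f, s}" unfolding S ..
    then show ?thesis using that by simp
  qed
  have "(f, s) \<in> chords ?w" using fs pos[of f] pos[of s] by (simp add: chords_def)
  then have sn: "snd (E ! s) = (\<not> snd (E ! f))" using assms(1) unfolding good_shadow_def by blast
  define p where "p = (if c \<le> f then f - c else if c \<le> s then s - c else f + (?L - c))"
  define g where "g i = (if i < ?L - c then c + i else i - (?L - c))" for i
  have nth: "rotated c ?w ! i = ?w ! g i" "rotated c E ! i = E ! g i" if "i < ?L" for i
    using rotated_nth[of c ?w i] rotated_nth[of c E i] assms(2) that unfolding g_def by simp_all
  have gl: "g i < ?L" if "i < ?L" for i using that assms(2) unfolding g_def by auto
  have p: "p < ?L" "g p = (if f < c \<and> c \<le> s then s else f)"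
    using fs assms(2) unfolding p_def g_def by auto
  have "first_pos (rotated c ?w) x = p"
    unfolding first_pos_def
  proof (rule Min_eqI)
    show "p \<in> {i. i < length (rotated c ?w) \<and> rotated c ?w ! i = x}"
      using p nth(1)[OF p(1)] pos[of "g p"] gl[OF p(1)] by auto
    fix i assume "i \<in> {i. i < length (rotated c ?w) \<and> rotated c ?w ! i = x}"
    then have i: "i < ?L" "rotated c ?w ! i = x" by simp_all
    then have "g i = f \<or> g i = s" using nth(1)[OF i(1)] pos[OF gl[OF i(1)]] by simp
    then show "p \<le> i" using fs assms(2) i(1) unfolding p_def g_def by (auto split: if_splits)
  qed simp
  then have "desc_sign (rotated c E) x = (if snd (E ! g p) then 1 else -1)"
    unfolding desc_sign_def map_rotated using nth(2)[OF p(1)] by simp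
  also have "\<dots> = desc_sign E x * passed ?w x c"
    unfolding desc_sign_def passed_def p(2) f_def[symmetric] s_def[symmetric] using sn by auto
  finally show ?thesis .
qed

text \<open>These are the signs of the diagram that descends from base point \<open>c\<close>, read
  on the unrotated word; the Jones polynomial of a word does not see the rotation.\<close>

lemma third_order_passed:
  assumes "good_shadow E" "planar E" "c \<le> length E"
  shows "third_order (map fst E) (\<lambda>x. real_of_int (desc_sign E x * passed (map fst E) x c)) = 0"
proof (rule third_order_trivial)
  let ?w = "map fst E"
  show "dow ?w" using assms(1) by (simp add: good_shadow_def)
  show "desc_sign E x * passed ?w x c = 1 \<or> desc_sign E x * passed ?w x c = -1" for x
    by (simp add: desc_sign_def passed_def)
  fix t :: real assume t: "t > 0"
  have pl: "planar (rotated c E)"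
    unfolding rotated_def by (rule planar_rotate) (simp add: assms(2))
  have "jones_word ?w (\<lambda>x. desc_sign E x * passed ?w x c) t = jones_word ?w (desc_sign (rotated c E)) t"
    by (rule jones_word_sign_cong) (use desc_sign_rotated[OF assms(1,3)] in simp)
  also have "\<dots> = jones_word (rotated c ?w) (desc_sign (rotated c E)) t"
    using jones_word_rotate[of "take c ?w" "drop c ?w"] by (simp add: rotated_def)
  also have "\<dots> = 1"
    using jones_word_descending[OF good_rotated[OF assms(1,3)] pl t] by (simp add: map_rotated)
  finally show "jones_word ?w (\<lambda>x. desc_sign E x * passed ?w x c) t = 1" .
qed

subsection \<open>Sums over triples of distinct crossings\<close>

definition triples :: "'a set \<Rightarrow> ('a \<Rightarrow> 'a \<Rightarrow> 'a \<Rightarrow> real) \<Rightarrow> real" where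
  "triples N F = (\<Sum>x\<in>N. \<Sum>y\<in>N. \<Sum>z\<in>N. if x \<noteq> y \<and> y \<noteq> z \<and> x \<noteq> z then F x y z else 0)"

lemma triples_cong:
  "(\<And>x y z. x \<in> N \<Longrightarrow> y \<in> N \<Longrightarrow> z \<in> N \<Longrightarrow> x \<noteq> y \<Longrightarrow> y \<noteq> z \<Longrightarrow> x \<noteq> z \<Longrightarrow> F x y z = G x y z) \<Longrightarrow> triples N F = triples N G"
  unfolding triples_def by (intro sum.cong refl) auto

lemma triples_mono:
  "(\<And>x y z. x \<in> N \<Longrightarrow> y \<in> N \<Longrightarrow> z \<in> N \<Longrightarrow> x \<noteq> y \<Longrightarrow> y \<noteq> z \<Longrightarrow> x \<noteq> z \<Longrightarrow> F x y z \<le> G x y z) \<Longrightarrow> triples N F \<le> triples N G"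
  unfolding triples_def by (intro sum_mono) auto

lemma triples_add: "triples N (\<lambda>x y z. F x y z + G x y z) = triples N F + triples N G"
  unfolding triples_def sum.distrib[symmetric] by (intro sum.cong refl) auto

lemma triples_cmult: "triples N (\<lambda>x y z. c * F x y z) = c * triples N F"
  unfolding triples_def sum_distrib_left by (intro sum.cong refl) auto

lemma triples_diff: "triples N (\<lambda>x y z. F x y z - G x y z) = triples N F - triples N G"
  unfolding triples_def sum_subtractf[symmetric] by (intro sum.cong refl) auto

lemma triples_swap12: "triples N (\<lambda>x y z. F y x z) = triples N F"
  unfolding triples_def by (subst sum.swap) (intro sum.cong refl, auto)

lemma triples_swap23: "triples N (\<lambda>x y z. F x z y) = triples N F"
  unfolding triples_def by (rule sum.cong[OF refl], subst sum.swap) (intro sum.cong refl, auto)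

lemma triples_one:
  assumes "finite N"
  shows "triples N (\<lambda>_ _ _. 1) = real (card N) * (real (card N) - 1) * (real (card N) - 2)"
proof -
  have z: "(\<Sum>z\<in>N. if x \<noteq> y \<and> y \<noteq> z \<and> x \<noteq> z then 1 else 0) = (if x \<noteq> y then real (card N) - 2 else 0)"
    if "x \<in> N" "y \<in> N" for x y
  proof (cases "x = y")
    case False
    have "(\<Sum>z\<in>N. if x \<noteq> y \<and> y \<noteq> z \<and> x \<noteq> z then 1 else 0 :: real) = (\<Sum>z\<in>N. 1 - (if z = x then 1 else 0) - (if z = y then 1 else 0))"
      using False by (intro sum.cong refl) auto
    also have "\<dots> = real (card N) - 1 - 1"
      unfolding sum_subtractf using assms that by simp
    finally show ?thesis using False by simp
  qed simp
  have "triples N (\<lambda>_ _ _. 1) = (\<Sum>x\<in>N. \<Sum>y\<in>N. (real (card N) - 2) - (if y = x then real (card N) - 2 else 0))"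
    unfolding triples_def by (intro sum.cong refl) (use z in auto)
  also have "\<dots> = real (card N) * ((real (card N) - 1) * (real (card N) - 2))"
    unfolding sum_subtractf using assms by (simp add: algebra_simps)
  finally show ?thesis by (simp add: mult.assoc)
qed

text \<open>A sum of squares of row sums is nonnegative.\<close>

lemma triples_row_products:
  fixes l :: "'a \<Rightarrow> 'a \<Rightarrow> real"
  assumes "finite N" "\<And>x y. \<bar>l x y\<bar> \<le> 1" "\<And>x. l x x = 0"
  shows "- (real (card N) * (real (card N) - 1)) \<le> triples N (\<lambda>x y z. l x y * l x z)"
proof -
  \<comment> \<open>The zero diagonal of \<open>l\<close> removes all coincidences except
    \<open>y = z\<close>; subtracting these leaves squares of row sums minus sums of squared
    entries.\<close>
  have "triples N (\<lambda>x y z. l x y * l x z) = (\<Sum>x\<in>N. \<Sum>y\<in>N. \<Sum>z\<in>N. l x y * l x z - (if z = y then (l x y)\<^sup>2 else 0))"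
    unfolding triples_def by (intro sum.cong refl) (auto simp: assms(3) power2_eq_square)
  also have "\<dots> = (\<Sum>x\<in>N. (\<Sum>y\<in>N. l x y)\<^sup>2 - (\<Sum>y\<in>N. (l x y)\<^sup>2))"
    unfolding sum_subtractf using assms(1) by (simp add: power2_eq_square sum_product)
  also have "\<dots> \<ge> (\<Sum>x\<in>N. - (real (card N) - 1))"
  proof (rule sum_mono)
    fix x assume x: "x \<in> N"
    have "(\<Sum>y\<in>N. (l x y)\<^sup>2) \<le> (\<Sum>y\<in>N. 1 - (if y = x then 1 else 0))"
      by (intro sum_mono) (use assms(2,3) abs_square_le_1 in auto)
    also have "\<dots> = real (card N) - 1" unfolding sum_subtractf using assms(1) x by simp
    finally show "- (real (card N) - 1) \<le> (\<Sum>y\<in>N. l x y)\<^sup>2 - (\<Sum>y\<in>N. (l x y)\<^sup>2)"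
      using zero_le_power2[of "\<Sum>y\<in>N. l x y"] by linarith
  qed
  finally show ?thesis by (simp add: algebra_simps)
qed

subsection \<open>The local inequality\<close>

text \<open>Up to the factor \<open>-3/4\<close> this is the third mixed moment of the exponents; it
  vanishes unless at least two of the three pairs interleave.\<close>

definition excess :: "nat list \<Rightarrow> nat \<Rightarrow> nat \<Rightarrow> nat \<Rightarrow> real" where
  "excess w x y z = max 0 (crossings_among w x y z - 1)"

text \<open>The signed interlacement matrix. It is antisymmetric, since exchanging the arguments
  reverses the direction of interleaving.\<close>

definition lk :: "nat list \<Rightarrow> (nat \<Rightarrow> real) \<Rightarrow> nat \<Rightarrow> nat \<Rightarrow> real" where
  "lk w s x y = s x * s y * (of_bool (interleaved w x y) - of_bool (interleaved w y x))"

text \<open>Here \<open>s\<close> will measure agreement with the descending signs. Multiplying by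
  \<open>passed\<close> moves the base point to a passage of \<open>x\<close>, and the two passages
  are added.\<close>

definition base_term :: "nat list \<Rightarrow> (nat \<Rightarrow> real) \<Rightarrow> nat \<Rightarrow> nat \<Rightarrow> nat \<Rightarrow> real" where
  "base_term w s x y z = s y * s z *
     (real_of_int (passed w y (first_pos w x) * passed w z (first_pos w x)) +
      real_of_int (passed w y (second_pos w x) * passed w z (second_pos w x)))"

lemma excess_commute: "excess w x y z = excess w y x z" "excess w x y z = excess w x z y"
  unfolding excess_def crossings_among_def crossing_def by (simp_all add: disj_commute add_ac)

lemma base_term_commute: "base_term w s x y z = base_term w s x z y"
  by (simp add: base_term_def mult_ac)

text \<open>Let \<open>q\<close> be the sum of the three products of \<open>lk\<close>. If at most
  one pair interleaves, \<open>excess\<close> and \<open>q\<close> are both 0. Otherwise half the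
  sum of the base terms equals \<open>q\<close>, in each of the four such orders. For two
  interleaved pairs \<open>q\<close> is \<open>1\<close> or \<open>-1\<close>, for three it is
  \<open>1\<close> or \<open>-3\<close>. So \<open>1 - q\<close> is nonnegative, and
  \<open>excess\<close> is at most 2.\<close>

lemma local_inequality_sorted:
  assumes w: "dow w" "x \<in> set w" "y \<in> set w" "z \<in> set w"
    and lt: "first_pos w x < first_pos w y" "first_pos w y < first_pos w z"
    and s: "s x = 1 \<or> s x = -1" "s y = 1 \<or> s y = -1" "s z = 1 \<or> s z = -1"
  shows "excess w x y z * \<bar>1 - 1/2 * (base_term w s x y z + base_term w s y x z + base_term w s z x y)\<bar>
    \<le> 2 * (1 - (lk w s x y * lk w s x z + lk w s y x * lk w s y z + lk w s z x * lk w s z y))"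
proof -
  define fx where "fx = first_pos w x"
  define sx where "sx = second_pos w x"
  define fy where "fy = first_pos w y"
  define sy where "sy = second_pos w y"
  define fz where "fz = first_pos w z"
  define sz where "sz = second_pos w z"
  note defs = fx_def[symmetric] sx_def[symmetric] fy_def[symmetric] sy_def[symmetric] fz_def[symmetric] sz_def[symmetric]
  have ne: "x \<noteq> y" "y \<noteq> z" "x \<noteq> z" using lt by auto
  note o = occurs_positions(2)[OF w(1,2)] occurs_positions(2)[OF w(1,3)] occurs_positions(2)[OF w(1,4)]
  note d = positions_distinct[OF w(1,2,3) ne(1)] positions_distinct[OF w(1,3,4) ne(2)] positions_distinct[OF w(1,2,4) ne(3)]
    positions_distinct[OF w(1,3,2) ne(1)[symmetric]] positions_distinct[OF w(1,4,3) ne(2)[symmetric]] positions_distinct[OF w(1,4,2) ne(3)[symmetric]]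
  define u where "u = s x * s y"
  define v where "v = s y * s z"
  have uv: "u = 1 \<or> u = -1" "v = 1 \<or> v = -1"
    "s x * s y = u" "s y * s z = v" "s x * s z = u * v" "s y * s x = u" "s z * s y = v" "s z * s x = u * v"
    using s unfolding u_def v_def by auto
  have "fx < sx \<and> sx < fy \<and> fy < sy \<and> sy < fz \<and> fz < sz \<or>
    fx < sx \<and> sx < fy \<and> fy < fz \<and> fz < sy \<and> sy < sz \<or>
    fx < sx \<and> sx < fy \<and> fy < fz \<and> fz < sz \<and> sz < sy \<or>
    fx < fy \<and> fy < sx \<and> sx < sy \<and> sy < fz \<and> fz < sz \<or>
    fx < fy \<and> fy < sx \<and> sx < fz \<and> fz < sy \<and> sy < sz \<or>
    fx < fy \<and> fy < sx \<and> sx < fz \<and> fz < sz \<and> sz < sy \<or>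
    fx < fy \<and> fy < sy \<and> sy < sx \<and> sx < fz \<and> fz < sz \<or>
    fx < fy \<and> fy < sy \<and> sy < fz \<and> fz < sx \<and> sx < sz \<or>
    fx < fy \<and> fy < sy \<and> sy < fz \<and> fz < sz \<and> sz < sx \<or>
    fx < fy \<and> fy < fz \<and> fz < sx \<and> sx < sy \<and> sy < sz \<or>
    fx < fy \<and> fy < fz \<and> fz < sx \<and> sx < sz \<and> sz < sy \<or>
    fx < fy \<and> fy < fz \<and> fz < sy \<and> sy < sx \<and> sx < sz \<or>
    fx < fy \<and> fy < fz \<and> fz < sy \<and> sy < sz \<and> sz < sx \<or>
    fx < fy \<and> fy < fz \<and> fz < sz \<and> sz < sx \<and> sx < sy \<or>
    fx < fy \<and> fy < fz \<and> fz < sz \<and> sz < sy \<and> sy < sx"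
    by (rule three_pairs_order) (use lt o d in \<open>simp_all add: defs eq_commute\<close>)
  then show ?thesis
    unfolding excess_def crossings_among_def crossing_def lk_def base_term_def interleaved_def passed_def defs uv(3-8)
    by (elim disjE conjE; use uv(1,2) in \<open>elim disjE; simp\<close>)
qed

lemma local_inequality:
  assumes w: "dow w" "x \<in> set w" "y \<in> set w" "z \<in> set w" "x \<noteq> y" "y \<noteq> z" "x \<noteq> z"
    and s: "\<And>x. s x = 1 \<or> s x = -1"
  shows "excess w x y z * \<bar>1 - 1/2 * (base_term w s x y z + base_term w s y x z + base_term w s z x y)\<bar>
    \<le> 2 * (1 - (lk w s x y * lk w s x z + lk w s y x * lk w s y z + lk w s z x * lk w s z y))"
proof -
  let ?P = "\<lambda>x y z. excess w x y z * \<bar>1 - 1/2 * (base_term w s x y z + base_term w s y x z + base_term w s z x y)\<bar>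
    \<le> 2 * (1 - (lk w s x y * lk w s x z + lk w s y x * lk w s y z + lk w s z x * lk w s z y))"
  let ?f = "first_pos w"
  have perm: "?P a b c \<Longrightarrow> ?P b a c" "?P a b c \<Longrightarrow> ?P a c b" for a b c
    using excess_commute[of w a b c] base_term_commute[of w s] by (simp_all add: add_ac mult.commute)
  have "?f x \<noteq> ?f y" "?f y \<noteq> ?f z" "?f x \<noteq> ?f z"
    using positions_distinct(1)[OF w(1)] w by blast+
  then consider "?f x < ?f y" "?f y < ?f z" | "?f x < ?f z" "?f z < ?f y" | "?f y < ?f x" "?f x < ?f z"
    | "?f y < ?f z" "?f z < ?f x" | "?f z < ?f x" "?f x < ?f y" | "?f z < ?f y" "?f y < ?f x"
    by linarith
  then show ?thesis
  proof cases
    case 1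
    show ?thesis by (rule local_inequality_sorted[OF w(1,2,3,4) 1 s s s])
  next
    case 2
    show ?thesis by (rule perm(2)) (rule local_inequality_sorted[OF w(1,2,4,3) 2 s s s])
  next
    case 3
    show ?thesis by (rule perm(1)) (rule local_inequality_sorted[OF w(1,3,2,4) 3 s s s])
  next
    case 4
    show ?thesis by (rule perm(1), rule perm(2)) (rule local_inequality_sorted[OF w(1,3,4,2) 4 s s s])
  next
    case 5
    show ?thesis by (rule perm(2), rule perm(1)) (rule local_inequality_sorted[OF w(1,4,2,3) 5 s s s])
  next
    case 6
    show ?thesis by (rule perm(2), rule perm(1), rule perm(2)) (rule local_inequality_sorted[OF w(1,4,3,2) 6 s s s])
  qed
qed

subsection \<open>Averaging over base points\<close>

lemma sum_swap3:
  fixes F :: "'a \<Rightarrow> 'a \<Rightarrow> 'a \<Rightarrow> 'a \<Rightarrow> real"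
  shows "(\<Sum>u\<in>N. \<Sum>x\<in>N. \<Sum>y\<in>N. \<Sum>z\<in>N. F u x y z) = (\<Sum>x\<in>N. \<Sum>y\<in>N. \<Sum>z\<in>N. \<Sum>u\<in>N. F u x y z)"
proof -
  have "(\<Sum>u\<in>N. \<Sum>x\<in>N. \<Sum>y\<in>N. \<Sum>z\<in>N. F u x y z) = (\<Sum>x\<in>N. \<Sum>u\<in>N. \<Sum>y\<in>N. \<Sum>z\<in>N. F u x y z)"
    by (rule sum.swap)
  also have "\<dots> = (\<Sum>x\<in>N. \<Sum>y\<in>N. \<Sum>u\<in>N. \<Sum>z\<in>N. F u x y z)"
    by (rule sum.cong[OF refl]) (rule sum.swap)
  also have "\<dots> = (\<Sum>x\<in>N. \<Sum>y\<in>N. \<Sum>z\<in>N. \<Sum>u\<in>N. F u x y z)"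
    by (rule sum.cong[OF refl], rule sum.cong[OF refl]) (rule sum.swap)
  finally show ?thesis .
qed

lemma triples_sum_delta:
  assumes "finite N"
  shows "(\<Sum>i\<in>N. triples N (\<lambda>x y z. of_bool (x = i) * F x y z)) = triples N F"
proof -
  have "(\<Sum>i\<in>N. triples N (\<lambda>x y z. of_bool (x = i) * F x y z)) =
      (\<Sum>x\<in>N. \<Sum>y\<in>N. \<Sum>z\<in>N. \<Sum>i\<in>N. if x \<noteq> y \<and> y \<noteq> z \<and> x \<noteq> z then of_bool (x = i) * F x y z else 0)"
    unfolding triples_def by (rule sum_swap3)
  also have "\<dots> = triples N F"
    unfolding triples_def
  proof (intro sum.cong refl)
    fix x y z assume x: "x \<in> N"
    have "(\<Sum>i\<in>N. if x \<noteq> y \<and> y \<noteq> z \<and> x \<noteq> z then of_bool (x = i) * F x y z else 0) =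
        (\<Sum>i\<in>N. if i = x then (if x \<noteq> y \<and> y \<noteq> z \<and> x \<noteq> z then F x y z else 0) else 0)"
      by (intro sum.cong refl) auto
    also have "\<dots> = (if x \<noteq> y \<and> y \<noteq> z \<and> x \<noteq> z then F x y z else 0)"
      using assms x by (simp only: sum.delta if_True)
    finally show "(\<Sum>i\<in>N. if x \<noteq> y \<and> y \<noteq> z \<and> x \<noteq> z then of_bool (x = i) * F x y z else 0) =
        (if x \<noteq> y \<and> y \<noteq> z \<and> x \<noteq> z then F x y z else 0)" .
  qed
  finally show ?thesis .
qed

lemma triples_abs_le:
  assumes "\<And>x y z. x \<in> N \<Longrightarrow> y \<in> N \<Longrightarrow> z \<in> N \<Longrightarrow> x \<noteq> y \<Longrightarrow> y \<noteq> z \<Longrightarrow> x \<noteq> z \<Longrightarrow> \<bar>F x y z\<bar> \<le> G x y z"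
  shows "\<bar>triples N F\<bar> \<le> triples N G"
proof -
  have "triples N F \<le> triples N G" by (rule triples_mono) (use assms in \<open>fastforce simp: abs_le_iff\<close>)
  moreover have "triples N (\<lambda>x y z. -1 * F x y z) \<le> triples N G" by (rule triples_mono) (use assms in \<open>fastforce simp: abs_le_iff\<close>)
  ultimately show ?thesis unfolding triples_cmult by simp
qed

lemma third_order_cong:
  "(\<And>x. x \<in> set w \<Longrightarrow> s x = s' x) \<Longrightarrow> third_order w s = third_order w s'"
  unfolding third_order_def by (intro arg_cong2[of _ _ _ _ "(+)"] sum.cong refl) simp_all

text \<open>
  As the square of a sign is 1, the terms of \<open>third_order\<close> with repeated crossings are linear in the
  signs.
\<close>

lemma third_order_split:
  assumes "dow w"
  shows "\<exists>m. \<forall>e. (\<forall>x. e x = 1 \<or> e x = -1) \<longrightarrow>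
    third_order w e = - (3/4) * triples (set w) (\<lambda>x y z. e x * e y * e z * excess w x y z) + (\<Sum>u\<in>set w. e u * m u)"
proof -
  let ?N = "set w"
  define a where "a x y z = mean w (\<lambda>S. exponent S x * exponent S y * exponent S z)" for x y z
  define M where "M x = mean w (\<lambda>S. 3/4 * (exponent S x * real (circ w (state S) - 1)))" for x
  define dist :: "nat \<Rightarrow> nat \<Rightarrow> nat \<Rightarrow> bool" where "dist x y z \<longleftrightarrow> x \<noteq> y \<and> y \<noteq> z \<and> x \<noteq> z" for x y z
  \<comment> \<open>In a triple with a repetition, \<open>h\<close> is the label that remains when
    two equal ones are cancelled against each other.\<close>
  define h where "h x y z = (if x = y then z else if y = z then x else y)" for x y z :: nat
  define m where "m u = (\<Sum>x\<in>?N. \<Sum>y\<in>?N. \<Sum>z\<in>?N. if \<not> dist x y z \<and> h x y z = u then a x y z else 0) + M u" for u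
  have hN: "h x y z \<in> ?N" if "x \<in> ?N" "y \<in> ?N" "z \<in> ?N" for x y z using that by (simp add: h_def)
  have "third_order w e = - (3/4) * triples ?N (\<lambda>x y z. e x * e y * e z * excess w x y z) + (\<Sum>u\<in>?N. e u * m u)"
    if e: "\<And>x. e x = 1 \<or> e x = -1" for e
  proof -
    have e2: "e x * e x = 1" for x using e[of x] by auto
    have lin: "(\<Sum>u\<in>?N. e u * (\<Sum>x\<in>?N. \<Sum>y\<in>?N. \<Sum>z\<in>?N. if \<not> dist x y z \<and> h x y z = u then a x y z else 0)) =
        (\<Sum>x\<in>?N. \<Sum>y\<in>?N. \<Sum>z\<in>?N. if \<not> dist x y z then e (h x y z) * a x y z else 0)"
    proof -
      have "(\<Sum>u\<in>?N. e u * (\<Sum>x\<in>?N. \<Sum>y\<in>?N. \<Sum>z\<in>?N. if \<not> dist x y z \<and> h x y z = u then a x y z else 0)) =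
          (\<Sum>u\<in>?N. \<Sum>x\<in>?N. \<Sum>y\<in>?N. \<Sum>z\<in>?N. e u * (if \<not> dist x y z \<and> h x y z = u then a x y z else 0))"
        unfolding sum_distrib_left ..
      also have "\<dots> = (\<Sum>x\<in>?N. \<Sum>y\<in>?N. \<Sum>z\<in>?N. \<Sum>u\<in>?N. e u * (if \<not> dist x y z \<and> h x y z = u then a x y z else 0))"
        by (rule sum_swap3)
      also have "\<dots> = (\<Sum>x\<in>?N. \<Sum>y\<in>?N. \<Sum>z\<in>?N. if \<not> dist x y z then e (h x y z) * a x y z else 0)"
      proof (intro sum.cong refl)
        fix x y z assume N: "x \<in> ?N" "y \<in> ?N" "z \<in> ?N"
        have "(\<Sum>u\<in>?N. e u * (if \<not> dist x y z \<and> h x y z = u then a x y z else 0)) =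
            (\<Sum>u\<in>?N. if u = h x y z then (if \<not> dist x y z then e (h x y z) * a x y z else 0) else 0)"
          by (intro sum.cong refl) auto
        also have "\<dots> = (if \<not> dist x y z then e (h x y z) * a x y z else 0)"
          using hN[OF N] by (simp only: sum.delta finite_set if_True)
        finally show "(\<Sum>u\<in>?N. e u * (if \<not> dist x y z \<and> h x y z = u then a x y z else 0)) =
            (if \<not> dist x y z then e (h x y z) * a x y z else 0)" .
      qed
      finally show ?thesis .
    qed
    have entry: "e x * e y * e z * a x y z = - (3/4) * (if x \<noteq> y \<and> y \<noteq> z \<and> x \<noteq> z then e x * e y * e z * excess w x y z else 0) +
        (if \<not> dist x y z then e (h x y z) * a x y z else 0)" if N: "x \<in> ?N" "y \<in> ?N" "z \<in> ?N" for x y z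
    proof (cases "dist x y z")
      case True
      then have d: "x \<noteq> y" "y \<noteq> z" "x \<noteq> z" by (simp_all add: dist_def)
      have "a x y z = - (3/4) * excess w x y z"
        unfolding a_def excess_def by (rule mean_exponent3[OF assms N d])
      then show ?thesis using True d by simp
    next
      case False
      have "e x * e y * e z = e (h x y z)"
      proof -
        consider "x = y" | "x \<noteq> y" "y = z" | "x \<noteq> y" "y \<noteq> z" "x = z" using False by (auto simp: dist_def)
        then show ?thesis
        proof cases
          case 1
          then show ?thesis using e2[of y] by (simp add: h_def)
        next
          case 2
          then show ?thesis using e2[of z] by (simp add: h_def mult.assoc)
        next
          case 3
          then have "e x * e y * e z = (e z * e z) * e y" by simp
          then show ?thesis using 3 e2[of z] by (simp add: h_def)
        qed
      qed
      then show ?thesis using False by (auto simp: dist_def)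
    qed
    have "third_order w e = (\<Sum>x\<in>?N. \<Sum>y\<in>?N. \<Sum>z\<in>?N. e x * e y * e z * a x y z) + (\<Sum>u\<in>?N. e u * M u)"
      unfolding third_order_def a_def M_def ..
    also have "(\<Sum>x\<in>?N. \<Sum>y\<in>?N. \<Sum>z\<in>?N. e x * e y * e z * a x y z) =
        - (3/4) * triples ?N (\<lambda>x y z. e x * e y * e z * excess w x y z) +
        (\<Sum>x\<in>?N. \<Sum>y\<in>?N. \<Sum>z\<in>?N. if \<not> dist x y z then e (h x y z) * a x y z else 0)"
      unfolding triples_def sum_distrib_left sum.distrib[symmetric] by (intro sum.cong refl) (rule entry)
    finally show ?thesis
      unfolding m_def distrib_left sum.distrib lin by simp
  qed
  then show ?thesis by blast
qed

text \<open>Flipping the sign at \<open>i\<close> reverses the triples through \<open>i\<close>,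
  which may stand in any of three places, so the cubic sum changes by 6 copies of the restricted
  one. The linear part changes by \<open>2 * (e i * m i)\<close>, and
  \<open>3/4 * 6 / 2 = 9/4\<close>.\<close>

lemma excess_linear_term:
  fixes e e' :: "nat \<Rightarrow> real"
  assumes "finite N" "i \<in> N" "\<And>x. x \<noteq> i \<Longrightarrow> e' x = e x" "e' i = - e i"
    and z: "- (3/4) * triples N (\<lambda>x y z. e x * e y * e z * excess w x y z) + (\<Sum>u\<in>N. e u * m u) = 0"
    and z': "- (3/4) * triples N (\<lambda>x y z. e' x * e' y * e' z * excess w x y z) + (\<Sum>u\<in>N. e' u * m u) = 0"
  shows "e i * m i = 9/4 * triples N (\<lambda>x y z. of_bool (x = i) * (e x * e y * e z * excess w x y z))"
proof -
  let ?F = "\<lambda>x y z. e x * e y * e z * excess w x y z"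
  let ?S = "triples N (\<lambda>x y z. of_bool (x = i) * ?F x y z)"
  have sym: "?F y x z = ?F x y z" "?F x z y = ?F x y z" for x y z
    using excess_commute[of w x y z] by simp_all
  have S2: "triples N (\<lambda>x y z. of_bool (y = i) * ?F x y z) = ?S"
    using triples_swap12[of N "\<lambda>x y z. of_bool (x = i) * ?F x y z"] unfolding sym .
  have S3: "triples N (\<lambda>x y z. of_bool (z = i) * ?F x y z) = ?S"
    using triples_swap23[of N "\<lambda>x y z. of_bool (y = i) * ?F x y z"] unfolding sym S2 .
  have "triples N ?F - triples N (\<lambda>x y z. e' x * e' y * e' z * excess w x y z) =
      triples N (\<lambda>x y z. 2 * (of_bool (x = i) * ?F x y z + of_bool (y = i) * ?F x y z + of_bool (z = i) * ?F x y z))"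
    unfolding triples_diff[symmetric]
  proof (rule triples_cong)
    fix x y z :: nat assume d: "x \<noteq> y" "y \<noteq> z" "x \<noteq> z"
    consider "x = i" "y \<noteq> i" "z \<noteq> i" | "y = i" "x \<noteq> i" "z \<noteq> i" | "z = i" "x \<noteq> i" "y \<noteq> i" | "x \<noteq> i" "y \<noteq> i" "z \<noteq> i"
      using d by auto
    then show "?F x y z - e' x * e' y * e' z * excess w x y z =
        2 * (of_bool (x = i) * ?F x y z + of_bool (y = i) * ?F x y z + of_bool (z = i) * ?F x y z)"
      by cases (simp_all add: assms(3,4))
  qed
  also have "\<dots> = 6 * ?S" unfolding triples_cmult triples_add S2 S3 by simp
  finally have F: "triples N ?F - triples N (\<lambda>x y z. e' x * e' y * e' z * excess w x y z) = 6 * ?S" .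
  have "(\<Sum>u\<in>N. e u * m u) - (\<Sum>u\<in>N. e' u * m u) = (\<Sum>u\<in>N. if u = i then 2 * (e i * m i) else 0)"
    unfolding sum_subtractf[symmetric] by (intro sum.cong refl) (auto simp: assms(3,4))
  also have "\<dots> = 2 * (e i * m i)" using assms(1,2) by simp
  finally show ?thesis using F z z' by linarith
qed

text \<open>Advancing the base point by one position crosses a single passage, here one of
  \<open>i\<close>, and affects no other crossing.\<close>

lemma passed_Suc:
  assumes "dow w" "x \<in> set w" "i \<in> set w" "c = first_pos w i \<or> c = second_pos w i"
  shows "passed w x (Suc c) = (if x = i then - passed w x c else passed w x c)"
proof (cases "x = i")
  case True
  then show ?thesis using assms(4) occurs_positions(2)[OF assms(1,3)] by (auto simp: passed_def)
next
  case False
  have "first_pos w x \<noteq> c" "second_pos w x \<noteq> c"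
    using positions_distinct[OF assms(1,2,3) False] positions_distinct(2)[OF assms(1,3,2)] False assms(4) by auto
  then show ?thesis using False by (auto simp: passed_def)
qed

text \<open>
  For the signs of the descending diagram with base point \<open>c\<close> the third order term vanishes. Moving
  the base point across \<open>i\<close> changes one sign, which determines the linear term at \<open>i\<close>; both passages
  through \<open>i\<close> are used, and the two results are averaged.
\<close>

lemma third_order_bound:
  assumes E: "good_shadow E" "planar E" and s: "\<And>x. s x = 1 \<or> s x = (-1 :: real)"
  defines "w \<equiv> map fst E"
  defines "n \<equiv> real (card (set w))"
  shows "\<bar>third_order w s\<bar> \<le> 3/2 * (n ^ 3 - n)"
proof -
  let ?N = "set w"
  have dow: "dow w" using E(1) by (simp add: good_shadow_def w_def)
  have fin: "finite ?N" by simp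
  define eta where "eta x = real_of_int (desc_sign E x)" for x
  \<comment> \<open>\<open>eta\<close> holds the descending signs for the original base point,
    \<open>e c\<close> those for base point \<open>c\<close>, and \<open>tau\<close> compares the
    given signs with \<open>eta\<close>.\<close>
  define tau where "tau x = s x * eta x" for x
  define e where "e c x = eta x * real_of_int (passed w x c)" for c x
  have eta: "eta x = 1 \<or> eta x = -1" for x by (simp add: eta_def desc_sign_def)
  have tau: "tau x = 1 \<or> tau x = -1" for x using eta[of x] s[of x] by (auto simp: tau_def)
  have e: "e c x = 1 \<or> e c x = -1" for c x using eta[of x] by (auto simp: e_def passed_def)
  have sq: "s x * s x = 1" "e c x * e c x = 1" for x c using s[of x] e[of c x] by auto
  obtain m where m: "\<And>e. (\<And>x. e x = 1 \<or> e x = -1) \<Longrightarrow>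
      third_order w e = - (3/4) * triples ?N (\<lambda>x y z. e x * e y * e z * excess w x y z) + (\<Sum>u\<in>?N. e u * m u)"
    using third_order_split[OF dow] by blast
  have zero: "third_order w (e c) = 0" if "c \<le> length E" for c
    using third_order_passed[OF E that] unfolding w_def[symmetric] e_def eta_def by simp
  define P where "P x y z = s x * s y * s z * excess w x y z" for x y z
  define B where "B = base_term w tau"
  \<comment> \<open>The linear coefficient \<open>m i\<close> does not depend on the signs, so the
    value found for the descending signs \<open>e c\<close> is carried over to \<open>s\<close> by
    the factor \<open>s i * e c i\<close>.\<close>
  have lin: "s i * m i = 9/4 * triples ?N (\<lambda>x y z. of_bool (x = i) * (s x * (e c y * e c z) * excess w x y z))"
    if i: "i \<in> ?N" and c: "c = first_pos w i \<or> c = second_pos w i" for i c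
  proof -
    let ?e' = "(e c)(i := - e c i)"
    have cl: "Suc c \<le> length E" using c positions_facts(3,4)[OF dow i] by (auto simp: w_def)
    have "third_order w ?e' = third_order w (e (Suc c))"
      by (rule third_order_cong) (use passed_Suc[OF dow _ i c] in \<open>auto simp: e_def\<close>)
    then have z': "third_order w ?e' = 0" using zero[OF cl] by simp
    have e': "?e' x = 1 \<or> ?e' x = -1" for x using e[of c x] by auto
    have z: "third_order w (e c) = 0" using zero[of c] cl by simp
    have "e c i * m i = 9/4 * triples ?N (\<lambda>x y z. of_bool (x = i) * (e c x * e c y * e c z * excess w x y z))"
    proof (rule excess_linear_term[OF fin i])
      show "?e' x = e c x" if "x \<noteq> i" for x using that by simp
      show "?e' i = - e c i" by simp
    qed (use m[of "e c", OF e] m[of ?e', OF e'] z z' in auto)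
    then have 1: "s i * e c i * (e c i * m i) = s i * e c i * (9/4 * triples ?N (\<lambda>x y z. of_bool (x = i) * (e c x * e c y * e c z * excess w x y z)))"
      by simp
    have 2: "s i * e c i * (e c i * m i) = (e c i * e c i) * (s i * m i)" by simp
    have 3: "s i * e c i * (9/4 * triples ?N (\<lambda>x y z. of_bool (x = i) * (e c x * e c y * e c z * excess w x y z))) =
        9/4 * triples ?N (\<lambda>x y z. of_bool (x = i) * (s x * (e c y * e c z) * excess w x y z))"
    proof -
      have "triples ?N (\<lambda>x y z. s i * e c i * (of_bool (x = i) * (e c x * e c y * e c z * excess w x y z))) =
          triples ?N (\<lambda>x y z. of_bool (x = i) * (s x * (e c y * e c z) * excess w x y z))"
      proof (rule triples_cong)
        fix x y z
        have "s i * e c i * (e c i * e c y * e c z * excess w i y z) = (e c i * e c i) * (s i * (e c y * e c z) * excess w i y z)"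
          by simp
        then show "s i * e c i * (of_bool (x = i) * (e c x * e c y * e c z * excess w x y z)) =
            of_bool (x = i) * (s x * (e c y * e c z) * excess w x y z)"
          unfolding sq(2) by (cases "x = i") simp_all
      qed
      then show ?thesis unfolding triples_cmult by simp
    qed
    show ?thesis using 1 unfolding 2 3 sq(2) mult_1 .
  qed
  \<comment> \<open>The mean of the formulas for the two passages through \<open>i\<close>, whence
    half of \<open>9/4\<close>. Averaging brings in \<open>base_term\<close>, which treats both
    passages alike.\<close>
  have avg: "s i * m i = 9/8 * triples ?N (\<lambda>x y z. of_bool (x = i) * (P x y z * B x y z))" if i: "i \<in> ?N" for i
  proof -
    let ?f = "first_pos w i" and ?l = "second_pos w i"
    have "triples ?N (\<lambda>x y z. of_bool (x = i) * (s x * (e ?f y * e ?f z) * excess w x y z)) +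
        triples ?N (\<lambda>x y z. of_bool (x = i) * (s x * (e ?l y * e ?l z) * excess w x y z)) =
        triples ?N (\<lambda>x y z. of_bool (x = i) * (P x y z * B x y z))"
      unfolding triples_add[symmetric]
    proof (rule triples_cong)
      fix x y z
      have "P i y z * B i y z = (s y * s y) * (s z * s z) * (s i * (e ?f y * e ?f z) * excess w i y z + s i * (e ?l y * e ?l z) * excess w i y z)"
        unfolding P_def B_def base_term_def tau_def e_def by (simp add: algebra_simps)
      then show "of_bool (x = i) * (s x * (e ?f y * e ?f z) * excess w x y z) + of_bool (x = i) * (s x * (e ?l y * e ?l z) * excess w x y z) =
          of_bool (x = i) * (P x y z * B x y z)"
        unfolding sq(1) by (cases "x = i") simp_all
    qed
    then show ?thesis using lin[OF i, of ?f] lin[OF i, of ?l] by simp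
  qed
  let ?PB = "triples ?N (\<lambda>x y z. P x y z * B x y z)"
  have "(\<Sum>i\<in>?N. s i * m i) = 9/8 * (\<Sum>i\<in>?N. triples ?N (\<lambda>x y z. of_bool (x = i) * (P x y z * B x y z)))"
    unfolding sum_distrib_left by (intro sum.cong refl) (rule avg)
  also have "\<dots> = 9/8 * ?PB" unfolding triples_sum_delta[OF fin] ..
  finally have T0: "third_order w s = - (3/4) * triples ?N P + 9/8 * ?PB"
    using m[of s, OF s] unfolding P_def by simp
  have Psym: "P y x z = P x y z" "P x z y = P x y z" for x y z
    unfolding P_def using excess_commute[of w x y z] by simp_all
  have PB2: "triples ?N (\<lambda>x y z. P x y z * B y x z) = ?PB"
  proof -
    have "triples ?N (\<lambda>x y z. P x y z * B y x z) = triples ?N (\<lambda>x y z. P y x z * B y x z)"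
      by (rule triples_cong) (simp only: Psym(1))
    also have "\<dots> = ?PB" by (rule triples_swap12)
    finally show ?thesis .
  qed
  have PB3: "triples ?N (\<lambda>x y z. P x y z * B z x y) = ?PB"
  proof -
    have "triples ?N (\<lambda>x y z. P x y z * B z x y) = triples ?N (\<lambda>x y z. P x z y * B z x y)"
      by (rule triples_cong) (simp only: Psym(2))
    also have "\<dots> = triples ?N (\<lambda>x y z. P x y z * B y x z)" by (rule triples_swap23)
    finally show ?thesis unfolding PB2 .
  qed
  \<comment> \<open>\<open>P\<close> is symmetric, so the three versions of the base term have equal
    sums. Writing \<open>9/8 = 3/4 * 3/2\<close> then distributes a coefficient \<open>1/2\<close>
    to each of them.\<close>
  have S: "triples ?N (\<lambda>x y z. P x y z - 1/2 * (P x y z * B x y z + P x y z * B y x z + P x y z * B z x y)) = triples ?N P - 3/2 * ?PB"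
    unfolding triples_diff triples_cmult triples_add PB2 PB3 by simp
  have T: "third_order w s = - (3/4) * triples ?N (\<lambda>x y z. P x y z - 1/2 * (P x y z * B x y z + P x y z * B y x z + P x y z * B z x y))"
    unfolding S T0 by (simp add: field_simps)
  let ?l = "lk w tau"
  let ?q = "\<lambda>x y z. ?l x y * ?l x z"
  have "\<bar>triples ?N (\<lambda>x y z. P x y z - 1/2 * (P x y z * B x y z + P x y z * B y x z + P x y z * B z x y))\<bar> \<le>
      triples ?N (\<lambda>x y z. 2 * (1 - (?q x y z + ?q y x z + ?q z x y)))"
  proof (rule triples_abs_le)
    fix x y z assume N: "x \<in> ?N" "y \<in> ?N" "z \<in> ?N" "x \<noteq> y" "y \<noteq> z" "x \<noteq> z"
    have "P x y z - 1/2 * (P x y z * B x y z + P x y z * B y x z + P x y z * B z x y) =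
        (s x * s y * s z) * (excess w x y z * (1 - 1/2 * (B x y z + B y x z + B z x y)))"
      unfolding P_def by (simp add: algebra_simps)
    moreover have "\<bar>s x * s y * s z\<bar> = 1" using s[of x] s[of y] s[of z] by auto
    moreover have "excess w x y z \<ge> 0" by (simp add: excess_def)
    ultimately have "\<bar>P x y z - 1/2 * (P x y z * B x y z + P x y z * B y x z + P x y z * B z x y)\<bar> =
        excess w x y z * \<bar>1 - 1/2 * (B x y z + B y x z + B z x y)\<bar>"
      by (simp add: abs_mult)
    then show "\<bar>P x y z - 1/2 * (P x y z * B x y z + P x y z * B y x z + P x y z * B z x y)\<bar> \<le> 2 * (1 - (?q x y z + ?q y x z + ?q z x y))"
      using local_inequality[OF dow N, of tau, OF tau] unfolding B_def by simp
  qed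
  also have "\<dots> = 2 * (n * (n - 1) * (n - 2) - 3 * triples ?N ?q)"
  proof -
    have q2: "triples ?N (\<lambda>x y z. ?q y x z) = triples ?N ?q" by (rule triples_swap12)
    have q3: "triples ?N (\<lambda>x y z. ?q z x y) = triples ?N ?q"
      using triples_swap23[of ?N "\<lambda>x y z. ?q y x z"] unfolding q2 .
    have "triples ?N (\<lambda>x y z. 2 * (1 - (?q x y z + ?q y x z + ?q z x y))) = 2 * (triples ?N (\<lambda>_ _ _. 1) - (triples ?N ?q + triples ?N (\<lambda>x y z. ?q y x z) + triples ?N (\<lambda>x y z. ?q z x y)))"
      unfolding triples_cmult triples_diff triples_add ..
    also have "\<dots> = 2 * (n * (n - 1) * (n - 2) - 3 * triples ?N ?q)"
      unfolding q2 q3 triples_one[OF fin] n_def by simp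
    finally show ?thesis .
  qed
  also have "\<dots> \<le> 2 * (n * (n - 1) * (n - 2) + 3 * (n * (n - 1)))"
  proof -
    have "- (n * (n - 1)) \<le> triples ?N ?q"
      unfolding n_def
    proof (rule triples_row_products[OF fin])
      show "\<bar>?l x y\<bar> \<le> 1" for x y
        using tau[of x] tau[of y] by (auto simp: lk_def)
      show "?l x x = 0" for x by (simp add: lk_def)
    qed
    then show ?thesis by simp
  qed
  also have "\<dots> = 2 * (n ^ 3 - n)" by (simp add: algebra_simps power3_eq_cube)
  finally show ?thesis unfolding T abs_mult by simp
qed

subsection \<open>Knots\<close>

lemma diagram_jones_equiv:
  assumes "equivclp diagram_move D D'" "knot_diagram D"
  shows "knot_diagram D' \<and> (\<forall>t>0. diagram_jones D' t = diagram_jones D t)"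
  using assms(1)
proof (induction rule: equivclp_induct)
  case base
  show ?case using assms(2) by simp
next
  case (step y z)
  have *: "knot_diagram u \<and> knot_diagram v \<and> (\<forall>t>0. diagram_jones u t = diagram_jones v t)" if "diagram_move u v" for u v
  proof -
    have uv: "knot_diagram u" "knot_diagram v" "move u v" using that by (simp_all add: diagram_move_def)
    then have gc: "is_gauss_code u" "is_gauss_code v" by (simp_all add: knot_diagram_def)
    have "diagram_jones u t = diagram_jones v t" if "t > 0" for t
      unfolding diagram_jones_eq[OF gc(1) that] diagram_jones_eq[OF gc(2) that] by (rule jones_word_move[OF gc uv(3) that])
    then show ?thesis using uv by blast
  qed
  from step.hyps(2) show ?case
  proof
    assume "diagram_move y z"
    from *[OF this] show ?thesis using step.IH by simp
  next
    assume "diagram_move z y"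
    from *[OF this] show ?thesis using step.IH by simp
  qed
qed

theorem proposition3p10:
  fixes K :: "gauss_code set"
  assumes "K \<in> knots"
  shows "- (1/24) * (real (crossing_number K) ^ 3 - real (crossing_number K)) \<le> 4 * v3 K
    \<and> 4 * v3 K \<le> 1/24 * (real (crossing_number K) ^ 3 - real (crossing_number K))"
proof -
  obtain D0 where D0: "knot_diagram D0" "K = {D. equivclp diagram_move D0 D}"
    using assms unfolding knots_def quotient_def by auto
  have K: "knot_diagram D \<and> (\<forall>t>0. diagram_jones D t = diagram_jones D0 t)" if "D \<in> K" for D
    by (rule diagram_jones_equiv[OF _ D0(1)]) (use that D0(2) in simp)
  have mem: "D0 \<in> K" using D0(2) by simp
  have "\<exists>D\<in>K. crossings D = crossing_number K"
    unfolding crossing_number_def by (rule LeastI[of _ "crossings D0"]) (use mem in blast)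
  \<comment> \<open>A diagram with the least number of crossings; it may differ from the
    representative used in \<open>jones\<close>, which is compared with it through
    \<open>D0\<close>.\<close>
  then obtain D where D: "D \<in> K" "crossings D = crossing_number K" by blast
  have gc: "is_gauss_code D" using K[OF D(1)] by (simp add: knot_diagram_def)
  have "(SOME D. D \<in> K) \<in> K" using mem by (rule someI)
  note some = K[OF this]
  let ?w = "word D" and ?s = "crossing_sign D"
  have sign: "?s x = 1 \<or> ?s x = -1" if "x \<in> set ?w" for x
    using crossing_sign_cases[OF gc] that set_word by blast
  obtain f a2 where f: "\<forall>t>0. jones_word ?w ?s t = f t" "jet f 1 0 a2 (third_order ?w (\<lambda>x. real_of_int (?s x)))"
    using jet_jones_third_order[of ?w ?s, OF dow_word[OF gc] sign] by blast
  have J: "jones K t = f t" if "t > 0" for t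
    using some K[OF D(1)] f(1) that diagram_jones_eq[OF gc that] unfolding jones_def by simp
  \<comment> \<open>With first coefficient 0 and third coefficient \<open>T\<close>, the second
    derivative is \<open>a2\<close> and the third is \<open>T - 3 * a2\<close>. The coefficients in
    \<open>v3\<close> are such that \<open>a2\<close> cancels, leaving
    \<open>v3 = - T / 144\<close>.\<close>
  have v: "4 * v3 K = - third_order ?w (\<lambda>x. real_of_int (?s x)) / 36"
    using jet_derivs(2,3)[OF f(2) J] unfolding v3_def by (simp add: field_simps)
  define s where "s x = (if x \<in> set ?w then real_of_int (?s x) else 1)" for x
  have s: "s x = 1 \<or> s x = -1" for x using sign[of x] by (auto simp: s_def)
  have good: "good_shadow (shadow D)"
    unfolding good_shadow_def map_fst_shadow using dow_word[OF gc] shadow_chord[OF gc] by blast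
  have pl: "planar (shadow D)" using K[OF D(1)] knot_diagram_planar by blast
  have "third_order ?w (\<lambda>x. real_of_int (?s x)) = third_order ?w s"
    by (rule third_order_cong) (simp add: s_def)
  moreover have "\<bar>third_order ?w s\<bar> \<le> 3/2 * (real (crossing_number K) ^ 3 - real (crossing_number K))"
    using third_order_bound[OF good pl s] D(2) unfolding map_fst_shadow set_word crossings_def by simp
  ultimately show ?thesis using v unfolding abs_le_iff by (simp add: field_simps)
qed

end
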